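(* Let $F(x)\in\mathcal O[x]$ be a monic irreducible separable polynomial, $\theta\in k^{\rm sep}$ a root of $F$, $L=k(\theta)$, and let $\mathbf t=(\psi_0;(\phi_1,\lambda_1,\psi_1);\dots;(\phi_r,\lambda_r,\psi_r))$ be an $F$-complete type of order $r$. Let $f(x)\in\mathcal O[x]$ be a monic separable polynomial divisible by $F(x)$ in $\mathcal O[x]$. Let $J=\{(j_0,\dots,j_r)\in\mathbb N^{r+1}\mid 0\le j_i<e_if_i,\ \forall\,0\le i\le r\}$, and for each multiindex $\mathbf j=(j_0,\dots,j_r)\in J$ consider $$Q_{\mathbf j}:=\theta^{j_0}Q_{1,j_1}(\theta)\star\cdots\star Q_{r,j_r}(\theta)=\frac{\theta^{j_0}Q_{1,j_1}(\theta)\cdots Q_{r,j_r}(\theta)}{\pi^{\lfloor H_{1,j_1}+\cdots+H_{r,j_r}\rfloor}}\in\mathbb B.$$ Then the family $\mathcal B:=\{Q_{\mathbf j}\mid\mathbf j\in J\}$ is an $\mathcal O$-basis of $\mathcal O_L$ in standard form.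
   Context: Local setting. $k$ is a local field with valuation $v$ normalized by $v(k^* )=\mathbb Z$ and extended to an algebraic closure of $k$; $\mathcal O$ is its valuation ring, $\pi$ a uniformizer, $\mathbb F=\mathbb F_0$ its (finite) residue field. $\mathcal O_L$ is the valuation ring of $L$, $\mathbb F_L$ its residue field, $e=e(L/k)$, $f(L/k)$ the ramification index and residual degree (for an $F$-complete type of order $r$, $e(L/k)=e_0\cdots e_r$ and $f(L/k)=f_0\cdots f_r$). $\mathbb B:=\{\alpha\in\mathcal O_L\mid 0\le v(\alpha)<1\}$. For non-zero $\alpha,\beta\in\mathcal O_L$, $\alpha\star\beta:=\alpha\beta/\pi^{\lfloor v(\alpha\beta)\rfloor}$ (associative and commutative). An $\mathcal O$-basis $\mathcal B$ of $\mathcal O_L$ is in standard form if $\mathcal B\subset\mathbb B$ and, for all $0\le t<e$, the set $\mathcal B_t:=\{\alpha\in\mathcal B\mid v(\alpha)=t/e\}$ has $f(L/k)$ elements and, for some $\omega\in\mathcal B_t$, the reduction of $\omega^{-1}\mathcal B_t$ modulo the maximal ideal of $\mathcal O_L$ is an $\mathbb F$-basis of $\mathbb F_L$. Types. The symbol $\sim$ means equality up to a non-zero constant factor. The $\phi$-expansion of a polynomial $g$ is $g=\sum_{s\ge0}a_s\phi^s$ with $\deg a_s<\deg\phi$. A type of order $0$ is $\mathbf t=(\psi_0)$ with $\psi_0\in\mathbb F[y]$ monic irreducible. Put $e_0=1$, $h_0=V_0=0$, $m_0=1$, $f_0=m_1=\deg\psi_0$, $\mathbb F_1=\mathbb F[y]/(\psi_0)$,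 $z_0$ = class of $y$; $v_1(g)$ is the minimum of the $v$-values of the coefficients of $g\in k[x]$; $R_0(g)\in\mathbb F[y]$ is the reduction of $g/\pi^{v_1(g)}$. Recursively, a type of order $i\ge1$ is $\mathbf t=(\psi_0;(\phi_1,\lambda_1,\psi_1);\dots;(\phi_i,\lambda_i,\psi_i))$, where dropping the last level gives a type of order $i-1$, $\phi_i$ is a representative of that type of order $i-1$, $\lambda_i=-h_i/e_i$ with $h_i,e_i$ positive coprime integers, and $\psi_i\in\mathbb F_i[y]$ is monic irreducible, $\psi_i\ne y$. A representative of a type of order $i-1$ is a monic $\phi_i\in\mathcal O[x]$ of degree $m_i$ with $R_{i-1}(\phi_i)\sim\psi_{i-1}$. Given a type of order $i-1$ and a representative $\phi_i$: (1) For $0\ne g\in k[x]$ with $\phi_i$-expansion $g=\sum_s a_s\phi_i^s$, $N_i(g)$ is the lower convex hull of the points $(s,v_i(a_s\phi_i^s))$ and $N_i^-(g)$ is its part formed by the sides of negative slope (only the left end point if there are none). (2) For $\lambda=-h/e<0$ ($h,e$ positive coprime), the $\lambda$-component of a polygon $N$ is $\{(x,y)\in N: y-\lambda x \text{ minimal}\}$. For $s$ in the abscissa range of $N_i^-(g)$ put $c_s=0$ if $(s,v_i(a_s\phi_i^s))$ lies above $N_i^-(g)$, and $c_s=z_{i-1}^{t_{i-1}(s)}R_{i-1}(a_s)(z_{i-1})\in\mathbb F_i$ if it lies on $N_i^-(g)$, where $t_0(s)=0$ and, for $i>1$, $t_{i-1}(s)=(\sigma-\ell_{i-1}v_i(a_s\phi_i^s))/e_{i-1}$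 with $\sigma$ the abscissa of the left end point of the $\lambda_{i-1}$-component of $N_{i-1}(a_s)$. If the $\lambda$-component of $N_i(g)$ has left end abscissa $s_0$ and its projection has length $de$, then $R_{\lambda,i}(g)(y)=\sum_{0\le j\le d}c_{s_0+je}\,y^j\in\mathbb F_i[y]$. (3) Given also $\lambda_i,\psi_i$: $R_i=R_{\lambda_i,i}$, $f_i=\deg\psi_i$, $m_{i+1}=e_if_im_i$, $\mathbb F_{i+1}=\mathbb F_i[y]/(\psi_i)$, $z_i$ = class of $y$, $\ell_i,\ell_i'$ are fixed integers with $\ell_ih_i-\ell_i'e_i=1$, and $v_{i+1}$ is the valuation of $k(x)$ given on polynomials by $v_{i+1}(g)=\min_s\{e_iv_i(a_s\phi_i^s)+sh_i\}$. Put $V_i:=v_i(\phi_i)$. For a type $\mathbf t$ of order $i$, $\operatorname{ord}_{\mathbf t}(g)$ is the exponent of $\psi_i$ in $R_i(g)$; $\mathbf t$ is $g$-complete if $\operatorname{ord}_{\mathbf t}(g)=1$. Quotients. For $1\le i\le r$: $(b_i,u_i)$ is the right end point of the side of slope $\lambda_i$ of $N_i^-(f)$; for $0\le j<b_i$, $Q_{i,j}(x)$ is the $(b_i-j)$-th $\phi_i$-quotient of $f(x)$, i.e. the quotient of the division with remainder of $f$ by $\phi_i^{\,b_i-j}$; $y_{i,j}$ is the ordinate of the point of $N_i^-(f)$ with abscissa $b_i-j$; and $H_{i,j}=(y_{i,j}-(b_i-j)V_i)/(e_0\cdots e_{i-1})$. *)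

theory Defs
  imports "HOL-Analysis.Analysis" "HOL-Algebra.Algebraic_Closure_Type"
begin

hide_const (open) Divisibility.irreducible Polynomials.degree Polynomials.lead_coeff Coset.order
  up_ring.coeff up_ring.monom module.smult

section \<open>Generalities on polynomials, bases and polygons\<close>

definition polys_over :: "'a::zero set \<Rightarrow> 'a poly set" where
  "polys_over A = {p. \<forall>n. coeff p n \<in> A}"

definition irreducible_over :: "'a::field set \<Rightarrow> 'a poly \<Rightarrow> bool" where
  "irreducible_over A p \<longleftrightarrow> p \<in> polys_over A \<and> 0 < degree p \<and>
     (\<forall>a \<in> polys_over A. \<forall>b \<in> polys_over A. p = a * b \<longrightarrow> degree a = 0 \<or> degree b = 0)"

definition separable_poly :: "'a::field poly \<Rightarrow> bool" where
  "separable_poly p \<longleftrightarrow> rsquarefree (map_poly to_ac p)"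

text \<open>\<open>B\<close> is a (finite) basis of the \<open>A\<close>-module \<open>M\<close>, where \<open>A\<close> is a subring of the ambient ring.\<close>

definition is_basis :: "'a::comm_ring_1 set \<Rightarrow> 'a set \<Rightarrow> 'a set \<Rightarrow> bool" where
  "is_basis A M B \<longleftrightarrow> finite B \<and> B \<subseteq> M \<and>
     (\<forall>c \<in> B \<rightarrow>\<^sub>E A. (\<Sum>b\<in>B. c b * b) \<in> M) \<and>
     (\<forall>m \<in> M. \<exists>!c. c \<in> B \<rightarrow>\<^sub>E A \<and> m = (\<Sum>b\<in>B. c b * b))"

text \<open>\<open>expansion_coeff q g s\<close> is the coefficient \<open>a\<^sub>s\<close> of the \<open>q\<close>-expansion
  \<open>g = (\<Sum>s. a\<^sub>s * q ^ s)\<close>; see the two lemmas below.\<close>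

definition expansion_coeff :: "'a::field poly \<Rightarrow> 'a poly \<Rightarrow> nat \<Rightarrow> 'a poly" where
  "expansion_coeff q g s = (g div q ^ s) mod q"

lemma degree_expansion_coeff:
  assumes "0 < degree q"
  shows "degree (expansion_coeff q g s) < degree q"
  using assms degree_mod_less[of q "g div q ^ s"] unfolding expansion_coeff_def by fastforce

lemma expansion_coeff_sum:
  assumes q: "0 < degree q"
  shows "g = (\<Sum>s\<le>degree g. expansion_coeff q g s * q ^ s)"
proof -
  have partial: "g = (\<Sum>s<n. expansion_coeff q g s * q ^ s) + (g div q ^ n) * q ^ n" for n
  proof (induction n)
    case (Suc n)
    have "g div q ^ n = (g div q ^ Suc n) * q + expansion_coeff q g n"
      by (simp only: power_Suc2 poly_div_mult_right expansion_coeff_def div_mult_mod_eq)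
    then have "(g div q ^ n) * q ^ n = expansion_coeff q g n * q ^ n + (g div q ^ Suc n) * q ^ Suc n"
      by (simp add: algebra_simps)
    with Suc show ?case
      by (simp add: add.assoc)
  qed simp
  have "degree g < degree (q ^ Suc (degree g))"
  proof -
    have "degree (q ^ Suc (degree g)) = Suc (degree g) * degree q"
      using q by (intro degree_power_eq) auto
    moreover have "Suc (degree g) * 1 \<le> Suc (degree g) * degree q"
      using q by (intro mult_le_mono2) simp
    ultimately show ?thesis by (metis Suc_le_eq mult.right_neutral)
  qed
  then have "g div q ^ Suc (degree g) = 0"
    by (rule div_poly_less)
  with partial[of "Suc (degree g)"] show ?thesis
    by (simp add: lessThan_Suc_atMost del: power_Suc)
qed

definition lower_hull :: "(real \<times> real) set \<Rightarrow> (real \<times> real) set" where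
  "lower_hull P = {p \<in> convex hull P. \<forall>q \<in> convex hull P. fst q = fst p \<longrightarrow> snd p \<le> snd q}"

definition slope_component :: "real \<Rightarrow> (real \<times> real) set \<Rightarrow> (real \<times> real) set" where
  "slope_component l N = {p \<in> N. \<forall>q \<in> N. snd p - l * fst p \<le> snd q - l * fst q}"

text \<open>For a convex polygon, a component is either a side or a vertex.  The components of
  negative slope are the sides of negative slope and their end points, and the left end point
  of the whole polygon (which is the component of every sufficiently small slope), also when
  no side of negative slope exists.\<close>

definition negative_part :: "(real \<times> real) set \<Rightarrow> (real \<times> real) set" where
  "negative_part N = (\<Union>l \<in> {..<0}. slope_component l N)"

text \<open>The end points of the sides of the polygons below are vertices, so they have natural
  abscissas.\<close>

definition left_abscissa :: "(real \<times> real) set \<Rightarrow> nat" where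
  "left_abscissa S = Min {s. real s \<in> fst ` S}"

definition right_abscissa :: "(real \<times> real) set \<Rightarrow> nat" where
  "right_abscissa S = Max {s. real s \<in> fst ` S}"


section \<open>Local fields\<close>

text \<open>\<open>val\<close> is the normalized valuation of the base field, \<open>aval\<close> its extension to the algebraic
  closure, \<open>unif\<close> a uniformizer.  All values at \<open>0\<close> are irrelevant and every use is guarded.
  \<open>red\<close> is the reduction map from the valuation ring of the algebraic closure onto its residue
  field \<open>'f\<close>; only its values on that ring matter.  The residue fields of all finite extensions
  are then the images under \<open>red\<close> of their valuation rings.\<close>

record (overloaded) ('k::field, 'f) valued_field =
  val :: "'k \<Rightarrow> int"
  aval :: "'k alg_closure \<Rightarrow> real"
  red :: "'k alg_closure \<Rightarrow> 'f"
  unif :: 'k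

definition val_ge :: "('k::field, 'f) valued_field \<Rightarrow> 'k \<Rightarrow> int \<Rightarrow> bool" where
  "val_ge K a n \<longleftrightarrow> a = 0 \<or> n \<le> val K a"

definition int_ring :: "('k::field, 'f) valued_field \<Rightarrow> 'k set" where
  "int_ring K = {a. val_ge K a 0}"

definition ac_int_ring :: "('k::field, 'f) valued_field \<Rightarrow> 'k alg_closure set" where
  "ac_int_ring K = {\<alpha>. \<alpha> = 0 \<or> 0 \<le> aval K \<alpha>}"

definition residue_field :: "('k::field, 'f) valued_field \<Rightarrow> 'f set" where
  "residue_field K = red K ` to_ac ` int_ring K"

locale local_field =
  fixes K :: "('k::field, 'f::field) valued_field"
  assumes val_mult: "a \<noteq> 0 \<Longrightarrow> b \<noteq> 0 \<Longrightarrow> val K (a * b) = val K a + val K b"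
    and val_add: "a \<noteq> 0 \<Longrightarrow> b \<noteq> 0 \<Longrightarrow> a + b \<noteq> 0 \<Longrightarrow> min (val K a) (val K b) \<le> val K (a + b)"
    and val_surj: "val K ` (UNIV - {0}) = UNIV"
    and unif: "unif K \<noteq> 0" "val K (unif K) = 1"
    and complete: "\<And>u :: nat \<Rightarrow> 'k. (\<forall>N. \<exists>M. \<forall>m\<ge>M. \<forall>n\<ge>M. val_ge K (u m - u n) N) \<Longrightarrow>
        \<exists>x. \<forall>N. \<exists>M. \<forall>n\<ge>M. val_ge K (u n - x) N"
    and finite_residue_field: "finite (residue_field K)"
    and aval_mult: "\<alpha> \<noteq> 0 \<Longrightarrow> \<beta> \<noteq> 0 \<Longrightarrow> aval K (\<alpha> * \<beta>) = aval K \<alpha> + aval K \<beta>"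
    and aval_add: "\<alpha> \<noteq> 0 \<Longrightarrow> \<beta> \<noteq> 0 \<Longrightarrow> \<alpha> + \<beta> \<noteq> 0 \<Longrightarrow>
        min (aval K \<alpha>) (aval K \<beta>) \<le> aval K (\<alpha> + \<beta>)"
    and aval_to_ac: "a \<noteq> 0 \<Longrightarrow> aval K (to_ac a) = real_of_int (val K a)"
    and red_one: "red K 1 = 1"
    and red_add: "\<alpha> \<in> ac_int_ring K \<Longrightarrow> \<beta> \<in> ac_int_ring K \<Longrightarrow>
        red K (\<alpha> + \<beta>) = red K \<alpha> + red K \<beta>"
    and red_mult: "\<alpha> \<in> ac_int_ring K \<Longrightarrow> \<beta> \<in> ac_int_ring K \<Longrightarrow>
        red K (\<alpha> * \<beta>) = red K \<alpha> * red K \<beta>"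
    and red_eq_0: "\<alpha> \<in> ac_int_ring K \<Longrightarrow> red K \<alpha> = 0 \<longleftrightarrow> \<alpha> = 0 \<or> 0 < aval K \<alpha>"
    and red_surj: "red K ` ac_int_ring K = UNIV"

text \<open>\<open>star\<close> is meant for non-zero integral arguments.\<close>

definition star :: "('k::field, 'f) valued_field \<Rightarrow> 'k alg_closure \<Rightarrow> 'k alg_closure \<Rightarrow> 'k alg_closure" where
  "star K \<alpha> \<beta> = \<alpha> * \<beta> / to_ac (unif K) powi \<lfloor>aval K (\<alpha> * \<beta>)\<rfloor>"

text \<open>An intermediate field between the base field and its algebraic closure is given by its set
  \<open>L\<close> of elements.\<close>

definition adjoin :: "'k::field alg_closure \<Rightarrow> 'k alg_closure set" where
  "adjoin \<theta> = {poly (map_poly to_ac p) \<theta> / poly (map_poly to_ac q) \<theta> | p q.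
                 poly (map_poly to_ac q) \<theta> \<noteq> 0}"

definition int_ring_of :: "('k::field, 'f) valued_field \<Rightarrow> 'k alg_closure set \<Rightarrow> 'k alg_closure set" where
  "int_ring_of K L = L \<inter> ac_int_ring K"

definition residue_field_of :: "('k::field, 'f) valued_field \<Rightarrow> 'k alg_closure set \<Rightarrow> 'f set" where
  "residue_field_of K L = red K ` int_ring_of K L"

text \<open>The index of the value group of the base field in the value group of \<open>L\<close>.\<close>

definition ram_index :: "('k::field, 'f) valued_field \<Rightarrow> 'k alg_closure set \<Rightarrow> nat" where
  "ram_index K L = card ((aval K ` (L - {0})) // {(x, y). x - y \<in> \<int>})"

definition res_degree :: "('k::field, 'f::field) valued_field \<Rightarrow> 'k alg_closure set \<Rightarrow> nat" where
  "res_degree K L = ring.dim ring_of_type_algebra (residue_field K) (residue_field_of K L)"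

definition unit_strip :: "('k::field, 'f) valued_field \<Rightarrow> 'k alg_closure set \<Rightarrow> 'k alg_closure set" where
  "unit_strip K L = {\<alpha> \<in> int_ring_of K L. \<alpha> \<noteq> 0 \<and> 0 \<le> aval K \<alpha> \<and> aval K \<alpha> < 1}"

definition int_basis :: "('k::field, 'f) valued_field \<Rightarrow> 'k alg_closure set \<Rightarrow> 'k alg_closure set \<Rightarrow> bool" where
  "int_basis K L B \<longleftrightarrow> is_basis (to_ac ` int_ring K) (int_ring_of K L) B"

definition standard_form :: "('k::field, 'f::field) valued_field \<Rightarrow> 'k alg_closure set \<Rightarrow> 'k alg_closure set \<Rightarrow> bool" where
  "standard_form K L B \<longleftrightarrow> B \<subseteq> unit_strip K L \<and>
     (\<forall>t < ram_index K L.
        let B\<^sub>t = {\<alpha> \<in> B. aval K \<alpha> = real t / real (ram_index K L)} in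
        card B\<^sub>t = res_degree K L \<and>
        (\<exists>\<omega> \<in> B\<^sub>t. is_basis (residue_field K) (residue_field_of K L)
                       ((\<lambda>\<alpha>. red K (inverse \<omega> * \<alpha>)) ` B\<^sub>t)))"


section \<open>Types\<close>

text \<open>\<open>phi T i\<close> is \<open>\<phi>\<^sub>i\<close>, the slope \<open>\<lambda>\<^sub>i\<close> is \<open>- hh T i / ee T i\<close>, \<open>psi T i\<close> is \<open>\<psi>\<^sub>i\<close>, and
  \<open>(ell T i, ell' T i)\<close> are the fixed Bezout coefficients of \<open>(h\<^sub>i, e\<^sub>i)\<close>.  The tower
  of the fields \<open>\<FF>\<^sub>i\<close> with \<open>\<FF>\<^sub>i\<^sub>+\<^sub>1 = \<FF>\<^sub>i[y]/(\<psi>\<^sub>i)\<close> is realized inside the algebraically closed field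
  \<open>'f\<close> by means of a chosen root \<open>zz T i\<close> of \<open>\<psi>\<^sub>i\<close>, the image of the class of \<open>y\<close>.  Data with index
  exceeding the order of the type are ignored.\<close>

record (overloaded) ('k::zero, 'f::zero) type_data =
  phi :: "nat \<Rightarrow> 'k poly"
  hh :: "nat \<Rightarrow> nat"
  ee :: "nat \<Rightarrow> nat"
  psi :: "nat \<Rightarrow> 'f poly"
  zz :: "nat \<Rightarrow> 'f"
  ell :: "nat \<Rightarrow> int"
  ell' :: "nat \<Rightarrow> int"

definition slope :: "('k::zero, 'f::zero) type_data \<Rightarrow> nat \<Rightarrow> real" where
  "slope T i = - (real (hh T i) / real (ee T i))"

definition ff :: "('k::zero, 'f::zero) type_data \<Rightarrow> nat \<Rightarrow> nat" where
  "ff T i = degree (psi T i)"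

primrec mm :: "('k::zero, 'f::zero) type_data \<Rightarrow> nat \<Rightarrow> nat" where
  "mm T 0 = 1"
| "mm T (Suc i) = ee T i * ff T i * mm T i"

primrec FF :: "('k::field, 'f::field) valued_field \<Rightarrow> ('k, 'f) type_data \<Rightarrow> nat \<Rightarrow> 'f set" where
  "FF K T 0 = residue_field K"
| "FF K T (Suc i) = {poly p (zz T i) | p. p \<in> polys_over (FF K T i)}"

text \<open>\<open>vv K T i\<close> is \<open>v\<^sub>i\<close> on non-zero polynomials, for \<open>i \<ge> 1\<close>; the value for \<open>i = 0\<close> is a dummy.\<close>

fun vv :: "('k::field, 'f::field) valued_field \<Rightarrow> ('k, 'f) type_data \<Rightarrow> nat \<Rightarrow> 'k poly \<Rightarrow> int" where
  "vv K T 0 g = 0"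
| "vv K T (Suc 0) g = Min {val K (coeff g n) | n. coeff g n \<noteq> 0}"
| "vv K T (Suc (Suc i)) g =
     Min {int (ee T (Suc i)) * vv K T (Suc i) (expansion_coeff (phi T (Suc i)) g s * phi T (Suc i) ^ s)
            + int s * int (hh T (Suc i)) | s. expansion_coeff (phi T (Suc i)) g s \<noteq> 0}"

text \<open>The valuation of a zero coefficient is infinite, so it contributes no point.\<close>

definition newton_point :: "('k::field, 'f::field) valued_field \<Rightarrow> ('k, 'f) type_data \<Rightarrow> nat \<Rightarrow> 'k poly \<Rightarrow> nat \<Rightarrow> real \<times> real" where
  "newton_point K T i g s =
     (real s, real_of_int (vv K T i (expansion_coeff (phi T i) g s * phi T i ^ s)))"

definition newton :: "('k::field, 'f::field) valued_field \<Rightarrow> ('k, 'f) type_data \<Rightarrow> nat \<Rightarrow> 'k poly \<Rightarrow> (real \<times> real) set" where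
  "newton K T i g = lower_hull {newton_point K T i g s | s. expansion_coeff (phi T i) g s \<noteq> 0}"

definition newton_neg :: "('k::field, 'f::field) valued_field \<Rightarrow> ('k, 'f) type_data \<Rightarrow> nat \<Rightarrow> 'k poly \<Rightarrow> (real \<times> real) set" where
  "newton_neg K T i g = negative_part (newton K T i g)"

text \<open>\<open>tt K T i g s\<close> is the exponent \<open>t\<^sub>i(s)\<close> attached to the \<open>\<phi>\<^sub>i\<^sub>+\<^sub>1\<close>-expansion of \<open>g\<close>.
  The division is exact whenever the corresponding coefficient is non-zero.\<close>

definition tt :: "('k::field, 'f::field) valued_field \<Rightarrow> ('k, 'f) type_data \<Rightarrow> nat \<Rightarrow> 'k poly \<Rightarrow> nat \<Rightarrow> int" where
  "tt K T i g s =
     (if i = 0 then 0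
      else let a = expansion_coeff (phi T (Suc i)) g s;
               \<sigma> = left_abscissa (slope_component (slope T i) (newton K T i a))
           in (int \<sigma> - ell T i * vv K T (Suc i) (a * phi T (Suc i) ^ s)) div int (ee T i))"

text \<open>\<open>RR K T i\<close> is the residual polynomial operator \<open>R\<^sub>i\<close>, i.e. \<open>R\<^sub>\<lambda>\<^sub>,\<^sub>i\<close> for \<open>\<lambda> = \<lambda>\<^sub>i\<close> when \<open>i \<ge> 1\<close>.\<close>

primrec RR :: "('k::field, 'f::field) valued_field \<Rightarrow> ('k, 'f) type_data \<Rightarrow> nat \<Rightarrow> 'k poly \<Rightarrow> 'f poly" where
  "RR K T 0 = (\<lambda>g. map_poly (\<lambda>a. red K (to_ac (a / unif K powi vv K T 1 g))) g)"
| "RR K T (Suc i) = (\<lambda>g.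
     let c = (\<lambda>s. let a = expansion_coeff (phi T (Suc i)) g s in
                if a \<noteq> 0 \<and> newton_point K T (Suc i) g s \<in> newton_neg K T (Suc i) g
                then zz T i powi tt K T i g s * poly (RR K T i a) (zz T i)
                else 0);
         S = slope_component (slope T (Suc i)) (newton K T (Suc i) g);
         d = (right_abscissa S - left_abscissa S) div ee T (Suc i)
     in (\<Sum>j\<le>d. monom (c (left_abscissa S + j * ee T (Suc i))) j))"

definition eq_up_to_const :: "'f::field poly \<Rightarrow> 'f poly \<Rightarrow> bool" where
  "eq_up_to_const p q \<longleftrightarrow> (\<exists>c. c \<noteq> 0 \<and> p = smult c q)"

text \<open>\<open>representative K T i p\<close>: \<open>p\<close> is a representative of the type of order \<open>i\<close> given by \<open>T\<close>.\<close>

definition representative :: "('k::field, 'f::field) valued_field \<Rightarrow> ('k, 'f) type_data \<Rightarrow> nat \<Rightarrow> 'k poly \<Rightarrow> bool" where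
  "representative K T i p \<longleftrightarrow> p \<in> polys_over (int_ring K) \<and> lead_coeff p = 1 \<and>
     degree p = mm T (Suc i) \<and> eq_up_to_const (RR K T i p) (psi T i)"

primrec is_type :: "('k::field, 'f::field) valued_field \<Rightarrow> ('k, 'f) type_data \<Rightarrow> nat \<Rightarrow> bool" where
  "is_type K T 0 \<longleftrightarrow>
     ee T 0 = 1 \<and> hh T 0 = 0 \<and>
     irreducible_over (FF K T 0) (psi T 0) \<and> lead_coeff (psi T 0) = 1 \<and>
     poly (psi T 0) (zz T 0) = 0"
| "is_type K T (Suc i) \<longleftrightarrow>
     is_type K T i \<and> representative K T i (phi T (Suc i)) \<and>
     0 < hh T (Suc i) \<and> 0 < ee T (Suc i) \<and> coprime (hh T (Suc i)) (ee T (Suc i)) \<and>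
     ell T (Suc i) * int (hh T (Suc i)) - ell' T (Suc i) * int (ee T (Suc i)) = 1 \<and>
     irreducible_over (FF K T (Suc i)) (psi T (Suc i)) \<and> lead_coeff (psi T (Suc i)) = 1 \<and>
     psi T (Suc i) \<noteq> [:0, 1:] \<and>
     poly (psi T (Suc i)) (zz T (Suc i)) = 0"

text \<open>Since \<open>\<psi>\<^sub>i\<close> is monic, divisibility by its powers over \<open>\<FF>\<^sub>i\<close> and over \<open>'f\<close> agree.\<close>

definition ord_type :: "('k::field, 'f::field) valued_field \<Rightarrow> ('k, 'f) type_data \<Rightarrow> nat \<Rightarrow> 'k poly \<Rightarrow> nat" where
  "ord_type K T i g = Max {n. psi T i ^ n dvd RR K T i g}"

definition complete_type :: "('k::field, 'f::field) valued_field \<Rightarrow> ('k, 'f) type_data \<Rightarrow> nat \<Rightarrow> 'k poly \<Rightarrow> bool" where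
  "complete_type K T r g \<longleftrightarrow> is_type K T r \<and> ord_type K T r g = 1"


section \<open>Quotients\<close>

definition side_end :: "('k::field, 'f::field) valued_field \<Rightarrow> ('k, 'f) type_data \<Rightarrow> 'k poly \<Rightarrow> nat \<Rightarrow> nat" where
  "side_end K T f i = right_abscissa (slope_component (slope T i) (newton_neg K T i f))"

definition quotient_poly :: "('k::field, 'f::field) valued_field \<Rightarrow> ('k, 'f) type_data \<Rightarrow> 'k poly \<Rightarrow> nat \<Rightarrow> nat \<Rightarrow> 'k poly" where
  "quotient_poly K T f i j = f div phi T i ^ (side_end K T f i - j)"

definition side_ordinate :: "('k::field, 'f::field) valued_field \<Rightarrow> ('k, 'f) type_data \<Rightarrow> 'k poly \<Rightarrow> nat \<Rightarrow> nat \<Rightarrow> real" where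
  "side_ordinate K T f i j = (THE y. (real (side_end K T f i - j), y) \<in> newton_neg K T i f)"

definition HH :: "('k::field, 'f::field) valued_field \<Rightarrow> ('k, 'f) type_data \<Rightarrow> 'k poly \<Rightarrow> nat \<Rightarrow> nat \<Rightarrow> real" where
  "HH K T f i j =
     (side_ordinate K T f i j - real (side_end K T f i - j) * real_of_int (vv K T i (phi T i)))
       / real (\<Prod>n<i. ee T n)"

definition quotient_val :: "('k::field, 'f::field) valued_field \<Rightarrow> ('k, 'f) type_data \<Rightarrow> 'k poly \<Rightarrow> 'k alg_closure \<Rightarrow> nat \<Rightarrow> nat \<Rightarrow> 'k alg_closure" where
  "quotient_val K T f \<theta> i j = poly (map_poly to_ac (quotient_poly K T f i j)) \<theta>"

definition multiindices :: "('k::zero, 'f::zero) type_data \<Rightarrow> nat \<Rightarrow> (nat \<Rightarrow> nat) set" where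
  "multiindices T r = (\<Pi>\<^sub>E i\<in>{..r}. {..<ee T i * ff T i})"

definition QQ :: "('k::field, 'f::field) valued_field \<Rightarrow> ('k, 'f) type_data \<Rightarrow> nat \<Rightarrow> 'k poly \<Rightarrow> 'k alg_closure \<Rightarrow> (nat \<Rightarrow> nat) \<Rightarrow> 'k alg_closure" where
  "QQ K T r f \<theta> j = foldl (star K) (\<theta> ^ j 0) (map (\<lambda>i. quotient_val K T f \<theta> i (j i)) [1..<Suc r])"

end

theory Submission
  imports Defs
begin

text \<open>At a root \<open>\<theta>\<close> of \<open>F\<close>, level \<open>i\<close> of the type provides an element \<open>w\<^sub>i\<close> of value \<open>1 / (e\<^sub>0 \<cdots> e\<^sub>i\<^sub>-\<^sub>1)\<close>, and
  \<open>\<phi>\<^sub>i(\<theta>)\<close>, multiplied by a power of \<open>w\<^sub>i\<^sub>-\<^sub>1\<close>, gives an element \<open>\<Phi>\<^sub>i\<close> such that \<open>\<Phi>\<^sub>i\<^bsup>e\<^sub>i\<^esup> / w\<^sub>i\<^bsup>h\<^sub>i\<^esup>\<close> is a unit with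
  residue \<open>z\<^sub>i\<close>.  The value at \<open>\<theta>\<close> of a polynomial is dominated by the terms of its \<open>\<phi>\<^sub>i\<close>-expansion on the side of
  slope \<open>\<lambda>\<^sub>i\<close> as long as the residual polynomial does not vanish at \<open>z\<^sub>i\<close>.  For \<open>Q\<^sub>i\<^sub>,\<^sub>j\<close> the residual polynomial has
  degree less than \<open>f\<^sub>i\<close>, so \<open>Q\<^sub>i\<^sub>,\<^sub>j(\<theta>)\<close> has value \<open>H\<^sub>i\<^sub>,\<^sub>j\<close> and is, up to a power of \<open>w\<^sub>i\<close>, the product of
  \<open>\<Phi>\<^sub>i\<^bsup>j mod e\<^sub>i\<^esup>\<close> and a unit whose residue is a polynomial of degree \<open>j div e\<^sub>i\<close> in \<open>z\<^sub>i\<close>.  Different classes of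
  \<open>j\<close> modulo \<open>e\<^sub>i\<close> give different classes of values, and in one class the residues are independent over \<open>\<FF>\<^sub>i\<close>.
  By induction on the level, the value of a \<open>k\<close>-linear combination of the products \<open>Q\<^bold>j\<close> is the minimum of the
  values of its terms.  Their number is \<open>m\<^sub>r\<^sub>+\<^sub>1\<close>, which is the degree of \<open>F\<close>: otherwise the values at the roots of
  \<open>F\<close> of a polynomial \<open>\<Phi>\<close> of degree \<open>m\<^sub>r\<^sub>+\<^sub>1\<close> approximating a factor of \<open>F\<close> would contradict
  \<open>\<Prod>\<^sub>\<theta> (\<Phi>(\<theta>) - c) = \<plusminus> \<Prod>\<^sub>\<xi> F(\<xi>)\<close>, where \<open>\<xi>\<close> runs through the roots of \<open>\<Phi> - c\<close>.  An orthogonal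
  family of \<open>[L : k]\<close> elements with values in \<open>[0, 1)\<close> is an integral basis in standard form.\<close>


section \<open>Polynomials over subfields\<close>

text \<open>Residual polynomials determine a point only up to conjugacy, whereas the fields
  \<open>FF K T i\<close> are cut out by fixed roots \<open>zz T i\<close>. The point is therefore
  kept and the reduction map is twisted by a Frobenius power; hence a stage consists of pairs of a
  point and a place. The valuations of a type are studied by evaluation: \<open>nn'\<close> is the
  exponent of a maximum norm, and its multiplicativity is read off at points where the norm of
  \<open>\<phi>\<close> is slightly above the critical value \<open>G\<close>. This needs many
  points, and the bound \<open>B\<close> with the assumption \<open>outside\<close> is what the
  induction carries along to provide them: every point at which \<open>\<phi>\<close> has norm below
  \<open>B\<close> belongs to \<open>D\<close>. Completeness enters through the equality of norms at
  conjugate roots, a consequence of the equivalence of norms on a finite-dimensional space. Level 0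
  runs through the same machinery with \<open>h = 0\<close>; for types it is the only level where
  \<open>z = 0\<close> can occur, which explains the case distinctions on \<open>z\<close>. The
  polygons of the statement are linked separately, by showing that the recursively built
  \<open>nv\<close> and \<open>resv\<close> compute \<open>vv\<close> and \<open>RR\<close>.\<close>

lemma map_poly_add_hom:
  fixes h :: "'a::comm_ring_1 \<Rightarrow> 'b::comm_ring_1"
  assumes "h 0 = 0" "\<And>x y. h (x + y) = h x + h y"
  shows "map_poly h (p + q) = map_poly h p + map_poly h q"
  by (rule poly_eqI) (simp add: coeff_map_poly assms)

lemma map_poly_mult_hom:
  fixes h :: "'a::comm_ring_1 \<Rightarrow> 'b::comm_ring_1"
  assumes "h 0 = 0" "\<And>x y. h (x + y) = h x + h y" "\<And>x y. h (x * y) = h x * h y"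
  shows "map_poly h (p * q) = map_poly h p * map_poly h q"
proof (rule poly_eqI)
  fix n
  have hs: "h (sum f B) = (\<Sum>x\<in>B. h (f x))" if "finite B" for f :: "nat \<Rightarrow> 'a" and B
    using that by (induction B rule: finite_induct) (auto simp: assms)
  show "coeff (map_poly h (p * q)) n = coeff (map_poly h p * map_poly h q) n"
    by (simp add: coeff_map_poly assms coeff_mult hs)
qed

definition subfld :: "'f::field set \<Rightarrow> bool" where
  "subfld A \<longleftrightarrow> 0 \<in> A \<and> 1 \<in> A \<and> (\<forall>x\<in>A. \<forall>y\<in>A. x + y \<in> A \<and> x * y \<in> A) \<and>
     (\<forall>x\<in>A. - x \<in> A \<and> inverse x \<in> A)"

lemma subfldD:
  assumes "subfld A"
  shows "0 \<in> A" "1 \<in> A" "x \<in> A \<Longrightarrow> y \<in> A \<Longrightarrow> x + y \<in> A" "x \<in> A \<Longrightarrow> y \<in> A \<Longrightarrow> x * y \<in> A"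
    "x \<in> A \<Longrightarrow> - x \<in> A" "x \<in> A \<Longrightarrow> inverse x \<in> A"
  using assms by (auto simp: subfld_def)

lemma subfld_diff: "subfld A \<Longrightarrow> x \<in> A \<Longrightarrow> y \<in> A \<Longrightarrow> x - y \<in> A"
  using subfldD(3)[of A x "-y"] subfldD(5)[of A y] by simp

lemma subfld_divide: "subfld A \<Longrightarrow> x \<in> A \<Longrightarrow> y \<in> A \<Longrightarrow> x / y \<in> A"
  by (simp add: field_class.field_divide_inverse subfldD)

lemma subfld_power: "subfld A \<Longrightarrow> x \<in> A \<Longrightarrow> x ^ n \<in> A"
  by (induction n) (auto simp: subfldD)

lemma subfld_powi: "subfld A \<Longrightarrow> x \<in> A \<Longrightarrow> x powi n \<in> A"
  by (auto simp: power_int_def subfld_power subfldD)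

lemma subfld_sum: "subfld A \<Longrightarrow> (\<And>x. x \<in> B \<Longrightarrow> f x \<in> A) \<Longrightarrow> sum f B \<in> A"
  by (induction B rule: infinite_finite_induct) (auto simp: subfldD)

lemma polys_overD: "p \<in> polys_over A \<Longrightarrow> coeff p n \<in> A"
  by (simp add: polys_over_def)

lemma polys_over_add: "subfld A \<Longrightarrow> p \<in> polys_over A \<Longrightarrow> q \<in> polys_over A \<Longrightarrow> p + q \<in> polys_over A"
  by (simp add: polys_over_def subfldD)

lemma polys_over_diff: "subfld A \<Longrightarrow> p \<in> polys_over A \<Longrightarrow> q \<in> polys_over A \<Longrightarrow> p - q \<in> polys_over A"
  by (simp add: polys_over_def subfld_diff)

lemma polys_over_mult: "subfld A \<Longrightarrow> p \<in> polys_over A \<Longrightarrow> q \<in> polys_over A \<Longrightarrow> p * q \<in> polys_over A"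
  by (auto simp: polys_over_def coeff_mult intro!: subfld_sum subfldD(4))

lemma polys_over_monom: "subfld A \<Longrightarrow> c \<in> A \<Longrightarrow> monom c n \<in> polys_over A"
  by (simp add: polys_over_def subfldD)

lemma polys_over_sum: "subfld A \<Longrightarrow> (\<And>x. x \<in> B \<Longrightarrow> f x \<in> polys_over A) \<Longrightarrow> sum f B \<in> polys_over A"
  by (auto simp: polys_over_def coeff_sum intro!: subfld_sum)

lemma polys_over_0: "subfld A \<Longrightarrow> 0 \<in> polys_over A"
  by (simp add: polys_over_def subfldD)

lemma polys_over_pCons: "subfld A \<Longrightarrow> a \<in> A \<Longrightarrow> p \<in> polys_over A \<Longrightarrow> pCons a p \<in> polys_over A"
  by (simp add: polys_over_def coeff_pCons split: nat.splits)

lemma polys_over_smult: "subfld A \<Longrightarrow> a \<in> A \<Longrightarrow> p \<in> polys_over A \<Longrightarrow> smult a p \<in> polys_over A"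
  by (simp add: polys_over_def subfldD)

text \<open>Long division keeps the coefficients in \<open>A\<close>, and uniqueness of quotient and
  remainder over the ambient field identifies its result with \<open>div\<close> and
  \<open>mod\<close>.\<close>

lemma polys_over_divide:
  assumes A: "subfld A" and q: "q \<in> polys_over A" "q \<noteq> 0" and p: "p \<in> polys_over A"
  shows "p div q \<in> polys_over A" "p mod q \<in> polys_over A"
proof -
  have "\<exists>s\<in>polys_over A. \<exists>r\<in>polys_over A. p = s * q + r \<and> (r = 0 \<or> degree r < degree q)"
    using p
  proof (induction "degree p" arbitrary: p rule: less_induct)
    case less
    show ?case
    proof (cases "p = 0 \<or> degree p < degree q")
      case True
      then show ?thesis using less.prems polys_over_0[OF A] by (intro bexI[of _ 0] bexI[of _ p]) auto
    next
      case False
      define c where "c = lead_coeff p / lead_coeff q"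
      define t where "t = monom c (degree p - degree q)"
      have t: "t \<in> polys_over A" unfolding t_def c_def
        using less.prems q A by (auto intro!: polys_over_monom subfld_divide polys_overD)
      have c0: "c \<noteq> 0" using False q by (auto simp: c_def)
      define p' where "p' = p - t * q"
      have p': "p' \<in> polys_over A" unfolding p'_def
        using A t q less.prems by (auto intro!: polys_over_diff polys_over_mult)
      have tq: "degree (t * q) = degree p" 
        using False q c0 by (simp add: t_def degree_mult_eq degree_monom_eq)
      have lc: "coeff (t * q) (degree p) = lead_coeff p"
        using False q by (simp add: t_def coeff_monom_mult c_def)
      have "p' = 0 \<or> degree p' < degree p"
      proof (cases "p' = 0")
        case False
        have "degree p' \<le> degree p" unfolding p'_def by (rule degree_diff_le) (auto simp: tq)
        moreover have "coeff p' (degree p) = 0" by (simp add: p'_def lc)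
        ultimately show ?thesis using False by (metis leading_coeff_0_iff le_neq_implies_less)
      qed auto
      then obtain s r where sr: "s \<in> polys_over A" "r \<in> polys_over A" "p' = s * q + r"
        "r = 0 \<or> degree r < degree q"
      proof
        assume "p' = 0"
        with polys_over_0[OF A] that[of 0 0] show ?thesis by auto
      next
        assume "degree p' < degree p"
        from less.hyps[OF this p'] that show ?thesis by auto
      qed
      have "p = (s + t) * q + r" using sr(3) by (simp add: p'_def algebra_simps)
      with sr t A show ?thesis by (intro bexI[of _ "s + t"] bexI[of _ r]) (auto intro: polys_over_add)
    qed
  qed
  then obtain s r where sr: "s \<in> polys_over A" "r \<in> polys_over A" "p = s * q + r"
    "r = 0 \<or> degree r < degree q" by blast
  have "r div q = 0" "r mod q = r" using sr(4) by (auto simp: div_poly_less mod_poly_less)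
  then have "p div q = s" "p mod q = r" using q(2) by (simp_all add: sr(3))
  with sr show "p div q \<in> polys_over A" "p mod q \<in> polys_over A" by auto
qed

text \<open>The polynomials over \<open>A\<close> vanishing at \<open>z\<close> are the multiples of
  one of least degree, \<open>d\<close>. Since \<open>d\<close> divides \<open>\<psi>\<close>,
  irreducibility makes the cofactor constant.\<close>

lemma irreducible_over_dvd:
  assumes A: "subfld A" and psi: "irreducible_over A \<psi>" "poly \<psi> z = 0"
    and p: "p \<in> polys_over A" "poly p z = 0"
  shows "\<psi> dvd p"
proof -
  define I where "I = {q \<in> polys_over A. q \<noteq> 0 \<and> poly q z = 0}"
  have "\<psi> \<noteq> 0" using psi by (auto simp: irreducible_over_def)
  have psiI: "\<psi> \<in> I" using psi \<open>\<psi> \<noteq> 0\<close> by (auto simp: I_def irreducible_over_def)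
  define d where "d = arg_min degree (\<lambda>q. q \<in> I)"
  have d: "d \<in> I" unfolding d_def using psiI by (rule arg_min_natI)
  have dmin: "degree d \<le> degree q" if "q \<in> I" for q unfolding d_def using that by (rule arg_min_nat_le)
  have ddvd: "d dvd q" if q: "q \<in> polys_over A" "poly q z = 0" for q
  proof -
    have "q mod d \<in> polys_over A" using polys_over_divide[OF A _ _ q(1), of d] d by (auto simp: I_def)
    moreover have "poly (q mod d) z = 0"
      using q(2) d by (subst minus_div_mult_eq_mod[symmetric]) (auto simp: I_def)
    moreover have "q mod d = 0 \<or> degree (q mod d) < degree d" using d by (intro degree_mod_less) (auto simp: I_def)
    ultimately have "q mod d = 0" using dmin[of "q mod d"] by (force simp: I_def)
    then show ?thesis by auto
  qed
  have psi_A: "\<psi> \<in> polys_over A" using psi by (simp add: irreducible_over_def)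
  obtain q where q: "\<psi> = d * q" using ddvd[OF psi_A psi(2)] by (elim dvdE)
  have "q = \<psi> div d" using q d by (simp add: I_def)
  then have "q \<in> polys_over A" using polys_over_divide[OF A _ _ psi_A, of d] d by (auto simp: I_def)
  with psi q d have "degree d = 0 \<or> degree q = 0" by (auto simp: irreducible_over_def I_def)
  moreover have "degree d \<noteq> 0"
  proof
    assume "degree d = 0"
    then obtain c where "d = [:c:]" by (rule degree_eq_zeroE)
    with d show False by (auto simp: I_def)
  qed
  ultimately obtain c where c: "q = [:c:]" by (auto elim: degree_eq_zeroE)
  with q \<open>\<psi> \<noteq> 0\<close> have "c \<noteq> 0" by auto
  with q c have "\<psi> dvd d" by (simp add: smult_dvd)
  from dvd_trans[OF this ddvd[OF p]] show ?thesis .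
qed

text \<open>The form in which the independence over \<open>A\<close> of the powers of
  \<open>z\<close> below \<open>degree \<psi>\<close> is used throughout.\<close>

lemma irreducible_over_small_root:
  assumes "subfld A" "irreducible_over A \<psi>" "poly \<psi> z = 0"
    and "p \<in> polys_over A" "degree p < degree \<psi>" "p \<noteq> 0"
  shows "poly p z \<noteq> 0"
  using irreducible_over_dvd[OF assms(1-4)] assms(5,6) dvd_imp_degree_le[of \<psi> p] by linarith


section \<open>Finite fields\<close>

text \<open>Multiplication by \<open>x\<close> permutes the nonzero elements; compare their
  products.\<close>

lemma finite_subfld_power_card:
  assumes A: "subfld A" "finite A" and x: "x \<in> A"
  shows "x ^ card A = x"
proof (cases "x = 0")
  case True
  moreover have "card A \<noteq> 0" using A subfldD(1)[OF A(1)] by (auto simp: card_eq_0_iff)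
  ultimately show ?thesis by simp
next
  case False
  define U where "U = A - {0}"
  have U: "finite U" "0 \<notin> U" using A by (auto simp: U_def)
  have inj: "inj_on ((*) x) U" using False by (auto simp: inj_on_def)
  have img: "(*) x ` U = U"
  proof (rule card_subset_eq[OF U(1)])
    show "(*) x ` U \<subseteq> U" using x False A by (auto simp: U_def subfldD)
    show "card ((*) x ` U) = card U" by (rule card_image[OF inj])
  qed
  have "\<Prod>U = (\<Prod>u\<in>U. x * u)"
    using prod.reindex[OF inj, of "\<lambda>u. u"] img by simp
  also have "\<dots> = x ^ card U * \<Prod>U" by (simp add: prod.distrib)
  finally have "x ^ card U = 1" using U by simp
  moreover have "card A = Suc (card U)"
    using card_Suc_Diff1[OF A(2) subfldD(1)[OF A(1)]] by (simp add: U_def)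
  ultimately show ?thesis by simp
qed

lemma degree_prod_linear: "degree (\<Prod>a\<in>A. [:- f a, 1::'a::field:]) = card A"
proof (cases "finite A")
  case True
  then show ?thesis by (subst degree_prod_sum_eq) auto
qed auto

lemma lead_coeff_prod_linear: "lead_coeff (\<Prod>a\<in>A. [:- f a, 1::'a::field:]) = 1"
  by (subst lead_coeff_prod) simp

text \<open>Both sides are monic of degree \<open>card A\<close>, so their difference has smaller
  degree than its number of zeros in \<open>A\<close>.\<close>

lemma finite_subfld_poly:
  assumes A: "subfld A" "finite A"
  shows "monom 1 (card A) - monom 1 1 = (\<Prod>a\<in>A. [:-a, 1:])" (is "?l = ?r")
proof -
  have c: "card A \<ge> 2"
  proof -
    have "card {0::'a, 1} \<le> card A" using A subfldD[OF A(1)] by (intro card_mono) auto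
    then show ?thesis by simp
  qed
  have "degree (?l - ?r) < card A"
  proof -
    have "coeff (?l - ?r) i = 0" if "i \<ge> card A" for i
    proof (cases "i = card A")
      case True
      then show ?thesis using lead_coeff_prod_linear[of "\<lambda>x. x" A] c by (simp add: degree_prod_linear)
    next
      case False
      with that c show ?thesis by (simp add: coeff_eq_0 degree_prod_linear)
    qed
    then have "degree (?l - ?r) \<le> card A - 1" by (intro degree_le) auto
    then show ?thesis using c by simp
  qed
  moreover have "poly (?l - ?r) x = poly 0 x" if "x \<in> A" for x
    using that A finite_subfld_power_card[OF A that] by (auto simp: poly_monom poly_prod)
  ultimately have "?l - ?r = 0"
    using poly_eqI_degree[of A "?l - ?r" 0] c by simp
  then show ?thesis by simp
qed

text \<open>The characteristic is not mentioned: \<open>P x\<close>, the product of all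
  \<open>x - a\<close>, equals \<open>x ^ card A - x\<close> and is invariant under shifts by
  \<open>A\<close>. Hence \<open>P (x + y) - P x - P y\<close>, as a polynomial in \<open>x\<close>,
  vanishes on \<open>A\<close> while its degree is below \<open>card A\<close>.\<close>

lemma finite_subfld_power_add:
  fixes x y :: "'f::field" and A :: "'f set"
  assumes A: "subfld A" "finite A"
  shows "(x + y) ^ card A = x ^ card A + y ^ card A"
proof -
  let ?N = "card A"
  define P where "P x = (\<Prod>a\<in>A. x - a)" for x :: 'f
  have P: "P x = x ^ ?N - x" for x
  proof -
    have "poly (monom 1 ?N - monom 1 1) x = P x"
      unfolding finite_subfld_poly[OF A] P_def poly_prod by simp
    then show ?thesis by (simp add: poly_monom)
  qed
  have N: "?N > 0" using A subfldD(1)[OF A(1)] by (auto simp: card_gt_0_iff)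
  have Pa: "P a = 0" if "a \<in> A" for a using that A by (auto simp: P_def)
  have Pshift: "P (a + y) = P y" if a: "a \<in> A" for a y
  proof -
    have "bij_betw (\<lambda>b. a + b) A A"
      by (rule bij_betwI[of _ _ _ "\<lambda>b. b - a"]) (use A a in \<open>auto simp: subfldD subfld_diff\<close>)
    from prod.reindex_bij_betw[OF this, of "\<lambda>b. a + y - b"] show ?thesis by (simp add: P_def)
  qed
  define Q where "Q = (\<Prod>a\<in>A. [:y - a, 1:]) - (\<Prod>a\<in>A. [:-a, 1:]) - [:P y:]"
  have Qv: "poly Q x = P (x + y) - P x - P y" for x
    by (simp add: Q_def poly_prod P_def algebra_simps)
  have Qd: "coeff Q i = 0" if "i \<ge> ?N" for i
  proof (cases "i = ?N")
    case True
    have "coeff (\<Prod>a\<in>A. [:y - a, 1:]) ?N = 1"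
      using lead_coeff_prod_linear[of "\<lambda>a. a - y" A] degree_prod_linear[of "\<lambda>a. a - y" A] by simp
    moreover have "coeff (\<Prod>a\<in>A. [:-a, 1:]) ?N = 1"
      using lead_coeff_prod_linear[of "\<lambda>a. a" A] degree_prod_linear[of "\<lambda>a. a" A] by simp
    ultimately show ?thesis using True N by (simp add: Q_def coeff_pCons split: nat.splits)
  next
    case False
    have "degree (\<Prod>a\<in>A. [:y - a, 1:]) = ?N" using degree_prod_linear[of "\<lambda>a. a - y" A] by simp
    moreover have "degree (\<Prod>a\<in>A. [:-a, 1:]) = ?N" using degree_prod_linear[of "\<lambda>a. a" A] by simp
    ultimately show ?thesis using False that N
      by (simp add: Q_def coeff_eq_0 coeff_pCons split: nat.splits)
  qed
  have "degree Q \<le> ?N - 1" using Qd N by (intro degree_le) auto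
  then have "degree Q < ?N" using N by simp
  moreover have "poly Q x = poly 0 x" if "x \<in> A" for x
    using that by (simp add: Qv Pa Pshift)
  ultimately have "Q = 0" using poly_eqI_degree[of A Q 0] N by simp
  with Qv[of x] have "P (x + y) = P x + P y" by (simp add: algebra_simps)
  then show ?thesis by (simp add: P algebra_simps)
qed

lemma finite_subfld_power_inj:
  fixes x y :: "'f::field" and A :: "'f set"
  assumes A: "subfld A" "finite A" and xy: "x ^ card A = y ^ card A"
  shows "x = y"
proof -
  have N: "card A > 0" using A subfldD(1)[OF A(1)] by (auto simp: card_gt_0_iff)
  have "x ^ card A = ((x - y) + y) ^ card A" by simp
  also have "\<dots> = (x - y) ^ card A + y ^ card A" by (rule finite_subfld_power_add[OF A])
  finally show ?thesis using xy N by simp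
qed

lemma finite_subfld_fixed:
  assumes A: "subfld A" "finite A" and x: "x ^ card A = x"
  shows "x \<in> A"
proof -
  have "poly (monom 1 (card A) - monom 1 1) x = 0" using x by (simp add: poly_monom)
  then have "(\<Prod>a\<in>A. x - a) = 0" unfolding finite_subfld_poly[OF A] poly_prod by simp
  with A show ?thesis by auto
qed

text \<open>The product of the linear factors over a Frobenius orbit has coefficients fixed by the
  Frobenius map, i.e. in \<open>A\<close>, so it is divisible by \<open>\<psi>\<close>.\<close>

lemma frobenius_conjugate:
  assumes A: "subfld A" "finite A" and psi: "irreducible_over A \<psi>" "poly \<psi> x = 0" "poly \<psi> z = 0"
  shows "\<exists>k. x ^ (card A ^ k) = z"
proof -
  define h where "h y = y ^ card A" for y :: 'a
  have N: "card A > 0" using A subfldD(1)[OF A(1)] by (auto simp: card_gt_0_iff)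
  have h: "h 0 = 0" "\<And>x y. h (x + y) = h x + h y" "\<And>x y. h (x * y) = h x * h y" "h 1 = 1"
    using N finite_subfld_power_add[OF A] by (auto simp: h_def power_mult_distrib)
  have hneg: "h (- y) = - h y" for y
    using h(2)[of y "-y"] h(1) by (simp add: eq_neg_iff_add_eq_0 add.commute)
  have hinj: "h x = h y \<Longrightarrow> x = y" for x y using finite_subfld_power_inj[OF A] by (simp add: h_def)
  have hk: "(h ^^ k) y = y ^ (card A ^ k)" for k y
    by (induction k) (auto simp: h_def power_mult[symmetric] mult.commute)
  have hA: "h a = a" if "a \<in> A" for a using finite_subfld_power_card[OF A that] by (simp add: h_def)
  have psiA: "\<psi> \<in> polys_over A" "\<psi> \<noteq> 0" using psi by (auto simp: irreducible_over_def)
  have map_psi: "map_poly h p = p" if "p \<in> polys_over A" for p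
    using that by (intro poly_eqI) (simp add: coeff_map_poly h(1) hA polys_over_def)
  have hpoly: "poly p (h y) = h (poly p y)" if "p \<in> polys_over A" for p y
  proof -
    have "h (poly q y) = poly (map_poly h q) (h y)" for q
      by (induction q) (auto simp: map_poly_pCons h)
    then show ?thesis using map_psi[OF that] by metis
  qed
  have orbit: "poly \<psi> ((h ^^ k) x) = 0" for k
    by (induction k) (use psi in \<open>auto simp: hpoly[OF psiA(1)] h\<close>)
  have "finite (range (\<lambda>k. (h ^^ k) x))"
    by (rule finite_subset[OF _ poly_roots_finite[OF psiA(2)]]) (use orbit in auto)
  then have "\<not> inj (\<lambda>k. (h ^^ k) x)" using finite_imageD infinite_UNIV_nat by blast
  then obtain i j where ij: "i < j" "(h ^^ i) x = (h ^^ j) x"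
    unfolding inj_on_def by (metis linorder_neqE_nat)
  \<comment> \<open>Injectivity allows common iterates to be cancelled, so the orbit returns to
    \<open>x\<close> itself and not only to a later iterate.\<close>
  have "(h ^^ i) x = (h ^^ (i + n)) x \<Longrightarrow> x = (h ^^ n) x" for n i
    by (induction i) (auto dest: hinj)
  from this[of i "j - i"] ij have per: "(h ^^ (j - i)) x = x" by simp
  define M where "M = j - i"
  have M: "M > 0" "(h ^^ M) x = x" using ij per by (auto simp: M_def)
  define q where "q = (\<Prod>k<M. [:- ((h ^^ k) x), 1:])"
  have "map_poly h q = (\<Prod>k<M. [:- ((h ^^ Suc k) x), 1:])"
  proof -
    have "map_poly h (\<Prod>k\<in>I. [:- ((h ^^ k) x), 1:]) = (\<Prod>k\<in>I. [:- ((h ^^ Suc k) x), 1:])"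
      if "finite I" for I
      using that by (induction I rule: finite_induct)
        (simp_all add: map_poly_mult_hom[of h, OF h(1-3)] map_poly_pCons h hneg del: mult_pCons_left)
    then show ?thesis by (simp add: q_def)
  qed
  also have "\<dots> = q"
  proof -
    obtain M' where M': "M = Suc M'" using M by (cases M) auto
    have "(\<Prod>k<M. [:- ((h ^^ Suc k) x), 1:]) = (\<Prod>k<M'. [:- ((h ^^ Suc k) x), 1:]) * [:- x, 1:]"
      using M by (simp add: M')
    also have "\<dots> = q" unfolding q_def M' prod.lessThan_Suc_shift by simp
    finally show ?thesis .
  qed
  finally have fix_q: "map_poly h q = q" .
  have "q \<in> polys_over A" unfolding polys_over_def
  proof safe
    fix n
    have "h (coeff q n) = coeff (map_poly h q) n" by (simp add: coeff_map_poly h)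
    then show "coeff q n \<in> A" using fix_q by (intro finite_subfld_fixed[OF A]) (simp add: h_def)
  qed
  moreover have "poly q x = 0" using M(1) by (auto simp: q_def poly_prod intro!: bexI[of _ 0])
  ultimately have "\<psi> dvd q" using irreducible_over_dvd[OF A(1) psi(1,2)] by blast
  then have "poly q z = 0" using psi(3) by (auto simp: dvd_def)
  then obtain k where "(h ^^ k) x = z" by (auto simp: q_def poly_prod)
  then show ?thesis by (auto simp: hk)
qed

definition adjoin_root :: "'f::field set \<Rightarrow> 'f \<Rightarrow> 'f set" where
  "adjoin_root A z = {poly p z | p. p \<in> polys_over A}"

lemma adjoin_root_small:
  assumes A: "subfld A" and psi: "irreducible_over A \<psi>" "poly \<psi> z = 0" and x: "x \<in> adjoin_root A z"
  shows "\<exists>p \<in> polys_over A. degree p < degree \<psi> \<and> x = poly p z"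
proof -
  from x obtain p where p: "p \<in> polys_over A" "x = poly p z" by (auto simp: adjoin_root_def)
  have psi': "\<psi> \<in> polys_over A" "\<psi> \<noteq> 0" "0 < degree \<psi>" using psi by (auto simp: irreducible_over_def)
  have "poly (p mod \<psi>) z = poly p z"
    using psi(2) by (subst minus_div_mult_eq_mod[symmetric]) auto
  moreover have "degree (p mod \<psi>) < degree \<psi>"
    using degree_mod_less[OF psi'(2), of p] psi'(3) by auto
  ultimately show ?thesis using polys_over_divide(2)[OF A psi'(1,2) p(1)] p(2)
    by (intro bexI[of _ "p mod \<psi>"]) auto
qed

lemma finite_adjoin_root:
  assumes A: "subfld A" "finite A" and psi: "irreducible_over A \<psi>" "poly \<psi> z = 0"
  shows "finite (adjoin_root A z)"
proof -
  let ?F = "\<lambda>xs. poly (Poly xs) z"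
  have "adjoin_root A z \<subseteq> ?F ` {xs. set xs \<subseteq> A \<and> length xs \<le> degree \<psi>}"
  proof
    fix x assume "x \<in> adjoin_root A z"
    from adjoin_root_small[OF A(1) psi this] obtain p where p: "p \<in> polys_over A" "degree p < degree \<psi>" "x = poly p z"
      by blast
    have "set (coeffs p) \<subseteq> A" using p(1) by (auto simp: polys_over_def coeffs_def)
    moreover have "length (coeffs p) \<le> degree \<psi>" using p(2) by (simp add: coeffs_def)
    ultimately show "x \<in> ?F ` {xs. set xs \<subseteq> A \<and> length xs \<le> degree \<psi>}"
      using p(3) by (intro image_eqI[of _ _ "coeffs p"]) auto
  qed
  moreover have "finite {xs. set xs \<subseteq> A \<and> length xs \<le> degree \<psi>}" by (rule finite_lists_length_le[OF A(2)])
  ultimately show ?thesis by (meson finite_imageI finite_subset)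
qed

text \<open>Multiplication by a nonzero element is injective on a finite set, hence hits
  \<open>1\<close>.\<close>

lemma finite_subring_subfld:
  assumes "finite B" "0 \<in> B" "1 \<in> B" "\<And>x y. x \<in> B \<Longrightarrow> y \<in> B \<Longrightarrow> x + y \<in> B"
    "\<And>x y. x \<in> B \<Longrightarrow> y \<in> B \<Longrightarrow> x * y \<in> B" "\<And>x. x \<in> B \<Longrightarrow> - x \<in> B"
  shows "subfld B"
proof -
  have "inverse x \<in> B" if x: "x \<in> B" "x \<noteq> 0" for x
  proof -
    have "inj_on ((*) x) B" using x by (auto simp: inj_on_def)
    moreover have "(*) x ` B \<subseteq> B" using assms x by auto
    ultimately have "(*) x ` B = B" using assms(1) by (metis card_image card_subset_eq)
    with assms(3) have "1 \<in> (*) x ` B" by simp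
    then obtain y where "y \<in> B" "1 = x * y" by blast
    then show ?thesis using x by (metis inverse_unique)
  qed
  then show ?thesis using assms by (auto simp: subfld_def) (metis inverse_zero)
qed

lemma subfld_adjoin_root:
  assumes A: "subfld A" "finite A" and psi: "irreducible_over A \<psi>" "poly \<psi> z = 0"
  shows "subfld (adjoin_root A z)"
proof (rule finite_subring_subfld[OF finite_adjoin_root[OF A psi]])
  show "0 \<in> adjoin_root A z" using polys_over_0[OF A(1)] by (force simp: adjoin_root_def)
  show "1 \<in> adjoin_root A z" 
    using polys_over_monom[OF A(1) subfldD(2)[OF A(1)], of 0] by (force simp: adjoin_root_def)
  fix x y assume "x \<in> adjoin_root A z" "y \<in> adjoin_root A z"
  then obtain p q where pq: "p \<in> polys_over A" "q \<in> polys_over A" "x = poly p z" "y = poly q z"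
    by (auto simp: adjoin_root_def)
  show "x + y \<in> adjoin_root A z"
    using pq polys_over_add[OF A(1) pq(1,2)] by (auto simp: adjoin_root_def intro!: exI[of _ "p + q"])
  show "x * y \<in> adjoin_root A z"
    using pq polys_over_mult[OF A(1) pq(1,2)] by (auto simp: adjoin_root_def intro!: exI[of _ "p * q"])
next
  fix x assume "x \<in> adjoin_root A z"
  then obtain p where p: "p \<in> polys_over A" "x = poly p z" by (auto simp: adjoin_root_def)
  then have "0 - p \<in> polys_over A" using polys_over_diff[OF A(1) polys_over_0[OF A(1)]] by blast
  with p show "- x \<in> adjoin_root A z" by (auto simp: adjoin_root_def intro!: exI[of _ "0 - p"])
qed

lemma adjoin_root_incl: "subfld A \<Longrightarrow> A \<subseteq> adjoin_root A z"
  by (auto simp: adjoin_root_def intro!: exI[of _ "monom _ 0"] polys_over_monom) (simp add: poly_monom)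

lemma adjoin_root_gen: "subfld A \<Longrightarrow> z \<in> adjoin_root A z"
  by (auto simp: adjoin_root_def intro!: exI[of _ "monom 1 1"] polys_over_monom subfldD) (simp add: poly_monom)

section \<open>Expansions and evaluation\<close>

lemma expansion_coeff_add: "expansion_coeff q (f + g) s = expansion_coeff q f s + expansion_coeff q g s"
  by (simp add: expansion_coeff_def poly_div_add_left poly_mod_add_left)

lemma expansion_coeff_0 [simp]: "expansion_coeff q 0 s = 0"
  by (simp add: expansion_coeff_def)

lemma expansion_coeff_sum_left: "expansion_coeff q (sum f I) s = (\<Sum>i\<in>I. expansion_coeff q (f i) s)"
  by (induction I rule: infinite_finite_induct) (auto simp: expansion_coeff_add)

lemma expansion_coeff_monomial:
  assumes "0 < degree q" "degree b < degree q"
  shows "expansion_coeff q (b * q ^ t) s = (if s = t then b else 0)"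
proof -
  have q: "q \<noteq> 0" using assms by auto
  show ?thesis
  proof (cases "s \<le> t")
    case True
    then have "b * q ^ t = (b * q ^ (t - s)) * q ^ s" by (simp add: power_add[symmetric] mult.assoc)
    then have "(b * q ^ t) div q ^ s = b * q ^ (t - s)" using q by (metis nonzero_mult_div_cancel_right power_not_zero)
    moreover have "(b * q ^ (t - s)) mod q = (if s = t then b else 0)"
    proof (cases "s = t")
      case False
      then have "q dvd b * q ^ (t - s)" using True by (simp add: dvd_power)
      then show ?thesis using False by simp
    qed (use assms in \<open>simp add: mod_poly_less\<close>)
    ultimately show ?thesis by (simp add: expansion_coeff_def)
  next
    case False
    then have "q ^ s = q ^ (s - t) * q ^ t" by (simp add: power_add[symmetric])
    then have "(b * q ^ t) div q ^ s = b div q ^ (s - t)" using q by (metis div_mult_mult2 power_not_zero)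
    also have "degree b < degree (q ^ (s - t))"
    proof -
      have "1 * degree q \<le> (s - t) * degree q" using False by (intro mult_le_mono1) auto
      then have "degree b < (s - t) * degree q" using assms(2) by linarith
      then show ?thesis using q by (simp add: degree_power_eq)
    qed
    then have "b div q ^ (s - t) = 0" by (rule div_poly_less)
    finally show ?thesis using False by (simp add: expansion_coeff_def)
  qed
qed

lemma expansion_coeff_unique:
  assumes "0 < degree q" "finite I" "\<And>s. s \<in> I \<Longrightarrow> degree (b s) < degree q"
  shows "expansion_coeff q (\<Sum>s\<in>I. b s * q ^ s) t = (if t \<in> I then b t else 0)"
proof -
  have "expansion_coeff q (\<Sum>s\<in>I. b s * q ^ s) t = (\<Sum>s\<in>I. if t = s then b s else 0)"
    unfolding expansion_coeff_sum_left using assms by (intro sum.cong refl expansion_coeff_monomial) auto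
  also have "\<dots> = (if t \<in> I then b t else 0)" using assms(2) by simp
  finally show ?thesis .
qed

lemma expansion_coeff_eq_0:
  assumes "0 < degree q" "degree g < s * degree q"
  shows "expansion_coeff q g s = 0"
proof -
  have "degree g < degree (q ^ s)" using assms by (subst degree_power_eq) auto
  then show ?thesis by (simp add: expansion_coeff_def div_poly_less)
qed

lemma expansion_support:
  assumes q: "0 < degree q" and s: "expansion_coeff q g s \<noteq> 0"
  shows "s * degree q \<le> degree g" "s \<le> degree g"
proof -
  show "s * degree q \<le> degree g" using expansion_coeff_eq_0[OF q, of g s] s by fastforce
  moreover have "s * 1 \<le> s * degree q" using q by (intro mult_le_mono2) simp
  ultimately show "s \<le> degree g" by linarith
qed

definition exp_supp :: "'a::field poly \<Rightarrow> 'a poly \<Rightarrow> nat set" where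
  "exp_supp q g = {s. expansion_coeff q g s \<noteq> 0}"

lemma finite_exp_supp: "0 < degree q \<Longrightarrow> finite (exp_supp q g)"
  unfolding exp_supp_def using expansion_support(2) by (metis (mono_tags, lifting) finite_nat_set_iff_bounded_le mem_Collect_eq)

lemma expansion_sum_supp:
  assumes q: "0 < degree q"
  shows "g = (\<Sum>s\<in>exp_supp q g. expansion_coeff q g s * q ^ s)"
proof -
  have "g = (\<Sum>s\<le>degree g. expansion_coeff q g s * q ^ s)" by (rule expansion_coeff_sum[OF q])
  also have "\<dots> = (\<Sum>s\<in>exp_supp q g. expansion_coeff q g s * q ^ s)"
    using expansion_support(2)[OF q] by (intro sum.mono_neutral_right) (auto simp: exp_supp_def)
  finally show ?thesis .
qed

lemma exp_supp_nonempty: "0 < degree q \<Longrightarrow> g \<noteq> 0 \<Longrightarrow> exp_supp q g \<noteq> {}"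
  using expansion_sum_supp[of q g] by force

text \<open>Needed for level 0, whose expansion base is \<open>x\<close>.\<close>

lemma expansion_coeff_X: "expansion_coeff [:0, 1:] g s = [:coeff g s:]"
proof -
  have "g = (\<Sum>s\<le>degree g. [:coeff g s:] * [:0, 1:] ^ s)"
    by (simp add: monom_altdef[symmetric] poly_as_sum_of_monoms)
  then have "expansion_coeff [:0, 1:] g s = expansion_coeff [:0,1:] (\<Sum>s\<le>degree g. [:coeff g s:] * [:0, 1:] ^ s) s"
    by simp
  also have "\<dots> = [:coeff g s:]" by (subst expansion_coeff_unique) (auto simp: coeff_eq_0)
  finally show ?thesis .
qed

lemma expansion_coeff_top:
  assumes q: "lead_coeff q = 1" "0 < degree q" and g: "lead_coeff g = 1" "degree g = n * degree q"
  shows "expansion_coeff q g n = 1"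
proof -
  have q0: "q \<noteq> 0" "q ^ n \<noteq> 0" using q by auto
  have dq: "degree (q ^ n) = n * degree q" using q0 by (simp add: degree_power_eq)
  have lq: "lead_coeff (q ^ n) = 1" using q by (simp add: lead_coeff_power)
  have "degree (g - q ^ n) < n * degree q \<or> g - q ^ n = 0"
  proof (cases "g - q ^ n = 0")
    case False
    have "degree (g - q ^ n) \<le> n * degree q" using g dq by (intro degree_diff_le) auto
    moreover have "coeff (g - q ^ n) (n * degree q) = 0" using g dq lq by simp
    ultimately show ?thesis using False by (metis leading_coeff_0_iff le_neq_implies_less)
  qed auto
  then have "(g - q ^ n) div q ^ n = 0" using dq by (auto simp: div_poly_less)
  moreover have "((g - q ^ n) + 1 * q ^ n) div q ^ n = 1 + (g - q ^ n) div q ^ n"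
    by (rule div_mult_self1[OF q0(2)])
  ultimately have "g div q ^ n = 1" by simp
  then show ?thesis using q(2) by (simp add: expansion_coeff_def mod_poly_less)
qed

definition ev :: "'k::field poly \<Rightarrow> 'k alg_closure \<Rightarrow> 'k alg_closure" where
  "ev g \<xi> = poly (map_poly to_ac g) \<xi>"

lemma ev_0 [simp]: "ev 0 \<xi> = 0" by (simp add: ev_def)
lemma ev_1 [simp]: "ev 1 \<xi> = 1" by (simp add: ev_def)
lemma ev_const [simp]: "ev [:c:] \<xi> = to_ac c" by (simp add: ev_def map_poly_pCons)
lemma ev_X [simp]: "ev [:0, 1:] \<xi> = \<xi>" by (simp add: ev_def map_poly_pCons)
lemma ev_add: "ev (f + g) \<xi> = ev f \<xi> + ev g \<xi>"
  by (simp add: ev_def map_poly_add_hom)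
lemma ev_mult: "ev (f * g) \<xi> = ev f \<xi> * ev g \<xi>"
  by (simp add: ev_def map_poly_mult_hom)
lemma ev_power: "ev (f ^ n) \<xi> = ev f \<xi> ^ n"
  by (induction n) (auto simp: ev_mult)
lemma ev_sum: "ev (sum f I) \<xi> = (\<Sum>i\<in>I. ev (f i) \<xi>)"
  by (induction I rule: infinite_finite_induct) (auto simp: ev_add)
lemma ev_smult: "ev (smult c g) \<xi> = to_ac c * ev g \<xi>"
  by (simp add: ev_def map_poly_smult)
lemma ev_uminus: "ev (- g) \<xi> = - ev g \<xi>"
  using ev_smult[of "-1" g \<xi>] by simp
lemma ev_diff: "ev (f - g) \<xi> = ev f \<xi> - ev g \<xi>"
  using ev_add[of f "-g" \<xi>] by (simp add: ev_uminus)

lemma ev_altdef: "ev g \<xi> = (\<Sum>i\<le>degree g. to_ac (coeff g i) * \<xi> ^ i)"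
  by (simp add: ev_def poly_altdef coeff_map_poly degree_map_poly)

lemma ev_expansion:
  assumes "0 < degree q"
  shows "ev g \<xi> = (\<Sum>s\<in>exp_supp q g. ev (expansion_coeff q g s) \<xi> * ev q \<xi> ^ s)"
  by (subst expansion_sum_supp[OF assms, of g]) (simp add: ev_sum ev_mult ev_power)

lemma ev_eq_solvable:
  assumes "0 < degree q"
  shows "\<exists>\<xi>. ev q \<xi> = c"
proof -
  have "degree (map_poly to_ac q - [:c:]) > 0"
    using assms by (metis degree_map_poly degree_pCons_0 diff_add_cancel degree_add_le gr0I le_zero_eq to_ac_eq_0_iff)
  then obtain \<xi> where "poly (map_poly to_ac q - [:c:]) \<xi> = 0" using alg_closed_imp_poly_has_root by blast
  then show ?thesis by (intro exI[of _ \<xi>]) (simp add: ev_def)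
qed

lemma poly_prod_mset: "poly (prod_mset A) x = (\<Prod>p\<in>#A. poly p x)"
  by (induction A) auto

text \<open>The constant \<open>c\<close> lies in the closure, so \<open>q - c\<close> need not have
  coefficients in the base field. Its roots form a multiset because exactly \<open>degree q\<close>
  factors are wanted.\<close>

lemma ev_roots:
  fixes q :: "'k::field poly"
  assumes "lead_coeff q = 1" "0 < degree q"
  shows "\<exists>A. size A = degree q \<and> (\<forall>\<xi>. ev q \<xi> - c = (\<Prod>\<alpha>\<in>#A. \<xi> - \<alpha>))"
proof -
  define P where "P = map_poly to_ac q - [:c:]"
  have mp: "degree (map_poly to_ac q) = degree q" "coeff (map_poly to_ac q) (degree q) = 1"
    using assms by (auto simp: degree_map_poly coeff_map_poly)
  have cP: "coeff P (degree q) = 1" using mp assms(2) by (simp add: P_def coeff_pCons split: nat.splits)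
  have "degree P \<le> degree q" unfolding P_def using mp by (intro degree_diff_le) auto
  moreover have "degree q \<le> degree P" using cP by (intro le_degree) auto
  ultimately have dP: "degree P = degree q" by simp
  have "P \<noteq> 0" using cP by auto
  from alg_closed_imp_factorization[OF this] obtain A
    where A: "size A = degree P" "P = smult (lead_coeff P) (\<Prod>x\<in>#A. [:-x, 1:])" by blast
  have "lead_coeff P = 1" unfolding dP by (rule cP)
  with A(2) have "P = (\<Prod>x\<in>#A. [:-x, 1:])" by simp
  then have "poly P \<xi> = (\<Prod>\<alpha>\<in>#A. \<xi> - \<alpha>)" for \<xi>
    by (simp add: poly_prod_mset image_mset.compositionality o_def)
  moreover have "poly P \<xi> = ev q \<xi> - c" for \<xi> by (simp add: P_def ev_def)
  ultimately show ?thesis using A(1) dP by metis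
qed


section \<open>Norm and places\<close>

context local_field
begin

text \<open>The multiplicative form of the valuation needs no special treatment of \<open>0\<close>.\<close>

definition nrm :: "'k alg_closure \<Rightarrow> real" where
  "nrm \<alpha> = (if \<alpha> = 0 then 0 else exp (- aval K \<alpha>))"

lemma nrm_0 [simp]: "nrm 0 = 0" by (simp add: nrm_def)
lemma nrm_ge_0 [simp]: "0 \<le> nrm \<alpha>" by (simp add: nrm_def)
lemma nrm_eq_0 [simp]: "nrm \<alpha> = 0 \<longleftrightarrow> \<alpha> = 0" by (simp add: nrm_def)
lemma nrm_pos [simp]: "0 < nrm \<alpha> \<longleftrightarrow> \<alpha> \<noteq> 0" by (simp add: nrm_def)

lemma nrm_mult: "nrm (\<alpha> * \<beta>) = nrm \<alpha> * nrm \<beta>"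
  by (auto simp: nrm_def aval_mult exp_add[symmetric])

lemma nrm_1 [simp]: "nrm 1 = 1"
  using nrm_mult[of 1 1] nrm_pos[of 1] by (simp del: nrm_pos)

lemma nrm_power: "nrm (\<alpha> ^ n) = nrm \<alpha> ^ n"
  by (induction n) (auto simp: nrm_mult)

lemma nrm_inverse: "nrm (inverse \<alpha>) = inverse (nrm \<alpha>)"
proof (cases "\<alpha> = 0")
  case False
  then have "nrm \<alpha> * nrm (inverse \<alpha>) = 1" by (simp add: nrm_mult[symmetric])
  then show ?thesis by (simp add: inverse_unique)
qed auto

lemma nrm_divide: "nrm (\<alpha> / \<beta>) = nrm \<alpha> / nrm \<beta>"
  by (simp add: field_class.field_divide_inverse nrm_mult nrm_inverse)

lemma nrm_powi: "nrm (\<alpha> powi n) = nrm \<alpha> powi n"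
  by (auto simp: power_int_def nrm_power nrm_inverse)

lemma nrm_minus: "nrm (- \<alpha>) = nrm \<alpha>"
proof -
  have "nrm (-1) ^ 2 = 1" by (simp add: nrm_power[symmetric])
  then have "nrm (-1) = 1" using nrm_ge_0[of "-1"] by (simp add: power2_eq_1_iff)
  then show ?thesis using nrm_mult[of "-1" \<alpha>] by simp
qed

lemma nrm_add: "nrm (\<alpha> + \<beta>) \<le> max (nrm \<alpha>) (nrm \<beta>)"
proof (cases "\<alpha> = 0 \<or> \<beta> = 0 \<or> \<alpha> + \<beta> = 0")
  case False
  have "max (exp (- aval K \<alpha>)) (exp (- aval K \<beta>)) = exp (- min (aval K \<alpha>) (aval K \<beta>))"
    by (simp add: max_def min_def)
  then show ?thesis using aval_add[of \<alpha> \<beta>] False by (simp add: nrm_def)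
qed (auto simp: max_def)

lemma nrm_diff: "nrm (\<alpha> - \<beta>) \<le> max (nrm \<alpha>) (nrm \<beta>)"
  using nrm_add[of \<alpha> "-\<beta>"] by (simp add: nrm_minus)

lemma nrm_add_eq: "nrm \<beta> < nrm \<alpha> \<Longrightarrow> nrm (\<alpha> + \<beta>) = nrm \<alpha>"
  using nrm_add[of \<alpha> \<beta>] nrm_diff[of "\<alpha> + \<beta>" \<beta>] by (auto simp: max_def split: if_splits)

lemma nrm_diff_eq: "nrm \<beta> < nrm \<alpha> \<Longrightarrow> nrm (\<alpha> - \<beta>) = nrm \<alpha>"
  using nrm_add_eq[of "-\<beta>" \<alpha>] by (simp add: nrm_minus)

lemma nrm_sum_le: "0 \<le> B \<Longrightarrow> (\<And>i. i \<in> I \<Longrightarrow> nrm (f i) \<le> B) \<Longrightarrow> nrm (sum f I) \<le> B"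
proof (induction I rule: infinite_finite_induct)
  case (insert x F)
  then show ?case using nrm_add[of "f x" "sum f F"] by (auto intro: order_trans)
qed auto

lemma nrm_sum_less: "0 < B \<Longrightarrow> (\<And>i. i \<in> I \<Longrightarrow> nrm (f i) < B) \<Longrightarrow> nrm (sum f I) < B"
proof (induction I rule: infinite_finite_induct)
  case (insert x F)
  then show ?case using nrm_add[of "f x" "sum f F"] by (auto intro: le_less_trans)
qed auto

lemma nrm_sum_dominant:
  assumes "finite I" "i \<in> I" "\<And>j. j \<in> I \<Longrightarrow> j \<noteq> i \<Longrightarrow> nrm (f j) < nrm (f i)"
  shows "nrm (sum f I) = nrm (f i)"
proof (cases "I = {i}")
  case False
  then obtain j where "j \<in> I" "j \<noteq> i" using assms(2) by blast
  then have pos: "0 < nrm (f i)" using assms(3)[of j] nrm_ge_0[of "f j"] by linarith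
  have "sum f I = f i + sum f (I - {i})" using assms by (simp add: sum.remove)
  moreover have "nrm (sum f (I - {i})) < nrm (f i)" using assms(3) pos by (intro nrm_sum_less) auto
  ultimately show ?thesis by (simp add: nrm_add_eq)
qed auto

lemma nrm_prod_mset: "nrm (\<Prod>x\<in>#A. f x) = (\<Prod>x\<in>#A. nrm (f x))"
  by (induction A) (auto simp: nrm_mult)

lemma nrm_to_ac: "a \<noteq> 0 \<Longrightarrow> nrm (to_ac a) = exp (- real_of_int (val K a))"
  by (simp add: nrm_def aval_to_ac)

abbreviation \<pi> :: "'k alg_closure" where "\<pi> \<equiv> to_ac (unif K)"

lemma nrm_unif: "nrm \<pi> = exp (-1)"
  using unif by (simp add: nrm_to_ac)

lemma unif_nz [simp]: "\<pi> \<noteq> 0" using unif by simp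

lemma exp_powi: "exp (x::real) powi n = exp (real_of_int n * x)"
  by (cases n rule: int_cases2) (auto simp: power_int_def exp_of_nat_mult exp_minus power_inverse)

lemma nrm_to_ac': "a \<noteq> 0 \<Longrightarrow> nrm (to_ac a) = nrm \<pi> powi val K a"
  by (simp add: nrm_to_ac nrm_unif exp_powi)

text \<open>The closure contains roots of all powers of the uniformizer, so every rational value
  occurs.\<close>

lemma nrm_value_exists:
  assumes "0 < d"
  shows "\<exists>c. nrm c = exp (real_of_int n / real d)"
proof -
  obtain c where c: "c ^ d = \<pi> powi (-n)" using nth_root_exists[OF assms] by blast
  have "nrm c ^ d = exp (real_of_int n)"
    by (simp add: nrm_power[symmetric] c nrm_powi nrm_unif exp_powi)
  also have "\<dots> = exp (real_of_int n / real d) ^ d"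
    using assms by (simp add: exp_of_nat_mult[symmetric])
  finally have "nrm c = exp (real_of_int n / real d)"
    by (rule power_eq_imp_eq_base[OF _ nrm_ge_0 exp_ge_zero assms])
  then show ?thesis ..
qed

lemma nrm_value_rat: "q \<in> \<rat> \<Longrightarrow> \<exists>c. nrm c = exp q"
proof -
  assume "q \<in> \<rat>"
  then obtain n :: int and d :: nat where "d \<noteq> 0" "q = real_of_int n / real d"
    unfolding Rats_eq_int_div_nat by blast
  with nrm_value_exists[of d n] show ?thesis by simp
qed

lemma int_ring_iff: "a \<in> int_ring K \<longleftrightarrow> nrm (to_ac a) \<le> 1"
  by (cases "a = 0") (auto simp: int_ring_def val_ge_def nrm_to_ac)

lemma ac_int_ring_iff: "\<alpha> \<in> ac_int_ring K \<longleftrightarrow> nrm \<alpha> \<le> 1"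
  by (auto simp: ac_int_ring_def nrm_def)

text \<open>The behaviour of a reduction map on the valuation ring; values outside that ring are
  left free. Besides \<open>red K\<close> itself, its Frobenius twists are meant.\<close>

definition place :: "('k alg_closure \<Rightarrow> 'f) \<Rightarrow> bool" where
  "place r \<longleftrightarrow> r 1 = 1 \<and> (\<forall>\<alpha> \<beta>. nrm \<alpha> \<le> 1 \<longrightarrow> nrm \<beta> \<le> 1 \<longrightarrow> r (\<alpha> + \<beta>) = r \<alpha> + r \<beta> \<and> r (\<alpha> * \<beta>) = r \<alpha> * r \<beta>) \<and>
     (\<forall>\<alpha>. nrm \<alpha> \<le> 1 \<longrightarrow> (r \<alpha> = 0 \<longleftrightarrow> nrm \<alpha> < 1))"

lemma place_red: "place (red K)"
  unfolding place_def
proof (intro conjI allI impI)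
  fix \<alpha> assume "nrm \<alpha> \<le> 1"
  then show "red K \<alpha> = 0 \<longleftrightarrow> nrm \<alpha> < 1"
    using red_eq_0[of \<alpha>] by (auto simp: ac_int_ring_iff) (auto simp: nrm_def split: if_splits)
qed (auto simp: red_one red_add red_mult ac_int_ring_iff)

lemma placeD:
  assumes "place r"
  shows "r 1 = 1" "nrm \<alpha> \<le> 1 \<Longrightarrow> nrm \<beta> \<le> 1 \<Longrightarrow> r (\<alpha> + \<beta>) = r \<alpha> + r \<beta>"
    "nrm \<alpha> \<le> 1 \<Longrightarrow> nrm \<beta> \<le> 1 \<Longrightarrow> r (\<alpha> * \<beta>) = r \<alpha> * r \<beta>"
    "nrm \<alpha> \<le> 1 \<Longrightarrow> r \<alpha> = 0 \<longleftrightarrow> nrm \<alpha> < 1"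
  using assms by (auto simp: place_def)

lemma place_0: "place r \<Longrightarrow> r 0 = 0" using placeD(4)[of r 0] by simp

lemma place_small: "place r \<Longrightarrow> nrm \<alpha> < 1 \<Longrightarrow> r \<alpha> = 0" using placeD(4)[of r \<alpha>] by simp

lemma place_nz: "place r \<Longrightarrow> nrm \<alpha> = 1 \<Longrightarrow> r \<alpha> \<noteq> 0" using placeD(4)[of r \<alpha>] by simp

lemma place_sum:
  assumes r: "place r" and "\<And>i. i \<in> I \<Longrightarrow> nrm (f i) \<le> 1"
  shows "r (sum f I) = (\<Sum>i\<in>I. r (f i))"
  using assms(2)
proof (induction I rule: infinite_finite_induct)
  case (insert x F)
  moreover have "nrm (sum f F) \<le> 1" using insert by (intro nrm_sum_le) auto
  ultimately show ?case by (simp add: placeD(2)[OF r])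
qed (auto simp: place_0[OF r])

lemma place_power: "place r \<Longrightarrow> nrm \<alpha> \<le> 1 \<Longrightarrow> r (\<alpha> ^ n) = r \<alpha> ^ n"
  by (induction n) (auto simp: placeD nrm_power power_le_one)

lemma place_inverse:
  assumes r: "place r" and "nrm \<alpha> = 1" shows "r (inverse \<alpha>) = inverse (r \<alpha>)"
proof -
  have "\<alpha> \<noteq> 0" using assms(2) by auto
  then have "r \<alpha> * r (inverse \<alpha>) = 1"
    using assms by (subst placeD(3)[OF r, symmetric]) (auto simp: nrm_inverse placeD(1))
  then show ?thesis by (metis inverse_unique)
qed

lemma place_powi: "place r \<Longrightarrow> nrm \<alpha> = 1 \<Longrightarrow> r (\<alpha> powi n) = r \<alpha> powi n"
  by (auto simp: power_int_def place_power place_inverse nrm_inverse power_inverse[symmetric] nrm_power)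

text \<open>The element is \<open>w powi n\<close> times a unit with residue \<open>\<rho>\<close>:
  \<open>n\<close> is its value in units of the value of \<open>w\<close>, and \<open>\<rho>\<close>
  is its leading coefficient.\<close>

definition lead :: "('k alg_closure \<Rightarrow> 'f) \<Rightarrow> 'k alg_closure \<Rightarrow> 'k alg_closure \<Rightarrow> int \<Rightarrow> 'f \<Rightarrow> bool" where
  "lead r w \<alpha> n \<rho> \<longleftrightarrow> nrm \<alpha> = nrm w powi n \<and> r (\<alpha> / w powi n) = \<rho>"

lemma lead_norm1: "w \<noteq> 0 \<Longrightarrow> lead r w \<alpha> n \<rho> \<Longrightarrow> nrm (\<alpha> / w powi n) = 1"
  by (simp add: lead_def nrm_divide nrm_powi)

lemma lead_nz: "place r \<Longrightarrow> w \<noteq> 0 \<Longrightarrow> lead r w \<alpha> n \<rho> \<Longrightarrow> \<rho> \<noteq> 0 \<and> \<alpha> \<noteq> 0"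
  using lead_norm1[of w r \<alpha> n \<rho>] place_nz[of r "\<alpha> / w powi n"] by (auto simp: lead_def)

lemma lead_mult:
  assumes "place r" "w \<noteq> 0" "lead r w \<alpha> n \<rho>" "lead r w \<beta> m \<sigma>"
  shows "lead r w (\<alpha> * \<beta>) (n + m) (\<rho> * \<sigma>)"
proof -
  have "\<alpha> * \<beta> / w powi (n + m) = (\<alpha> / w powi n) * (\<beta> / w powi m)"
    using assms(2) by (simp add: power_int_add)
  then have "r (\<alpha> * \<beta> / w powi (n + m)) = r (\<alpha> / w powi n) * r (\<beta> / w powi m)"
    using lead_norm1[OF assms(2,3)] lead_norm1[OF assms(2,4)]
    by (simp only: placeD(3)[OF assms(1)] order_refl)
  then show ?thesis using assms by (simp add: lead_def nrm_mult power_int_add)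
qed

lemma lead_inverse:
  assumes "place r" "w \<noteq> 0" "lead r w \<alpha> n \<rho>"
  shows "lead r w (inverse \<alpha>) (- n) (inverse \<rho>)"
proof -
  have "inverse \<alpha> / w powi (- n) = inverse (\<alpha> / w powi n)"
    by (simp add: power_int_minus field_simps)
  then have "r (inverse \<alpha> / w powi (- n)) = inverse (r (\<alpha> / w powi n))"
    using lead_norm1[OF assms(2,3)] by (simp only: place_inverse[OF assms(1)])
  then show ?thesis using assms by (simp add: lead_def nrm_inverse power_int_minus)
qed

lemma lead_1: "place r \<Longrightarrow> lead r w 1 0 1"
  by (simp add: lead_def placeD)

lemma lead_power:
  assumes "place r" "w \<noteq> 0" "lead r w \<alpha> n \<rho>"
  shows "lead r w (\<alpha> ^ k) (int k * n) (\<rho> ^ k)"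
proof (induction k)
  case (Suc k)
  from lead_mult[OF assms(1,2,3) Suc] show ?case by (simp add: algebra_simps)
qed (simp add: lead_1[OF assms(1)])

lemma lead_powi:
  assumes "place r" "w \<noteq> 0" "lead r w \<alpha> n \<rho>"
  shows "lead r w (\<alpha> powi k) (k * n) (\<rho> powi k)"
proof (cases "k \<ge> 0")
  case True
  then show ?thesis using lead_power[OF assms, of "nat k"] by (simp add: power_int_def)
next
  case False
  then show ?thesis using lead_power[OF assms(1,2) lead_inverse[OF assms], of "nat (-k)"]
    by (simp add: power_int_def)
qed

lemma lead_w: "place r \<Longrightarrow> w \<noteq> 0 \<Longrightarrow> lead r w (w powi n) n 1"
  by (simp add: lead_def nrm_powi placeD)

end

section \<open>Conjugate roots have equal norms\<close>

text \<open>A nonzero polynomial of least degree vanishing at \<open>\<theta>\<close> divides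
  \<open>F\<close>, so it has the degree of \<open>F\<close>.\<close>

lemma ev_root_small_degree:
  fixes F :: "'k::field poly"
  assumes F: "irreducible F" "ev F \<theta> = 0" and g: "ev g \<theta> = 0" "degree g < degree F"
  shows "g = 0"
proof (rule ccontr)
  assume g0: "g \<noteq> 0"
  define I where "I = {q. q \<noteq> 0 \<and> ev q \<theta> = 0}"
  define d where "d = arg_min degree (\<lambda>q. q \<in> I)"
  have gI: "g \<in> I" using g g0 by (simp add: I_def)
  have d: "d \<in> I" unfolding d_def using gI by (rule arg_min_natI)
  have dmin: "degree d \<le> degree q" if "q \<in> I" for q unfolding d_def using that by (rule arg_min_nat_le)
  have d0: "d \<noteq> 0" using d by (simp add: I_def)
  have "ev (F mod d) \<theta> = 0"
    unfolding minus_div_mult_eq_mod[symmetric] using F(2) d by (simp add: I_def ev_diff ev_mult)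
  then have "F mod d = 0" using degree_mod_less[OF d0, of F] dmin[of "F mod d"] by (force simp: I_def)
  then have "F = (F div d) * d" by (metis add.right_neutral div_mult_mod_eq)
  then have "is_unit (F div d) \<or> is_unit d" by (rule Factorial_Ring.irreducibleD[OF F(1)])
  moreover have "\<not> is_unit d"
  proof
    assume "is_unit d"
    then obtain c where "d = [:c:]" by (auto simp: is_unit_poly_iff)
    then show False using d by (auto simp: I_def)
  qed
  ultimately obtain c where c: "F div d = [:c:]" "c dvd 1" by (auto simp: is_unit_poly_iff)
  then have "c \<noteq> 0" by auto
  with c \<open>F = (F div d) * d\<close> have "degree F = degree d"
    by (metis degree_smult_eq mult_pCons_left mult_zero_left add.right_neutral pCons_0_0)
  then show False using dmin[OF gI] g(2) by simp
qed

text \<open>Removes a multiplicative constant from an estimate that holds for all powers.\<close>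

lemma le_if_powers_le:
  fixes a b B :: real
  assumes "0 \<le> a" "0 \<le> b" "\<And>k::nat. a ^ k \<le> B * b ^ k"
  shows "a \<le> b"
proof (rule ccontr)
  assume "\<not> a \<le> b"
  show False
  proof (cases "b = 0")
    case True
    then show False using assms(3)[of 1] \<open>\<not> a \<le> b\<close> by simp
  next
    case False
    then have b: "b > 0" using assms by simp
    then have "1 < a / b" using \<open>\<not> a \<le> b\<close> by simp
    then obtain k where "B < (a / b) ^ k" using real_arch_pow by blast
    then have "B * b ^ k < a ^ k" using b by (simp add: power_divide field_simps)
    then show False using assms(3)[of k] by simp
  qed
qed

context local_field
begin

lemma val_ge_iff_nrm: "val_ge K a N \<longleftrightarrow> nrm (to_ac a) \<le> exp (- real_of_int N)"
  by (cases "a = 0") (auto simp: val_ge_def nrm_to_ac)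

lemma nrm_complete:
  fixes u :: "nat \<Rightarrow> 'k"
  assumes "\<And>\<epsilon>. \<epsilon> > 0 \<Longrightarrow> \<exists>M. \<forall>m\<ge>M. \<forall>n\<ge>M. nrm (to_ac (u m - u n)) \<le> \<epsilon>"
  shows "\<exists>x. \<forall>\<epsilon>>0. \<exists>M. \<forall>n\<ge>M. nrm (to_ac (u n - x)) \<le> \<epsilon>"
proof -
  have "\<forall>N. \<exists>M. \<forall>m\<ge>M. \<forall>n\<ge>M. val_ge K (u m - u n) N"
    unfolding val_ge_iff_nrm by (rule allI, rule assms) simp
  from complete[OF this] obtain x where x: "\<forall>N. \<exists>M. \<forall>n\<ge>M. val_ge K (u n - x) N" by blast
  have "\<exists>M. \<forall>n\<ge>M. nrm (to_ac (u n - x)) \<le> \<epsilon>" if "\<epsilon> > 0" for \<epsilon>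
  proof -
    obtain M where M: "\<forall>n\<ge>M. val_ge K (u n - x) \<lceil>- ln \<epsilon>\<rceil>" using x by blast
    have "exp (- real_of_int \<lceil>- ln \<epsilon>\<rceil>) \<le> exp (ln \<epsilon>)" by (subst exp_le_cancel_iff) linarith
    then have "exp (- real_of_int \<lceil>- ln \<epsilon>\<rceil>) \<le> \<epsilon>" using that by simp
    with M show ?thesis unfolding val_ge_iff_nrm by (meson order_trans)
  qed
  then show ?thesis by blast
qed

lemma nrm_ev_le:
  assumes "\<And>i. i \<le> degree g \<Longrightarrow> nrm (to_ac (coeff g i)) * nrm \<xi> ^ i \<le> B" "0 \<le> B"
  shows "nrm (ev g \<xi>) \<le> B"
  unfolding ev_altdef using assms by (intro nrm_sum_le) (auto simp: nrm_mult nrm_power)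

text \<open>Over a complete field the size of the coefficients is controlled by any norm on a
  finite-dimensional space; the induction is on the dimension \<open>d\<close>. The point is that
  the power of \<open>\<theta>\<close> added in the step keeps a positive distance from the span of
  the lower ones.\<close>

lemma norm_equivalence:
  fixes \<theta> :: "'k alg_closure"
  assumes nz: "\<And>g. degree g < n \<Longrightarrow> ev g \<theta> = 0 \<Longrightarrow> g = 0"
  shows "d \<le> n \<Longrightarrow> \<exists>C>0. \<forall>g i. (\<forall>j\<ge>d. coeff g j = 0) \<longrightarrow> nrm (to_ac (coeff g i)) \<le> C * nrm (ev g \<theta>)"
proof (induction d)
  case 0
  then show ?case by (intro exI[of _ 1]) auto
next
  case (Suc d)
  then obtain C where C: "C > 0" "\<And>g i. (\<forall>j\<ge>d. coeff g j = 0) \<Longrightarrow> nrm (to_ac (coeff g i)) \<le> C * nrm (ev g \<theta>)"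
    by auto
  \<comment> \<open>Otherwise there are arbitrarily good approximations. By the induction hypothesis
    their coefficients form Cauchy sequences, and the limits give a polynomial of degree
    \<open>d\<close> vanishing at \<open>\<theta>\<close>.\<close>
  have "\<exists>c0>0. \<forall>h. (\<forall>j\<ge>d. coeff h j = 0) \<longrightarrow> c0 \<le> nrm (ev (monom 1 d + h) \<theta>)"
  proof (rule ccontr)
    assume neg: "\<not> ?thesis"
    have "\<forall>m. \<exists>h. (\<forall>j\<ge>d. coeff h j = 0) \<and> nrm (ev (monom 1 d + h) \<theta>) < 1 / real (Suc m)"
    proof
      fix m
      have "1 / real (Suc m) > 0" by simp
      with neg show "\<exists>h. (\<forall>j\<ge>d. coeff h j = 0) \<and> nrm (ev (monom 1 d + h) \<theta>) < 1 / real (Suc m)"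
        by (meson not_le)
    qed
    then obtain H where H: "\<And>m j. j \<ge> d \<Longrightarrow> coeff (H m) j = 0"
      "\<And>m. nrm (ev (monom 1 d + H m) \<theta>) < 1 / real (Suc m)" by metis
    have cauchy: "\<exists>M. \<forall>m\<ge>M. \<forall>l\<ge>M. nrm (to_ac (coeff (H m) i - coeff (H l) i)) \<le> \<epsilon>" if "\<epsilon> > 0" for \<epsilon> i
    proof -
      obtain M where M: "1 / real (Suc M) < \<epsilon> / C" by (rule nat_approx_posE[OF divide_pos_pos[OF \<open>\<epsilon> > 0\<close> C(1)]])
      have "nrm (to_ac (coeff (H m) i - coeff (H l) i)) \<le> \<epsilon>" if "m \<ge> M" "l \<ge> M" for m l
      proof -
        have le: "nrm (ev (monom 1 d + H m) \<theta>) \<le> \<epsilon> / C" if "m \<ge> M" for m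
        proof -
          have "1 / real (Suc m) \<le> 1 / real (Suc M)" using that by (intro divide_left_mono) auto
          then show ?thesis using M H(2)[of m] by linarith
        qed
        have "nrm (to_ac (coeff (H m - H l) i)) \<le> C * nrm (ev (H m - H l) \<theta>)"
          using H(1) by (intro C(2)) auto
        also have "ev (H m - H l) \<theta> = ev (monom 1 d + H m) \<theta> - ev (monom 1 d + H l) \<theta>"
          by (simp add: ev_diff[symmetric])
        also have "nrm \<dots> \<le> \<epsilon> / C"
          using nrm_diff[of "ev (monom 1 d + H m) \<theta>" "ev (monom 1 d + H l) \<theta>"] le[OF that(1)] le[OF that(2)]
          by linarith
        finally show ?thesis using C(1) by (simp add: mult_left_mono)
      qed
      then show ?thesis by blast
    qed
    have "\<forall>i. \<exists>x. \<forall>\<epsilon>>0. \<exists>M. \<forall>m\<ge>M. nrm (to_ac (coeff (H m) i - x)) \<le> \<epsilon>"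
      by (intro allI nrm_complete cauchy)
    then obtain x where x: "\<And>i \<epsilon>. \<epsilon> > 0 \<Longrightarrow> \<exists>M. \<forall>m\<ge>M. nrm (to_ac (coeff (H m) i - x i)) \<le> \<epsilon>" by metis
    define h where "h = (\<Sum>i<d. monom (x i) i)"
    have ch: "coeff h j = (if j < d then x j else 0)" for j
      by (simp add: h_def coeff_sum)
    have small: "nrm (ev (monom 1 d + h) \<theta>) \<le> \<epsilon>" if e: "\<epsilon> > 0" for \<epsilon>
    proof -
      \<comment> \<open>Absorbs the powers of \<open>\<theta>\<close> with exponent below
        \<open>d\<close>.\<close>
      define D where "D = max 1 (nrm \<theta>) ^ d"
      have D: "D \<ge> 1" by (simp add: D_def one_le_power)
      have "\<epsilon> / D > 0" using e D by simp
      then obtain M where M: "\<And>i m. m \<ge> M i \<Longrightarrow> nrm (to_ac (coeff (H m) i - x i)) \<le> \<epsilon> / D"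
        using x by metis
      obtain M0 where M0: "1 / real (Suc M0) < \<epsilon>" using nat_approx_posE[OF e] by auto
      define m where "m = Max (insert M0 (M ` {..<d}))"
      have m: "m \<ge> M0" "\<And>i. i < d \<Longrightarrow> m \<ge> M i" by (auto simp: m_def)
      have "nrm (ev (h - H m) \<theta>) \<le> \<epsilon>"
      proof (rule nrm_ev_le)
        fix i
        show "nrm (to_ac (coeff (h - H m) i)) * nrm \<theta> ^ i \<le> \<epsilon>"
        proof (cases "i < d")
          case True
          have "nrm (to_ac (coeff (h - H m) i)) = nrm (to_ac (coeff (H m) i - x i))"
            using True nrm_minus[of "to_ac (coeff (H m) i) - to_ac (x i)"] by (simp add: ch)
          also have "\<dots> \<le> \<epsilon> / D" using True m M by blast
          finally have "nrm (to_ac (coeff (h - H m) i)) * nrm \<theta> ^ i \<le> (\<epsilon> / D) * D"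
          proof (rule mult_mono)
            have "nrm \<theta> ^ i \<le> max 1 (nrm \<theta>) ^ i" by (intro power_mono) auto
            also have "\<dots> \<le> D" unfolding D_def using True by (intro power_increasing) auto
            finally show "nrm \<theta> ^ i \<le> D" .
          qed (use e D in auto)
          then show ?thesis using D by simp
        next
          case False
          then show ?thesis using H(1) e by (simp add: ch)
        qed
      qed (use e in simp)
      moreover have "nrm (ev (monom 1 d + H m) \<theta>) \<le> \<epsilon>"
      proof -
        have "1 / real (Suc m) \<le> 1 / real (Suc M0)" using m by (intro divide_left_mono) auto
        then show ?thesis using M0 H(2)[of m] by linarith
      qed
      moreover have "ev (monom 1 d + h) \<theta> = ev (monom 1 d + H m) \<theta> + ev (h - H m) \<theta>"
        by (simp add: ev_add[symmetric])
      ultimately show ?thesis using nrm_add[of "ev (monom 1 d + H m) \<theta>" "ev (h - H m) \<theta>"] by simp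
    qed
    have "nrm (ev (monom 1 d + h) \<theta>) \<le> 0"
      by (rule field_le_epsilon) (use small in simp)
    then have "ev (monom 1 d + h) \<theta> = 0" using nrm_ge_0 nrm_eq_0 by (metis order_antisym)
    moreover have "degree (monom 1 d + h) < n"
    proof -
      have "degree (monom 1 d + h) \<le> d" by (intro degree_le) (auto simp: ch)
      then show ?thesis using Suc.prems by simp
    qed
    ultimately have "monom 1 d + h = 0" by (rule nz[rotated])
    then have "coeff (monom 1 d + h) d = 0" by simp
    then show False by (simp add: ch)
  qed
  then obtain c0 where c0: "c0 > 0" "\<And>h. (\<forall>j\<ge>d. coeff h j = 0) \<Longrightarrow> c0 \<le> nrm (ev (monom 1 d + h) \<theta>)" by blast
  \<comment> \<open>For a polynomial \<open>smult c (monom 1 d + h)\<close> the leading coefficient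
    is controlled by \<open>1 / c0\<close>. The others are controlled by \<open>C\<close>, after the
    top power has been split off at the cost of the factor \<open>max\<close>.\<close>
  define C1 where "C1 = C * max 1 (nrm \<theta> ^ d / c0)"
  define C' where "C' = max C (max (1 / c0) C1)"
  have C': "C' \<ge> C" "C' \<ge> 1 / c0" "C' \<ge> C1" "C' > 0" using C by (auto simp: C'_def)
  have "nrm (to_ac (coeff g i)) \<le> C' * nrm (ev g \<theta>)" if g: "\<forall>j\<ge>Suc d. coeff g j = 0" for g i
  proof (cases "coeff g d = 0")
    case True
    then have "\<forall>j\<ge>d. coeff g j = 0" using g by (metis Suc_leI le_neq_implies_less)
    then have "nrm (to_ac (coeff g i)) \<le> C * nrm (ev g \<theta>)" by (rule C(2))
    also have "\<dots> \<le> C' * nrm (ev g \<theta>)" using C' by (intro mult_right_mono) auto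
    finally show ?thesis .
  next
    case False
    define c where "c = coeff g d"
    define h where "h = smult (inverse c) g - monom 1 d"
    have c: "c \<noteq> 0" using False by (simp add: c_def)
    have hj: "\<forall>j\<ge>d. coeff h j = 0" using g c by (auto simp: h_def c_def coeff_monom) 
    have gh: "g = smult c (monom 1 d + h)" using c by (simp add: h_def)
    define W where "W = nrm (ev (monom 1 d + h) \<theta>)"
    have W: "c0 \<le> W" unfolding W_def using c0(2) hj by blast
    have evg: "nrm (ev g \<theta>) = nrm (to_ac c) * W" by (subst gh) (simp add: ev_smult nrm_mult W_def)
    have "nrm (to_ac (coeff (monom 1 d + h) i)) \<le> C' * W"
    proof (cases "i = d")
      case True
      have "1 \<le> (1 / c0) * W" using W c0(1) by (simp add: field_simps)
      also have "\<dots> \<le> C' * W" using C' W c0(1) by (intro mult_right_mono) auto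
      finally show ?thesis using True hj by simp
    next
      case False
      have "nrm (to_ac (coeff h i)) \<le> C * nrm (ev h \<theta>)" using C(2) hj by blast
      also have "ev h \<theta> = ev (monom 1 d + h) \<theta> - \<theta> ^ d" by (simp add: ev_add) (simp add: ev_def map_poly_monom poly_monom)
      also have "nrm \<dots> \<le> max W (nrm \<theta> ^ d)" unfolding W_def nrm_power[symmetric] by (rule nrm_diff)
      also have "\<dots> \<le> max 1 (nrm \<theta> ^ d / c0) * W"
      proof (rule max.boundedI)
        show "W \<le> max 1 (nrm \<theta> ^ d / c0) * W" using W c0(1) by (simp add: mult_le_cancel_right1)
        have "nrm \<theta> ^ d = (nrm \<theta> ^ d / c0) * c0" using c0(1) by simp
        also have "\<dots> \<le> max 1 (nrm \<theta> ^ d / c0) * W" using W c0(1) by (intro mult_mono) auto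
        finally show "nrm \<theta> ^ d \<le> max 1 (nrm \<theta> ^ d / c0) * W" .
      qed
      finally have "nrm (to_ac (coeff h i)) \<le> C1 * W" using C(1) by (simp add: C1_def mult.assoc mult_left_mono)
      also have "\<dots> \<le> C' * W" using C' W c0(1) by (intro mult_right_mono) auto
      finally show ?thesis using False by simp
    qed
    then have "nrm (to_ac c) * nrm (to_ac (coeff (monom 1 d + h) i)) \<le> nrm (to_ac c) * (C' * W)"
      by (rule mult_left_mono) simp
    then show ?thesis unfolding evg by (subst gh) (simp add: nrm_mult mult_ac)
  qed
  with C'(4) show ?case by blast
qed

text \<open>Equivalence of norms bounds the norm of \<open>g\<close> at one root by a constant times
  the norm at the other. Since norms are multiplicative, passing to powers of \<open>g\<close> makes
  the constant disappear.\<close>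

lemma nrm_conjugate_le:
  assumes F: "irreducible F" and \<theta>: "ev F \<theta> = 0" "ev F \<theta>' = 0"
  shows "nrm (ev g \<theta>') \<le> nrm (ev g \<theta>)"
proof -
  have F0: "F \<noteq> 0" using F by auto
  have dF: "degree F > 0" using F by (metis gr0I is_unit_iff_degree irreducible_not_unit F0)
  have "\<exists>C>0. \<forall>g i. (\<forall>j\<ge>degree F. coeff g j = 0) \<longrightarrow> nrm (to_ac (coeff g i)) \<le> C * nrm (ev g \<theta>)"
    by (rule norm_equivalence[of "degree F"]) (use ev_root_small_degree[OF F \<theta>(1)] in auto)
  then obtain C where C: "C > 0" "\<And>g i. degree g < degree F \<Longrightarrow> nrm (to_ac (coeff g i)) \<le> C * nrm (ev g \<theta>)"
    by (metis coeff_eq_0 less_le_trans)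
  define D where "D = max 1 (nrm \<theta>') ^ degree F"
  have bound: "nrm (ev g \<theta>') \<le> C * D * nrm (ev g \<theta>)" for g
  proof -
    have ev_mod: "ev (g mod F) \<xi> = ev g \<xi>" if "ev F \<xi> = 0" for \<xi>
      unfolding minus_div_mult_eq_mod[symmetric] using that by (simp add: ev_diff ev_mult)
    have deg: "degree (g mod F) < degree F" using degree_mod_less[OF F0, of g] dF by auto
    have "nrm (ev (g mod F) \<theta>') \<le> (C * nrm (ev (g mod F) \<theta>)) * D"
    proof (rule nrm_ev_le)
      fix i assume i: "i \<le> degree (g mod F)"
      show "nrm (to_ac (coeff (g mod F) i)) * nrm \<theta>' ^ i \<le> (C * nrm (ev (g mod F) \<theta>)) * D"
      proof (rule mult_mono)
        show "nrm (to_ac (coeff (g mod F) i)) \<le> C * nrm (ev (g mod F) \<theta>)" by (rule C(2)[OF deg])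
        have "nrm \<theta>' ^ i \<le> max 1 (nrm \<theta>') ^ i" by (intro power_mono) auto
        also have "\<dots> \<le> D" unfolding D_def using i deg by (intro power_increasing) auto
        finally show "nrm \<theta>' ^ i \<le> D" .
      qed (use C in auto)
    qed (use C in \<open>simp add: D_def\<close>)
    then show ?thesis by (simp add: ev_mod \<theta> mult_ac)
  qed
  show ?thesis
  proof (rule le_if_powers_le[where B = "C * D"])
    fix k show "nrm (ev g \<theta>') ^ k \<le> C * D * nrm (ev g \<theta>) ^ k"
      using bound[of "g ^ k"] by (simp add: ev_power nrm_power)
  qed auto
qed

lemma nrm_conjugate:
  assumes "irreducible F" "ev F \<theta> = 0" "ev F \<theta>' = 0"
  shows "nrm (ev g \<theta>') = nrm (ev g \<theta>)"
  using nrm_conjugate_le[OF assms] nrm_conjugate_le[OF assms(1,3,2)] by (rule antisym)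

text \<open>Up to sign both products are the resultant of \<open>F\<close> and \<open>G - c\<close>,
  the product of all differences between a root of one and a root of the other; norms ignore the
  sign.\<close>

lemma double_product:
  assumes F: "lead_coeff F = 1" "0 < degree F" and G: "lead_coeff G = 1" "0 < degree G"
  shows "\<exists>A B. size A = degree F \<and> size B = degree G \<and> (\<forall>\<theta>\<in>#A. ev F \<theta> = 0) \<and> (\<forall>\<xi>\<in>#B. ev G \<xi> = c) \<and>
    (\<Prod>\<theta>\<in>#A. nrm (ev G \<theta> - c)) = (\<Prod>\<xi>\<in>#B. nrm (ev F \<xi>))"
proof -
  obtain A where A: "size A = degree F" "\<And>\<xi>. ev F \<xi> - 0 = (\<Prod>\<alpha>\<in>#A. \<xi> - \<alpha>)" using ev_roots[OF F, of 0] by blast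
  obtain B where B: "size B = degree G" "\<And>\<xi>. ev G \<xi> - c = (\<Prod>\<alpha>\<in>#B. \<xi> - \<alpha>)" using ev_roots[OF G] by blast
  have "nrm (\<theta> - \<xi>) = nrm (\<xi> - \<theta>)" for \<theta> \<xi> using nrm_minus[of "\<theta> - \<xi>"] by simp
  then have "(\<Prod>\<theta>\<in>#A. nrm (ev G \<theta> - c)) = (\<Prod>\<theta>\<in>#A. \<Prod>\<xi>\<in>#B. nrm (\<xi> - \<theta>))"
    by (simp add: B nrm_prod_mset)
  also have "\<dots> = (\<Prod>\<xi>\<in>#B. \<Prod>\<theta>\<in>#A. nrm (\<xi> - \<theta>))" by (rule prod_mset.swap)
  also have "\<dots> = (\<Prod>\<xi>\<in>#B. nrm (ev F \<xi>))" using A(2) by (simp add: nrm_prod_mset)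
  finally have "(\<Prod>\<theta>\<in>#A. nrm (ev G \<theta> - c)) = (\<Prod>\<xi>\<in>#B. nrm (ev F \<xi>))" .
  moreover have "ev F \<theta> = 0" if "\<theta> \<in># A" for \<theta>
    using A(2)[of \<theta>] that by (auto simp: prod_mset_zero_iff)
  moreover have "ev G \<xi> = c" if "\<xi> \<in># B" for \<xi>
  proof -
    have "ev G \<xi> - c = 0" using B(2)[of \<xi>] that by (auto simp: prod_mset_zero_iff)
    then show ?thesis by simp
  qed
  ultimately show ?thesis using A(1) B(1) by blast
qed

end

section \<open>One level of the construction\<close>

text \<open>A stage collects what is known after \<open>i\<close> levels of a type.  A pair \<open>(\<xi>, r) \<in> D\<close> is a point of type
  \<open>\<psi>\<^sub>0, \<dots>, \<psi>\<^sub>i\<^sub>-\<^sub>1\<close>, together with a place \<open>r\<close>, a Frobenius twist of the reduction map, for which the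
  residues at \<open>\<xi>\<close> are the chosen roots \<open>z\<^sub>0, \<dots>, z\<^sub>i\<^sub>-\<^sub>1\<close>; \<open>w \<xi>\<close> is an element of value \<open>1 / (e\<^sub>0 \<cdots> e\<^sub>i\<^sub>-\<^sub>1)\<close>.
  Polynomials of degree less than \<open>m\<close> have the same leading term at all these points.\<close>

definition additive_power :: "'f::field itself \<Rightarrow> nat \<Rightarrow> bool" where
  "additive_power _ N \<longleftrightarrow> 0 < N \<and> (\<forall>x y :: 'f. (x + y) ^ N = x ^ N + y ^ N)"

locale stage = local_field K for K :: "('k::field, 'f::field) valued_field" +
  fixes m :: nat and nn :: "'k poly \<Rightarrow> int" and rho :: "'k poly \<Rightarrow> 'f"
    and D :: "('k alg_closure \<times> ('k alg_closure \<Rightarrow> 'f)) set"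
    and w :: "'k alg_closure \<Rightarrow> 'k alg_closure" and p :: real and A :: "'f set"
  assumes m_pos: "0 < m" and p_pos: "0 < p" and p_less_1: "p < 1" and A: "subfld A" "finite A"
    and D_place: "(\<xi>, r) \<in> D \<Longrightarrow> place r"
    and D_w: "(\<xi>, r) \<in> D \<Longrightarrow> nrm (w \<xi>) = p"
    and D_twist: "(\<xi>, r) \<in> D \<Longrightarrow> additive_power TYPE('f) N \<Longrightarrow> (\<And>a. a \<in> A \<Longrightarrow> a ^ N = a) \<Longrightarrow>
        (\<xi>, \<lambda>\<alpha>. r \<alpha> ^ N) \<in> D"
    and D_lead: "(\<xi>, r) \<in> D \<Longrightarrow> a \<noteq> 0 \<Longrightarrow> degree a < m \<Longrightarrow> lead r (w \<xi>) (ev a \<xi>) (nn a) (rho a)"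
    and rho_A: "a \<noteq> 0 \<Longrightarrow> degree a < m \<Longrightarrow> rho a \<in> A \<and> rho a \<noteq> 0"
    and lift: "\<rho> \<in> A \<Longrightarrow> \<rho> \<noteq> 0 \<Longrightarrow> \<exists>a. a \<noteq> 0 \<and> degree a < m \<and> nn a = n \<and> rho a = \<rho>"
begin

definition W :: "'k poly \<Rightarrow> real" where
  "W g = (if g = 0 then 0 else p powi nn g)"

lemma W_ge_0 [simp]: "0 \<le> W g" using p_pos by (simp add: W_def)

lemma D_nrm: "(\<xi>, r) \<in> D \<Longrightarrow> degree a < m \<Longrightarrow> nrm (ev a \<xi>) = W a"
  using D_lead[of \<xi> r a] D_w[of \<xi> r] by (cases "a = 0") (auto simp: W_def lead_def)

lemma D_w_nz: "(\<xi>, r) \<in> D \<Longrightarrow> w \<xi> \<noteq> 0"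
  using D_w[of \<xi> r] p_pos by force

end

locale level = stage K m nn rho D w p A
  for K :: "('k::field, 'f::field) valued_field" and m nn rho D w p A +
  fixes \<phi> :: "'k poly" and \<eta> :: "'k alg_closure \<Rightarrow> 'k alg_closure" and V :: int and \<kappa> :: 'f
    and e h :: nat and lb lb' :: int and \<psi> :: "'f poly" and z :: 'f and B :: real
  assumes phi_monic: "lead_coeff \<phi> = 1" and phi_degree: "degree \<phi> = m"
    and e_pos: "0 < e" and coprime_he: "coprime h e" and bezout: "lb * int h - lb' * int e = 1"
    and eta: "(\<xi>, r) \<in> D \<Longrightarrow> lead r (w \<xi>) (\<eta> \<xi>) (- V) \<kappa>" and kappa: "\<kappa> \<in> A" "\<kappa> \<noteq> 0"
    and psi: "irreducible_over A \<psi>" "lead_coeff \<psi> = 1" "poly \<psi> z = 0"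
    and z_eq_0: "z = 0 \<Longrightarrow> e = 1 \<and> h = 0 \<and> lb = 0"
    and B_greater: "p powr (real_of_int V + real h / real e) < B"
    and outside: "\<xi> \<notin> fst ` D \<Longrightarrow> \<exists>T\<ge>1. (\<forall>a. degree a < m \<longrightarrow> nrm (ev a \<xi>) \<le> W a * T ^ degree a) \<and>
        B * T ^ m \<le> nrm (ev \<phi> \<xi>)"
begin

definition q :: real where "q = p powr (1 / real e)"
text \<open>The critical norm: the one that \<open>\<phi>\<close> has at points belonging to the
  slope \<open>- h / e\<close>.\<close>

definition G :: real where "G = q powi (int e * V + int h)"
definition Ph where "Ph \<xi> = ev \<phi> \<xi> * \<eta> \<xi>"
definition gam where "gam \<xi> = Ph \<xi> ^ e / w \<xi> ^ h"
text \<open>The Bezout relation gives this monomial the norm \<open>q\<close> on \<open>D'\<close>,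
  the unit of value of the next stage.\<close>

definition w' where "w' \<xi> = Ph \<xi> powi lb * w \<xi> powi (- lb')"
definition D' where "D' = {(\<xi>, r) \<in> D. nrm (gam \<xi>) \<le> 1 \<and> r (gam \<xi>) = z}"
definition f :: nat where "f = degree \<psi>"
definition m' :: nat where "m' = e * f * m"
text \<open>The value, in units of \<open>q\<close>, of the term with exponent \<open>s\<close> when
  \<open>\<phi>\<close> has norm \<open>G\<close>. It is \<open>e\<close> times the height at which
  the line of slope \<open>- h / e\<close> through the Newton point meets the vertical axis.\<close>

definition N :: "'k poly \<Rightarrow> nat \<Rightarrow> int" where
  "N g s = int e * (nn (expansion_coeff \<phi> g s) + int s * V) + int s * int h"
definition nn' :: "'k poly \<Rightarrow> int" where "nn' g = Min (N g ` exp_supp \<phi> g)"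
definition S :: "'k poly \<Rightarrow> nat set" where "S g = {s \<in> exp_supp \<phi> g. N g s = nn' g}"
definition cc :: "'k poly \<Rightarrow> nat \<Rightarrow> 'f" where "cc g s = rho (expansion_coeff \<phi> g s) / \<kappa> ^ s"
text \<open>The base point \<open>b\<close> is a parameter because the comparisons below read
  residual polynomials from base points other than the left end of the component.\<close>

definition res :: "nat \<Rightarrow> 'k poly \<Rightarrow> 'f poly" where "res b g = (\<Sum>s\<in>S g. monom (cc g s) ((s - b) div e))"
text \<open>The power of \<open>z\<close> comes from rewriting \<open>Ph\<close> and
  \<open>w\<close> in terms of \<open>w'\<close> and \<open>gam\<close>, as in
  \<open>lead_Ph_w_mult\<close>.\<close>

definition rho' :: "'k poly \<Rightarrow> 'f" where
  "rho' g = z powi ((int (Min (S g)) - lb * nn' g) div int e) * poly (res (Min (S g)) g) z"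
definition W' :: "'k poly \<Rightarrow> real" where "W' g = (if g = 0 then 0 else q powi nn' g)"

lemma phi_degree_pos: "0 < degree \<phi>" using phi_degree m_pos by simp

lemma q_pos: "0 < q" using p_pos by (simp add: q_def)

lemma q_pow_e: "q ^ e = p"
  using e_pos p_pos by (simp add: q_def powr_realpow[symmetric] powr_powr)

lemma q_less_1: "q < 1"
proof (rule ccontr)
  assume "\<not> q < 1"
  then have "1 \<le> q ^ e" by (intro one_le_power) simp
  then show False using p_less_1 q_pow_e by simp
qed

lemma p_powi: "p powi n = q powi (int e * n)"
proof -
  have "(q ^ e) powi n = q powi (int e * n)" by (simp add: power_int_mult)
  then show ?thesis by (simp only: q_pow_e)
qed

lemma G_pos: "0 < G" using q_pos by (simp add: G_def)

lemma G_less_B: "G < B"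
proof -
  have "real_of_int V + real h / real e = 1 / real e * real_of_int (int e * V + int h)"
    using e_pos by (simp add: add_divide_distrib)
  then have "p powr (real_of_int V + real h / real e) = q powr (real_of_int (int e * V + int h))"
    by (simp only: q_def powr_powr)
  also have "\<dots> = q powi (int e * V + int h)" by (rule powr_real_of_int') (use q_pos in auto)
  also have "\<dots> = G" by (simp only: G_def)
  finally show ?thesis using B_greater by simp
qed

lemma f_pos: "0 < f" using psi by (simp add: f_def irreducible_over_def)

lemma q_powi_le: "q powi a \<le> q powi b \<longleftrightarrow> b \<le> a"
proof -
  have "q powi n = exp (real_of_int n * ln q)" for n
    using exp_powi[of "ln q" n] q_pos by simp
  moreover have "ln q < 0" using q_pos q_less_1 by simp
  ultimately show ?thesis by (simp add: mult_le_cancel_right)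
qed

lemma q_powi_less: "q powi a < q powi b \<longleftrightarrow> b < a"
  using q_powi_le[of b a] by linarith

lemma q_powi_inj: "q powi a = q powi b \<longleftrightarrow> a = b"
  using q_powi_le[of b a] q_powi_le[of a b] by auto

lemma eta_D:
  assumes "(\<xi>, r) \<in> D"
  shows "\<eta> \<xi> \<noteq> 0" "nrm (\<eta> \<xi>) = q powi (- (int e * V))"
proof -
  show "\<eta> \<xi> \<noteq> 0" using lead_nz[OF D_place[OF assms] D_w_nz[OF assms] eta[OF assms]] by simp
  show "nrm (\<eta> \<xi>) = q powi (- (int e * V))"
    using eta[OF assms] D_w[OF assms] by (simp add: lead_def p_powi)
qed

lemma nrm_Ph: "(\<xi>, r) \<in> D \<Longrightarrow> nrm (Ph \<xi>) = nrm (ev \<phi> \<xi>) / G * q ^ h"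
  using q_pos by (simp add: Ph_def nrm_mult eta_D G_def power_int_minus power_int_add field_simps)

lemma nrm_gam:
  assumes "(\<xi>, r) \<in> D"
  shows "nrm (gam \<xi>) = (nrm (ev \<phi> \<xi>) / G) ^ e"
proof -
  have "p ^ h = (q ^ e) ^ h" by (simp only: q_pow_e)
  then have "p ^ h = (q ^ h) ^ e" by (simp add: power_mult[symmetric] mult.commute)
  then show ?thesis using q_pos assms
    by (simp add: gam_def nrm_divide nrm_power nrm_Ph D_w power_mult_distrib power_divide)
qed

lemma nrm_gam_le_1: "(\<xi>, r) \<in> D \<Longrightarrow> nrm (gam \<xi>) \<le> 1 \<longleftrightarrow> nrm (ev \<phi> \<xi>) \<le> G"
  using G_pos e_pos by (simp add: nrm_gam power_le_one_iff)

lemma nrm_gam_eq_1: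
  assumes "(\<xi>, r) \<in> D"
  shows "nrm (gam \<xi>) = 1 \<longleftrightarrow> nrm (ev \<phi> \<xi>) = G"
proof -
  have "x ^ e = 1 \<longleftrightarrow> x = 1" if "0 \<le> x" for x :: real
    using power_eq_imp_eq_base[of x e 1] that e_pos by auto
  from this[of "nrm (ev \<phi> \<xi>) / G"] show ?thesis using G_pos nrm_gam[OF assms] by auto
qed

text \<open>The summands of minimal value contribute the monomials of a polynomial in the residue of \<open>gam\<close>.\<close>

lemma residue_of_sum:
  assumes D: "(\<xi>, r) \<in> D" and gam: "nrm (gam \<xi>) \<le> 1" "b = 0 \<or> nrm (gam \<xi>) = 1" and I: "finite I"
    and x: "\<And>s. s \<in> I \<Longrightarrow> lead r (w \<xi>) (x s) (n s) (\<rho> s)"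
    and M: "M = int e * u0 + int b * int h" "\<And>s. s \<in> I \<Longrightarrow> M \<le> int e * (n s + int s * V) + int s * int h"
    and J: "J = {s \<in> I. int e * (n s + int s * V) + int s * int h = M}" and b: "\<And>s. s \<in> J \<Longrightarrow> b \<le> s"
  shows "nrm (Ph \<xi> ^ b * w \<xi> powi u0) = q powi M"
    and "nrm (\<Sum>s\<in>I. x s * ev \<phi> \<xi> ^ s) \<le> q powi M"
    and "r ((\<Sum>s\<in>I. x s * ev \<phi> \<xi> ^ s) / (Ph \<xi> ^ b * w \<xi> powi u0)) =
       (\<Sum>s\<in>J. \<rho> s / \<kappa> ^ s * r (gam \<xi>) ^ ((s - b) div e))"
    and "\<And>s. s \<in> J \<Longrightarrow> e dvd s - b"
proof -
  note r = D_place[OF D] and w = D_w_nz[OF D]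
  let ?c = "Ph \<xi> ^ b * w \<xi> powi u0"
  have phi_le: "nrm (ev \<phi> \<xi>) \<le> G" using gam(1) nrm_gam_le_1[OF D] by simp
  \<comment> \<open>For \<open>b > 0\<close> the norm of \<open>gam\<close> is 1, so
    \<open>\<phi>\<close> has exactly the norm \<open>G\<close>; for \<open>b = 0\<close> the factor
    \<open>Ph\<close> is absent and a smaller norm of \<open>\<phi>\<close> does no harm.\<close>
  show c: "nrm ?c = q powi M"
  proof (cases "b = 0")
    case True
    then show ?thesis using D_w[OF D] M by (simp add: nrm_powi p_powi)
  next
    case False
    then have "nrm (ev \<phi> \<xi>) = G" using gam nrm_gam_eq_1[OF D] by simp
    then have "nrm (Ph \<xi>) = q ^ h" using nrm_Ph[OF D] G_pos by simp
    then show ?thesis using M(1) D_w[OF D] q_pos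
      by (simp add: nrm_mult nrm_powi nrm_power p_powi power_int_add power_mult[symmetric] mult.commute
          flip: of_nat_mult)
  qed
  then have c0: "?c \<noteq> 0" using q_pos by (metis nrm_eq_0 power_int_eq_0_iff less_irrefl)
  define t where "t s = x s * ev \<phi> \<xi> ^ s / ?c" for s
  have nt: "nrm (t s) \<le> q powi (int e * (n s + int s * V) + int s * int h - M)" if "s \<in> I" for s
  proof -
    have "nrm (t s) = q powi (int e * n s) * nrm (ev \<phi> \<xi>) ^ s / q powi M"
      using x[OF that] c D_w[OF D] by (simp add: t_def nrm_divide nrm_mult nrm_power lead_def p_powi)
    also have "\<dots> \<le> q powi (int e * n s) * G ^ s / q powi M"
      using phi_le q_pos by (intro divide_right_mono mult_left_mono power_mono) auto
    also have "G ^ s = q powi (int s * (int e * V + int h))" 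
      using power_int_mult[of q "int e * V + int h" "int s"] by (simp add: G_def mult.commute)
    also have "q powi (int e * n s) * q powi (int s * (int e * V + int h)) / q powi M =
        q powi (int e * n s + int s * (int e * V + int h) - M)"
      using q_pos by (simp add: power_int_add power_int_diff)
    finally show ?thesis by (simp add: algebra_simps)
  qed
  have nt1: "nrm (t s) \<le> 1" if "s \<in> I" for s
    using nt[OF that] M(2)[OF that] q_powi_le[of "int e * (n s + int s * V) + int s * int h - M" 0] by simp
  have nt0: "r (t s) = 0" if "s \<in> I" "s \<notin> J" for s
  proof -
    have "M < int e * (n s + int s * V) + int s * int h" using M(2)[OF that(1)] that J by auto
    then have "nrm (t s) < 1" using nt[OF that(1)]
        q_powi_less[of "int e * (n s + int s * V) + int s * int h - M" 0] by simp
    then show ?thesis by (rule place_small[OF r])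
  qed
  \<comment> \<open>Equal values make \<open>(s - b) * h\<close> divisible by \<open>e\<close>, and
    \<open>h\<close> is coprime to \<open>e\<close>.\<close>
  show dvd: "e dvd s - b" if "s \<in> J" for s
  proof -
    have "int e * (n s + int s * V) + int s * int h = int e * u0 + int b * int h" using that J M by auto
    then have "int (s - b) * int h = int e * (u0 - (n s + int s * V))" using b[OF that]
      by (simp add: of_nat_diff algebra_simps)
    then have "int e dvd int ((s - b) * h)" by simp
    then have "e dvd (s - b) * h" by (simp only: int_dvd_int_iff)
    then show ?thesis using coprime_he by (simp add: coprime_commute coprime_dvd_mult_left_iff)
  qed
  have ntJ: "r (t s) = \<rho> s / \<kappa> ^ s * r (gam \<xi>) ^ ((s - b) div e)" if s: "s \<in> J" for s
  proof -
    have sI: "s \<in> I" using s J by simp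
    define l where "l = (s - b) div e"
    have sl: "s = b + e * l" using dvd[OF s] b[OF s] by (simp add: l_def)
    have "int e * (n s + int s * V) + int s * int h = int e * u0 + int b * int h" using s J M by auto
    then have "int e * (n s + int s * V) = int e * (u0 - int l * int h)"
      by (simp add: sl algebra_simps)
    then have us: "n s + int s * V = u0 - int l * int h" using e_pos by simp
    have ld: "lead r (w \<xi>) (x s * inverse (\<eta> \<xi>) ^ s) (n s + int s * V) (\<rho> s / \<kappa> ^ s)"
      using lead_mult[OF r w x[OF sI] lead_power[OF r w lead_inverse[OF r w eta[OF D]], of s]]
      by (simp add: field_class.field_divide_inverse power_inverse)
    have phi_eq: "ev \<phi> \<xi> = inverse (\<eta> \<xi>) * Ph \<xi>" using eta_D[OF D] by (simp add: Ph_def)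
    \<comment> \<open>Exchanging \<open>e * l\<close> factors \<open>Ph\<close> for
      \<open>l * h\<close> factors \<open>w\<close> leaves the factor
      \<open>gam \<xi> ^ l\<close>.\<close>
    have "Ph \<xi> ^ s * w \<xi> powi (n s + int s * V) = ?c * gam \<xi> ^ l"
    proof -
      have "gam \<xi> ^ l = Ph \<xi> ^ (e * l) / w \<xi> powi (int l * int h)"
        by (simp add: gam_def power_divide power_mult[symmetric] mult.commute flip: of_nat_mult)
      moreover have "w \<xi> powi (n s + int s * V) = w \<xi> powi u0 / w \<xi> powi (int l * int h)"
        unfolding us using w by (simp add: power_int_diff)
      moreover have "Ph \<xi> ^ s = Ph \<xi> ^ b * Ph \<xi> ^ (e * l)" by (subst sl) (simp add: power_add)
      ultimately show ?thesis by simp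
    qed
    note eq = this
    have aux: "a * x' / c = (a / Y) * g" if "x' * Y = c * g" "c \<noteq> 0" "Y \<noteq> 0" for a x' Y c g :: "'k alg_closure"
    proof -
      have "a * x' / c = a * (x' * Y) / (c * Y)" using that(2,3) by simp
      also have "\<dots> = (a / Y) * g" unfolding that(1) using that(2,3) by simp
      finally show ?thesis .
    qed
    have "t s = (x s * inverse (\<eta> \<xi>) ^ s / w \<xi> powi (n s + int s * V)) * gam \<xi> ^ l"
      unfolding t_def phi_eq power_mult_distrib mult.assoc[symmetric]
      by (rule aux[OF eq c0]) (use w in simp)
    moreover have "nrm (x s * inverse (\<eta> \<xi>) ^ s / w \<xi> powi (n s + int s * V)) = 1" by (rule lead_norm1[OF w ld])
    moreover have "nrm (gam \<xi> ^ l) \<le> 1" using gam by (simp add: nrm_power power_le_one)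
    ultimately have "r (t s) = r (x s * inverse (\<eta> \<xi>) ^ s / w \<xi> powi (n s + int s * V)) * r (gam \<xi> ^ l)"
      by (simp only: placeD(3)[OF r] order_refl)
    also have "\<dots> = \<rho> s / \<kappa> ^ s * r (gam \<xi>) ^ l" using ld gam by (simp add: lead_def place_power[OF r])
    finally show ?thesis by (simp add: l_def)
  qed
  have sum_t: "(\<Sum>s\<in>I. x s * ev \<phi> \<xi> ^ s) / ?c = sum t I" by (simp add: t_def sum_divide_distrib)
  have "nrm (sum t I) \<le> 1" using nt1 by (intro nrm_sum_le) auto
  then have "nrm (\<Sum>s\<in>I. x s * ev \<phi> \<xi> ^ s) / nrm ?c \<le> 1" unfolding sum_t[symmetric] nrm_divide .
  then show "nrm (\<Sum>s\<in>I. x s * ev \<phi> \<xi> ^ s) \<le> q powi M" unfolding c using q_pos by simp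
  have "r (sum t I) = (\<Sum>s\<in>I. r (t s))" by (rule place_sum[OF r nt1])
  also have "\<dots> = (\<Sum>s\<in>J. r (t s))" using I J nt0 by (intro sum.mono_neutral_right) auto
  also have "\<dots> = (\<Sum>s\<in>J. \<rho> s / \<kappa> ^ s * r (gam \<xi>) ^ ((s - b) div e))" using ntJ by (rule sum.cong[OF refl])
  finally show "r ((\<Sum>s\<in>I. x s * ev \<phi> \<xi> ^ s) / ?c) = (\<Sum>s\<in>J. \<rho> s / \<kappa> ^ s * r (gam \<xi>) ^ ((s - b) div e))"
    unfolding sum_t .
qed

end

lemma degree_div_add:
  fixes g u :: "'a::field poly"
  assumes "g div u \<noteq> 0"
  shows "degree (g div u) + degree u = degree g"
proof -
  have u: "u \<noteq> 0" using assms by auto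
  have d: "degree ((g div u) * u) = degree (g div u) + degree u" using assms u by (simp add: degree_mult_eq)
  have "g mod u = 0 \<or> degree (g mod u) < degree ((g div u) * u)"
    using degree_mod_less[OF u, of g] d by auto
  then have "degree ((g div u) * u + g mod u) = degree ((g div u) * u)"
    by (elim disjE) (simp only: add_0_right, rule degree_add_eq_left)
  then show ?thesis using d by simp
qed

lemma (in local_field) nrm_dense:
  assumes "0 < x1" "x1 < x2"
  shows "\<exists>c. x1 < nrm c \<and> nrm c < x2"
proof -
  have "ln x1 < ln x2" using assms by simp
  then obtain t where t: "t \<in> \<rat>" "ln x1 < t" "t < ln x2" using Rats_dense_in_real by blast
  obtain c where c: "nrm c = exp t" using nrm_value_rat[OF t(1)] by blast
  have "x1 < nrm c" "nrm c < x2" using t assms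
    by (metis c exp_less_cancel_iff exp_ln order.strict_trans)+
  then show ?thesis by blast
qed

section \<open>Values of polynomials on a level and multiplicativity of the new valuation\<close>

context level
begin

abbreviation "ec \<equiv> expansion_coeff \<phi>"
abbreviation "supp \<equiv> exp_supp \<phi>"

lemma degree_ec: "degree (ec g s) < m"
  using degree_expansion_coeff[OF phi_degree_pos] phi_degree by simp

lemma finite_supp [simp]: "finite (supp g)" by (rule finite_exp_supp[OF phi_degree_pos])

lemma supp_nonempty: "g \<noteq> 0 \<Longrightarrow> supp g \<noteq> {}" by (rule exp_supp_nonempty[OF phi_degree_pos])

lemma in_supp: "s \<in> supp g \<longleftrightarrow> ec g s \<noteq> 0" by (simp add: exp_supp_def)

lemma degree_ec_add_le: "s \<in> supp g \<Longrightarrow> degree (ec g s) + s * m \<le> degree g"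
proof -
  assume s: "s \<in> supp g"
  then have le: "s * m \<le> degree g" using expansion_support(1)[OF phi_degree_pos] phi_degree by (auto simp: in_supp)
  have phi0: "\<phi> \<noteq> 0" using phi_degree_pos by auto
  have "degree (ec g s) \<le> degree (g div \<phi> ^ s)"
    unfolding expansion_coeff_def
  proof (cases "degree (g div \<phi> ^ s) < degree \<phi>")
    case False
    then show "degree (g div \<phi> ^ s mod \<phi>) \<le> degree (g div \<phi> ^ s)"
      using degree_mod_less[OF phi0, of "g div \<phi> ^ s"] by auto
  qed (simp add: mod_poly_less)
  also have "degree (g div \<phi> ^ s) + s * m = degree g"
  proof -
    have "g div \<phi> ^ s \<noteq> 0" using s by (auto simp: in_supp expansion_coeff_def)
    from degree_div_add[OF this] show ?thesis using phi0 phi_degree by (simp add: degree_power_eq)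
  qed
  finally show ?thesis using le by simp
qed

lemma N_ge: "s \<in> supp g \<Longrightarrow> nn' g \<le> N g s" by (simp add: nn'_def)

lemma S_nonempty: "g \<noteq> 0 \<Longrightarrow> S g \<noteq> {}"
proof -
  assume "g \<noteq> 0"
  then have "nn' g \<in> N g ` supp g" unfolding nn'_def using supp_nonempty by (intro Min_in) auto
  then show ?thesis by (auto simp: S_def)
qed

lemma S_supp: "s \<in> S g \<Longrightarrow> s \<in> supp g" by (simp add: S_def)

lemma finite_S [simp]: "finite (S g)" by (rule finite_subset[OF _ finite_supp]) (auto simp: S_def)

lemma S_cong: "s \<in> S g \<Longrightarrow> t \<in> S g \<Longrightarrow> int e dvd int s - int t"
proof -
  assume "s \<in> S g" "t \<in> S g"
  then have "N g s = N g t" by (simp add: S_def)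
  then have "(int s - int t) * int h = int e * ((nn (ec g t) + int t * V) - (nn (ec g s) + int s * V))"
    by (simp add: N_def algebra_simps)
  then have "int e dvd (int s - int t) * int h" by simp
  moreover have "coprime (int e) (int h)" using coprime_he by (simp add: coprime_commute)
  ultimately show ?thesis by (simp add: coprime_dvd_mult_left_iff)
qed

lemma S_cong_nat: "s \<in> S g \<Longrightarrow> t \<in> S g \<Longrightarrow> t \<le> s \<Longrightarrow> e dvd s - t"
  using S_cong[of s g t] by (simp flip: of_nat_diff)

text \<open>\<open>based b g\<close>: \<open>b\<close> is an admissible base point for reading off the residual polynomial.\<close>

definition based :: "nat \<Rightarrow> 'k poly \<Rightarrow> bool" where
  "based b g \<longleftrightarrow> (\<forall>s\<in>S g. b \<le> s \<and> e dvd s - b)"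

lemma based_Min: "g \<noteq> 0 \<Longrightarrow> based (Min (S g)) g"
  unfolding based_def using S_nonempty[of g] S_cong_nat[OF _ Min_in[OF finite_S]] by (simp add: Min_le)

text \<open>The value splits into the contribution of \<open>b\<close> factors \<open>Ph\<close> and
  that of an integral power of \<open>w\<close>; \<open>u0\<close> is the exponent of that power in
  the normalizing factor.\<close>

lemma based_base:
  assumes "g \<noteq> 0" "based b g"
  shows "\<exists>u0. nn' g = int e * u0 + int b * int h"
proof -
  obtain s where s: "s \<in> S g" using S_nonempty[OF assms(1)] by blast
  then obtain l where l: "s = b + e * l" using assms(2) unfolding based_def by (metis dvdE le_add_diff_inverse)
  have "nn' g = N g s" using s by (simp add: S_def)
  then show ?thesis
    by (intro exI[of _ "nn (ec g s) + int s * V + int l * int h"]) (simp add: N_def l algebra_simps)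
qed

lemma coeff_res:
  assumes "based b g"
  shows "coeff (res b g) l = (if b + e * l \<in> S g then cc g (b + e * l) else 0)"
proof -
  have "coeff (res b g) l = (\<Sum>s\<in>S g. if s = b + e * l then cc g s else 0)"
    unfolding res_def coeff_sum coeff_monom
  proof (rule sum.cong[OF refl])
    fix s assume "s \<in> S g"
    then obtain l' where "s = b + e * l'" using assms unfolding based_def by (metis dvdE le_add_diff_inverse)
    then show "(if (s - b) div e = l then cc g s else 0) = (if s = b + e * l then cc g s else 0)" using e_pos by simp
  qed
  then show ?thesis by simp
qed

lemma cc_nz: "s \<in> supp g \<Longrightarrow> cc g s \<in> A \<and> cc g s \<noteq> 0"
  using rho_A[of "ec g s"] degree_ec kappa A(1) by (simp add: cc_def in_supp subfld_divide subfld_power)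

lemma res_polys_over: "res b g \<in> polys_over A"
  unfolding res_def using A(1) cc_nz S_supp by (intro polys_over_sum polys_over_monom) auto

lemma res_nz: "g \<noteq> 0 \<Longrightarrow> based b g \<Longrightarrow> res b g \<noteq> 0"
proof -
  assume g: "g \<noteq> 0" "based b g"
  obtain s where s: "s \<in> S g" using S_nonempty[OF g(1)] by blast
  then obtain l where l: "s = b + e * l" using g(2) unfolding based_def by (metis dvdE le_add_diff_inverse)
  have "coeff (res b g) l \<noteq> 0" using s l cc_nz[OF S_supp[OF s]] by (simp add: coeff_res[OF g(2)])
  then show ?thesis by auto
qed

lemma res_shift:
  assumes "g \<noteq> 0" "based b g"
  shows "res b g = monom 1 ((Min (S g) - b) div e) * res (Min (S g)) g"
proof -
  let ?b = "Min (S g)"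
  have b: "?b \<in> S g" using S_nonempty[OF assms(1)] by simp
  then obtain l where l: "?b = b + e * l" using assms unfolding based_def by (metis dvdE le_add_diff_inverse)
  show ?thesis unfolding res_def sum_distrib_left
  proof (rule sum.cong[OF refl])
    fix s assume s: "s \<in> S g"
    then obtain k where k: "s = ?b + e * k"
      using based_Min[OF assms(1)] unfolding based_def by (metis dvdE le_add_diff_inverse)
    have "(s - b) div e = l + k" using e_pos unfolding k l by (simp add: algebra_simps flip: distrib_left)
    moreover have "(s - ?b) div e = k" using e_pos unfolding k by simp
    moreover have "(?b - b) div e = l" using e_pos unfolding l by simp
    ultimately show "monom (cc g s) ((s - b) div e) = monom 1 ((?b - b) div e) * monom (cc g s) ((s - ?b) div e)"
      by (simp add: mult_monom)
  qed
qed

text \<open>Each unit of degree of the residual polynomial costs \<open>e * m\<close> in the degree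
  of \<open>g\<close>.\<close>

lemma degree_res_less:
  assumes "g \<noteq> 0" "degree g < m'" "based b g"
  shows "degree (res b g) < f"
proof -
  have "degree (res b g) \<le> f - 1"
  proof (rule degree_le, safe)
    fix l assume l: "f - 1 < l"
    have "b + e * l \<notin> S g"
    proof
      assume "b + e * l \<in> S g"
      then have "(b + e * l) * m \<le> degree g" using degree_ec_add_le S_supp by fastforce
      moreover have "e * f \<le> e * l" using l f_pos by (intro mult_le_mono2) simp
      then have "e * f \<le> b + e * l" by linarith
      then have "m' \<le> (b + e * l) * m" unfolding m'_def by (rule mult_le_mono1)
      ultimately show False using assms(2) by linarith
    qed
    then show "coeff (res b g) l = 0" by (simp add: coeff_res[OF assms(3)])
  qed
  then show ?thesis using f_pos by simp
qed

lemma W'_ge_0 [simp]: "0 \<le> W' g" using q_pos by (simp add: W'_def)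
lemma W'_pos: "g \<noteq> 0 \<Longrightarrow> 0 < W' g" using q_pos by (simp add: W'_def)

lemma term_norm: "s \<in> supp g \<Longrightarrow> W (ec g s) * G ^ s = q powi N g s"
proof -
  assume "s \<in> supp g"
  moreover have "G ^ s = q powi (int s * (int e * V + int h))"
    using power_int_mult[of q "int e * V + int h" "int s"] by (simp add: G_def mult.commute)
  ultimately show ?thesis using q_pos
    by (simp add: W_def in_supp p_powi N_def power_int_add[symmetric] algebra_simps)
qed

lemma term_le: "s \<in> supp g \<Longrightarrow> W (ec g s) * G ^ s \<le> W' g"
  using N_ge[of s g] by (auto simp: term_norm W'_def q_powi_le in_supp)

lemma eval_poly:
  assumes D: "(\<xi>, r) \<in> D" and gam: "nrm (gam \<xi>) \<le> 1" "b = 0 \<or> nrm (gam \<xi>) = 1"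
    and g: "g \<noteq> 0" "based b g" "nn' g = int e * u0 + int b * int h"
  shows "nrm (Ph \<xi> ^ b * w \<xi> powi u0) = W' g" "nrm (ev g \<xi>) \<le> W' g"
    "r (ev g \<xi> / (Ph \<xi> ^ b * w \<xi> powi u0)) = poly (res b g) (r (gam \<xi>))"
proof -
  have x: "lead r (w \<xi>) (ev (ec g s) \<xi>) (nn (ec g s)) (rho (ec g s))" if "s \<in> supp g" for s
    using D_lead[OF D _ degree_ec] that by (simp add: in_supp)
  have M: "nn' g \<le> int e * (nn (ec g s) + int s * V) + int s * int h" if "s \<in> supp g" for s
    using N_ge[OF that] by (simp add: N_def)
  have J: "S g = {s \<in> supp g. int e * (nn (ec g s) + int s * V) + int s * int h = nn' g}"
    by (simp add: S_def N_def)
  have b: "b \<le> s" if "s \<in> S g" for s using g(2) that by (simp add: based_def)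
  note c = residue_of_sum[where x = "\<lambda>s. ev (ec g s) \<xi>", OF D gam finite_supp x g(3) M J b]
  show "nrm (Ph \<xi> ^ b * w \<xi> powi u0) = W' g" using c(1) g(1) by (simp add: W'_def)
  show "nrm (ev g \<xi>) \<le> W' g" using c(2) g(1) by (simp add: W'_def ev_expansion[OF phi_degree_pos, of g])
  show "r (ev g \<xi> / (Ph \<xi> ^ b * w \<xi> powi u0)) = poly (res b g) (r (gam \<xi>))"
    using c(3) by (simp add: ev_expansion[OF phi_degree_pos, of g] res_def poly_sum poly_monom cc_def)
qed

text \<open>Divided by the normalizing factor the value becomes integral, and it is a unit exactly
  when its residue, a value of the residual polynomial, is nonzero.\<close>

lemma eval_poly_eq:
  assumes D: "(\<xi>, r) \<in> D" and gam: "nrm (gam \<xi>) \<le> 1" "b = 0 \<or> nrm (gam \<xi>) = 1"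
    and g: "g \<noteq> 0" "based b g"
  shows "nrm (ev g \<xi>) = W' g \<longleftrightarrow> poly (res b g) (r (gam \<xi>)) \<noteq> 0"
proof -
  obtain u0 where u0: "nn' g = int e * u0 + int b * int h" using based_base[OF g] by blast
  note E = eval_poly[OF D gam g u0]
  let ?c = "Ph \<xi> ^ b * w \<xi> powi u0"
  have "nrm (ev g \<xi> / ?c) = nrm (ev g \<xi>) / W' g" unfolding nrm_divide E(1) ..
  moreover from this have "nrm (ev g \<xi> / ?c) \<le> 1" using E(2) W'_pos[OF g(1)] by simp
  moreover have "nrm (ev g \<xi>) / W' g = 1 \<longleftrightarrow> nrm (ev g \<xi>) = W' g" using W'_pos[OF g(1)] by auto
  ultimately show ?thesis using placeD(4)[OF D_place[OF D], of "ev g \<xi> / ?c"] unfolding E(3) by linarith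
qed

text \<open>Here \<open>\<phi>\<close> counts as a quantity of degree \<open>m\<close>, so the bound
  \<open>G * T' ^ m\<close> for its norm fits a growth by \<open>T'\<close> per degree.\<close>

lemma eval_bound:
  assumes T: "1 \<le> T" "T \<le> T'" and a: "\<And>a. degree a < m \<Longrightarrow> nrm (ev a \<xi>) \<le> W a * T ^ degree a"
    and phi: "nrm (ev \<phi> \<xi>) \<le> G * T' ^ m"
  shows "nrm (ev g \<xi>) \<le> W' g * T' ^ degree g"
proof -
  have "nrm (ev (ec g s) \<xi> * ev \<phi> \<xi> ^ s) \<le> W' g * T' ^ degree g" if s: "s \<in> supp g" for s
  proof -
    have "nrm (ev (ec g s) \<xi> * ev \<phi> \<xi> ^ s) \<le> (W (ec g s) * T ^ degree (ec g s)) * (G * T' ^ m) ^ s"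
      unfolding nrm_mult nrm_power using T a[OF degree_ec] phi
      by (intro mult_mono power_mono) (auto intro!: mult_nonneg_nonneg)
    also have "\<dots> = (W (ec g s) * G ^ s) * (T ^ degree (ec g s) * T' ^ (s * m))"
      by (simp add: power_mult_distrib power_mult[symmetric] mult_ac)
    also have "\<dots> \<le> W' g * (T' ^ degree (ec g s) * T' ^ (s * m))"
      using term_le[OF s] T G_pos by (intro mult_mono power_mono) auto
    also have "\<dots> \<le> W' g * T' ^ degree g" unfolding power_add[symmetric]
      using degree_ec_add_le[OF s] T by (intro mult_left_mono power_increasing) auto
    finally show ?thesis .
  qed
  then show ?thesis unfolding ev_expansion[OF phi_degree_pos, of g] using T by (intro nrm_sum_le) auto
qed

text \<open>The values are dense, so some \<open>c\<close> has its norm in the interval; a root of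
  \<open>\<phi> - c\<close> outside \<open>D\<close> would give \<open>\<phi>\<close> a norm of at
  least \<open>B\<close>.\<close>

lemma D_point:
  assumes "0 < x1" "x1 < x2" "x2 \<le> B"
  shows "\<exists>\<xi> r. (\<xi>, r) \<in> D \<and> x1 < nrm (ev \<phi> \<xi>) \<and> nrm (ev \<phi> \<xi>) < x2"
proof -
  obtain c where c12: "x1 < nrm c" "nrm c < x2" using nrm_dense[OF assms(1,2)] by blast
  obtain \<xi> where \<xi>: "ev \<phi> \<xi> = c" using ev_eq_solvable[OF phi_degree_pos] by blast
  have "\<xi> \<in> fst ` D"
  proof (rule ccontr)
    assume "\<xi> \<notin> fst ` D"
    from outside[OF this] obtain T where T: "T \<ge> 1" "B * T ^ m \<le> nrm (ev \<phi> \<xi>)" by blast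
    have "B \<le> B * T ^ m" using T assms G_less_B G_pos mult_left_mono[of 1 "T ^ m" B] by (simp add: one_le_power)
    then show False using T(2) c12 assms unfolding \<xi> by linarith
  qed
  then show ?thesis using \<xi> c12 by force
qed

lemma D_nonempty: "\<exists>\<xi> r. (\<xi>, r) \<in> D"
  using D_point[of "G / 2" G] G_pos G_less_B by force

text \<open>Any single point of \<open>D\<close> determines the leading data; evaluate the constant
  polynomial there.\<close>

lemma nn_1: "nn 1 = 0" "rho 1 = 1"
proof -
  obtain \<xi> r where D: "(\<xi>, r) \<in> D" using D_nonempty by blast
  have l: "lead r (w \<xi>) 1 (nn 1) (rho 1)" using D_lead[OF D, of 1] m_pos by simp
  then have "q powi (int e * nn 1) = q powi 0" by (simp add: lead_def D_w[OF D] p_powi)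
  then have "int e * nn 1 = 0" unfolding q_powi_inj .
  then show *: "nn 1 = 0" using e_pos by simp
  show "rho 1 = 1" using l placeD(1)[OF D_place[OF D]] by (simp add: lead_def *)
qed

text \<open>Slightly above \<open>G\<close> the terms of minimal value are separated by their
  exponents, so the one with the largest exponent dominates alone.\<close>

lemma nrm_near:
  assumes g: "g \<noteq> 0"
  shows "\<exists>\<delta>>0. \<forall>\<xi> r. (\<xi>, r) \<in> D \<longrightarrow> G < nrm (ev \<phi> \<xi>) \<longrightarrow> nrm (ev \<phi> \<xi>) < G + \<delta> \<longrightarrow>
    nrm (ev g \<xi>) = W' g * (nrm (ev \<phi> \<xi>) / G) ^ Max (S g)"
proof -
  define d where "d = Suc (degree g)"
  \<comment> \<open>Terms outside \<open>S g\<close> are smaller by at least the factor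
    \<open>q\<close> at the critical norm. With \<open>y < y0\<close> the growth
    \<open>y ^ s\<close> stays below \<open>1 / q\<close>, because \<open>s < d\<close>.\<close>
  define y0 where "y0 = root d (1 / q)"
  have y0: "y0 > 1" "y0 ^ d = 1 / q" using q_pos q_less_1 real_root_pow_pos2[of d "1 / q"]
    by (simp_all add: y0_def d_def del: power_Suc)
  define \<delta> where "\<delta> = G * (y0 - 1)"
  have "\<delta> > 0" using y0 G_pos by (simp add: \<delta>_def)
  moreover have "nrm (ev g \<xi>) = W' g * (nrm (ev \<phi> \<xi>) / G) ^ Max (S g)"
    if D: "(\<xi>, r) \<in> D" and x: "G < nrm (ev \<phi> \<xi>)" "nrm (ev \<phi> \<xi>) < G + \<delta>" for \<xi> r
  proof -
    define y where "y = nrm (ev \<phi> \<xi>) / G"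
    have y: "1 < y" "y < y0" using x G_pos by (auto simp: y_def \<delta>_def field_simps)
    define s1 where "s1 = Max (S g)"
    have s1: "s1 \<in> S g" using S_nonempty[OF g] by (simp add: s1_def)
    have tm: "nrm (ev (ec g s) \<xi> * ev \<phi> \<xi> ^ s) = q powi N g s * y ^ s" if "s \<in> supp g" for s
      using D_nrm[OF D degree_ec] term_norm[OF that] G_pos
      by (simp add: nrm_mult nrm_power y_def power_divide field_simps)
    have tm1: "nrm (ev (ec g s1) \<xi> * ev \<phi> \<xi> ^ s1) = W' g * y ^ s1"
      using tm[OF S_supp[OF s1]] s1 g by (simp add: S_def W'_def)
    have "nrm (ev (ec g s) \<xi> * ev \<phi> \<xi> ^ s) < nrm (ev (ec g s1) \<xi> * ev \<phi> \<xi> ^ s1)" if s: "s \<in> supp g" "s \<noteq> s1" for s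
    proof (cases "s \<in> S g")
      case True
      then have "s < s1" using s(2) by (simp add: s1_def le_neq_implies_less)
      then have "y ^ s < y ^ s1" using y by (intro power_strict_increasing) auto
      moreover have "q powi N g s = W' g" using True g by (simp add: S_def W'_def)
      ultimately show ?thesis using tm[OF s(1)] tm1 W'_pos[OF g] by simp
    next
      case False
      then have "nn' g + 1 \<le> N g s" using N_ge[OF s(1)] s(1) by (simp add: S_def)
      then have "q powi N g s \<le> q powi (nn' g + 1)" by (simp add: q_powi_le)
      also have "\<dots> = W' g * q" using g q_pos by (simp add: W'_def power_int_add)
      finally have "q powi N g s * y ^ s \<le> (W' g * q) * y ^ s" using y by (intro mult_right_mono) auto
      also have "y ^ s < 1 / q"
      proof -
        have "s \<le> degree g" using expansion_support(2)[OF phi_degree_pos] s by (simp add: in_supp)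
        then have "y ^ s \<le> y ^ d" using y by (intro power_increasing) (auto simp: d_def)
        also have "\<dots> < y0 ^ d" using y by (intro power_strict_mono) (auto simp: d_def)
        finally show ?thesis using y0 by simp
      qed
      then have "(W' g * q) * y ^ s < (W' g * q) * (1 / q)"
        using W'_pos[OF g] q_pos by (intro mult_strict_left_mono) auto
      also have "\<dots> \<le> W' g * y ^ s1" using q_pos y W'_pos[OF g] by simp
      finally show ?thesis using tm[OF s(1)] tm1 by simp
    qed
    then have "nrm (ev g \<xi>) = nrm (ev (ec g s1) \<xi> * ev \<phi> \<xi> ^ s1)"
      unfolding ev_expansion[OF phi_degree_pos, of g] using S_supp[OF s1] by (intro nrm_sum_dominant) auto
    then show ?thesis using tm1 by (simp add: y_def s1_def)
  qed
  ultimately show ?thesis by blast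
qed

text \<open>Turns estimates at points of \<open>D\<close> into estimates of \<open>W'\<close>; the
  point is taken just above the critical norm, where no cancellation can occur.\<close>

lemma W'_le_nrm: "\<exists>\<xi> r. (\<xi>, r) \<in> D \<and> W' g \<le> nrm (ev g \<xi>)"
proof (cases "g = 0")
  case True
  then show ?thesis using D_nonempty by (auto simp: W'_def)
next
  case False
  obtain \<delta> where d: "\<delta> > 0" "\<And>\<xi> r. (\<xi>, r) \<in> D \<Longrightarrow> G < nrm (ev \<phi> \<xi>) \<Longrightarrow> nrm (ev \<phi> \<xi>) < G + \<delta> \<Longrightarrow>
      nrm (ev g \<xi>) = W' g * (nrm (ev \<phi> \<xi>) / G) ^ Max (S g)" using nrm_near[OF False] by blast
  obtain \<xi> r where x: "(\<xi>, r) \<in> D" "G < nrm (ev \<phi> \<xi>)" "nrm (ev \<phi> \<xi>) < min (G + \<delta>) B"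
    using D_point[of G "min (G + \<delta>) B"] d(1) G_pos G_less_B by auto
  have "W' g * 1 \<le> W' g * (nrm (ev \<phi> \<xi>) / G) ^ Max (S g)"
    using x G_pos by (intro mult_left_mono one_le_power) auto
  then show ?thesis using x d(2)[of \<xi> r] by auto
qed

text \<open>Norms are multiplicative at every point. Just above \<open>G\<close> the norms of
  \<open>g\<close>, \<open>g'\<close> and their product are monomials in the norm of
  \<open>\<phi>\<close>, and two different norms of \<open>\<phi>\<close> determine exponent and
  coefficient of a monomial.\<close>

lemma nn'_mult:
  assumes "g \<noteq> 0" "g' \<noteq> 0"
  shows "nn' (g * g') = nn' g + nn' g'"
proof -
  have gg: "g * g' \<noteq> 0" using assms by simp
  obtain d1 where d1: "d1 > 0" "\<And>\<xi> r. (\<xi>, r) \<in> D \<Longrightarrow> G < nrm (ev \<phi> \<xi>) \<Longrightarrow> nrm (ev \<phi> \<xi>) < G + d1 \<Longrightarrow>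
      nrm (ev g \<xi>) = W' g * (nrm (ev \<phi> \<xi>) / G) ^ Max (S g)" using nrm_near[OF assms(1)] by blast
  obtain d2 where d2: "d2 > 0" "\<And>\<xi> r. (\<xi>, r) \<in> D \<Longrightarrow> G < nrm (ev \<phi> \<xi>) \<Longrightarrow> nrm (ev \<phi> \<xi>) < G + d2 \<Longrightarrow>
      nrm (ev g' \<xi>) = W' g' * (nrm (ev \<phi> \<xi>) / G) ^ Max (S g')" using nrm_near[OF assms(2)] by blast
  obtain d3 where d3: "d3 > 0" "\<And>\<xi> r. (\<xi>, r) \<in> D \<Longrightarrow> G < nrm (ev \<phi> \<xi>) \<Longrightarrow> nrm (ev \<phi> \<xi>) < G + d3 \<Longrightarrow>
      nrm (ev (g * g') \<xi>) = W' (g * g') * (nrm (ev \<phi> \<xi>) / G) ^ Max (S (g * g'))" using nrm_near[OF gg] by blast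
  define x0 where "x0 = Min {G + d1, G + d2, G + d3, B}"
  have x0: "G < x0" "x0 \<le> G + d1" "x0 \<le> G + d2" "x0 \<le> G + d3" "x0 \<le> B"
    using d1 d2 d3 G_less_B by (auto simp: x0_def)
  have eq: "W' (g * g') * (nrm (ev \<phi> \<xi>) / G) ^ Max (S (g * g')) =
      (W' g * W' g') * (nrm (ev \<phi> \<xi>) / G) ^ (Max (S g) + Max (S g'))"
    if "(\<xi>, r) \<in> D" "G < nrm (ev \<phi> \<xi>)" "nrm (ev \<phi> \<xi>) < x0" for \<xi> r
    using d1(2)[OF that(1,2)] d2(2)[OF that(1,2)] d3(2)[OF that(1,2)] that(3) x0
    by (simp add: ev_mult nrm_mult power_add mult_ac)
  obtain \<xi> r where x: "(\<xi>, r) \<in> D" "G < nrm (ev \<phi> \<xi>)" "nrm (ev \<phi> \<xi>) < x0"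
    using D_point[of G x0] x0 G_pos by blast
  obtain \<xi>' r' where x': "(\<xi>', r') \<in> D" "G < nrm (ev \<phi> \<xi>')" "nrm (ev \<phi> \<xi>') < nrm (ev \<phi> \<xi>)"
    using D_point[of G "nrm (ev \<phi> \<xi>)"] x x0 G_pos by force
  define k l where "k = Max (S (g * g'))" and "l = Max (S g) + Max (S g')"
  define y y' where "y = nrm (ev \<phi> \<xi>) / G" and "y' = nrm (ev \<phi> \<xi>') / G"
  define a b where "a = W' (g * g')" and "b = W' g * W' g'"
  have y: "1 < y'" "y' < y" using x x' G_pos by (auto simp: y_def y'_def divide_strict_right_mono)
  have ab: "a > 0" "b > 0" using W'_pos assms gg by (auto simp: a_def b_def)
  have e1: "a * y ^ k = b * y ^ l" using eq[OF x] by (simp add: a_def b_def y_def k_def l_def)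
  have e2: "a * y' ^ k = b * y' ^ l" using eq[OF x'(1,2)] x' x by (simp add: a_def b_def y'_def k_def l_def)
  have "(a * y ^ k) * (b * y' ^ l) = (b * y ^ l) * (a * y' ^ k)" using e1 e2 by simp
  then have "y ^ k * y' ^ l = y ^ l * y' ^ k" using ab by simp
  then have "(y / y') ^ k = (y / y') ^ l" using y by (simp add: power_divide field_simps)
  then have "k = l" using y by (intro power_inject_exp[THEN iffD1, of "y / y'"]) auto
  then have "a = b" using e1 y by simp
  then have "q powi nn' (g * g') = q powi (nn' g + nn' g')"
    using assms q_pos by (simp add: a_def b_def W'_def power_int_add)
  then show ?thesis by (simp only: q_powi_inj)
qed

end

section \<open>Passage to the next stage: leading terms and lifting\<close>

context level
begin

text \<open>If \<open>z = 0\<close> then \<open>\<psi>\<close> is \<open>y\<close>, and the level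
  changes neither the degree bound nor the unit of value.\<close>

lemma z0:
  assumes "z = 0"
  shows "e = 1" "h = 0" "lb = 0" "lb' = -1" "f = 1" "m' = m" "q = p" "w' \<xi> = w \<xi>"
proof -
  show *: "e = 1" "h = 0" "lb = 0" using z_eq_0[OF assms] by auto
  show l: "lb' = -1" using bezout * by simp
  have "[:0, 1:] \<in> polys_over A" using A(1) by (intro polys_over_pCons) (auto simp: subfldD polys_over_0)
  then have "\<psi> dvd [:0, 1:]" using irreducible_over_dvd[OF A(1) psi(1,3)] assms by simp
  then have "degree \<psi> \<le> 1" using dvd_imp_degree_le[of \<psi> "[:0, 1:]"] by simp
  then show f: "f = 1" using f_pos by (simp add: f_def)
  show "m' = m" unfolding m'_def f by (simp add: *)
  show "q = p" unfolding q_def using p_pos by (simp add: *)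
  show "w' \<xi> = w \<xi>" unfolding w'_def by (simp add: * l)
qed

lemma m'_pos: "0 < m'" using e_pos f_pos m_pos by (simp add: m'_def)

text \<open>The coefficients of \<open>P\<close> are lifted separately to the abscissas
  \<open>b + e * l\<close>, with values that put all points on one line of slope
  \<open>- h / e\<close>; hence every term of \<open>H\<close> is minimal.\<close>

lemma lift_res:
  assumes P: "P \<in> polys_over A" "P \<noteq> 0"
  shows "\<exists>H. H \<noteq> 0 \<and> based b H \<and> nn' H = int e * u0 + int b * int h \<and> res b H = P \<and>
    S H = supp H \<and> degree H < m * (b + e * degree P + 1)"
proof -
  have "\<forall>l. \<exists>a. (coeff P l = 0 \<longrightarrow> a = 0) \<and> (coeff P l \<noteq> 0 \<longrightarrow> a \<noteq> 0 \<and> degree a < m \<and>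
      nn a = u0 - int l * int h - int (b + e * l) * V \<and> rho a = coeff P l * \<kappa> ^ (b + e * l))"
  proof
    fix l
    show "\<exists>a. (coeff P l = 0 \<longrightarrow> a = 0) \<and> (coeff P l \<noteq> 0 \<longrightarrow> a \<noteq> 0 \<and> degree a < m \<and>
      nn a = u0 - int l * int h - int (b + e * l) * V \<and> rho a = coeff P l * \<kappa> ^ (b + e * l))"
    proof (cases "coeff P l = 0")
      case False
      have "coeff P l * \<kappa> ^ (b + e * l) \<in> A" using P A kappa by (simp add: subfldD subfld_power polys_overD)
      moreover have "coeff P l * \<kappa> ^ (b + e * l) \<noteq> 0" using False kappa by simp
      ultimately show ?thesis using lift[of "coeff P l * \<kappa> ^ (b + e * l)"] False by simp
    qed auto
  qed
  then obtain a where a0: "\<And>l. coeff P l = 0 \<Longrightarrow> a l = 0"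
    and a: "\<And>l. coeff P l \<noteq> 0 \<Longrightarrow> a l \<noteq> 0 \<and> degree (a l) < m \<and>
      nn (a l) = u0 - int l * int h - int (b + e * l) * V \<and> rho (a l) = coeff P l * \<kappa> ^ (b + e * l)"
    by metis
  have e0: "e \<noteq> 0" using e_pos by simp
  define L where "L = {l. coeff P l \<noteq> 0}"
  have L: "finite L" "L \<noteq> {}" 
    using P(2) by (auto simp: L_def MOST_nat poly_eq_iff intro: finite_subset[of _ "{..degree P}"] le_degree)
  have inj: "inj_on (\<lambda>l. b + e * l) L" using e_pos by (auto simp: inj_on_def)
  define I where "I = (\<lambda>l. b + e * l) ` L"
  define H where "H = (\<Sum>s\<in>I. a ((s - b) div e) * \<phi> ^ s)"
  have fI: "finite I" using L by (simp add: I_def)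
  have dega: "degree (a ((s - b) div e)) < degree \<phi>" if "s \<in> I" for s
    using that a phi_degree by (auto simp: I_def L_def e0)
  have ecH: "ec H s = (if s \<in> I then a ((s - b) div e) else 0)" for s
    unfolding H_def by (rule expansion_coeff_unique[OF phi_degree_pos fI dega])
  have suppH: "supp H = I" using a by (auto simp: exp_supp_def ecH I_def L_def e0)
  have NH: "N H s = int e * u0 + int b * int h" if "s \<in> I" for s
  proof -
    obtain l where l: "s = b + e * l" "coeff P l \<noteq> 0" using \<open>s \<in> I\<close> by (auto simp: I_def L_def)
    have "nn (ec H s) + int s * V = u0 - int l * int h" using that a[OF l(2)] by (simp add: ecH l(1) e0)
    then have "N H s = int e * (u0 - int l * int h) + int s * int h" by (simp only: N_def)
    then show ?thesis by (simp add: l(1) algebra_simps)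
  qed
  have H0: "H \<noteq> 0"
  proof
    assume "H = 0"
    then have "supp H = {}" by (simp add: exp_supp_def)
    then show False using suppH L by (simp add: I_def)
  qed
  have "N H ` supp H = {int e * u0 + int b * int h}" using NH L unfolding suppH by (auto simp: I_def)
  then have nH: "nn' H = int e * u0 + int b * int h" by (simp add: nn'_def)
  have SH: "S H = I" using NH by (auto simp: S_def suppH nH)
  have bH: "based b H" using e_pos by (auto simp: based_def SH I_def)
  have "res b H = P"
  proof (rule poly_eqI)
    fix l
    have "b + e * l \<in> I \<longleftrightarrow> coeff P l \<noteq> 0" using inj e_pos by (auto simp: I_def L_def)
    then show "coeff (res b H) l = coeff P l"
      using a[of l] kappa by (auto simp: coeff_res[OF bH] SH cc_def ecH e0)
  qed
  moreover have "degree H < m * (b + e * degree P + 1)"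
  proof -
    have "degree H \<le> m * (b + e * degree P + 1) - 1"
      unfolding H_def
    proof (rule degree_sum_le[OF fI])
      fix s assume s: "s \<in> I"
      then obtain l where l: "s = b + e * l" "coeff P l \<noteq> 0" by (auto simp: I_def L_def)
      have "degree (a ((s - b) div e) * \<phi> ^ s) \<le> degree (a ((s - b) div e)) + degree (\<phi> ^ s)" by (rule degree_mult_le)
      also have "degree (\<phi> ^ s) \<le> m * s" using degree_power_le[of \<phi> s] phi_degree by simp
      finally have "degree (a ((s - b) div e) * \<phi> ^ s) < m + m * s" using dega[OF s] phi_degree by linarith
      also have "l \<le> degree P" using l by (simp add: le_degree)
      then have "e * l \<le> e * degree P" by simp
      then have "m + m * s \<le> m * (b + e * degree P + 1)" unfolding l(1)
        by (metis add.commute add_mono_thms_linordered_semiring(3) add_mult_distrib2 mult.commute mult_le_mono1 nat_mult_1_right add_le_mono1 add_left_mono)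
      finally show "degree (a ((s - b) div e) * \<phi> ^ s) \<le> m * (b + e * degree P + 1) - 1" by linarith
    qed
    then show ?thesis using m_pos by (metis Suc_pred' add_gr_0 le_imp_less_Suc nat_0_less_mult_iff zero_less_one)
  qed
  ultimately show ?thesis using H0 bH nH SH suppH by blast
qed

lemma D'_D: "(\<xi>, r) \<in> D' \<Longrightarrow> (\<xi>, r) \<in> D" by (simp add: D'_def)
lemma D'_gam_le: "(\<xi>, r) \<in> D' \<Longrightarrow> nrm (gam \<xi>) \<le> 1" by (simp add: D'_def)
lemma D'_gam: "(\<xi>, r) \<in> D' \<Longrightarrow> r (gam \<xi>) = z" by (simp add: D'_def)

lemma D'_gam_1: "(\<xi>, r) \<in> D' \<Longrightarrow> z \<noteq> 0 \<Longrightarrow> nrm (gam \<xi>) = 1"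
  using placeD(4)[OF D_place[OF D'_D], of \<xi> r "gam \<xi>"] by (force simp: D'_def)

lemma Ph_nz: "(\<xi>, r) \<in> D' \<Longrightarrow> z \<noteq> 0 \<Longrightarrow> Ph \<xi> \<noteq> 0"
  using D'_gam_1[of \<xi> r] e_pos by (auto simp: gam_def zero_power)

lemma gam_powi: "gam \<xi> powi k = Ph \<xi> powi (int e * k) / w \<xi> powi (int h * k)"
  by (simp add: gam_def power_int_divide_distrib power_int_mult)

lemma nrm_w': "(\<xi>, r) \<in> D' \<Longrightarrow> nrm (w' \<xi>) = q"
proof -
  assume D': "(\<xi>, r) \<in> D'"
  note D = D'_D[OF D']
  show ?thesis
  proof (cases "z = 0")
    case True
    show ?thesis unfolding z0(7,8)[OF True] by (rule D_w[OF D])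
  next
    case False
    have "nrm (ev \<phi> \<xi>) = G" using D'_gam_1[OF D' False] nrm_gam_eq_1[OF D] by simp
    then have "nrm (Ph \<xi>) = q powi int h" using nrm_Ph[OF D] G_pos by simp
    then have "nrm (w' \<xi>) = q powi (int h * lb) * q powi (int e * (- lb'))"
      by (simp add: w'_def nrm_mult nrm_powi D_w[OF D] p_powi power_int_mult)
    also have "\<dots> = q powi (int h * lb + int e * (- lb'))"
      by (rule power_int_add[symmetric]) (use q_pos in simp)
    also have "int h * lb + int e * (- lb') = 1" using bezout by (simp add: algebra_simps)
    finally show ?thesis by simp
  qed
qed

lemma w'_nz: "(\<xi>, r) \<in> D' \<Longrightarrow> w' \<xi> \<noteq> 0"
  using nrm_w'[of \<xi> r] q_pos by force

lemma lead_gam_powi: "(\<xi>, r) \<in> D' \<Longrightarrow> z \<noteq> 0 \<Longrightarrow> x = w' \<xi> powi n * gam \<xi> powi k \<Longrightarrow> lead r (w' \<xi>) x n (z powi k)"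
  using w'_nz[of \<xi> r] D'_gam_1[of \<xi> r] place_powi[OF D_place[OF D'_D], of \<xi> r "gam \<xi>" k] D'_gam[of \<xi> r]
  by (simp add: lead_def nrm_mult nrm_powi)

text \<open>The exponent matrix of \<open>w'\<close> and \<open>gam\<close> as monomials in
  \<open>Ph\<close> and \<open>w\<close> has determinant \<open>-1\<close> by the Bezout relation,
  so conversely \<open>Ph\<close> and \<open>w\<close> are monomials in \<open>w'\<close> and
  \<open>gam\<close>.\<close>

lemma lead_Ph_w:
  assumes D': "(\<xi>, r) \<in> D'" and z: "z \<noteq> 0"
  shows "lead r (w' \<xi>) (Ph \<xi>) (int h) (z powi (- lb'))" "lead r (w' \<xi>) (w \<xi>) (int e) (z powi (- lb))"
proof -
  note Ph = Ph_nz[OF D' z] and w = D_w_nz[OF D'_D[OF D']]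
  have w': "w' \<xi> powi n = Ph \<xi> powi (lb * n) * w \<xi> powi (- lb' * n)" for n
    unfolding w'_def power_int_mult_distrib power_int_mult ..
  show "lead r (w' \<xi>) (Ph \<xi>) (int h) (z powi (- lb'))"
  proof (rule lead_gam_powi[OF D' z])
    have "w' \<xi> powi int h * gam \<xi> powi (- lb') =
      Ph \<xi> powi (lb * int h + int e * (- lb')) * w \<xi> powi (- lb' * int h - int h * (- lb'))"
      unfolding w' gam_powi power_int_add[OF disjI1[OF Ph]] power_int_diff[OF disjI1[OF w]]
      by (simp only: times_divide_eq_right times_divide_eq_left mult_ac)
    also have "lb * int h + int e * (- lb') = 1" using bezout by (simp add: algebra_simps)
    finally show "Ph \<xi> = w' \<xi> powi int h * gam \<xi> powi (- lb')" by simp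
  qed
  show "lead r (w' \<xi>) (w \<xi>) (int e) (z powi (- lb))"
  proof (rule lead_gam_powi[OF D' z])
    have "w' \<xi> powi int e * gam \<xi> powi (- lb) =
      Ph \<xi> powi (lb * int e + int e * (- lb)) * w \<xi> powi (- lb' * int e - int h * (- lb))"
      unfolding w' gam_powi power_int_add[OF disjI1[OF Ph]] power_int_diff[OF disjI1[OF w]]
      by (simp only: times_divide_eq_right times_divide_eq_left mult_ac)
    also have "- lb' * int e - int h * (- lb) = 1" using bezout by (simp add: algebra_simps)
    finally show "w \<xi> = w' \<xi> powi int e * gam \<xi> powi (- lb)" by simp
  qed
qed

text \<open>The source of the exponent of \<open>z\<close> in \<open>rho'\<close> and, for types, of
  the exponent \<open>tt\<close>.\<close>

lemma lead_Ph_w_mult: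
  assumes D': "(\<xi>, r) \<in> D'" and z: "z \<noteq> 0"
  shows "lead r (w' \<xi>) (Ph \<xi> ^ b * w \<xi> powi u) (int e * u + int b * int h)
     (z powi ((int b - lb * (int e * u + int b * int h)) div int e))"
proof -
  note r = D_place[OF D'_D[OF D']] and w' = w'_nz[OF D']
  have lead: "lead r (w' \<xi>) (Ph \<xi> ^ b * w \<xi> powi u) (int b * int h + u * int e) ((z powi (- lb')) ^ b * (z powi (- lb)) powi u)"
    by (rule lead_mult[OF r w' lead_power[OF r w' lead_Ph_w(1)[OF D' z]] lead_powi[OF r w' lead_Ph_w(2)[OF D' z]]])
  have pw: "(z powi (- lb')) ^ b * (z powi (- lb)) powi u = z powi (- lb' * int b + - lb * u)"
    unfolding power_int_add[OF disjI1[OF z]] power_int_mult power_int_of_nat ..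
  have ex: "(int b - lb * (int e * u + int b * int h)) div int e = - lb' * int b + - lb * u"
  proof -
    have "int b - lb * (int e * u + int b * int h) = int e * (- lb * u) + int b * (1 - lb * int h)"
      by (simp add: algebra_simps)
    also have "1 - lb * int h = - lb' * int e" using bezout by simp
    finally have "int b - lb * (int e * u + int b * int h) = int e * (- lb' * int b + - lb * u)"
      by (simp add: algebra_simps)
    then show ?thesis using e_pos by simp
  qed
  have n: "int b * int h + u * int e = int e * u + int b * int h" by simp
  show ?thesis using lead unfolding pw ex n .
qed

lemma lead_poly:
  assumes D': "(\<xi>, r) \<in> D'" and z: "z \<noteq> 0" and g: "g \<noteq> 0" "based b g" "poly (res b g) z \<noteq> 0"
  shows "lead r (w' \<xi>) (ev g \<xi>) (nn' g) (z powi ((int b - lb * nn' g) div int e) * poly (res b g) z)"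
proof -
  note D = D'_D[OF D'] and gam1 = D'_gam_1[OF D' z] and w' = w'_nz[OF D']
  note r = D_place[OF D]
  have gam: "nrm (gam \<xi>) \<le> 1" "b = 0 \<or> nrm (gam \<xi>) = 1" using gam1 by auto
  obtain u0 where u0: "nn' g = int e * u0 + int b * int h" using based_base[OF g(1,2)] by blast
  note E = eval_poly[OF D gam g(1,2) u0]
  let ?c = "Ph \<xi> ^ b * w \<xi> powi u0"
  have c: "?c \<noteq> 0" using E(1) W'_pos[OF g(1)] by force
  have "r (ev g \<xi> / ?c) \<noteq> 0" using E(3) D'_gam[OF D'] g(3) by simp
  moreover have "nrm (ev g \<xi> / ?c) \<le> 1" using E(2) W'_pos[OF g(1)] by (simp only: nrm_divide E(1)) simp
  ultimately have "nrm (ev g \<xi> / ?c) = 1" using placeD(4)[OF r, of "ev g \<xi> / ?c"] by linarith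
  then have "lead r (w' \<xi>) (ev g \<xi> / ?c) 0 (poly (res b g) z)"
    using E(3) D'_gam[OF D'] by (simp add: lead_def)
  from lead_mult[OF r w' lead_Ph_w_mult[OF D' z] this, of b u0]
  have "lead r (w' \<xi>) (?c * (ev g \<xi> / ?c)) (nn' g) (z powi ((int b - lb * nn' g) div int e) * poly (res b g) z)"
    by (simp only: u0 add_0_right)
  moreover have "?c * (ev g \<xi> / ?c) = ev g \<xi>" by (metis c nonzero_mult_div_cancel_left times_divide_eq_right)
  ultimately show ?thesis by (simp only:)
qed

text \<open>Lowering the base point by \<open>e * l\<close> multiplies the residual polynomial at
  \<open>z\<close> by \<open>z ^ l\<close> and lowers the exponent of the factor in front by
  \<open>l\<close>, so the choice does not matter.\<close>

lemma rho'_based: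
  assumes z: "z \<noteq> 0" and g: "g \<noteq> 0" "based b g"
  shows "rho' g = z powi ((int b - lb * nn' g) div int e) * poly (res b g) z"
proof -
  let ?b = "Min (S g)"
  have "?b \<in> S g" using S_nonempty[OF g(1)] by simp
  then obtain l where l: "?b = b + e * l" using g unfolding based_def by (metis dvdE le_add_diff_inverse)
  have "int ?b - lb * nn' g = (int b - lb * nn' g) + int e * int l" unfolding l by simp
  then have "(int ?b - lb * nn' g) div int e = (int b - lb * nn' g) div int e + int l"
    using e_pos by (metis div_mult_self2 of_nat_0_eq_iff less_irrefl add.commute)
  moreover have "poly (res b g) z = z ^ l * poly (res ?b g) z"
    using e_pos unfolding res_shift[OF g] by (simp add: l poly_monom)
  ultimately show ?thesis using z by (simp add: rho'_def power_int_add)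
qed

lemma poly_res_nz:
  assumes "g \<noteq> 0" "degree g < m'" "based b g"
  shows "poly (res b g) z \<noteq> 0"
  using irreducible_over_small_root[OF A(1) psi(1,3) res_polys_over] degree_res_less[OF assms] res_nz[OF assms(1,3)]
  by (simp add: f_def)

lemma S_z0: "z = 0 \<Longrightarrow> g \<noteq> 0 \<Longrightarrow> degree g < m' \<Longrightarrow> S g = {0}"
proof -
  assume z: "z = 0" and g: "g \<noteq> 0" "degree g < m'"
  have "s = 0" if "s \<in> S g" for s
    using degree_ec_add_le[OF S_supp[OF that]] g(2) z0[OF z] by (cases s) auto
  then show ?thesis using S_nonempty[OF g(1)] by blast
qed

text \<open>For degrees below \<open>m'\<close> the residual polynomial has degree below
  \<open>f\<close> and cannot vanish at \<open>z\<close>, so the leading term is the same at all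
  points of \<open>D'\<close>.\<close>

lemma lead_poly_small:
  assumes D': "(\<xi>, r) \<in> D'" and g: "g \<noteq> 0" "degree g < m'"
  shows "lead r (w' \<xi>) (ev g \<xi>) (nn' g) (rho' g)"
proof (cases "z = 0")
  case False
  then show ?thesis unfolding rho'_def
    using lead_poly[OF D' False g(1) based_Min poly_res_nz[OF g based_Min]] g by simp
next
  case True
  note D = D'_D[OF D'] and z = z0[OF True]
  have S: "S g = {0}" by (rule S_z0[OF True g])
  have b: "based 0 g" by (simp add: based_def S)
  have "nn' g = int e * nn' g + int 0 * int h" by (simp add: z)
  note E = eval_poly[OF D D'_gam_le[OF D'] _ g(1) b this, simplified]
  have "nrm (ev g \<xi>) = W' g"
    using eval_poly_eq[OF D D'_gam_le[OF D'] _ g(1) b] poly_res_nz[OF g b] D'_gam[OF D'] by simp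
  then have "nrm (ev g \<xi>) = nrm (w \<xi>) powi nn' g" using g(1) D_w[OF D] z(7) by (simp add: W'_def)
  moreover have "z powi ((int (Min {0}) - lb * nn' g) div int e) = 1" by (simp add: z(3))
  ultimately show ?thesis using E(3) D'_gam[OF D']
    unfolding lead_def rho'_def S z(8) by simp
qed

lemma adjoin_powi: "x \<in> adjoin_root A z \<Longrightarrow> x powi n \<in> adjoin_root A z"
  by (rule subfld_powi[OF subfld_adjoin_root[OF A psi(1,3)]])

lemma rho'_in: 
  assumes g: "g \<noteq> 0" "degree g < m'"
  shows "rho' g \<in> adjoin_root A z \<and> rho' g \<noteq> 0"
proof
  note A' = subfld_adjoin_root[OF A psi(1,3)]
  have "poly (res (Min (S g)) g) z \<in> adjoin_root A z" using res_polys_over by (auto simp: adjoin_root_def)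
  then show "rho' g \<in> adjoin_root A z" unfolding rho'_def
    using subfldD(4)[OF A'] adjoin_powi[OF adjoin_root_gen[OF A(1)]] by blast
  show "rho' g \<noteq> 0"
    using poly_res_nz[OF g based_Min[OF g(1)]] S_z0[OF _ g] z0(3) by (auto simp: rho'_def)
qed

text \<open>Modulo \<open>e\<close> the wanted value \<open>n\<close> fixes the number
  \<open>b < e\<close> of factors \<open>Ph\<close>, congruent to \<open>lb * n\<close>. The wanted
  residue is then, up to a power of \<open>z\<close>, a polynomial of degree below \<open>f\<close>
  in \<open>z\<close>. Both bounds together keep the degree of the lift below
  \<open>m'\<close>.\<close>

lemma lift':
  assumes \<rho>: "\<rho> \<in> adjoin_root A z" "\<rho> \<noteq> 0"
  shows "\<exists>a. a \<noteq> 0 \<and> degree a < m' \<and> nn' a = n \<and> rho' a = \<rho>"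
proof -
  note A' = subfld_adjoin_root[OF A psi(1,3)]
  define b where "b = nat ((lb * n) mod int e)"
  have b: "int b = (lb * n) mod int e" "b < e"
  proof -
    have "0 \<le> (lb * n) mod int e" "(lb * n) mod int e < int e" using e_pos by simp_all
    then show "int b = (lb * n) mod int e" "b < e" by (simp_all add: b_def nat_less_iff)
  qed
  have "int e dvd n - int b * int h"
  proof -
    have "int e dvd lb * n - int b" using b(1) by (simp add: minus_mod_eq_mult_div)
    then have "int e dvd (lb * n - int b) * int h" by simp
    moreover have "n - int b * int h = (lb * n - int b) * int h - int e * (lb' * n)"
    proof -
      have "n = n * (lb * int h - lb' * int e)" using bezout by simp
      then show ?thesis by (simp add: algebra_simps)
    qed
    ultimately show ?thesis by simp
  qed
  then obtain u0 where u0: "n = int e * u0 + int b * int h" by (metis dvdE diff_add_cancel)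
  define t where "t = (int b - lb * n) div int e"
  have zt: "z powi t \<noteq> 0"
  proof (cases "z = 0")
    case True
    then have "t = 0" using b(2) by (simp add: t_def z0)
    then show ?thesis by simp
  qed simp
  have "\<rho> / z powi t \<in> adjoin_root A z"
    using subfld_divide[OF A' \<rho>(1) adjoin_powi[OF adjoin_root_gen[OF A(1)]]] by blast
  from adjoin_root_small[OF A(1) psi(1,3) this] obtain P where
    P: "P \<in> polys_over A" "degree P < degree \<psi>" "\<rho> / z powi t = poly P z" by blast
  have P0: "P \<noteq> 0" using P(3) \<rho>(2) zt by auto
  from lift_res[OF P(1) P0, of b u0] obtain H where H: "H \<noteq> 0" "based b H" "nn' H = n" "res b H = P"
    "degree H < m * (b + e * degree P + 1)" using u0 by blast
  have "b + e * degree P + 1 \<le> e * f"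
  proof -
    have "e * (degree P + 1) \<le> e * f" using P(2) by (intro mult_le_mono2) (simp add: f_def)
    then show ?thesis using b(2) by simp
  qed
  then have "m * (b + e * degree P + 1) \<le> m * (e * f)" by (rule mult_le_mono2)
  then have dH: "degree H < m'" using H(5) by (simp add: m'_def mult.commute)
  have "rho' H = z powi t * poly P z"
  proof (cases "z = 0")
    case False
    then show ?thesis using rho'_based[OF False H(1,2)] by (simp add: t_def H)
  next
    case True
    then have "b = 0" using b(2) by (simp add: z0)
    then have "t = 0" by (simp add: t_def z0(3)[OF True])
    moreover have "(int (Min {0}) - lb * nn' H) div int e = 0" by (simp add: z0(3)[OF True])
    ultimately show ?thesis unfolding rho'_def S_z0[OF True H(1) dH] using H(4) \<open>b = 0\<close> by simp
  qed
  also have "\<dots> = \<rho>" using P(3) zt by (simp add: field_simps)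
  finally show ?thesis using H dH by blast
qed

lemma next_stage: "stage K m' nn' rho' D' w' q (adjoin_root A z)"
proof (unfold_locales)
  show "0 < m'" by (rule m'_pos)
  show "0 < q" "q < 1" by (rule q_pos, rule q_less_1)
  show "subfld (adjoin_root A z)" by (rule subfld_adjoin_root[OF A psi(1,3)])
  show "finite (adjoin_root A z)" by (rule finite_adjoin_root[OF A psi(1,3)])
  show "place r" if "(\<xi>, r) \<in> D'" for \<xi> r using D_place[OF D'_D[OF that]] .
  show "nrm (w' \<xi>) = q" if "(\<xi>, r) \<in> D'" for \<xi> r by (rule nrm_w'[OF that])
  \<comment> \<open>The exponent fixes all of the larger field, in particular \<open>z\<close>, so
    the twisted place gives \<open>gam\<close> the same residue.\<close>
  show "(\<xi>, \<lambda>\<alpha>. r \<alpha> ^ N) \<in> D'" if "(\<xi>, r) \<in> D'" "additive_power TYPE('f) N"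
    "\<And>a. a \<in> adjoin_root A z \<Longrightarrow> a ^ N = a" for \<xi> r N
    using that D_twist[of \<xi> r N] adjoin_root_incl[OF A(1), of z] adjoin_root_gen[OF A(1), of z]
    by (auto simp: D'_def)
qed (use lead_poly_small rho'_in lift' in auto)

end

section \<open>Key polynomials and the points outside the next stage\<close>

context level
begin

text \<open>Key polynomials are the representatives of the type formed by the levels up to the present one.\<close>

definition key :: "'k poly \<Rightarrow> bool" where
  "key \<Phi> \<longleftrightarrow> lead_coeff \<Phi> = 1 \<and> degree \<Phi> = m' \<and> nn' \<Phi> = int e * (int f * (int e * V + int h)) \<and>
     (\<exists>c. c \<noteq> 0 \<and> res 0 \<Phi> = smult c \<psi>)"

lemma key_nz: "key \<Phi> \<Longrightarrow> \<Phi> \<noteq> 0"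
  by (auto simp: key_def)

lemma key_top:
  assumes "key \<Phi>"
  shows "ec \<Phi> (e * f) = 1" "e * f \<in> S \<Phi>"
proof -
  show *: "ec \<Phi> (e * f) = 1"
    using assms phi_monic phi_degree phi_degree_pos by (intro expansion_coeff_top) (auto simp: key_def m'_def)
  then have "N \<Phi> (e * f) = nn' \<Phi>" using assms by (simp add: N_def nn_1 key_def algebra_simps)
  with * show "e * f \<in> S \<Phi>" by (simp add: S_def in_supp)
qed

text \<open>The abscissa \<open>e * f\<close> lies on the component, and all others are congruent to
  it modulo \<open>e\<close>.\<close>

lemma key_based: "key \<Phi> \<Longrightarrow> based 0 \<Phi>"
proof -
  assume "key \<Phi>"
  then have "int e dvd int s - int (e * f)" if "s \<in> S \<Phi>" for s using S_cong[OF that] key_top by blast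
  then have "e dvd s" if "s \<in> S \<Phi>" for s
    using that by (metis diff_add_cancel dvd_add dvd_triv_left int_dvd_int_iff of_nat_mult)
  then show ?thesis by (simp add: based_def)
qed

lemma key_W':
  assumes "key \<Phi>"
  shows "W' \<Phi> = G ^ (e * f)"
proof -
  have "nn' \<Phi> = (int e * V + int h) * int (e * f)" using assms by (simp add: key_def)
  then have "W' \<Phi> = q powi ((int e * V + int h) * int (e * f))" using key_nz[OF assms] by (simp only: W'_def if_False)
  then show ?thesis by (simp only: power_int_mult power_int_of_nat G_def)
qed

lemma key_supp_le:
  assumes "key \<Phi>" "s \<in> supp \<Phi>"
  shows "s \<le> e * f"
proof -
  have d: "degree \<Phi> = e * f * m" using assms(1) by (simp add: key_def m'_def)
  have "s * m \<le> e * f * m" using degree_ec_add_le[OF assms(2)] unfolding d by (rule add_leD2)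
  then show ?thesis using m_pos by simp
qed

text \<open>Outside \<open>D'\<close> either \<open>\<phi>\<close> is too large, and then the top power of \<open>\<phi>\<close> dominates the expansion
  of a key polynomial, or the residue of \<open>gam\<close> is not a root of \<open>\<psi>\<close>.\<close>

lemma key_outside:
  assumes key: "key \<Phi>" and \<xi>: "\<xi> \<notin> fst ` D'"
  shows "\<exists>T\<ge>1. (\<forall>g. nrm (ev g \<xi>) \<le> W' g * T ^ degree g) \<and> W' \<Phi> * T ^ m' \<le> nrm (ev \<Phi> \<xi>)"
proof (cases "\<exists>r. (\<xi>, r) \<in> D \<and> nrm (ev \<phi> \<xi>) \<le> G")
  case True
  then obtain r where D: "(\<xi>, r) \<in> D" and le: "nrm (ev \<phi> \<xi>) \<le> G" by blast
  have gam: "nrm (gam \<xi>) \<le> 1" using nrm_gam_le_1[OF D] le by simp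
  have "poly \<psi> (r (gam \<xi>)) \<noteq> 0"
  proof
    assume "poly \<psi> (r (gam \<xi>)) = 0"
    \<comment> \<open>Any root of \<open>\<psi>\<close> is carried to \<open>z\<close> by a
      Frobenius power; twisting the place by that power would put the point into
      \<open>D'\<close>.\<close>
    from frobenius_conjugate[OF A psi(1) this psi(3)] obtain k where k: "r (gam \<xi>) ^ (card A ^ k) = z" by blast
    have fixA: "a ^ (card A ^ k) = a" if "a \<in> A" for a
      by (induction k) (auto simp: power_mult finite_subfld_power_card[OF A that] mult.commute[of "card A"])
    have "card A > 0" using A subfldD(1)[OF A(1)] by (auto simp: card_gt_0_iff)
    moreover have "(x + y) ^ (card A ^ k) = x ^ (card A ^ k) + y ^ (card A ^ k)" for x y :: 'f
      by (induction k) (auto simp: power_mult finite_subfld_power_add[OF A] mult.commute[of "card A"])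
    ultimately have "additive_power TYPE('f) (card A ^ k)" by (simp add: additive_power_def)
    from D_twist[OF D this fixA] have "(\<xi>, \<lambda>\<alpha>. r \<alpha> ^ (card A ^ k)) \<in> D" by blast
    then have "(\<xi>, \<lambda>\<alpha>. r \<alpha> ^ (card A ^ k)) \<in> D'" using gam k by (simp add: D'_def)
    then show False using \<xi> by force
  qed
  then have "poly (res 0 \<Phi>) (r (gam \<xi>)) \<noteq> 0" using key by (auto simp: key_def)
  then have "nrm (ev \<Phi> \<xi>) = W' \<Phi>" using eval_poly_eq[OF D gam _ key_nz[OF key] key_based[OF key]] by simp
  moreover have "nrm (ev g \<xi>) \<le> W' g * 1 ^ degree g" for g
    by (rule eval_bound[of 1]) (use D_nrm[OF D] le in auto)
  ultimately show ?thesis by (intro exI[of _ 1]) auto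
next
  case False
  have "\<exists>T\<ge>1. (\<forall>a. degree a < m \<longrightarrow> nrm (ev a \<xi>) \<le> W a * T ^ degree a) \<and> G * T ^ m < nrm (ev \<phi> \<xi>)"
  proof (cases "\<xi> \<in> fst ` D")
    case True
    then obtain r where "(\<xi>, r) \<in> D" by force
    then show ?thesis using False D_nrm by (intro exI[of _ 1]) auto
  next
    case False
    from outside[OF this] obtain T where T: "T \<ge> 1" "\<forall>a. degree a < m \<longrightarrow> nrm (ev a \<xi>) \<le> W a * T ^ degree a"
      "B * T ^ m \<le> nrm (ev \<phi> \<xi>)" by blast
    have "0 < T ^ m" using T(1) by simp
    then have "G * T ^ m < B * T ^ m" using G_less_B by (rule mult_strict_right_mono[rotated])
    from less_le_trans[OF this T(3)] show ?thesis using T(1,2) by blast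
  qed
  then obtain T where T: "T \<ge> 1" "\<And>a. degree a < m \<Longrightarrow> nrm (ev a \<xi>) \<le> W a * T ^ degree a"
    "G * T ^ m < nrm (ev \<phi> \<xi>)" by blast
  \<comment> \<open>Chosen so that the norm of \<open>\<phi>\<close> is \<open>G * T' ^ m\<close>.
    As \<open>T < T'\<close>, the bounds for small polynomials remain valid with
    \<open>T'\<close>.\<close>
  define T' where "T' = root m (nrm (ev \<phi> \<xi>) / G)"
  have T'm: "G * T' ^ m = nrm (ev \<phi> \<xi>)"
    using m_pos G_pos real_root_pow_pos2[of m "nrm (ev \<phi> \<xi>) / G"] by (simp add: T'_def)
  have T'0: "T' \<ge> 0" using m_pos G_pos by (simp add: T'_def)
  have "T < T'"
  proof (rule ccontr)
    assume "\<not> T < T'"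
    then have "T' ^ m \<le> T ^ m" using T'0 by (intro power_mono) auto
    then have "G * T' ^ m \<le> G * T ^ m" using G_pos by simp
    then show False using T(3) T'm by simp
  qed
  then have T': "1 < T'" using T by simp
  have bound: "nrm (ev g \<xi>) \<le> W' g * T' ^ degree g" for g
    by (rule eval_bound[of T]) (use T T'm \<open>T < T'\<close> in auto)
  define t where "t s = ev (ec \<Phi> s) \<xi> * ev \<phi> \<xi> ^ s" for s
  have top: "nrm (t (e * f)) = W' \<Phi> * T' ^ m'"
    by (simp add: t_def key_top[OF key] key_W'[OF key] nrm_power T'm[symmetric] power_mult_distrib
        power_mult[symmetric] m'_def mult_ac)
  have "nrm (t s) < nrm (t (e * f))" if s: "s \<in> supp \<Phi>" "s \<noteq> e * f" for s
  proof -
    have "nrm (t s) \<le> (W (ec \<Phi> s) * T ^ degree (ec \<Phi> s)) * (G * T' ^ m) ^ s"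
      unfolding t_def nrm_mult nrm_power T'm using T(2)[OF degree_ec]
      by (intro mult_right_mono) auto
    also have "\<dots> = (W (ec \<Phi> s) * G ^ s) * (T ^ degree (ec \<Phi> s) * T' ^ (s * m))"
      by (simp add: power_mult_distrib power_mult[symmetric] mult_ac)
    also have "\<dots> \<le> W' \<Phi> * (T' ^ degree (ec \<Phi> s) * T' ^ (s * m))"
      using term_le[OF s(1)] T(1) \<open>T < T'\<close> G_pos by (intro mult_mono power_mono) auto
    also have "\<dots> < W' \<Phi> * T' ^ m'" unfolding power_add[symmetric]
    proof (intro mult_strict_left_mono power_strict_increasing)
      have "Suc s \<le> e * f" using key_supp_le[OF key s(1)] s(2) by simp
      then have "Suc s * m \<le> m'" unfolding m'_def by (rule mult_le_mono1)
      then show "degree (ec \<Phi> s) + s * m < m'" using degree_ec[of \<Phi> s] by simp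
    qed (use T' W'_pos[OF key_nz[OF key]] in auto)
    finally show ?thesis unfolding top .
  qed
  then have "nrm (ev \<Phi> \<xi>) = nrm (t (e * f))"
    unfolding ev_expansion[OF phi_degree_pos, of \<Phi>] t_def[symmetric]
    using S_supp[OF key_top(2)[OF key]] by (intro nrm_sum_dominant) auto
  then show ?thesis using bound T' top by (intro exI[of _ T']) auto
qed

text \<open>A lift of a multiple of \<open>\<psi>\<close> is corrected to a monic polynomial: its
  top coefficient is replaced by 1, which has the same leading term.\<close>

lemma key_exists: "\<exists>\<Phi>. key \<Phi> \<and> S \<Phi> = supp \<Phi>"
proof -
  \<comment> \<open>Since \<open>cc\<close> divides by \<open>\<kappa> ^ (e * f)\<close>, this
    choice gives the top coefficient of the lift the residue 1.\<close>
  define c where "c = inverse (\<kappa> ^ (e * f))"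
  have c: "c \<in> A" "c \<noteq> 0" using kappa A(1) by (auto simp: c_def subfldD subfld_power)
  define P where "P = smult c \<psi>"
  have P: "P \<in> polys_over A" "P \<noteq> 0" "degree P = f" "coeff P f = c"
    using c psi A(1) by (auto simp: P_def f_def irreducible_over_def intro: polys_over_smult)
  obtain H where H: "H \<noteq> 0" "based 0 H" "nn' H = int e * (int f * (int e * V + int h))" "res 0 H = P" "S H = supp H"
    using lift_res[OF P(1,2), of 0 "int f * (int e * V + int h)"] by auto
  let ?t = "e * f"
  have coeffP: "coeff P l = (if e * l \<in> supp H then cc H (e * l) else 0)" for l
    using coeff_res[OF H(2), of l] by (simp add: H)
  have t: "?t \<in> supp H" using coeffP[of f] P c by (auto split: if_splits)
  have supp_le: "s \<le> ?t" if "s \<in> supp H" for s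
  proof -
    have "e dvd s" using that H(2) by (simp add: based_def H(5))
    then obtain l where l: "s = e * l" by (elim dvdE)
    have "coeff P l \<noteq> 0" using coeffP[of l] that cc_nz[OF that] by (simp add: l)
    then have "l \<le> f" using le_degree P(3) by metis
    then show ?thesis by (simp add: l)
  qed
  have "N H ?t = nn' H" using t H(5) by (auto simp: S_def)
  then have "int e * nn (ec H ?t) = 0" by (simp add: N_def H algebra_simps)
  then have nt: "nn (ec H ?t) = 0" using e_pos by simp
  define b where "b s = (if s = ?t then 1 else ec H s)" for s
  define \<Phi> where "\<Phi> = (\<Sum>s\<in>supp H. b s * \<phi> ^ s)"
  have db: "degree (b s) < degree \<phi>" for s using degree_ec[of H s] m_pos by (simp add: b_def phi_degree)
  have ec\<Phi>: "ec \<Phi> s = b s" for s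
  proof -
    have "ec \<Phi> s = (if s \<in> supp H then b s else 0)"
      unfolding \<Phi>_def by (rule expansion_coeff_unique[OF phi_degree_pos finite_supp db])
    moreover have "b s = 0" if "s \<notin> supp H" using that t by (auto simp: b_def in_supp)
    ultimately show ?thesis by auto
  qed
  have supp\<Phi>: "supp \<Phi> = supp H" using t by (auto simp: in_supp ec\<Phi> b_def split: if_splits)
  have N\<Phi>: "N \<Phi> s = N H s" if "s \<in> supp H" for s
    by (simp add: N_def ec\<Phi> b_def nt nn_1)
  have nn\<Phi>: "nn' \<Phi> = nn' H" unfolding nn'_def supp\<Phi> using N\<Phi> by (simp cong: image_cong)
  have S\<Phi>: "S \<Phi> = S H" unfolding S_def supp\<Phi> nn\<Phi> using N\<Phi> by auto
  have "cc \<Phi> s = cc H s" if "s \<in> supp H" for s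
  proof (cases "s = ?t")
    case True
    have "cc H ?t = c" using coeffP[of f] P t by simp
    then show ?thesis by (simp add: True cc_def ec\<Phi> b_def nn_1 c_def divide_inverse)
  qed (simp add: cc_def ec\<Phi> b_def)
  then have res\<Phi>: "res 0 \<Phi> = P" unfolding H(4)[symmetric] res_def S\<Phi> H(5) by (simp cong: sum.cong)
  define \<Psi> where "\<Psi> = (\<Sum>s\<in>supp H - {?t}. b s * \<phi> ^ s)"
  have \<Phi>_eq: "\<Phi> = \<phi> ^ ?t + \<Psi>" unfolding \<Phi>_def \<Psi>_def using t by (simp add: sum.remove b_def)
  have dt: "degree (\<phi> ^ ?t) = m'" using phi_degree_pos phi_degree by (subst degree_power_eq) (auto simp: m'_def)
  have d\<Psi>: "degree \<Psi> < m'"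
  proof -
    have "degree \<Psi> \<le> m' - 1" unfolding \<Psi>_def
    proof (rule degree_sum_le)
      fix s assume s: "s \<in> supp H - {?t}"
      then have "Suc s \<le> ?t" using supp_le[of s] by auto
      then have "Suc s * m \<le> m'" unfolding m'_def by (rule mult_le_mono1)
      moreover have "degree (b s * \<phi> ^ s) \<le> degree (b s) + m * s"
        using degree_mult_le[of "b s" "\<phi> ^ s"] degree_power_le[of \<phi> s] phi_degree by simp
      ultimately show "degree (b s * \<phi> ^ s) \<le> m' - 1" using db[of s] phi_degree by (simp add: mult.commute)
    qed simp
    then show ?thesis using m'_pos by simp
  qed
  have "degree \<Phi> = m'" unfolding \<Phi>_eq using d\<Psi> dt by (subst degree_add_eq_left) auto
  moreover have "lead_coeff \<Phi> = 1"
    unfolding \<open>degree \<Phi> = m'\<close> unfolding \<Phi>_eq using d\<Psi> dt phi_monic lead_coeff_power[of \<phi> ?t] by (simp add: coeff_eq_0)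
  ultimately have "key \<Phi>" unfolding key_def using nn\<Phi> H(3) res\<Phi> c by (auto simp: P_def)
  moreover have "S \<Phi> = supp \<Phi>" by (simp add: S\<Phi> supp\<Phi> H(5))
  ultimately show ?thesis by blast
qed

lemma key_small_in_D': "key \<Phi> \<Longrightarrow> nrm (ev \<Phi> \<xi>) < W' \<Phi> \<Longrightarrow> \<xi> \<in> fst ` D'"
proof (rule ccontr)
  assume *: "key \<Phi>" "nrm (ev \<Phi> \<xi>) < W' \<Phi>" "\<xi> \<notin> fst ` D'"
  from key_outside[OF *(1,3)] obtain T where "T \<ge> 1" "W' \<Phi> * T ^ m' \<le> nrm (ev \<Phi> \<xi>)" by blast
  moreover from this have "W' \<Phi> * 1 \<le> W' \<Phi> * T ^ m'" by (intro mult_left_mono one_le_power) auto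
  ultimately show False using *(2) by simp
qed

end

lemma poly_altdef_le:
  fixes p :: "'a::comm_semiring_1 poly"
  shows "degree p \<le> n \<Longrightarrow> poly p x = (\<Sum>i\<le>n. coeff p i * x ^ i)"
  unfolding poly_altdef by (rule sum.mono_neutral_left) (auto simp: coeff_eq_0)

section \<open>Approximate factorization and the degree of an irreducible polynomial of the
  type\<close>

context level
begin

text \<open>The coefficients are divided by the powers of \<open>w\<close> that belong to the
  supporting line. Points above the line get residue zero, so the residues give back all
  coefficients of the residual polynomial.\<close>

lemma residue_ec:
  assumes D: "(\<xi>, r) \<in> D" and g: "g \<noteq> 0" "based b g" "nn' g = int e * u0 + int b * int h"
  shows "nrm (ev (ec g (b + e * l)) \<xi> / w \<xi> powi (u0 - int l * int h - int (b + e * l) * V)) \<le> 1"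
    and "r (ev (ec g (b + e * l)) \<xi> / w \<xi> powi (u0 - int l * int h - int (b + e * l) * V)) =
      coeff (res b g) l * \<kappa> ^ (b + e * l)"
proof -
  let ?s = "b + e * l"
  let ?u = "u0 - int l * int h - int ?s * V"
  have "nrm (ev (ec g ?s) \<xi> / w \<xi> powi ?u) \<le> 1 \<and>
    r (ev (ec g ?s) \<xi> / w \<xi> powi ?u) = coeff (res b g) l * \<kappa> ^ ?s"
  proof (cases "?s \<in> supp g")
    case False
    then show ?thesis using place_0[OF D_place[OF D]] S_supp by (auto simp: in_supp coeff_res[OF g(2)])
  next
    case True
    then have ec: "ec g ?s \<noteq> 0" by (simp add: in_supp)
    note ld = D_lead[OF D ec degree_ec]
    let ?n = "nn (ec g ?s)"
    have Ns: "N g ?s = int e * (?n + int ?s * V) + int ?s * int h" by (simp add: N_def)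
    have eq: "N g ?s - nn' g = int e * (?n - ?u)" unfolding Ns g(3) by (simp add: algebra_simps)
    have nrm: "nrm (ev (ec g ?s) \<xi> / w \<xi> powi ?u) = p powi (?n - ?u)"
      using ld D_w[OF D] p_pos by (simp add: nrm_divide nrm_powi lead_def power_int_diff)
    then have nrm': "nrm (ev (ec g ?s) \<xi> / w \<xi> powi ?u) = q powi (N g ?s - nn' g)" unfolding eq p_powi .
    show ?thesis
    proof (cases "?s \<in> S g")
      case True
      then have "N g ?s = nn' g" by (simp add: S_def)
      then have "?n = ?u" using eq e_pos by simp
      then have "r (ev (ec g ?s) \<xi> / w \<xi> powi ?u) = rho (ec g ?s)" using ld by (simp add: lead_def)
      moreover have "rho (ec g ?s) = coeff (res b g) l * \<kappa> ^ ?s"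
        using True kappa(2) by (simp add: coeff_res[OF g(2)] cc_def)
      ultimately show ?thesis using nrm' \<open>N g ?s = nn' g\<close> by simp
    next
      case False
      then have "nn' g < N g ?s" using True N_ge[OF True] by (simp add: S_def)
      then have "nrm (ev (ec g ?s) \<xi> / w \<xi> powi ?u) < 1"
        unfolding nrm' using q_powi_less[of "N g ?s - nn' g" 0] by simp
      then show ?thesis using False place_small[OF D_place[OF D]] by (simp add: coeff_res[OF g(2)])
    qed
  qed
  then show "nrm (ev (ec g ?s) \<xi> / w \<xi> powi ?u) \<le> 1"
    "r (ev (ec g ?s) \<xi> / w \<xi> powi ?u) = coeff (res b g) l * \<kappa> ^ ?s" by auto
qed

lemma eval_bound_D: "(\<xi>, r) \<in> D \<Longrightarrow> nrm (ev \<phi> \<xi>) \<le> G \<Longrightarrow> nrm (ev g \<xi>) \<le> W' g"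
  using eval_bound[of 1 1 \<xi> g] D_nrm[of \<xi> r] by simp

text \<open>Terms with abscissas in the class of \<open>b\<close> are collected in a polynomial in
  \<open>\<phi> ^ e\<close>. Products of such polynomials can be compared coefficientwise without
  computing the expansion of a product.\<close>

lemma ev_classes:
  assumes "supp g - J \<subseteq> (\<lambda>l. b + e * l) ` {..M}" and "J = {s \<in> supp g. \<not> (b \<le> s \<and> e dvd s - b)}"
  shows "ev g \<xi> = (\<Sum>s\<in>J. ev (ec g s) \<xi> * ev \<phi> \<xi> ^ s) +
    ev \<phi> \<xi> ^ b * poly (\<Sum>l\<le>M. monom (ev (ec g (b + e * l)) \<xi>) l) (ev \<phi> \<xi> ^ e)"
proof -
  let ?t = "\<lambda>s. ev (ec g s) \<xi> * ev \<phi> \<xi> ^ s"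
  have J: "J \<subseteq> supp g" using assms(2) by auto
  have "ev g \<xi> = sum ?t (supp g)" by (rule ev_expansion[OF phi_degree_pos])
  also have "\<dots> = sum ?t J + sum ?t (supp g - J)"
    using sum.subset_diff[OF J finite_supp, of ?t] by (simp only: add.commute)
  also have "sum ?t (supp g - J) = sum ?t ((\<lambda>l. b + e * l) ` {..M})"
  proof (rule sum.mono_neutral_left)
    show "finite ((\<lambda>l. b + e * l) ` {..M})" by simp
    show "supp g - J \<subseteq> (\<lambda>l. b + e * l) ` {..M}" by (rule assms(1))
    show "\<forall>i\<in>(\<lambda>l. b + e * l) ` {..M} - (supp g - J). ?t i = 0"
    proof
      fix i assume i: "i \<in> (\<lambda>l. b + e * l) ` {..M} - (supp g - J)"
      then have "i \<notin> J" unfolding assms(2) by auto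
      then have "i \<notin> supp g" using i by blast
      then show "?t i = 0" by (simp add: in_supp)
    qed
  qed
  also have "\<dots> = (\<Sum>l\<le>M. ?t (b + e * l))"
    using e_pos by (subst sum.reindex) (auto simp: inj_on_def)
  also have "\<dots> = ev \<phi> \<xi> ^ b * poly (\<Sum>l\<le>M. monom (ev (ec g (b + e * l)) \<xi>) l) (ev \<phi> \<xi> ^ e)"
    by (simp add: poly_sum poly_monom sum_distrib_left power_add power_mult[symmetric] mult_ac)
  finally show ?thesis .
qed

text \<open>Lifting the factorization \<open>res b F = \<psi> P\<close> to polynomials \<open>\<Phi>\<close> and \<open>H\<close>, the difference
  \<open>F - H \<Phi>\<close> is uniformly smaller than \<open>F\<close> on \<open>D'\<close>, since all residues of its coefficients vanish.\<close>

lemma approximate_factorization: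
  assumes F: "F \<noteq> 0" "based b F" and \<Phi>: "key \<Phi>" "S \<Phi> = supp \<Phi>"
    and H: "H \<noteq> 0" "based b H" "S H = supp H"
    and nn: "nn' F = nn' H + nn' \<Phi>" and res: "res b F = res b H * res 0 \<Phi>"
  shows "\<exists>C<W' F. \<forall>\<xi> r. (\<xi>, r) \<in> D' \<longrightarrow> nrm (ev F \<xi> - ev H \<xi> * ev \<Phi> \<xi>) \<le> C"
proof -
  define JF where "JF = {s \<in> supp F. \<not> (b \<le> s \<and> e dvd s - b)}"
  define M where "M = degree F + degree H + degree \<Phi>"
  have cover: "supp g - {s \<in> supp g. \<not> (c \<le> s \<and> e dvd s - c)} \<subseteq> (\<lambda>l. c + e * l) ` {..M}"
    if "degree g \<le> M" for g c
  proof
    fix s assume s: "s \<in> supp g - {s \<in> supp g. \<not> (c \<le> s \<and> e dvd s - c)}"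
    then obtain l where l: "s = c + e * l" by (auto elim!: dvdE) (metis le_add_diff_inverse)
    have "s \<le> degree g" using s expansion_support(2)[OF phi_degree_pos] by (auto simp: in_supp)
    moreover have "l \<le> e * l" using e_pos by simp
    ultimately have "l \<le> M" using that l by linarith
    then show "s \<in> (\<lambda>l. c + e * l) ` {..M}" using l by blast
  qed
  define aP where "aP \<xi> = (\<Sum>l\<le>M. monom (ev (ec H (b + e * l)) \<xi>) l)" for \<xi>
  define bP where "bP \<xi> = (\<Sum>l\<le>M. monom (ev (ec \<Phi> (0 + e * l)) \<xi>) l)" for \<xi>
  define fP where "fP \<xi> = (\<Sum>l\<le>M. monom (ev (ec F (b + e * l)) \<xi>) l)" for \<xi>
  have evF: "ev F \<xi> = (\<Sum>s\<in>JF. ev (ec F s) \<xi> * ev \<phi> \<xi> ^ s) + ev \<phi> \<xi> ^ b * poly (fP \<xi>) (ev \<phi> \<xi> ^ e)" for \<xi>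
    unfolding fP_def by (rule ev_classes[OF _ JF_def]) (use cover[of F] in \<open>simp add: JF_def M_def\<close>)
  have JH: "{s \<in> supp H. \<not> (b \<le> s \<and> e dvd s - b)} = {}" using H by (auto simp: based_def)
  have evH: "ev H \<xi> = ev \<phi> \<xi> ^ b * poly (aP \<xi>) (ev \<phi> \<xi> ^ e)" for \<xi>
    using ev_classes[OF cover[of H b] refl, of \<xi>] unfolding aP_def JH by (simp add: M_def)
  have J\<Phi>: "{s \<in> supp \<Phi>. \<not> (0 \<le> s \<and> e dvd s - 0)} = {}" using key_based[OF \<Phi>(1)] \<Phi>(2) by (auto simp: based_def)
  have ev\<Phi>: "ev \<Phi> \<xi> = poly (bP \<xi>) (ev \<phi> \<xi> ^ e)" for \<xi>
    using ev_classes[OF cover[of \<Phi> 0] refl, of \<xi>] unfolding bP_def J\<Phi> by (simp add: M_def)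
  \<comment> \<open>The coefficients of the difference, as polynomials over the base field that do
    not depend on the point. They may have degree \<open>m\<close> or more, so they are measured by
    \<open>W'\<close> rather than by \<open>W\<close>.\<close>
  define \<delta> where "\<delta> L = ec F (b + e * L) - (\<Sum>l\<le>L. ec H (b + e * l) * ec \<Phi> (0 + e * (L - l)))" for L
  have zero: "ec g (c + e * l) = 0" if "M < l" "degree g \<le> M" for g c l
  proof -
    have "l \<le> e * l" using e_pos by simp
    then have "\<not> c + e * l \<le> degree g" using that by linarith
    then show ?thesis using expansion_support(2)[OF phi_degree_pos, of g "c + e * l"] by blast
  qed
  have coeff_sumM: "coeff (\<Sum>l\<le>M. monom (ev (ec g (c + e * l)) \<xi>) l) l = ev (ec g (c + e * l)) \<xi>"
    if "degree g \<le> M" for g c l \<xi>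
    using zero[of l g c] that by (auto simp: coeff_sum)
  have \<delta>_ev: "coeff (fP \<xi> - aP \<xi> * bP \<xi>) L = ev (\<delta> L) \<xi>" for \<xi> L
    unfolding fP_def aP_def bP_def \<delta>_def coeff_diff coeff_mult
    by (subst (1 2 3) coeff_sumM) (auto simp: M_def ev_diff ev_sum ev_mult)
  have deg: "degree (fP \<xi> - aP \<xi> * bP \<xi>) \<le> M + M" for \<xi>
  proof (rule degree_diff_le)
    have d: "degree (\<Sum>l\<le>M. monom (c l) l) \<le> M" for c :: "nat \<Rightarrow> 'k alg_closure"
      by (rule degree_sum_le) (auto intro: order_trans[OF degree_monom_le])
    show "degree (fP \<xi>) \<le> M + M" using d unfolding fP_def by (meson le_add1 order_trans)
    show "degree (aP \<xi> * bP \<xi>) \<le> M + M" unfolding aP_def bP_def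
      by (rule order_trans[OF degree_mult_le]) (intro add_mono d)
  qed
  have diff: "ev F \<xi> - ev H \<xi> * ev \<Phi> \<xi> = (\<Sum>s\<in>JF. ev (ec F s) \<xi> * ev \<phi> \<xi> ^ s) +
      (\<Sum>L\<le>M+M. ev (\<delta> L) \<xi> * ev \<phi> \<xi> ^ (b + e * L))" for \<xi>
  proof -
    have "ev F \<xi> - ev H \<xi> * ev \<Phi> \<xi> = (\<Sum>s\<in>JF. ev (ec F s) \<xi> * ev \<phi> \<xi> ^ s) +
      ev \<phi> \<xi> ^ b * poly (fP \<xi> - aP \<xi> * bP \<xi>) (ev \<phi> \<xi> ^ e)"
      unfolding evF evH ev\<Phi> by (simp add: algebra_simps)
    also have "poly (fP \<xi> - aP \<xi> * bP \<xi>) (ev \<phi> \<xi> ^ e) = (\<Sum>L\<le>M+M. ev (\<delta> L) \<xi> * (ev \<phi> \<xi> ^ e) ^ L)"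
      unfolding poly_altdef_le[OF deg] \<delta>_ev ..
    finally show ?thesis by (simp add: sum_distrib_left power_add power_mult[symmetric] mult_ac)
  qed
  obtain uF where uF: "nn' F = int e * uF + int b * int h" using based_base[OF F] by blast
  obtain u\<Phi> where u\<Phi>: "nn' \<Phi> = int e * u\<Phi> + int 0 * int h"
    using based_base[OF key_nz[OF \<Phi>(1)] key_based[OF \<Phi>(1)]] by blast
  have uH: "nn' H = int e * (uF - u\<Phi>) + int b * int h" using nn uF u\<Phi> by (simp add: algebra_simps)
  have small: "W' (\<delta> L) * G ^ (b + e * L) < W' F" for L
  proof -
    \<comment> \<open>One point at which the norm is at least \<open>W' (\<delta> L)\<close>
      suffices, since the bound to be proved does not depend on the point.\<close>
    obtain \<xi> r where D: "(\<xi>, r) \<in> D" and le: "W' (\<delta> L) \<le> nrm (ev (\<delta> L) \<xi>)" using W'_le_nrm by blast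
    note r = D_place[OF D] and w = D_w_nz[OF D]
    define u where "u = uF - int L * int h - int (b + e * L) * V"
    define x where "x = ev (ec F (b + e * L)) \<xi> / w \<xi> powi u"
    define y where "y l = ev (ec H (b + e * l)) \<xi> / w \<xi> powi (uF - u\<Phi> - int l * int h - int (b + e * l) * V)" for l
    define y' where "y' l = ev (ec \<Phi> (0 + e * l)) \<xi> / w \<xi> powi (u\<Phi> - int l * int h - int (0 + e * l) * V)" for l
    note xr = residue_ec[OF D F uF, of L, folded u_def, folded x_def]
    have yr: "nrm (y l) \<le> 1" "r (y l) = coeff (res b H) l * \<kappa> ^ (b + e * l)" for l
      unfolding y_def using residue_ec[OF D H(1,2) uH] by auto
    have y'r: "nrm (y' l) \<le> 1" "r (y' l) = coeff (res 0 \<Phi>) l * \<kappa> ^ (0 + e * l)" for l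
      unfolding y'_def using residue_ec[OF D key_nz[OF \<Phi>(1)] key_based[OF \<Phi>(1)] u\<Phi>] by auto
    have yy: "nrm (y l * y' l') \<le> 1" for l l'
      using yr(1) y'r(1) by (simp add: nrm_mult mult_le_one)
    have prod: "ev (ec H (b + e * l)) \<xi> * ev (ec \<Phi> (0 + e * (L - l))) \<xi> / w \<xi> powi u = y l * y' (L - l)"
      if "l \<le> L" for l
    proof -
      have u_eq: "u = (uF - u\<Phi> - int l * int h - int (b + e * l) * V) + (u\<Phi> - int (L - l) * int h - int (0 + e * (L - l)) * V)"
        using that by (simp add: u_def of_nat_diff algebra_simps)
      show ?thesis unfolding y_def y'_def u_eq power_int_add[OF disjI1[OF w]] times_divide_times_eq ..
    qed
    have quot: "ev (\<delta> L) \<xi> / w \<xi> powi u = x - (\<Sum>l\<le>L. y l * y' (L - l))"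
      unfolding \<delta>_def ev_diff ev_sum ev_mult diff_divide_distrib sum_divide_distrib x_def
      using prod by simp
    have sum1: "nrm (\<Sum>l\<le>L. y l * y' (L - l)) \<le> 1" using yy by (intro nrm_sum_le) auto
    have "r (\<Sum>l\<le>L. y l * y' (L - l)) = (\<Sum>l\<le>L. r (y l) * r (y' (L - l)))"
      using yy yr(1) y'r(1) by (simp add: place_sum[OF r] placeD(3)[OF r])
    also have "\<dots> = (\<Sum>l\<le>L. coeff (res b H) l * coeff (res 0 \<Phi>) (L - l) * \<kappa> ^ (b + e * L))"
    proof (rule sum.cong[OF refl])
      fix l assume "l \<in> {..L}"
      then have "b + e * L = (b + e * l) + (0 + e * (L - l))" by (simp flip: distrib_left)
      then show "r (y l) * r (y' (L - l)) = coeff (res b H) l * coeff (res 0 \<Phi>) (L - l) * \<kappa> ^ (b + e * L)"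
        unfolding yr y'r by (simp only: power_add mult_ac)
    qed
    also have "\<dots> = r x" unfolding xr(2) res coeff_mult sum_distrib_right ..
    finally have rs: "r (\<Sum>l\<le>L. y l * y' (L - l)) = r x" .
    have "nrm (x - (\<Sum>l\<le>L. y l * y' (L - l))) < 1"
    proof -
      let ?z = "x - (\<Sum>l\<le>L. y l * y' (L - l))"
      have z1: "nrm ?z \<le> 1" using nrm_diff[of x "\<Sum>l\<le>L. y l * y' (L - l)"] xr(1) sum1 by linarith
      have "r x = r (?z + (\<Sum>l\<le>L. y l * y' (L - l)))" by simp
      also have "\<dots> = r ?z + r (\<Sum>l\<le>L. y l * y' (L - l))" using z1 sum1 by (rule placeD(2)[OF r])
      finally have "r ?z = 0" using rs by simp
      then show ?thesis using placeD(4)[OF r z1] by simp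
    qed
    then have "nrm (ev (\<delta> L) \<xi>) < p powi u"
      unfolding quot[symmetric] nrm_divide nrm_powi D_w[OF D] using p_pos by simp
    then have "W' (\<delta> L) * G ^ (b + e * L) < p powi u * G ^ (b + e * L)"
      using le G_pos by (intro mult_strict_right_mono) auto
    also have "\<dots> = q powi (int e * u) * q powi ((int e * V + int h) * int (b + e * L))"
      unfolding p_powi G_def power_int_mult power_int_of_nat ..
    also have "\<dots> = q powi (int e * u + (int e * V + int h) * int (b + e * L))" using q_pos by (simp add: power_int_add)
    also have "int e * u + (int e * V + int h) * int (b + e * L) = nn' F"
      unfolding uF u_def by (simp add: algebra_simps)
    also have "q powi nn' F = W' F" using F(1) by (simp add: W'_def)
    finally show ?thesis .
  qed
  have smallJ: "W (ec F s) * G ^ s < W' F" if "s \<in> JF" for s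
  proof -
    have s: "s \<in> supp F" "s \<notin> S F" using that F(2) by (auto simp: JF_def based_def)
    then have "nn' F < N F s" using N_ge[OF s(1)] by (simp add: S_def)
    then show ?thesis unfolding term_norm[OF s(1)] using F(1) by (simp add: W'_def q_powi_less)
  qed
  \<comment> \<open>The maximum of finitely many numbers below \<open>W' F\<close> provides the
    uniform gap.\<close>
  define C where "C = Max (insert 0 ((\<lambda>s. W (ec F s) * G ^ s) ` JF \<union> (\<lambda>L. W' (\<delta> L) * G ^ (b + e * L)) ` {..M+M}))"
  have finJF: "finite JF" by (simp add: JF_def)
  have "C < W' F" unfolding C_def using finJF small smallJ W'_pos[OF F(1)] by (subst Max_less_iff) auto
  moreover have "nrm (ev F \<xi> - ev H \<xi> * ev \<Phi> \<xi>) \<le> C" if D': "(\<xi>, r) \<in> D'" for \<xi> r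
  proof -
    note D = D'_D[OF D']
    have le: "nrm (ev \<phi> \<xi>) \<le> G" using D'_gam_le[OF D'] nrm_gam_le_1[OF D] by simp
    have C0: "0 \<le> C" unfolding C_def using finJF by (intro Max_ge) auto
    have CJ: "W (ec F s) * G ^ s \<le> C" if "s \<in> JF" for s unfolding C_def using finJF that by (intro Max_ge) auto
    have CL: "W' (\<delta> L) * G ^ (b + e * L) \<le> C" if "L \<le> M + M" for L unfolding C_def using finJF that by (intro Max_ge) auto
    have "nrm (\<Sum>s\<in>JF. ev (ec F s) \<xi> * ev \<phi> \<xi> ^ s) \<le> C"
    proof (rule nrm_sum_le[OF C0])
      fix s assume s: "s \<in> JF"
      have "nrm (ev (ec F s) \<xi> * ev \<phi> \<xi> ^ s) \<le> W (ec F s) * G ^ s"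
        unfolding nrm_mult nrm_power using D_nrm[OF D degree_ec] le by (intro mult_mono power_mono) auto
      then show "nrm (ev (ec F s) \<xi> * ev \<phi> \<xi> ^ s) \<le> C" using CJ[OF s] by linarith
    qed
    moreover have "nrm (\<Sum>L\<le>M+M. ev (\<delta> L) \<xi> * ev \<phi> \<xi> ^ (b + e * L)) \<le> C"
    proof (rule nrm_sum_le[OF C0])
      fix L assume L: "L \<in> {..M+M}"
      have "nrm (ev (\<delta> L) \<xi> * ev \<phi> \<xi> ^ (b + e * L)) \<le> W' (\<delta> L) * G ^ (b + e * L)"
        unfolding nrm_mult nrm_power using eval_bound_D[OF D le] le by (intro mult_mono power_mono) auto
      then show "nrm (ev (\<delta> L) \<xi> * ev \<phi> \<xi> ^ (b + e * L)) \<le> C" using CL[of L] L by simp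
    qed
    ultimately show ?thesis unfolding diff using nrm_add order_trans by (metis (no_types, lifting) max.bounded_iff)
  qed
  ultimately show ?thesis by blast
qed

text \<open>By conjugacy all roots of \<open>F\<close> give the same value to \<open>\<Phi>\<close>.  Comparing the two sides of
  \<open>\<Prod>\<^sub>\<theta> (\<Phi>(\<theta>) - c) = \<plusminus> \<Prod>\<^sub>\<xi> F(\<xi>)\<close>, over the roots \<open>\<theta>\<close> of \<open>F\<close> and the roots \<open>\<xi>\<close> of \<open>\<Phi> - c\<close>, for different
  values of \<open>c\<close> slightly larger than that of a root of \<open>\<Phi>\<close> determines it, and the degree of \<open>F\<close>.\<close>

lemma irreducible_of_type:
  assumes F: "irreducible F" "lead_coeff F = 1" and b: "based b F" "b = 0 \<or> z \<noteq> 0"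
    and res: "\<psi> dvd res b F" "\<not> \<psi> ^ 2 dvd res b F"
  shows "degree F = m'" and "ev F \<theta> = 0 \<Longrightarrow> \<theta> \<in> fst ` D'"
proof -
  have F0: "F \<noteq> 0" using F(2) by auto
  have dF: "degree F > 0" using F(1) by (metis gr0I is_unit_iff_degree irreducible_not_unit F0)
  obtain P where P: "res b F = \<psi> * P" using res(1) by (elim dvdE)
  have psiA: "\<psi> \<in> polys_over A" "\<psi> \<noteq> 0" using psi by (auto simp: irreducible_over_def)
  have P0: "P \<noteq> 0" using res_nz[OF F0 b(1)] P by auto
  have "P = res b F div \<psi>" using P psiA by simp
  then have PA: "P \<in> polys_over A" using polys_over_divide(1)[OF A(1) psiA res_polys_over] by simp
  have "\<not> \<psi> dvd P" using res(2) P by (metis mult_dvd_mono dvd_refl power2_eq_square)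
  then have Pz: "poly P z \<noteq> 0" using irreducible_over_dvd[OF A(1) psi(1,3) PA] by blast
  obtain \<Phi> where \<Phi>: "key \<Phi>" "S \<Phi> = supp \<Phi>" using key_exists by blast
  obtain c where c: "c \<noteq> 0" "res 0 \<Phi> = smult c \<psi>" using \<Phi>(1) by (auto simp: key_def)
  have "c \<in> A"
    using polys_overD[OF res_polys_over, of 0 \<Phi> "degree \<psi>"] psi(2) by (simp add: c(2))
  then have cP: "smult (inverse c) P \<in> polys_over A" "smult (inverse c) P \<noteq> 0"
    using c(1) PA P0 A(1) by (auto intro!: polys_over_smult simp: subfldD)
  obtain uF where uF: "nn' F = int e * uF + int b * int h" using based_base[OF F0 b(1)] by blast
  obtain H where H: "H \<noteq> 0" "based b H" "nn' H = int e * (uF - int f * (int e * V + int h)) + int b * int h"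
    "res b H = smult (inverse c) P" "S H = supp H"
    using lift_res[OF cP, of b "uF - int f * (int e * V + int h)"] by blast
  have nn: "nn' F = nn' H + nn' \<Phi>" using \<Phi>(1) by (simp add: uF H(3) key_def algebra_simps)
  have "res b F = res b H * res 0 \<Phi>" using c(1) by (simp add: P H(4) c(2) mult.commute)
  from approximate_factorization[OF F0 b(1) \<Phi> H(1,2,5) nn this] obtain C where
    C: "C < W' F" "\<And>\<xi> r. (\<xi>, r) \<in> D' \<Longrightarrow> nrm (ev F \<xi> - ev H \<xi> * ev \<Phi> \<xi>) \<le> C" by blast
  have WH: "nrm (ev H \<xi>) = W' H" if D': "(\<xi>, r) \<in> D'" for \<xi> r
  proof -
    have "b = 0 \<or> nrm (gam \<xi>) = 1" using b(2) D'_gam_1[OF D'] by auto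
    from eval_poly_eq[OF D'_D[OF D'] D'_gam_le[OF D'] this H(1,2)]
    show ?thesis using c(1) Pz by (simp add: H(4) D'_gam[OF D'])
  qed
  have WF: "W' F = W' H * W' \<Phi>" using F0 H(1) key_nz[OF \<Phi>(1)] q_pos by (simp add: W'_def nn power_int_add)
  define a where "a = W' H"
  define Y where "Y = W' \<Phi>"
  have aY: "a > 0" "Y > 0" using W'_pos H(1) key_nz[OF \<Phi>(1)] by (auto simp: a_def Y_def)
  \<comment> \<open>For \<open>c\<close> of norm above \<open>y0\<close>, the main term of norm
    \<open>a * nrm c\<close> exceeds the error bound \<open>C\<close> at every root of
    \<open>\<Phi> - c\<close>; for norms below \<open>Y\<close> these roots all lie in
    \<open>D'\<close>.\<close>
  define y0 where "y0 = max 0 (C / a)"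
  have y0: "0 \<le> y0" "y0 < Y" using C(1) aY unfolding WF by (auto simp: y0_def a_def Y_def field_simps)
  have evF: "nrm (ev F \<xi>) = a * nrm c" if \<xi>: "ev \<Phi> \<xi> = c" and c: "y0 < nrm c" "nrm c < Y" for \<xi> c
  proof -
    have "\<xi> \<in> fst ` D'" using key_small_in_D'[OF \<Phi>(1)] \<xi> c by (simp add: Y_def)
    then obtain r where D': "(\<xi>, r) \<in> D'" by force
    have "C / a < nrm c" using c(1) by (simp add: y0_def)
    then have "C < a * nrm c" using aY by (simp add: field_simps)
    also have "a * nrm c = nrm (ev H \<xi> * ev \<Phi> \<xi>)" using WH[OF D'] \<xi> by (simp add: nrm_mult a_def)
    finally have "nrm (ev F \<xi> - ev H \<xi> * ev \<Phi> \<xi>) < nrm (ev H \<xi> * ev \<Phi> \<xi>)" using C(2)[OF D'] by linarith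
    from nrm_add_eq[OF this] have "nrm (ev F \<xi>) = nrm (ev H \<xi> * ev \<Phi> \<xi>)" by simp
    then show ?thesis using WH[OF D'] \<xi> by (simp add: nrm_mult a_def)
  qed
  obtain \<theta>\<^sub>0 where \<theta>\<^sub>0: "ev F \<theta>\<^sub>0 = 0" using ev_eq_solvable[OF dF] by blast
  define x where "x = nrm (ev \<Phi> \<theta>\<^sub>0)"
  have x: "nrm (ev \<Phi> \<theta>) = x" if "ev F \<theta> = 0" for \<theta> unfolding x_def by (rule nrm_conjugate[OF F(1) \<theta>\<^sub>0 that])
  have \<Phi>1: "lead_coeff \<Phi> = 1" "degree \<Phi> = m'" using \<Phi>(1) by (auto simp: key_def)
  have prod: "x' ^ degree F = (a * nrm c) ^ m'" if c: "y0 < nrm c" "nrm c < Y"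
    and x': "\<And>\<theta>. ev F \<theta> = 0 \<Longrightarrow> nrm (ev \<Phi> \<theta> - c) = x'" for c x'
  proof -
    have "0 < degree \<Phi>" using \<Phi>1 m'_pos by simp
    from double_product[OF F(2) dF \<Phi>1(1) this, of c] obtain As Bs where AB:
      "size As = degree F" "size Bs = degree \<Phi>" "\<forall>\<theta>\<in>#As. ev F \<theta> = 0" "\<forall>\<xi>\<in>#Bs. ev \<Phi> \<xi> = c"
      "(\<Prod>\<theta>\<in>#As. nrm (ev \<Phi> \<theta> - c)) = (\<Prod>\<xi>\<in>#Bs. nrm (ev F \<xi>))" by blast
    have "(\<Prod>\<theta>\<in>#As. nrm (ev \<Phi> \<theta> - c)) = (\<Prod>\<theta>\<in>#As. x')"
      using AB(3) x' by (intro arg_cong[of _ _ prod_mset] image_mset_cong) auto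
    moreover have "(\<Prod>\<xi>\<in>#Bs. nrm (ev F \<xi>)) = (\<Prod>\<xi>\<in>#Bs. a * nrm c)"
      using AB(4) evF c by (intro arg_cong[of _ _ prod_mset] image_mset_cong) auto
    ultimately show ?thesis using AB \<Phi>1 by simp
  qed
  \<comment> \<open>If \<open>x\<close> were at least \<open>Y\<close>, the product over the roots
    of \<open>F\<close> would not depend on \<open>c\<close> in this range, whereas the other
    product does.\<close>
  have x_less: "x < Y"
  proof (rule ccontr)
    assume "\<not> x < Y"
    then have xY: "Y \<le> x" by simp
    have *: "x ^ degree F = (a * nrm c) ^ m'" if c: "y0 < nrm c" "nrm c < Y" for c
      by (rule prod[OF c]) (use x xY c in \<open>simp add: nrm_diff_eq\<close>)
    \<comment> \<open>The midpoint serves as a positive lower end, since \<open>y0\<close> may be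
      0.\<close>
    obtain c1 where c1: "y0 < nrm c1" "nrm c1 < Y"
      using nrm_dense[of "(y0 + Y) / 2" Y] y0 aY by force
    obtain c2 where c2: "nrm c1 < nrm c2" "nrm c2 < Y" using nrm_dense[OF le_less_trans[OF y0(1) c1(1)] c1(2)] by blast
    have "(a * nrm c1) ^ m' = (a * nrm c2) ^ m'" using *[OF c1] *[of c2] c1 c2 by simp
    then have "a * nrm c1 = a * nrm c2"
      by (rule power_eq_imp_eq_base) (use aY m'_pos in auto)
    then show False using aY c2 by simp
  qed
  then show "ev F \<theta> = 0 \<Longrightarrow> \<theta> \<in> fst ` D'" using key_small_in_D'[OF \<Phi>(1)] x by (simp add: Y_def)
  define y1 where "y1 = max y0 x"
  have y1: "0 \<le> y1" "y1 < Y" "y0 \<le> y1" "x \<le> y1" using y0 x_less by (auto simp: y1_def)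
  \<comment> \<open>For \<open>c\<close> of norm above \<open>x\<close> the product over the roots
    of \<open>F\<close> becomes a power of the norm of \<open>c\<close>; two such norms then allow
    the exponents to be compared.\<close>
  have *: "nrm c ^ degree F = (a * nrm c) ^ m'" if c: "y1 < nrm c" "nrm c < Y" for c
  proof (rule prod)
    show "nrm (ev \<Phi> \<theta> - c) = nrm c" if "ev F \<theta> = 0" for \<theta>
    proof -
      have "nrm (ev \<Phi> \<theta> - c) = nrm (c - ev \<Phi> \<theta>)" using nrm_minus[of "c - ev \<Phi> \<theta>"] by simp
      then show ?thesis using nrm_diff_eq[of "ev \<Phi> \<theta>" c] x[OF that] c(1) y1 by simp
    qed
  qed (use c y1 in auto)
  obtain c1 where c1: "y1 < nrm c1" "nrm c1 < Y" using nrm_dense[of "(y1 + Y) / 2" Y] y1 aY by force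
  obtain c2 where c2: "nrm c1 < nrm c2" "nrm c2 < Y" using nrm_dense[OF le_less_trans[OF y1(1) c1(1)] c1(2)] by blast
  have c1_pos: "0 < nrm c1" using c1(1) y1(1) by linarith
  have e1: "nrm c1 ^ degree F = a ^ m' * nrm c1 ^ m'" using *[OF c1] by (simp add: power_mult_distrib)
  have e2: "nrm c2 ^ degree F = a ^ m' * nrm c2 ^ m'" using *[of c2] c1 c2 by (simp add: power_mult_distrib)
  have "(nrm c2 / nrm c1) ^ degree F = (nrm c2 / nrm c1) ^ m'"
    unfolding power_divide e1 e2 using aY by simp
  moreover have "1 < nrm c2 / nrm c1" using c1_pos c2 by simp
  ultimately show "degree F = m'" by (intro power_inject_exp[THEN iffD1, of "nrm c2 / nrm c1"]) auto
qed

end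

section \<open>Independence of the products and the shape of the quotients\<close>

context local_field
begin

text \<open>The property that makes an element usable as a coefficient over \<open>A\<close> when
  the factors of the next level are combined.\<close>

definition inG :: "('k alg_closure \<Rightarrow> 'f) \<Rightarrow> 'k alg_closure \<Rightarrow> 'f set \<Rightarrow> 'k alg_closure \<Rightarrow> bool" where
  "inG r w A x \<longleftrightarrow> (\<exists>n \<rho>. lead r w x n \<rho> \<and> \<rho> \<in> A)"

end

context level
begin

lemma nrm_Ph_le: "(\<xi>, r) \<in> D' \<Longrightarrow> b = 0 \<or> z \<noteq> 0 \<Longrightarrow> nrm (Ph \<xi> ^ b * w \<xi> powi u) = q powi (int e * u + int b * int h)"
proof -
  assume D': "(\<xi>, r) \<in> D'" and b: "b = 0 \<or> z \<noteq> 0"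
  note D = D'_D[OF D']
  have "nrm (Ph \<xi> ^ b) = q powi (int b * int h)"
  proof (cases "b = 0")
    case False
    then have "nrm (ev \<phi> \<xi>) = G" using b D'_gam_1[OF D'] nrm_gam_eq_1[OF D] by simp
    then have "nrm (Ph \<xi>) = q ^ h" using nrm_Ph[OF D] G_pos by simp
    then show ?thesis by (simp add: nrm_power power_mult[symmetric] mult.commute flip: of_nat_mult)
  qed simp
  then show ?thesis using q_pos D_w[OF D] by (simp add: nrm_mult nrm_powi p_powi power_int_add)
qed

lemma mod_e_0: "z = 0 \<Longrightarrow> j mod e = 0"
  by (simp add: z0(1))

text \<open>Summands of minimal norm have the same exponent of \<open>Ph\<close> modulo \<open>e\<close>; the residue of their sum is
  the value at \<open>z\<close> of a combination of polynomials of different degrees below \<open>f\<close>.\<close>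

lemma independent_combination:
  assumes D': "(\<xi>, r) \<in> D'"
    and \<alpha>: "\<And>j. j < e * f \<Longrightarrow> \<alpha> j = Ph \<xi> ^ (j mod e) * w \<xi> powi u j * t j"
    and t: "\<And>j. j < e * f \<Longrightarrow> nrm (t j) = 1 \<and> r (t j) = poly (P j) z"
    and P: "\<And>j. j < e * f \<Longrightarrow> P j \<in> polys_over A \<and> degree (P j) = j div e \<and> P j \<noteq> 0"
    and x: "\<And>j. j < e * f \<Longrightarrow> x j = 0 \<or> inG r (w \<xi>) A (x j)"
  defines "s \<equiv> \<Sum>j<e * f. x j * \<alpha> j"
  shows "s = 0 \<or> inG r (w' \<xi>) (adjoin_root A z) s" and "\<And>j. j < e * f \<Longrightarrow> nrm (x j * \<alpha> j) \<le> nrm s"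
proof -
  note D = D'_D[OF D'] and r = D_place[OF D'_D[OF D']] and w = D_w_nz[OF D'_D[OF D']]
  define J0 where "J0 = {j. j < e * f \<and> x j \<noteq> 0}"
  have finJ0: "finite J0" by (simp add: J0_def)
  have "\<forall>j\<in>J0. \<exists>n \<rho>. lead r (w \<xi>) (x j) n \<rho> \<and> \<rho> \<in> A" using x by (auto simp: J0_def inG_def)
  then obtain n \<rho> where n: "\<And>j. j \<in> J0 \<Longrightarrow> lead r (w \<xi>) (x j) (n j) (\<rho> j) \<and> \<rho> j \<in> A" by metis
  define M where "M j = int e * (n j + u j) + int (j mod e) * int h" for j
  have s_J0: "s = (\<Sum>j\<in>J0. x j * \<alpha> j)" unfolding s_def by (rule sum.mono_neutral_right) (auto simp: J0_def)
  have nrm_term: "nrm (x j * \<alpha> j) = q powi M j" if j: "j \<in> J0" for j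
  proof -
    have "nrm (x j) = q powi (int e * n j)" using n[OF j] D_w[OF D] by (simp add: lead_def p_powi)
    moreover have "nrm (\<alpha> j) = q powi (int e * u j + int (j mod e) * int h)"
    proof -
      have "j mod e = 0 \<or> z \<noteq> 0" using mod_e_0 by blast
      from nrm_Ph_le[OF D' this, of "u j"] show ?thesis
        using \<alpha>[of j] t[of j] j by (auto simp: J0_def nrm_mult)
    qed
    ultimately have "nrm (x j * \<alpha> j) = q powi (int e * n j + (int e * u j + int (j mod e) * int h))"
      using q_pos by (simp add: nrm_mult power_int_add)
    then show ?thesis by (simp add: M_def algebra_simps)
  qed
  show "s = 0 \<or> inG r (w' \<xi>) (adjoin_root A z) s" and "\<And>j. j < e * f \<Longrightarrow> nrm (x j * \<alpha> j) \<le> nrm s"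
  proof (atomize (full), cases "J0 = {}")
    case True
    then have "s = 0" "x j = 0" if "j < e * f" for j using that s_J0 by (auto simp: J0_def)
    moreover have "s = 0" using True s_J0 by simp
    ultimately show "(s = 0 \<or> inG r (w' \<xi>) (adjoin_root A z) s) \<and> (\<forall>j<e * f. nrm (x j * \<alpha> j) \<le> nrm s)"
      by auto
  next
    case False
    define M0 where "M0 = Min (M ` J0)"
    define J where "J = {j \<in> J0. M j = M0}"
    have M0: "M0 \<le> M j" if "j \<in> J0" for j using that finJ0 by (simp add: M0_def)
    have finJ: "finite J" using finJ0 by (simp add: J_def)
    have "M0 \<in> M ` J0" unfolding M0_def using finJ0 False by (intro Min_in) auto
    then obtain j0 where j0: "j0 \<in> J" by (auto simp: J_def)
    define b where "b = j0 mod e"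
    have modb: "j mod e = b" if "j \<in> J" for j
    proof -
      have "M j = M j0" using that j0 by (simp add: J_def)
      then have "(int (j mod e) - int b) * int h = int e * ((n j0 + u j0) - (n j + u j))"
        by (simp add: M_def b_def algebra_simps)
      then have "int e dvd (int (j mod e) - int b) * int h" by simp
      moreover have "coprime (int e) (int h)" using coprime_he by (simp add: coprime_commute)
      ultimately have "int e dvd int (j mod e) - int b" by (simp add: coprime_dvd_mult_left_iff)
      then have "int (j mod e) mod int e = int b mod int e" by (rule mod_eq_dvd_iff[THEN iffD2])
      then have "(j mod e) mod e = b mod e" by (metis of_nat_eq_iff of_nat_mod)
      then show ?thesis by (simp add: b_def)
    qed
    define U where "U = n j0 + u j0"
    have U: "n j + u j = U" if "j \<in> J" for j
    proof -
      have "M j = M j0" using that j0 by (simp add: J_def)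
      then show ?thesis using e_pos modb[OF that] by (simp add: M_def U_def b_def)
    qed
    define c where "c = Ph \<xi> ^ b * w \<xi> powi U"
    have bz: "b = 0 \<or> z \<noteq> 0" using mod_e_0 by (auto simp: b_def)
    have M0_eq: "M0 = int e * U + int b * int h" using j0 by (simp add: J_def M_def U_def b_def)
    have c: "nrm c = q powi M0" unfolding c_def nrm_Ph_le[OF D' bz] M0_eq ..
    have c0: "c \<noteq> 0" using c q_pos by force
    have t1: "nrm (x j * \<alpha> j / c) \<le> 1" if "j \<in> J0" for j
      using M0[OF that] q_pos by (simp add: nrm_divide nrm_term[OF that] c q_powi_le)
    have t0: "r (x j * \<alpha> j / c) = 0" if "j \<in> J0" "j \<notin> J" for j
    proof -
      have "M0 < M j" using M0[OF that(1)] that by (auto simp: J_def)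
      then have "nrm (x j * \<alpha> j / c) < 1" using q_pos
        by (simp add: nrm_divide nrm_term[OF that(1)] c q_powi_less)
      then show ?thesis by (rule place_small[OF r])
    qed
    have tJ: "r (x j * \<alpha> j / c) = \<rho> j * poly (P j) z" if j: "j \<in> J" for j
    proof -
      have jJ0: "j \<in> J0" and jef: "j < e * f" using j by (auto simp: J_def J0_def)
      have "\<alpha> j = Ph \<xi> ^ b * w \<xi> powi u j * t j" using \<alpha>[OF jef] modb[OF j] by simp
      moreover have "w \<xi> powi U = w \<xi> powi n j * w \<xi> powi u j"
        unfolding U[OF j, symmetric] using w by (simp add: power_int_add)
      moreover have "x' * (a * y * t') / (a * (n' * y)) = x' / n' * t'" if "a \<noteq> 0" "n' \<noteq> 0" "y \<noteq> 0"
        for x' a y t' n' :: "'k alg_closure" using that by simp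
      moreover have "Ph \<xi> ^ b \<noteq> 0" "w \<xi> powi i \<noteq> 0" for i using c0 w by (auto simp: c_def)
      ultimately have "x j * \<alpha> j / c = (x j / w \<xi> powi n j) * t j"
        by (simp only: c_def not_False_eq_True)
      then have "r (x j * \<alpha> j / c) = r (x j / w \<xi> powi n j) * r (t j)"
        using lead_norm1[OF w conjunct1[OF n[OF jJ0]]] conjunct1[OF t[OF jef]]
        by (simp only: placeD(3)[OF r] order_refl)
      then show ?thesis using n[OF jJ0] t[OF jef] by (simp add: lead_def)
    qed
    have s_c: "s / c = (\<Sum>j\<in>J0. x j * \<alpha> j / c)" by (simp add: s_J0 sum_divide_distrib)
    have "r (s / c) = (\<Sum>j\<in>J0. r (x j * \<alpha> j / c))" unfolding s_c by (rule place_sum[OF r t1])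
    also have "\<dots> = (\<Sum>j\<in>J. r (x j * \<alpha> j / c))"
      using t0 finJ0 by (intro sum.mono_neutral_right) (auto simp: J_def)
    also have "\<dots> = poly (\<Sum>j\<in>J. smult (\<rho> j) (P j)) z" using tJ by (simp add: poly_sum)
    finally have rs: "r (s / c) = poly (\<Sum>j\<in>J. smult (\<rho> j) (P j)) z" .
    define Q where "Q = (\<Sum>j\<in>J. smult (\<rho> j) (P j))"
    have JD: "j < e * f" "\<rho> j \<in> A" "\<rho> j \<noteq> 0" if "j \<in> J" for j
      using that n[of j] lead_nz[OF r w, of "x j" "n j" "\<rho> j"] by (auto simp: J_def J0_def)
    have QA: "Q \<in> polys_over A" unfolding Q_def using JD P A(1)
      by (intro polys_over_sum polys_over_smult) auto
    have divf: "j div e < f" if "j \<in> J" for j using JD(1)[OF that] by (simp add: less_mult_imp_div_less mult.commute)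
    have dQ: "degree Q < f"
    proof -
      have "degree Q \<le> f - 1" unfolding Q_def
      proof (rule degree_sum_le[OF finJ])
        fix j assume j: "j \<in> J"
        have "degree (smult (\<rho> j) (P j)) \<le> j div e" using P[OF JD(1)[OF j]] by (simp add: order_trans[OF degree_smult_le])
        then show "degree (smult (\<rho> j) (P j)) \<le> f - 1" using divf[OF j] by linarith
      qed
      then show ?thesis using f_pos by simp
    qed
    \<comment> \<open>Indices in \<open>J\<close> share the remainder modulo \<open>e\<close>, so
      their quotients by \<open>e\<close> differ and the largest index alone reaches the top
      degree.\<close>
    have "Q \<noteq> 0"
    proof -
      define j1 where "j1 = Max J"
      have j1: "j1 \<in> J" unfolding j1_def using finJ j0 by (intro Max_in) auto
      have "coeff Q (j1 div e) = (\<Sum>j\<in>J. if j = j1 then \<rho> j1 * lead_coeff (P j1) else 0)"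
        unfolding Q_def coeff_sum
      proof (rule sum.cong[OF refl])
        fix j assume j: "j \<in> J"
        show "coeff (smult (\<rho> j) (P j)) (j1 div e) = (if j = j1 then \<rho> j1 * lead_coeff (P j1) else 0)"
        proof (cases "j = j1")
          case True
          then show ?thesis using P[OF JD(1)[OF j1]] by simp
        next
          case False
          have "j \<le> j1" unfolding j1_def using finJ j by simp
          then have "j div e \<le> j1 div e" by (rule div_le_mono)
          moreover have "j div e \<noteq> j1 div e"
            using False modb[OF j] modb[OF j1] by (metis div_mult_mod_eq)
          ultimately have "degree (P j) < j1 div e" using P[OF JD(1)[OF j]] by simp
          then show ?thesis using False by (simp add: coeff_eq_0)
        qed
      qed
      also have "\<dots> = \<rho> j1 * lead_coeff (P j1)" using finJ j1 by simp
      also have "\<dots> \<noteq> 0" using JD(3)[OF j1] conjunct2[OF conjunct2[OF P[OF JD(1)[OF j1]]]]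
        by (simp only: mult_eq_0_iff leading_coeff_0_iff simp_thms)
      finally show ?thesis by auto
    qed
    have rs0: "r (s / c) \<noteq> 0"
      using irreducible_over_small_root[OF A(1) psi(1,3) QA _ \<open>Q \<noteq> 0\<close>] dQ rs by (simp add: f_def Q_def)
    have "nrm (s / c) \<le> 1" unfolding s_c using t1 by (intro nrm_sum_le) auto
    with rs0 have sc1: "nrm (s / c) = 1" using placeD(4)[OF r, of "s / c"] by linarith
    then have s: "nrm s = q powi M0" using c q_pos by (simp add: nrm_divide)
    have le: "nrm (x j * \<alpha> j) \<le> nrm s" if "j < e * f" for j
    proof (cases "j \<in> J0")
      case True
      then show ?thesis using M0 by (simp add: nrm_term s q_powi_le)
    next
      case False
      then show ?thesis using that by (simp add: J0_def)
    qed
    have rA: "r (s / c) \<in> adjoin_root A z" unfolding rs using QA by (auto simp: adjoin_root_def Q_def)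
    have "inG r (w' \<xi>) (adjoin_root A z) s"
    proof (cases "z = 0")
      case True
      then have "b = 0" using bz by simp
      have "w \<xi> powi M0 = c" unfolding c_def M0_eq \<open>b = 0\<close> by (simp add: z0(1)[OF True])
      then have "lead r (w' \<xi>) s M0 (r (s / c))" unfolding lead_def z0(8)[OF True]
        using s D_w[OF D] z0(7)[OF True] by simp
      then show ?thesis using rA by (auto simp: inG_def)
    next
      case False
      have "lead r (w' \<xi>) (s / c) 0 (r (s / c))" using sc1 by (simp add: lead_def)
      from lead_mult[OF r w'_nz[OF D'] lead_Ph_w_mult[OF D' False, of b U] this]
      have "lead r (w' \<xi>) (c * (s / c)) (int e * U + int b * int h)
        (z powi ((int b - lb * (int e * U + int b * int h)) div int e) * r (s / c))" by (simp add: c_def)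
      moreover have "c * (s / c) = s" using c0 by simp
      moreover have "z powi ((int b - lb * (int e * U + int b * int h)) div int e) * r (s / c) \<in> adjoin_root A z"
        using subfldD(4)[OF subfld_adjoin_root[OF A psi(1,3)] adjoin_powi[OF adjoin_root_gen[OF A(1)]] rA] .
      ultimately show ?thesis unfolding inG_def by metis
    qed
    then show "(s = 0 \<or> inG r (w' \<xi>) (adjoin_root A z) s) \<and> (\<forall>j<e * f. nrm (x j * \<alpha> j) \<le> nrm s)"
      using le by blast
  qed
qed

text \<open>A zero of \<open>g\<close> forces the residual polynomial to vanish at \<open>z\<close>,
  hence to have degree at least \<open>f\<close>. This ensures that quotients with index below
  \<open>e * f\<close> correspond to abscissas on the side.\<close>

lemma res_vanishes:
  assumes D': "(\<xi>, r) \<in> D'" and z: "z \<noteq> 0" and g: "g \<noteq> 0" "ev g \<xi> = 0"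
  shows "Min (S g) + e * f \<le> Max (S g)"
proof -
  let ?b = "Min (S g)"
  have gam: "nrm (gam \<xi>) \<le> 1" "?b = 0 \<or> nrm (gam \<xi>) = 1" using D'_gam_1[OF D' z] by auto
  have "poly (res ?b g) z = 0"
    using eval_poly_eq[OF D'_D[OF D'] gam g(1) based_Min[OF g(1)]] W'_pos[OF g(1)] g(2) D'_gam[OF D'] by auto
  then have "\<not> degree (res ?b g) < f"
    using irreducible_over_small_root[OF A(1) psi(1,3) res_polys_over] res_nz[OF g(1) based_Min[OF g(1)]]
    by (auto simp: f_def)
  moreover have "degree (res ?b g) \<le> (Max (S g) - ?b) div e" unfolding res_def
    by (rule degree_sum_le) (auto intro!: order_trans[OF degree_monom_le] div_le_mono diff_le_mono)
  ultimately have "f \<le> (Max (S g) - ?b) div e" by linarith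
  then have "e * f \<le> e * ((Max (S g) - ?b) div e)" by simp
  also have "\<dots> \<le> Max (S g) - ?b" by simp
  finally have "e * f \<le> Max (S g) - ?b" .
  moreover have "0 < e * f" using e_pos f_pos by simp
  ultimately show ?thesis by linarith
qed

text \<open>Division by \<open>\<phi> ^ k\<close> shifts the expansion by \<open>k\<close> and drops
  what lies further left. The right end of the component moves to abscissa \<open>j\<close>, so the
  residual polynomial based at \<open>j mod e\<close> has degree exactly \<open>j div e\<close>;
  this is below \<open>f\<close>, and it cannot vanish at \<open>z\<close>.\<close>

lemma quotient_lead:
  assumes D': "(\<xi>, r) \<in> D'" and z: "z \<noteq> 0" and g: "g \<noteq> 0" and j: "j < e * f" "j \<le> Max (S g)"
  defines "k \<equiv> Max (S g) - j"
  shows "nrm (ev (g div \<phi> ^ k) \<xi>) = q powi (nn' g - int k * (int e * V + int h))"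
    and "\<exists>u t P. ev (g div \<phi> ^ k) \<xi> = Ph \<xi> ^ (j mod e) * w \<xi> powi u * t \<and> nrm t = 1 \<and> r t = poly P z \<and>
      P \<in> polys_over A \<and> degree P = j div e \<and> P \<noteq> 0"
proof -
  note D = D'_D[OF D']
  define Q where "Q = g div \<phi> ^ k"
  have ecQ: "ec Q t = ec g (k + t)" for t
    by (simp add: Q_def expansion_coeff_def poly_div_mult_right[symmetric] power_add)
  have NQ: "N Q t = N g (k + t) - int k * (int e * V + int h)" for t
    by (simp add: N_def ecQ algebra_simps)
  have max: "Max (S g) \<in> S g" using S_nonempty[OF g] by simp
  have kj: "k + j = Max (S g)" using j by (simp add: k_def)
  have suppQ: "t \<in> supp Q \<longleftrightarrow> k + t \<in> supp g" for t by (simp add: in_supp ecQ)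
  have jQ: "j \<in> supp Q" using S_supp[OF max] by (simp add: suppQ kj)
  then have Q0: "Q \<noteq> 0" by (auto simp: in_supp)
  have "nn' Q = nn' g - int k * (int e * V + int h)" unfolding nn'_def
  proof (rule Min_eqI)
    have "N g (Max (S g)) = nn' g" using max by (simp add: S_def)
    then show "Min (N g ` supp g) - int k * (int e * V + int h) \<in> N Q ` supp Q"
      using jQ NQ[of j] by (auto simp: kj nn'_def intro!: image_eqI[of _ _ j])
  next
    fix y assume "y \<in> N Q ` supp Q"
    then show "Min (N g ` supp g) - int k * (int e * V + int h) \<le> y"
      using N_ge[of _ g] by (auto simp: NQ suppQ nn'_def)
  qed simp
  then have nnQ: "nn' Q = nn' g - int k * (int e * V + int h)" .
  have SQ: "t \<in> S Q \<longleftrightarrow> k + t \<in> S g" for t by (simp add: S_def suppQ NQ nnQ)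
  have jS: "j \<in> S Q" using max by (simp add: SQ kj)
  have le_j: "t \<le> j" if "t \<in> S Q" for t using Max_ge[OF finite_S, of "k + t" g] that by (simp add: SQ flip: kj)
  \<comment> \<open>Unlike the left end of the component, this base point is common to all
    \<open>j\<close> of one class modulo \<open>e\<close>, which makes their residues
    comparable.\<close>
  define b where "b = j mod e"
  have based: "based b Q" unfolding based_def
  proof
    fix t assume t: "t \<in> S Q"
    have "e dvd j - t" using S_cong_nat[OF jS t le_j[OF t]] .
    then have "t mod e = b" unfolding b_def using le_j[OF t] by (metis mod_eq_dvd_iff_nat)
    then show "b \<le> t \<and> e dvd t - b" by (metis mod_less_eq_dividend dvd_minus_mod)
  qed
  have gam: "nrm (gam \<xi>) \<le> 1" "b = 0 \<or> nrm (gam \<xi>) = 1" using D'_gam_1[OF D' z] by auto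
  obtain u0 where u0: "nn' Q = int e * u0 + int b * int h" using based_base[OF Q0 based] by blast
  note E = eval_poly[OF D gam Q0 based u0]
  have jb: "j = b + e * (j div e)" by (simp add: b_def)
  have deg_le: "degree (res b Q) \<le> j div e"
  proof (rule degree_le, safe)
    fix l assume "j div e < l"
    then have "e * (j div e) < e * l" using e_pos by simp
    then have "j < b + e * l" using jb by linarith
    then have "b + e * l \<notin> S Q" using le_j by fastforce
    then show "coeff (res b Q) l = 0" by (simp add: coeff_res[OF based])
  qed
  have "coeff (res b Q) (j div e) \<noteq> 0" using jS cc_nz[OF jQ] by (simp add: coeff_res[OF based] flip: jb)
  then have deg: "degree (res b Q) = j div e" using deg_le le_degree by (metis antisym)
  have "j div e < f" using j(1) by (simp add: less_mult_imp_div_less mult.commute)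
  then have nz: "poly (res b Q) z \<noteq> 0"
    using irreducible_over_small_root[OF A(1) psi(1,3) res_polys_over] res_nz[OF Q0 based] deg by (simp add: f_def)
  have nrmQ: "nrm (ev Q \<xi>) = W' Q" using eval_poly_eq[OF D gam Q0 based] nz D'_gam[OF D'] by simp
  then show "nrm (ev (g div \<phi> ^ k) \<xi>) = q powi (nn' g - int k * (int e * V + int h))"
    unfolding Q_def[symmetric] using Q0 by (simp add: W'_def nnQ)
  let ?c = "Ph \<xi> ^ b * w \<xi> powi u0"
  have c0: "?c \<noteq> 0" using E(1) W'_pos[OF Q0] by force
  have "ev Q \<xi> = ?c * (ev Q \<xi> / ?c)" by (metis c0 nonzero_mult_div_cancel_left times_divide_eq_right)
  moreover have "nrm (ev Q \<xi> / ?c) = 1" unfolding nrm_divide nrmQ E(1) using W'_pos[OF Q0] by simp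
  moreover have "r (ev Q \<xi> / ?c) = poly (res b Q) z" using E(3) D'_gam[OF D'] by simp
  ultimately show "\<exists>u t P. ev (g div \<phi> ^ k) \<xi> = Ph \<xi> ^ (j mod e) * w \<xi> powi u * t \<and> nrm t = 1 \<and> r t = poly P z \<and>
      P \<in> polys_over A \<and> degree P = j div e \<and> P \<noteq> 0"
    unfolding Q_def[symmetric] b_def[symmetric] using res_polys_over res_nz[OF Q0 based] deg by blast
qed

end

section \<open>Newton polygons\<close>

text \<open>The polygon is handled through its supporting lines: \<open>mu l\<close> is the least
  intercept of a line of slope \<open>l\<close> through one of the points, and \<open>side l\<close>
  collects the abscissas where it is attained.\<close>

locale polygon =
  fixes I :: "nat set" and u :: "nat \<Rightarrow> real"
  assumes finite_I: "finite I" and I_nonempty: "I \<noteq> {}"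
begin

definition P where "P = {(real s, u s) | s. s \<in> I}"
definition mu :: "real \<Rightarrow> real" where "mu l = Min ((\<lambda>s. u s - l * real s) ` I)"
definition side :: "real \<Rightarrow> nat set" where "side l = {s \<in> I. u s - l * real s = mu l}"

lemma mu_le: "s \<in> I \<Longrightarrow> mu l \<le> u s - l * real s"
  using finite_I by (simp add: mu_def)

lemma side_nonempty: "side l \<noteq> {}"
proof -
  have "mu l \<in> (\<lambda>s. u s - l * real s) ` I" unfolding mu_def using finite_I I_nonempty by (intro Min_in) auto
  then show ?thesis by (auto simp: side_def)
qed

lemma finite_side: "finite (side l)" using finite_I by (simp add: side_def)

lemma hull_ge:
  assumes "\<And>s. s \<in> I \<Longrightarrow> c \<le> u s - l * real s" and "x \<in> convex hull P"
  shows "c \<le> snd x - l * fst x"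
proof -
  have "convex {x :: real \<times> real. inner (- l, 1) x \<ge> c}" by (rule convex_halfspace_ge)
  moreover have "P \<subseteq> {x. inner (- l, 1) x \<ge> c}" using assms(1) by (auto simp: P_def)
  ultimately have "convex hull P \<subseteq> {x. inner (- l, 1) x \<ge> c}" by (intro hull_minimal)
  with assms(2) have "inner (- l, 1) x \<ge> c" by blast
  then show ?thesis by (cases x) simp
qed

lemma point_in_hull: "s \<in> I \<Longrightarrow> (real s, u s) \<in> convex hull P"
  by (rule hull_inc) (auto simp: P_def)

lemma segment_in_hull:
  assumes s: "s \<in> side l" "t \<in> side l" and x: "real s \<le> x" "x \<le> real t"
  shows "(x, mu l + l * x) \<in> convex hull P"
proof (cases "s = t")
  case True
  have "u s = mu l + l * real s" using s by (simp add: side_def algebra_simps)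
  moreover have "x = real s" using True x by simp
  ultimately have "(x, mu l + l * x) = (real s, u s)" by simp
  moreover have "s \<in> I" using s by (simp add: side_def)
  ultimately show ?thesis using point_in_hull[of s] by (simp only:)
next
  case False
  then have st: "real s < real t" using x by (cases "s < t") auto
  define a where "a = (x - real s) / (real t - real s)"
  have a: "0 \<le> a" "a \<le> 1" using st x by (auto simp: a_def)
  have ax: "(1 - a) * real s + a * real t = x"
  proof -
    have "a * (real t - real s) = x - real s" using st by (simp add: a_def)
    then show ?thesis by (simp add: algebra_simps)
  qed
  have us: "u s = mu l + l * real s" "u t = mu l + l * real t" using s by (auto simp: side_def)
  have "(1 - a) * u s + a * u t = mu l + l * ((1 - a) * real s + a * real t)"
    unfolding us by (simp add: algebra_simps)
  then have "(1 - a) *\<^sub>R (real s, u s) + a *\<^sub>R (real t, u t) = (x, mu l + l * x)"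
    unfolding ax by (simp add: ax)
  moreover have "(1 - a) *\<^sub>R (real s, u s) + a *\<^sub>R (real t, u t) \<in> convex hull P"
    using a s point_in_hull by (intro convexD convex_convex_hull) (auto simp: side_def)
  ultimately show ?thesis by simp
qed

lemma hull_ge_mu: "x \<in> convex hull P \<Longrightarrow> mu l \<le> snd x - l * fst x"
  by (rule hull_ge[OF mu_le])

lemma line_in_lower_hull:
  assumes "(x, mu l + l * x) \<in> convex hull P"
  shows "(x, mu l + l * x) \<in> lower_hull P"
proof -
  have "mu l + l * x \<le> snd q" if "q \<in> convex hull P" "fst q = x" for q
    using hull_ge_mu[OF that(1), of l] that(2) by simp
  then show ?thesis using assms by (simp add: lower_hull_def)
qed

lemma lower_hull_hull: "x \<in> lower_hull P \<Longrightarrow> x \<in> convex hull P" by (simp add: lower_hull_def)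

lemma component_eq: "slope_component l (lower_hull P) = {x \<in> lower_hull P. snd x - l * fst x = mu l}"
proof -
  obtain s where s: "s \<in> side l" using side_nonempty by blast
  have mem: "(real s, mu l + l * real s) \<in> lower_hull P"
    by (rule line_in_lower_hull[OF segment_in_hull[OF s s]]) auto
  have ge: "mu l \<le> snd x - l * fst x" if "x \<in> lower_hull P" for x
    by (rule hull_ge_mu[OF lower_hull_hull[OF that]])
  have "snd x - l * fst x \<le> mu l" if "x \<in> slope_component l (lower_hull P)" for x
    using that mem unfolding slope_component_def by force
  moreover have "x \<in> slope_component l (lower_hull P)" if "x \<in> lower_hull P" "snd x - l * fst x = mu l" for x
    using that ge unfolding slope_component_def by simp
  moreover have "x \<in> lower_hull P" if "x \<in> slope_component l (lower_hull P)" for x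
    using that by (simp add: slope_component_def)
  ultimately show ?thesis using ge by (auto intro: antisym)
qed

text \<open>The supporting line can be turned about its last point \<open>t\<close> by a small
  amount \<open>d\<close> and still lies below all points, so nothing on the component is to the
  right of \<open>t\<close>.\<close>

lemma component_le: "x \<in> slope_component l (lower_hull P) \<Longrightarrow> fst x \<le> real (Max (side l))"
proof -
  assume x: "x \<in> slope_component l (lower_hull P)"
  define t where "t = Max (side l)"
  have t: "t \<in> side l" unfolding t_def using finite_side side_nonempty by (intro Max_in)
  define J where "J = {s \<in> I. t < s}"
  have pos: "0 < u s - l * real s - mu l" if "s \<in> J" for s
  proof -
    have "s \<notin> side l" using that Max_ge[OF finite_side, of s l] by (auto simp: J_def t_def)
    then show ?thesis using that mu_le[of s l] by (force simp: J_def side_def)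
  qed
  \<comment> \<open>The turn is limited by the gaps at the points to the right of \<open>t\<close>;
    the entry 1 covers the case that there are none.\<close>
  define d where "d = Min (insert 1 ((\<lambda>s. (u s - l * real s - mu l) / (real s - real t)) ` J))"
  have finJ: "finite J" using finite_I by (simp add: J_def)
  have d: "0 < d" unfolding d_def using finJ pos by (subst Min_gr_iff) (auto simp: J_def)
  have dJ: "d * (real s - real t) \<le> u s - l * real s - mu l" if "s \<in> J" for s
  proof -
    have "d \<le> (u s - l * real s - mu l) / (real s - real t)" unfolding d_def using finJ that by (intro Min_le) auto
    then show ?thesis using that by (simp add: J_def field_simps)
  qed
  have "mu l - d * real t \<le> u s - (l + d) * real s" if "s \<in> I" for s
  proof (cases "s \<in> J")
    case True
    then show ?thesis using dJ[of s] by (simp add: algebra_simps)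
  next
    case False
    then have "real s \<le> real t" using that by (simp add: J_def)
    then have "d * real s \<le> d * real t" using d by simp
    then show ?thesis using mu_le[OF that, of l] by (simp add: algebra_simps)
  qed
  from hull_ge[OF this lower_hull_hull] x
  have "mu l - d * real t \<le> snd x - (l + d) * fst x" by (simp add: slope_component_def)
  moreover have "snd x - l * fst x = mu l" using x by (simp add: component_eq)
  ultimately have "d * fst x \<le> d * real t" by (simp add: algebra_simps)
  then show ?thesis using d by (simp add: t_def)
qed

lemma component_ge: "x \<in> slope_component l (lower_hull P) \<Longrightarrow> real (Min (side l)) \<le> fst x"
proof -
  assume x: "x \<in> slope_component l (lower_hull P)"
  define t where "t = Min (side l)"
  have t: "t \<in> side l" unfolding t_def using finite_side side_nonempty by (intro Min_in)
  define J where "J = {s \<in> I. s < t}"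
  have pos: "0 < u s - l * real s - mu l" if "s \<in> J" for s
  proof -
    have "s \<notin> side l" using that Min_le[OF finite_side, of s l] by (auto simp: J_def t_def)
    then show ?thesis using that mu_le[of s l] by (force simp: J_def side_def)
  qed
  define d where "d = Min (insert 1 ((\<lambda>s. (u s - l * real s - mu l) / (real t - real s)) ` J))"
  have finJ: "finite J" using finite_I by (simp add: J_def)
  have d: "0 < d" unfolding d_def using finJ pos by (subst Min_gr_iff) (auto simp: J_def)
  have dJ: "d * (real t - real s) \<le> u s - l * real s - mu l" if "s \<in> J" for s
  proof -
    have "d \<le> (u s - l * real s - mu l) / (real t - real s)" unfolding d_def using finJ that by (intro Min_le) auto
    then show ?thesis using that by (simp add: J_def field_simps)
  qed
  have "mu l + d * real t \<le> u s - (l - d) * real s" if "s \<in> I" for s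
  proof (cases "s \<in> J")
    case True
    then show ?thesis using dJ[of s] by (simp add: algebra_simps)
  next
    case False
    then have "real t \<le> real s" using that by (simp add: J_def)
    then have "d * real t \<le> d * real s" using d by simp
    then show ?thesis using mu_le[OF that, of l] by (simp add: algebra_simps)
  qed
  from hull_ge[OF this lower_hull_hull] x
  have "mu l + d * real t \<le> snd x - (l - d) * fst x" by (simp add: slope_component_def)
  moreover have "snd x - l * fst x = mu l" using x by (simp add: component_eq)
  ultimately have "d * real t \<le> d * fst x" by (simp add: algebra_simps)
  then show ?thesis using d by (simp add: t_def)
qed

lemma side_in_component: "s \<in> side l \<Longrightarrow> (real s, u s) \<in> slope_component l (lower_hull P)"
proof -
  assume s: "s \<in> side l"
  then have us: "u s = mu l + l * real s" by (simp add: side_def)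
  show ?thesis unfolding component_eq us
    using line_in_lower_hull[OF segment_in_hull[OF s s, of "real s"]] by simp
qed

lemma abscissas:
  "left_abscissa (slope_component l (lower_hull P)) = Min (side l)"
  "right_abscissa (slope_component l (lower_hull P)) = Max (side l)"
proof -
  let ?A = "{s. real s \<in> fst ` slope_component l (lower_hull P)}"
  have sub: "side l \<subseteq> ?A" using side_in_component by force
  have le: "s \<le> Max (side l)" "Min (side l) \<le> s" if "s \<in> ?A" for s
    using that component_le component_ge by force+
  have fin: "finite ?A" using le(1) by (meson finite_nat_set_iff_bounded_le)
  have mem: "Min (side l) \<in> ?A" "Max (side l) \<in> ?A" using sub finite_side side_nonempty Min_in Max_in by blast+
  show "left_abscissa (slope_component l (lower_hull P)) = Min (side l)"
    unfolding left_abscissa_def by (rule Min_eqI[OF fin le(2) mem(1)])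
  show "right_abscissa (slope_component l (lower_hull P)) = Max (side l)"
    unfolding right_abscissa_def by (rule Max_eqI[OF fin le(1) mem(2)])
qed

text \<open>Between its end abscissas the component is the lower boundary of the hull, so a point in
  this range is on the polygon only if it is on the supporting line.\<close>

lemma on_negative_part:
  assumes l: "l < 0" and s: "Min (side l) \<le> s" "s \<le> Max (side l)" "s \<in> I"
  shows "(real s, u s) \<in> negative_part (lower_hull P) \<longleftrightarrow> s \<in> side l"
proof
  assume "s \<in> side l"
  then show "(real s, u s) \<in> negative_part (lower_hull P)"
    using side_in_component l by (auto simp: negative_part_def)
next
  assume "(real s, u s) \<in> negative_part (lower_hull P)"
  then have "(real s, u s) \<in> lower_hull P" by (auto simp: negative_part_def slope_component_def)
  moreover have "(real s, mu l + l * real s) \<in> convex hull P"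
    using finite_side side_nonempty s by (intro segment_in_hull[of "Min (side l)" l "Max (side l)"]) auto
  ultimately have "u s \<le> mu l + l * real s" by (force simp: lower_hull_def)
  then show "s \<in> side l" using mu_le[OF s(3), of l] s(3) by (simp add: side_def)
qed

lemma negative_part_component:
  assumes l: "l < 0"
  shows "slope_component l (negative_part (lower_hull P)) = slope_component l (lower_hull P)"
proof -
  have sub: "negative_part (lower_hull P) \<subseteq> lower_hull P" "slope_component l (lower_hull P) \<subseteq> negative_part (lower_hull P)"
    using l by (auto simp: negative_part_def slope_component_def)
  obtain s where "s \<in> side l" using side_nonempty by blast
  from side_in_component[OF this] have s: "(real s, u s) \<in> slope_component l (lower_hull P)" .
  show ?thesis
  proof
    show "slope_component l (negative_part (lower_hull P)) \<subseteq> slope_component l (lower_hull P)"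
    proof
      fix x assume x: "x \<in> slope_component l (negative_part (lower_hull P))"
      then have "snd x - l * fst x \<le> u s - l * real s" using s sub(2) by (force simp: slope_component_def)
      then show "x \<in> slope_component l (lower_hull P)" using x s sub(1) by (force simp: slope_component_def)
    qed
    show "slope_component l (lower_hull P) \<subseteq> slope_component l (negative_part (lower_hull P))"
      using sub by (force simp: slope_component_def)
  qed
qed

lemma ordinate:
  assumes l: "l < 0" and x: "real (Min (side l)) \<le> x" "x \<le> real (Max (side l))"
  shows "(THE y. (x, y) \<in> negative_part (lower_hull P)) = mu l + l * x"
proof (rule the_equality)
  have h: "(x, mu l + l * x) \<in> convex hull P"
    using finite_side side_nonempty x by (intro segment_in_hull[of "Min (side l)" l "Max (side l)"]) auto
  then have "(x, mu l + l * x) \<in> lower_hull P" by (rule line_in_lower_hull)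
  then have "(x, mu l + l * x) \<in> slope_component l (lower_hull P)" by (simp add: component_eq)
  then show "(x, mu l + l * x) \<in> negative_part (lower_hull P)" using l by (auto simp: negative_part_def)
  fix y assume "(x, y) \<in> negative_part (lower_hull P)"
  then have y: "(x, y) \<in> lower_hull P" by (auto simp: negative_part_def slope_component_def)
  have "y \<le> mu l + l * x" using y h unfolding lower_hull_def by force
  moreover have "mu l \<le> y - l * x" using hull_ge_mu[OF lower_hull_hull[OF y], of l] by simp
  ultimately show "y = mu l + l * x" by simp
qed

end

section \<open>Newton polygons of a level and the constants of the next one\<close>

context level
begin

text \<open>The leading coefficient of \<open>\<psi>\<close> puts the abscissa
  \<open>b + e * f\<close> into the support, and the degree of \<open>\<Phi>\<close> leaves room for
  it only if \<open>b = 0\<close>.\<close>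

lemma key_from_res:
  assumes \<Phi>: "lead_coeff \<Phi> = 1" "degree \<Phi> = m'" and b: "based b \<Phi>" and res: "res b \<Phi> = smult c \<psi>" "c \<noteq> 0"
  shows "key \<Phi>"
proof -
  have \<Phi>0: "\<Phi> \<noteq> 0" using \<Phi>(1) by auto
  have "coeff (res b \<Phi>) f \<noteq> 0" using res psi(2) by (simp add: f_def)
  then have bf: "b + e * f \<in> S \<Phi>" by (simp add: coeff_res[OF b] split: if_splits)
  from degree_ec_add_le[OF S_supp[OF this]] have "(b + e * f) * m \<le> m'" using \<Phi>(2) by simp
  then have "b * m \<le> 0" by (simp add: m'_def add_mult_distrib)
  then have b_0: "b = 0" using m_pos by simp
  have "ec \<Phi> (e * f) = 1"
    using \<Phi> phi_monic phi_degree phi_degree_pos by (intro expansion_coeff_top) (auto simp: m'_def)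
  moreover have "nn' \<Phi> = N \<Phi> (e * f)" using bf b_0 by (simp add: S_def)
  ultimately have "nn' \<Phi> = int e * (int f * (int e * V + int h))" by (simp add: N_def nn_1 algebra_simps)
  then show ?thesis using \<Phi> res b_0 by (auto simp: key_def)
qed

text \<open>The ordinate of a Newton point, once \<open>vv\<close> is known to agree with
  \<open>nn\<close> on coefficients and to be additive on powers of \<open>\<phi>\<close>.\<close>

definition ord :: "'k poly \<Rightarrow> nat \<Rightarrow> real" where
  "ord g s = real_of_int (nn (ec g s) + int s * V)"

lemma ord_polygon: "g \<noteq> 0 \<Longrightarrow> polygon (supp g)"
  using supp_nonempty by unfold_locales auto

lemma N_ord: "real_of_int (N g s) = real e * (ord g s + real h / real e * real s)"
  using e_pos by (simp add: N_def ord_def algebra_simps)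

lemma polygon_mu:
  assumes "g \<noteq> 0"
  shows "polygon.mu (supp g) (ord g) (- (real h / real e)) = real_of_int (nn' g) / real e"
proof -
  interpret polygon "supp g" "ord g" by (rule ord_polygon[OF assms])
  have v: "ord g s - - (real h / real e) * real s = real_of_int (N g s) / real e" for s
    using e_pos by (simp add: N_ord)
  obtain s where s: "s \<in> S g" using S_nonempty[OF assms] by blast
  show ?thesis unfolding mu_def v
  proof (rule Min_eqI)
    show "real_of_int (nn' g) / real e \<in> (\<lambda>s. real_of_int (N g s) / real e) ` supp g"
      using s by (auto simp: S_def intro!: image_eqI[of _ _ s])
  next
    fix y assume "y \<in> (\<lambda>s. real_of_int (N g s) / real e) ` supp g"
    then show "real_of_int (nn' g) / real e \<le> y" using N_ge[of _ g] by (auto intro!: divide_right_mono)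
  qed simp
qed

lemma polygon_side:
  assumes "g \<noteq> 0"
  shows "polygon.side (supp g) (ord g) (- (real h / real e)) = S g"
proof -
  interpret polygon "supp g" "ord g" by (rule ord_polygon[OF assms])
  have "ord g s - - (real h / real e) * real s = real_of_int (nn' g) / real e \<longleftrightarrow> N g s = nn' g" for s
  proof -
    have "ord g s - - (real h / real e) * real s = real_of_int (N g s) / real e"
      using e_pos by (simp add: N_ord)
    then show ?thesis using e_pos by simp
  qed
  then show ?thesis unfolding side_def polygon_mu[OF assms] by (simp add: S_def)
qed

lemma nn'_power: "g \<noteq> 0 \<Longrightarrow> nn' (g ^ k) = int k * nn' g"
proof (induction k)
  case 0
  have "supp 1 = {0}" 
  proof -
    have "ec 1 s = (if s = 0 then 1 else 0)" for s
      using expansion_coeff_monomial[OF phi_degree_pos, of 1 0 s] phi_degree_pos by simp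
    then show ?thesis by (auto simp: in_supp split: if_splits)
  qed
  moreover have "ec 1 0 = 1" using expansion_coeff_monomial[OF phi_degree_pos, of 1 0 0] phi_degree_pos by simp
  ultimately show ?case by (simp add: nn'_def N_def nn_1)
qed (simp add: nn'_mult algebra_simps)

text \<open>The value of the next \<open>\<phi>\<close> is divisible by \<open>e\<close>, so a power
  of \<open>w\<close> can compensate it. This is the origin of the factor \<open>\<eta>\<close> and
  of the constant \<open>\<kappa>\<close> of the next level.\<close>

lemma lead_eta:
  assumes D': "(\<xi>, r) \<in> D'" and V': "V' = int e * k"
  shows "lead r (w' \<xi>) (w \<xi> powi (- k)) (- V') (z powi (lb * k))"
proof -
  note r = D_place[OF D'_D[OF D']]
  show ?thesis
  proof (cases "z = 0")
    case True
    then show ?thesis using lead_w[OF r D_w_nz[OF D'_D[OF D']], of "- k"] V' unfolding z0(8)[OF True]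
      by (simp add: z0(1,3)[OF True])
  next
    case False
    have "(z powi (- lb)) powi (- k) = z powi (lb * k)" using power_int_mult[of z "- lb" "- k"] by simp
    then show ?thesis using lead_powi[OF r w'_nz[OF D'] lead_Ph_w(2)[OF D' False], of "- k"]
      by (simp add: V' mult.commute)
  qed
qed

lemma rho'_base_0:
  assumes "g \<noteq> 0" "lb = 0" "e = 1"
  shows "rho' g = poly (res 0 g) z"
proof -
  have "based 0 g" unfolding based_def by (simp add: assms(3))
  from res_shift[OF assms(1) this] show ?thesis
    unfolding rho'_def by (simp add: assms(2,3) poly_monom)
qed

end

section \<open>The initial stage and level\<close>

context local_field
begin

lemma residue_fieldI: "nrm (to_ac a) \<le> 1 \<Longrightarrow> red K (to_ac a) \<in> residue_field K"
  by (simp add: residue_field_def int_ring_iff)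

lemma subfld_residue_field: "subfld (residue_field K)"
proof (rule finite_subring_subfld[OF finite_residue_field])
  have r: "place (red K)" by (rule place_red)
  have I: "int_ring K = {a. nrm (to_ac a) \<le> 1}" using int_ring_iff by auto
  show "0 \<in> residue_field K" using residue_fieldI[of 0] place_0[OF r] by simp
  show "1 \<in> residue_field K" using residue_fieldI[of 1] placeD(1)[OF r] by simp
  fix x assume "x \<in> residue_field K"
  then obtain a where a: "nrm (to_ac a) \<le> 1" "x = red K (to_ac a)" by (auto simp: residue_field_def I)
  have "red K (to_ac a + to_ac (- a)) = red K (to_ac a) + red K (to_ac (- a))"
    by (rule placeD(2)[OF r]) (use a in \<open>auto simp: nrm_minus\<close>)
  then have "red K (to_ac (- a)) = - x" using a(2) place_0[OF r] by (simp add: eq_neg_iff_add_eq_0 add.commute)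
  moreover have "nrm (to_ac (- a)) \<le> 1" using a(1) by (simp add: nrm_minus)
  ultimately show "- x \<in> residue_field K" using residue_fieldI[of "- a"] by (simp only:)
  fix y assume "y \<in> residue_field K"
  then obtain b where b: "nrm (to_ac b) \<le> 1" "y = red K (to_ac b)" by (auto simp: residue_field_def I)
  have "nrm (to_ac (a + b)) \<le> 1" using a b nrm_add[of "to_ac a" "to_ac b"] by simp
  moreover have "red K (to_ac (a + b)) = x + y" using a b placeD(2)[OF r] by simp
  ultimately show "x + y \<in> residue_field K" using residue_fieldI[of "a + b"] by (simp only:)
  have "nrm (to_ac (a * b)) \<le> 1" using a b by (simp add: nrm_mult mult_le_one)
  moreover have "red K (to_ac (a * b)) = x * y" using a b placeD(3)[OF r] by simp
  ultimately show "x * y \<in> residue_field K" using residue_fieldI[of "a * b"] by (simp only:)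
qed

lemma val_powi_unif: "val K (unif K powi n) = n"
proof -
  have "unif K powi n \<noteq> 0" using unif by simp
  have "exp (- real_of_int (val K (unif K powi n))) = nrm (\<pi> powi n)"
  proof -
    have "to_ac (unif K powi n) = \<pi> powi n" by (simp add: power_int_def)
    then show ?thesis using nrm_to_ac[OF \<open>unif K powi n \<noteq> 0\<close>] by simp
  qed
  also have "\<dots> = exp (- real_of_int n)" by (simp add: nrm_powi nrm_unif exp_powi)
  finally show ?thesis by simp
qed

lemma to_ac_powi: "to_ac (x powi n) = to_ac x powi n"
  by (simp add: power_int_def)

lemma lead_to_ac:
  assumes "c \<noteq> 0"
  shows "lead (red K) \<pi> (to_ac c) (val K c) (red K (to_ac (c / unif K powi val K c)))"
    and "red K (to_ac (c / unif K powi val K c)) \<in> residue_field K"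
proof -
  show l: "lead (red K) \<pi> (to_ac c) (val K c) (red K (to_ac (c / unif K powi val K c)))"
    using nrm_to_ac'[OF assms] by (simp add: lead_def to_ac_powi)
  have "nrm (to_ac (c / unif K powi val K c)) = 1" using lead_norm1[OF unif_nz l] by (simp add: to_ac_powi)
  then show "red K (to_ac (c / unif K powi val K c)) \<in> residue_field K" by (intro residue_fieldI) simp
qed

text \<open>All points, with the reduction map twisted by every power map that is additive and fixes
  the residue field. The family is closed under further twisting, as \<open>D_twist\<close>
  demands.\<close>

definition D0 :: "('k alg_closure \<times> ('k alg_closure \<Rightarrow> 'f)) set" where
  "D0 = {(\<xi>, r). \<exists>N. additive_power TYPE('f) N \<and> (\<forall>a\<in>residue_field K. a ^ N = a) \<and> r = (\<lambda>\<alpha>. red K \<alpha> ^ N)}"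

definition nn0 :: "'k poly \<Rightarrow> int" where "nn0 a = val K (coeff a 0)"
definition rho0 :: "'k poly \<Rightarrow> 'f" where
  "rho0 a = red K (to_ac (coeff a 0 / unif K powi val K (coeff a 0)))"

lemma stage_0: "stage K 1 nn0 rho0 D0 (\<lambda>_. \<pi>) (exp (-1)) (residue_field K)"
proof (unfold_locales)
  show "subfld (residue_field K)" "finite (residue_field K)" by (rule subfld_residue_field, rule finite_residue_field)
  fix \<xi> r assume "(\<xi>, r) \<in> D0"
  then obtain N where N: "additive_power TYPE('f) N" "\<And>a. a \<in> residue_field K \<Longrightarrow> a ^ N = a" "r = (\<lambda>\<alpha>. red K \<alpha> ^ N)"
    by (auto simp: D0_def)
  show "place r" using placeD[OF place_red] N(1)
    by (auto simp: place_def N(3) additive_power_def power_mult_distrib)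
  show "nrm \<pi> = exp (-1)" by (rule nrm_unif)
  show "(\<xi>, \<lambda>\<alpha>. r \<alpha> ^ N') \<in> D0" if "additive_power TYPE('f) N'" "\<And>a. a \<in> residue_field K \<Longrightarrow> a ^ N' = a" for N'
  proof -
    have "additive_power TYPE('f) (N * N')" using N(1) that(1) by (simp add: additive_power_def power_mult)
    then show ?thesis using N(2) that(2) by (auto simp: D0_def N(3) power_mult intro!: exI[of _ "N * N'"])
  qed
  fix a :: "'k poly" assume a: "a \<noteq> 0" "degree a < 1"
  then obtain c where c: "a = [:c:]" "c \<noteq> 0" by (auto elim: degree_eq_zeroE)
  show "lead r \<pi> (ev a \<xi>) (nn0 a) (rho0 a)"
    using lead_to_ac[OF c(2)] N(2) by (simp add: lead_def c(1) nn0_def rho0_def N(3))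
next
  fix a :: "'k poly" assume a: "a \<noteq> 0" "degree a < 1"
  then obtain c where c: "a = [:c:]" "c \<noteq> 0" by (auto elim: degree_eq_zeroE)
  show "rho0 a \<in> residue_field K \<and> rho0 a \<noteq> 0"
    using lead_to_ac[OF c(2)] lead_nz[OF place_red unif_nz] by (auto simp: c(1) rho0_def)
next
  fix \<rho> n assume \<rho>: "\<rho> \<in> residue_field K" "\<rho> \<noteq> 0"
  then obtain a where a: "nrm (to_ac a) \<le> 1" "\<rho> = red K (to_ac a)" by (auto simp: residue_field_def int_ring_iff)
  then have "\<not> nrm (to_ac a) < 1" using placeD(4)[OF place_red a(1)] \<rho>(2) by simp
  then have a1: "nrm (to_ac a) = 1" using a(1) by linarith
  then have a0: "a \<noteq> 0" by auto
  have "val K a = 0" using nrm_to_ac[OF a0] a1 by simp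
  define c where "c = a * unif K powi n"
  have c0: "c \<noteq> 0" using a0 unif by (simp add: c_def)
  have vc: "val K c = n" using val_mult[OF a0, of "unif K powi n"] unif \<open>val K a = 0\<close> val_powi_unif by (simp add: c_def)
  have "c / unif K powi n = a" using unif by (simp add: c_def)
  then show "\<exists>a. a \<noteq> 0 \<and> degree a < 1 \<and> nn0 a = n \<and> rho0 a = \<rho>"
    using c0 vc a(2) by (intro exI[of _ "[:c:]"]) (simp add: nn0_def rho0_def)
qed auto

text \<open>No point lies outside \<open>D0\<close>, so \<open>outside\<close> is vacuous and the
  bound only has to exceed 1, the critical norm of \<open>x\<close>; 2 is such a bound. The Bezout
  relation holds with the coefficients 0 and -1 because \<open>ee T 0 = 1\<close>.\<close>

lemma level_0:
  assumes T: "is_type K T 0"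
  shows "level K 1 nn0 rho0 D0 (\<lambda>_. \<pi>) (exp (-1)) (residue_field K) [:0, 1:] (\<lambda>_. 1) 0 1 (ee T 0) (hh T 0) 0 (-1)
    (psi T 0) (zz T 0) 2"
proof -
  interpret stage K 1 nn0 rho0 D0 "\<lambda>_. \<pi>" "exp (-1)" "residue_field K" by (rule stage_0)
  have D0: "fst ` D0 = UNIV"
  proof -
    have "(\<xi>, red K) \<in> D0" for \<xi>
      by (auto simp: D0_def additive_power_def intro!: exI[of _ 1])
    then show ?thesis by force
  qed
  show ?thesis
    by unfold_locales (use T subfldD[OF subfld_residue_field] in \<open>auto simp: D0 lead_1 D_place\<close>)
qed

end

section \<open>The levels of a type\<close>

context local_field
begin

text \<open>Level \<open>0\<close> is treated as a level with \<open>\<phi>\<^sub>0 = x\<close>,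
  \<open>\<ell>\<^sub>0 = 0\<close> and \<open>\<ell>\<^sub>0' = -1\<close>.\<close>

definition phv :: "('k, 'f) type_data \<Rightarrow> nat \<Rightarrow> 'k poly" where "phv T i = (if i = 0 then [:0, 1:] else phi T i)"
definition Vv :: "('k, 'f) type_data \<Rightarrow> nat \<Rightarrow> int" where "Vv T i = (if i = 0 then 0 else vv K T i (phi T i))"
definition lv :: "('k, 'f) type_data \<Rightarrow> nat \<Rightarrow> int" where "lv T i = (if i = 0 then 0 else ell T i)"
definition lv' :: "('k, 'f) type_data \<Rightarrow> nat \<Rightarrow> int" where "lv' T i = (if i = 0 then -1 else ell' T i)"

primrec kpv :: "('k, 'f) type_data \<Rightarrow> nat \<Rightarrow> 'f" where
  "kpv T 0 = 1"
| "kpv T (Suc i) = zz T i powi (lv T i * (Vv T (Suc i) div int (ee T i)))"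

text \<open>A recursive pair, since \<open>w\<close> of the next level is formed from both
  \<open>w\<close> and \<open>\<eta>\<close> of the present one.\<close>

primrec pev :: "('k, 'f) type_data \<Rightarrow> nat \<Rightarrow> ('k alg_closure \<Rightarrow> 'k alg_closure) \<times> ('k alg_closure \<Rightarrow> 'k alg_closure)" where
  "pev T 0 = (\<lambda>_. \<pi>, \<lambda>_. 1)"
| "pev T (Suc i) = (level.w' (fst (pev T i)) (phv T i) (snd (pev T i)) (lv T i) (lv' T i),
     \<lambda>\<xi>. fst (pev T i) \<xi> powi (- (Vv T (Suc i) div int (ee T i))))"

primrec nv :: "('k, 'f) type_data \<Rightarrow> nat \<Rightarrow> 'k poly \<Rightarrow> int" where
  "nv T 0 = nn0"
| "nv T (Suc i) = level.nn' (nv T i) (phv T i) (Vv T i) (ee T i) (hh T i)"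

primrec rv :: "('k, 'f) type_data \<Rightarrow> nat \<Rightarrow> 'k poly \<Rightarrow> 'f" where
  "rv T 0 = rho0"
| "rv T (Suc i) = level.rho' (nv T i) (rv T i) (phv T i) (Vv T i) (kpv T i) (ee T i) (hh T i) (lv T i) (zz T i)"

primrec Dv :: "('k, 'f) type_data \<Rightarrow> nat \<Rightarrow> ('k alg_closure \<times> ('k alg_closure \<Rightarrow> 'f)) set" where
  "Dv T 0 = D0"
| "Dv T (Suc i) = level.D' K (Dv T i) (fst (pev T i)) (phv T i) (snd (pev T i)) (ee T i) (hh T i) (zz T i)"

primrec pv :: "('k, 'f) type_data \<Rightarrow> nat \<Rightarrow> real" where
  "pv T 0 = exp (-1)"
| "pv T (Suc i) = level.q (pv T i) (ee T i)"

text \<open>At positive levels the bound is the norm \<open>W'\<close> of the new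
  \<open>\<phi>\<close>, which is what \<open>key_outside\<close> of the preceding level
  provides.\<close>

primrec Bv :: "('k, 'f) type_data \<Rightarrow> nat \<Rightarrow> real" where
  "Bv T 0 = 2"
| "Bv T (Suc i) = level.q (pv T i) (ee T i) powi Vv T (Suc i)"

abbreviation stage_at :: "('k, 'f) type_data \<Rightarrow> nat \<Rightarrow> bool" where
  "stage_at T i \<equiv> stage K (mm T i) (nv T i) (rv T i) (Dv T i) (fst (pev T i)) (pv T i) (FF K T i)"

abbreviation level_at :: "('k, 'f) type_data \<Rightarrow> nat \<Rightarrow> bool" where
  "level_at T i \<equiv> level K (mm T i) (nv T i) (rv T i) (Dv T i) (fst (pev T i)) (pv T i) (FF K T i) (phv T i)
     (snd (pev T i)) (Vv T i) (kpv T i) (ee T i) (hh T i) (lv T i) (lv' T i) (psi T i) (zz T i) (Bv T i)"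

abbreviation Sv :: "('k, 'f) type_data \<Rightarrow> nat \<Rightarrow> 'k poly \<Rightarrow> nat set" where
  "Sv T i \<equiv> level.S (nv T i) (phv T i) (Vv T i) (ee T i) (hh T i)"

abbreviation resv :: "('k, 'f) type_data \<Rightarrow> nat \<Rightarrow> nat \<Rightarrow> 'k poly \<Rightarrow> 'f poly" where
  "resv T i \<equiv> level.res (nv T i) (rv T i) (phv T i) (Vv T i) (kpv T i) (ee T i) (hh T i)"

text \<open>The polynomial \<open>RR K T 0 g\<close> is indexed from the constant coefficient, so
  its base point is 0; at positive levels the base point is the left end of the component.\<close>

definition bv :: "('k, 'f) type_data \<Rightarrow> nat \<Rightarrow> 'k poly \<Rightarrow> nat" where
  "bv T i g = (if i = 0 then 0 else Min (Sv T i g))"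

text \<open>Together with \<open>rlink\<close> and \<open>vadd\<close> this connects the recursively
  built data with the definitions used in the statement.\<close>

definition vlink :: "('k, 'f) type_data \<Rightarrow> nat \<Rightarrow> bool" where
  "vlink T i \<longleftrightarrow> (\<forall>g. g \<noteq> 0 \<longrightarrow> vv K T i g = nv T i g)"

definition rlink :: "('k, 'f) type_data \<Rightarrow> nat \<Rightarrow> bool" where
  "rlink T i \<longleftrightarrow> (\<forall>g. g \<noteq> 0 \<longrightarrow> RR K T i g = resv T i (bv T i g) g)"

declare kpv.simps [simp del] pev.simps [simp del] nv.simps [simp del] rv.simps [simp del]
  Dv.simps [simp del] pv.simps [simp del] Bv.simps [simp del]

lemma FF_Suc: "FF K T (Suc i) = adjoin_root (FF K T i) (zz T i)"
  by (auto simp: adjoin_root_def)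

lemma level_at_0: "is_type K T 0 \<Longrightarrow> level_at T 0"
  using level_0[of T] by (simp add: phv_def Vv_def lv_def lv'_def kpv.simps pev.simps nv.simps rv.simps
      Dv.simps pv.simps Bv.simps)

lemma stage_at_Suc:
  assumes "level_at T i"
  shows "stage_at T (Suc i)"
proof -
  interpret L: level K "mm T i" "nv T i" "rv T i" "Dv T i" "fst (pev T i)" "pv T i" "FF K T i" "phv T i"
     "snd (pev T i)" "Vv T i" "kpv T i" "ee T i" "hh T i" "lv T i" "lv' T i" "psi T i" "zz T i" "Bv T i" by (rule assms)
  have "mm T (Suc i) = L.m'" by (simp add: L.m'_def L.f_def ff_def)
  then show ?thesis unfolding FF_Suc pev.simps nv.simps rv.simps Dv.simps pv.simps fst_conv
    using L.next_stage by simp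
qed

definition vadd :: "('k, 'f) type_data \<Rightarrow> nat \<Rightarrow> bool" where
  "vadd T i \<longleftrightarrow> (\<forall>a s. a \<noteq> 0 \<longrightarrow> vv K T i (a * phi T i ^ s) = nv T i a + int s * Vv T i)"

lemma exp_supp_X: "exp_supp [:0, 1:] g = {n. coeff g n \<noteq> 0}"
  by (simp add: exp_supp_def expansion_coeff_X)

lemma vlink_1:
  assumes T: "is_type K T 0"
  shows "vlink T 1"
  unfolding vlink_def
proof (intro allI impI)
  fix g :: "'k poly" assume "g \<noteq> 0"
  have eh: "ee T 0 = 1" "hh T 0 = 0" using T by auto
  interpret L: level K "mm T 0" "nv T 0" "rv T 0" "Dv T 0" "fst (pev T 0)" "pv T 0" "FF K T 0" "phv T 0"
     "snd (pev T 0)" "Vv T 0" "kpv T 0" "ee T 0" "hh T 0" "lv T 0" "lv' T 0" "psi T 0" "zz T 0" "Bv T 0"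
    by (rule level_at_0[OF T])
  have "L.N g s = val K (coeff g s)" for s
    unfolding L.N_def unfolding eh by (simp add: nv.simps Vv_def phv_def expansion_coeff_X nn0_def)
  moreover have "L.supp g = {n. coeff g n \<noteq> 0}" by (simp add: phv_def exp_supp_X)
  ultimately have "nv T 1 g = Min ((\<lambda>n. val K (coeff g n)) ` {n. coeff g n \<noteq> 0})"
    unfolding One_nat_def nv.simps(2) L.nn'_def by simp
  then show "vv K T 1 g = nv T 1 g" by (simp add: setcompr_eq_image)
qed

lemma vadd_Suc:
  assumes "level_at T i" "vlink T (Suc i)" and phi: "phi T (Suc i) \<noteq> 0"
  shows "vadd T (Suc i)"
  unfolding vadd_def
proof (intro allI impI)
  fix a :: "'k poly" and s assume a: "a \<noteq> 0"
  interpret L: level K "mm T i" "nv T i" "rv T i" "Dv T i" "fst (pev T i)" "pv T i" "FF K T i" "phv T i"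
     "snd (pev T i)" "Vv T i" "kpv T i" "ee T i" "hh T i" "lv T i" "lv' T i" "psi T i" "zz T i" "Bv T i" by (rule assms(1))
  have V: "Vv T (Suc i) = L.nn' (phi T (Suc i))" using assms(2) phi by (simp add: Vv_def vlink_def nv.simps(2))
  have "vv K T (Suc i) (a * phi T (Suc i) ^ s) = L.nn' (a * phi T (Suc i) ^ s)"
    using assms(2) a phi by (simp add: vlink_def nv.simps(2))
  also have "\<dots> = L.nn' a + int s * L.nn' (phi T (Suc i))" using a phi by (simp add: L.nn'_mult L.nn'_power)
  finally show "vv K T (Suc i) (a * phi T (Suc i) ^ s) = nv T (Suc i) a + int s * Vv T (Suc i)" by (simp add: V nv.simps(2))
qed

lemma vlink_Suc:
  assumes "level_at T (Suc i)" "vadd T (Suc i)"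
  shows "vlink T (Suc (Suc i))"
  unfolding vlink_def
proof (intro allI impI)
  fix g :: "'k poly" assume "g \<noteq> 0"
  let ?i = "Suc i"
  interpret L: level K "mm T ?i" "nv T ?i" "rv T ?i" "Dv T ?i" "fst (pev T ?i)" "pv T ?i" "FF K T ?i" "phv T ?i"
     "snd (pev T ?i)" "Vv T ?i" "kpv T ?i" "ee T ?i" "hh T ?i" "lv T ?i" "lv' T ?i" "psi T ?i" "zz T ?i" "Bv T ?i"
    by (rule assms(1))
  have ph: "phv T ?i = phi T ?i" by (simp add: phv_def)
  have "int (ee T ?i) * vv K T ?i (L.ec g s * phi T ?i ^ s) + int s * int (hh T ?i) = L.N g s"
    if "s \<in> L.supp g" for s
    using assms(2) that unfolding L.N_def vadd_def L.in_supp by simp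
  then have "(\<lambda>s. int (ee T ?i) * vv K T ?i (L.ec g s * phi T ?i ^ s) + int s * int (hh T ?i)) ` L.supp g = L.N g ` L.supp g"
    by (intro image_cong) auto
  moreover have "vv K T (Suc ?i) g = Min ((\<lambda>s. int (ee T ?i) * vv K T ?i (L.ec g s * phi T ?i ^ s) + int s * int (hh T ?i)) ` L.supp g)"
    by (simp add: exp_supp_def ph setcompr_eq_image)
  moreover have "nv T (Suc ?i) g = Min (L.N g ` L.supp g)" unfolding nv.simps(2)[of T ?i] by (rule L.nn'_def)
  ultimately show "vv K T (Suc ?i) g = nv T (Suc ?i) g" by (simp only:)
qed

lemma rlink_0:
  assumes T: "is_type K T 0"
  shows "rlink T 0"
  unfolding rlink_def
proof (intro allI impI)
  fix g :: "'k poly" assume g: "g \<noteq> 0"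
  have eh: "ee T 0 = 1" "hh T 0 = 0" using T by auto
  interpret L: level K "mm T 0" "nv T 0" "rv T 0" "Dv T 0" "fst (pev T 0)" "pv T 0" "FF K T 0" "phv T 0"
     "snd (pev T 0)" "Vv T 0" "kpv T 0" "ee T 0" "hh T 0" "lv T 0" "lv' T 0" "psi T 0" "zz T 0" "Bv T 0"
    by (rule level_at_0[OF T])
  have v1: "vv K T 1 g = L.nn' g" using vlink_1[OF T] g by (simp add: vlink_def nv.simps(2))
  have N: "L.N g s = val K (coeff g s)" for s
    unfolding L.N_def unfolding eh by (simp add: nv.simps Vv_def phv_def expansion_coeff_X nn0_def)
  have supp: "s \<in> L.supp g \<longleftrightarrow> coeff g s \<noteq> 0" for s by (simp add: phv_def exp_supp_X)
  have b: "L.based 0 g" unfolding L.based_def by (simp add: eh)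
  have "RR K T 0 g = L.res 0 g"
  proof (rule poly_eqI)
    fix l
    have r0: "red K 0 = 0" using place_0[OF place_red] .
    have l: "coeff (RR K T 0 g) l = red K (to_ac (coeff g l / unif K powi L.nn' g))"
      using r0 v1 by (simp add: coeff_map_poly)
    have r: "coeff (L.res 0 g) l = (if l \<in> L.S g then L.cc g l else 0)"
      using L.coeff_res[OF b, of l] unfolding add_0 eh(1) mult_1 .
    show "coeff (RR K T 0 g) l = coeff (L.res 0 g) l"
    proof (cases "l \<in> L.supp g")
      case False
      then have "coeff g l = 0" by (simp add: supp)
      then show ?thesis using False r0 L.S_supp unfolding l r by auto
    next
      case True
      then have c: "coeff g l \<noteq> 0" by (simp add: supp)
      show ?thesis
      proof (cases "l \<in> L.S g")
        case True
        then have "L.nn' g = val K (coeff g l)" unfolding L.S_def N by simp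
        moreover have "L.cc g l = rho0 [:coeff g l:]"
          unfolding L.cc_def by (simp add: phv_def expansion_coeff_X rv.simps kpv.simps)
        ultimately show ?thesis unfolding l r using True by (simp add: rho0_def)
      next
        case False
        then have "L.nn' g < val K (coeff g l)" using L.N_ge[OF \<open>l \<in> L.supp g\<close>] \<open>l \<in> L.supp g\<close> unfolding L.S_def N by simp
        then have "nrm (to_ac (coeff g l / unif K powi L.nn' g)) < 1"
          using nrm_to_ac[OF c] by (simp add: nrm_divide to_ac_powi nrm_powi nrm_unif exp_powi)
        then show ?thesis unfolding l r using False place_small[OF place_red] by simp
      qed
    qed
  qed
  then show "RR K T 0 g = resv T 0 (bv T 0 g) g" by (simp add: bv_def)
qed

lemma newton_eq:
  assumes "level_at T i" "vadd T i" "0 < i" "g \<noteq> 0"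
  shows "newton K T i g = lower_hull (polygon.P (exp_supp (phi T i) g) (level.ord (nv T i) (phv T i) (Vv T i) g))"
    and "s \<in> exp_supp (phi T i) g \<Longrightarrow> newton_point K T i g s = (real s, level.ord (nv T i) (phv T i) (Vv T i) g s)"
proof -
  interpret L: level K "mm T i" "nv T i" "rv T i" "Dv T i" "fst (pev T i)" "pv T i" "FF K T i" "phv T i"
     "snd (pev T i)" "Vv T i" "kpv T i" "ee T i" "hh T i" "lv T i" "lv' T i" "psi T i" "zz T i" "Bv T i" by (rule assms(1))
  have ph: "phv T i = phi T i" using assms(3) by (simp add: phv_def)
  have pt: "newton_point K T i g s = (real s, L.ord g s)" if "s \<in> exp_supp (phi T i) g" for s
    using assms(2) that unfolding newton_point_def L.ord_def unfolding ph vadd_def exp_supp_def by simp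
  then show "s \<in> exp_supp (phi T i) g \<Longrightarrow> newton_point K T i g s = (real s, L.ord g s)" .
  have eq: "{newton_point K T i g s |s. expansion_coeff (phi T i) g s \<noteq> 0} = {(real s, L.ord g s) | s. s \<in> exp_supp (phi T i) g}"
    using pt by (force simp: exp_supp_def)
  interpret polygon "exp_supp (phi T i) g" "L.ord g" using L.ord_polygon[OF assms(4)] unfolding ph .
  show "newton K T i g = lower_hull (polygon.P (exp_supp (phi T i) g) (L.ord g))"
    unfolding newton_def P_def eq ..
qed

lemma newton_side:
  assumes "level_at T i" "vadd T i" "0 < i" "0 < hh T i" "g \<noteq> 0"
  shows "left_abscissa (slope_component (slope T i) (newton K T i g)) = Min (Sv T i g)"
    and "right_abscissa (slope_component (slope T i) (newton K T i g)) = Max (Sv T i g)"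
    and "slope_component (slope T i) (newton_neg K T i g) = slope_component (slope T i) (newton K T i g)"
    and "s \<in> exp_supp (phi T i) g \<Longrightarrow> Min (Sv T i g) \<le> s \<Longrightarrow> s \<le> Max (Sv T i g) \<Longrightarrow>
      newton_point K T i g s \<in> newton_neg K T i g \<longleftrightarrow> s \<in> Sv T i g"
    and "real (Min (Sv T i g)) \<le> x \<Longrightarrow> x \<le> real (Max (Sv T i g)) \<Longrightarrow>
      (THE y. (x, y) \<in> newton_neg K T i g) = real_of_int (nv T (Suc i) g) / real (ee T i) - real (hh T i) / real (ee T i) * x"
proof -
  interpret L: level K "mm T i" "nv T i" "rv T i" "Dv T i" "fst (pev T i)" "pv T i" "FF K T i" "phv T i"
     "snd (pev T i)" "Vv T i" "kpv T i" "ee T i" "hh T i" "lv T i" "lv' T i" "psi T i" "zz T i" "Bv T i" by (rule assms(1))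
  have ph: "phv T i = phi T i" using assms(3) by (simp add: phv_def)
  interpret Q: polygon "L.supp g" "L.ord g" by (rule L.ord_polygon[OF assms(5)])
  note nw = newton_eq[OF assms(1-3,5), folded ph]
  have sl: "slope T i = - (real (hh T i) / real (ee T i))" by (simp add: slope_def)
  have neg: "slope T i < 0" using assms(4) L.e_pos by (simp add: sl)
  have side: "Q.side (slope T i) = L.S g" unfolding sl by (rule L.polygon_side[OF assms(5)])
  have mu: "Q.mu (slope T i) = real_of_int (nv T (Suc i) g) / real (ee T i)"
    unfolding sl nv.simps by (rule L.polygon_mu[OF assms(5)])
  show "left_abscissa (slope_component (slope T i) (newton K T i g)) = Min (L.S g)"
    "right_abscissa (slope_component (slope T i) (newton K T i g)) = Max (L.S g)"
    using Q.abscissas[of "slope T i"] unfolding nw(1) side by auto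
  show "slope_component (slope T i) (newton_neg K T i g) = slope_component (slope T i) (newton K T i g)"
    unfolding newton_neg_def nw(1) by (rule Q.negative_part_component[OF neg])
  show "newton_point K T i g s \<in> newton_neg K T i g \<longleftrightarrow> s \<in> L.S g"
    if "s \<in> exp_supp (phi T i) g" "Min (L.S g) \<le> s" "s \<le> Max (L.S g)"
  proof -
    have "s \<in> L.supp g" using that(1) by (simp add: ph)
    then show ?thesis using Q.on_negative_part[OF neg, of s] that(2,3)
      unfolding newton_neg_def nw(1) nw(2)[OF \<open>s \<in> L.supp g\<close>] side by blast
  qed
  show "(THE y. (x, y) \<in> newton_neg K T i g) = real_of_int (nv T (Suc i) g) / real (ee T i) - real (hh T i) / real (ee T i) * x"
    if "real (Min (L.S g)) \<le> x" "x \<le> real (Max (L.S g))"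
    using Q.ordinate[OF neg, of x] that unfolding newton_neg_def nw(1) side mu by (simp add: sl)
qed

end

lemma irreducible_over_root_0:
  assumes A: "subfld A" and psi: "irreducible_over A \<psi>" "lead_coeff \<psi> = 1" "poly \<psi> 0 = 0"
  shows "\<psi> = [:0, 1:]"
proof -
  have "[:0, 1:] \<in> polys_over A" using A by (intro polys_over_pCons) (auto simp: subfldD polys_over_0)
  then have "\<psi> dvd [:0, 1:]" using irreducible_over_dvd[OF A psi(1,3)] by simp
  then have "degree \<psi> \<le> 1" using dvd_imp_degree_le[of \<psi> "[:0, 1:]"] by simp
  moreover have "degree \<psi> > 0" using psi(1) by (simp add: irreducible_over_def)
  ultimately have d: "degree \<psi> = 1" by simp
  obtain a p where p: "\<psi> = pCons a p" by (rule pCons_cases)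
  then have "degree p = 0" using d by (simp split: if_splits)
  then obtain b where "\<psi> = [:a, b:]" using p by (auto elim: degree_eq_zeroE)
  then show ?thesis using psi(2,3) d by simp
qed

context local_field
begin

lemma ee_0: "is_type K T i \<Longrightarrow> ee T 0 = 1"
  by (induction i) auto

lemma based_bv:
  assumes "level_at T i" "is_type K T i" "g \<noteq> 0"
  shows "level.based (nv T i) (phv T i) (Vv T i) (ee T i) (hh T i) (bv T i g) g"
proof -
  interpret L: level K "mm T i" "nv T i" "rv T i" "Dv T i" "fst (pev T i)" "pv T i" "FF K T i" "phv T i"
     "snd (pev T i)" "Vv T i" "kpv T i" "ee T i" "hh T i" "lv T i" "lv' T i" "psi T i" "zz T i" "Bv T i" by (rule assms(1))
  show "L.based (bv T i g) g"
  proof (cases "i = 0")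
    case True
    then show ?thesis unfolding L.based_def using ee_0[OF assms(2)] by (simp add: bv_def)
  next
    case False
    then show ?thesis using L.based_Min[OF assms(3)] by (simp add: bv_def)
  qed
qed

lemma key_phi:
  assumes "level_at T i" "is_type K T i" "rlink T i" "representative K T i p"
  shows "level.key (mm T i) (nv T i) (rv T i) (phv T i) (Vv T i) (kpv T i) (ee T i) (hh T i) (psi T i) p"
proof -
  interpret L: level K "mm T i" "nv T i" "rv T i" "Dv T i" "fst (pev T i)" "pv T i" "FF K T i" "phv T i"
     "snd (pev T i)" "Vv T i" "kpv T i" "ee T i" "hh T i" "lv T i" "lv' T i" "psi T i" "zz T i" "Bv T i" by (rule assms(1))
  have p: "lead_coeff p = 1" "degree p = mm T (Suc i)" "eq_up_to_const (RR K T i p) (psi T i)"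
    using assms(4) by (auto simp: representative_def)
  have p0: "p \<noteq> 0" using p(1) by auto
  obtain c where c: "c \<noteq> 0" "resv T i (bv T i p) p = smult c (psi T i)"
    using p(3) assms(3) p0 by (auto simp: eq_up_to_const_def rlink_def)
  have d: "degree p = L.m'" using p(2) by (simp add: L.m'_def L.f_def ff_def)
  show ?thesis by (rule L.key_from_res[OF p(1) d based_bv[OF assms(1,2) p0] c(2,1)])
qed

text \<open>Makes the divisions in \<open>kpv\<close> and \<open>pev\<close> exact: the value of a
  key polynomial is a multiple of \<open>e\<close>.\<close>

lemma Vv_Suc:
  assumes "level_at T i" "is_type K T i" "rlink T i" "representative K T i (phi T (Suc i))" "vlink T (Suc i)"
  shows "Vv T (Suc i) = int (ee T i) * (Vv T (Suc i) div int (ee T i))"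
proof -
  interpret L: level K "mm T i" "nv T i" "rv T i" "Dv T i" "fst (pev T i)" "pv T i" "FF K T i" "phv T i"
     "snd (pev T i)" "Vv T i" "kpv T i" "ee T i" "hh T i" "lv T i" "lv' T i" "psi T i" "zz T i" "Bv T i" by (rule assms(1))
  have key: "L.key (phi T (Suc i))" by (rule key_phi[OF assms(1-4)])
  have "Vv T (Suc i) = L.nn' (phi T (Suc i))"
    using assms(5) L.key_nz[OF key] by (simp add: Vv_def vlink_def nv.simps(2))
  also have "\<dots> = int (ee T i) * (int L.f * (int (ee T i) * Vv T i + int (hh T i)))"
    using key unfolding L.key_def by blast
  finally show ?thesis by simp
qed

lemma level_at_Suc:
  assumes "level_at T i" "is_type K T (Suc i)" "rlink T i" "vlink T (Suc i)"
  shows "level_at T (Suc i)"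
proof -
  interpret L: level K "mm T i" "nv T i" "rv T i" "Dv T i" "fst (pev T i)" "pv T i" "FF K T i" "phv T i"
     "snd (pev T i)" "Vv T i" "kpv T i" "ee T i" "hh T i" "lv T i" "lv' T i" "psi T i" "zz T i" "Bv T i" by (rule assms(1))
  interpret S: stage K "mm T (Suc i)" "nv T (Suc i)" "rv T (Suc i)" "Dv T (Suc i)" "fst (pev T (Suc i))" "pv T (Suc i)" "FF K T (Suc i)"
    by (rule stage_at_Suc[OF assms(1)])
  let ?\<phi> = "phi T (Suc i)"
  have T: "is_type K T i" "representative K T i ?\<phi>" "0 < hh T (Suc i)" "0 < ee T (Suc i)"
    "coprime (hh T (Suc i)) (ee T (Suc i))"
    "ell T (Suc i) * int (hh T (Suc i)) - ell' T (Suc i) * int (ee T (Suc i)) = 1"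
    "irreducible_over (FF K T (Suc i)) (psi T (Suc i))" "lead_coeff (psi T (Suc i)) = 1"
    "psi T (Suc i) \<noteq> [:0, 1:]" "poly (psi T (Suc i)) (zz T (Suc i)) = 0"
    using assms(2) unfolding is_type.simps by blast+
  have key: "L.key ?\<phi>" by (rule key_phi[OF assms(1) T(1) assms(3) T(2)])
  have ph: "phv T (Suc i) = ?\<phi>" by (simp add: phv_def)
  have V: "Vv T (Suc i) = L.nn' ?\<phi>"
    using assms(4) L.key_nz[OF key] by (simp add: Vv_def vlink_def nv.simps(2))
  note V_e = Vv_Suc[OF assms(1) T(1) assms(3) T(2) assms(4)]
  have zA: "zz T i \<in> FF K T (Suc i)" unfolding FF_Suc by (rule adjoin_root_gen[OF L.A(1)])
  have q: "pv T (Suc i) = L.q" by (simp only: pv.simps)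
  have W: "S.W g = L.W' g" for g unfolding S.W_def unfolding L.W'_def unfolding q nv.simps(2) ..
  have D: "Dv T (Suc i) = L.D'" by (simp only: Dv.simps)
  show ?thesis
  proof unfold_locales
    show "lead_coeff (phv T (Suc i)) = 1" "degree (phv T (Suc i)) = mm T (Suc i)"
      using T(2) unfolding ph representative_def by blast+
    show "0 < ee T (Suc i)" "coprime (hh T (Suc i)) (ee T (Suc i))" by (rule T)+
    show "lv T (Suc i) * int (hh T (Suc i)) - lv' T (Suc i) * int (ee T (Suc i)) = 1"
      using T(6) by (simp add: lv_def lv'_def)
    show "lead r (fst (pev T (Suc i)) \<xi>) (snd (pev T (Suc i)) \<xi>) (- Vv T (Suc i)) (kpv T (Suc i))"
      if "(\<xi>, r) \<in> Dv T (Suc i)" for \<xi> r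
      using L.lead_eta[OF that[unfolded D] V_e] unfolding pev.simps(2) kpv.simps(2) fst_conv snd_conv .
    show "kpv T (Suc i) \<in> FF K T (Suc i)" unfolding kpv.simps by (rule subfld_powi[OF S.A(1) zA])
    show "kpv T (Suc i) \<noteq> 0" unfolding kpv.simps using L.z_eq_0 by (cases "zz T i = 0") auto
    show "irreducible_over (FF K T (Suc i)) (psi T (Suc i))" "lead_coeff (psi T (Suc i)) = 1"
      "poly (psi T (Suc i)) (zz T (Suc i)) = 0" by (rule T)+
    \<comment> \<open>At positive levels \<open>\<psi>\<close> differs from \<open>y\<close>, so the
      premise is contradictory.\<close>
    show "ee T (Suc i) = 1 \<and> hh T (Suc i) = 0 \<and> lv T (Suc i) = 0" if "zz T (Suc i) = 0"
      using irreducible_over_root_0[OF S.A(1) T(7,8)] T(9,10) that by simp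
    \<comment> \<open>The base is less than 1 and \<open>h / e\<close> is positive, so the critical
      norm of \<open>\<phi>\<close> is strictly below its norm \<open>W'\<close> from the previous
      level.\<close>
    have "pv T (Suc i) powi Vv T (Suc i) = pv T (Suc i) powr real_of_int (Vv T (Suc i))"
      by (rule powr_real_of_int'[symmetric]) (use S.p_pos in auto)
    moreover have "pv T (Suc i) powr (real_of_int (Vv T (Suc i)) + real (hh T (Suc i)) / real (ee T (Suc i)))
        < pv T (Suc i) powr real_of_int (Vv T (Suc i))"
      using T(3,4) S.p_pos S.p_less_1 by (intro powr_less_mono') auto
    ultimately show "pv T (Suc i) powr (real_of_int (Vv T (Suc i)) + real (hh T (Suc i)) / real (ee T (Suc i))) < Bv T (Suc i)"
      by (simp only: Bv.simps q)
  next
    fix \<xi> assume "\<xi> \<notin> fst ` Dv T (Suc i)"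
    from L.key_outside[OF key this[unfolded D]] obtain t where t: "t \<ge> 1" "\<forall>g. nrm (ev g \<xi>) \<le> L.W' g * t ^ degree g"
      "L.W' ?\<phi> * t ^ L.m' \<le> nrm (ev ?\<phi> \<xi>)" by blast
    have "L.m' = mm T (Suc i)" by (simp add: L.m'_def L.f_def ff_def)
    moreover have "Bv T (Suc i) = L.W' ?\<phi>" unfolding Bv.simps V L.W'_def using L.key_nz[OF key] by simp
    ultimately show "\<exists>t\<ge>1. (\<forall>a. degree a < mm T (Suc i) \<longrightarrow> nrm (ev a \<xi>) \<le> S.W a * t ^ degree a) \<and>
        Bv T (Suc i) * t ^ mm T (Suc i) \<le> nrm (ev (phv T (Suc i)) \<xi>)"
      using t by (intro exI[of _ t]) (auto simp: W ph)
  qed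
qed

text \<open>Both residual polynomials have leading residues of the same expansion coefficients as
  their coefficients. The exponents of \<open>z\<close> differ by a multiple of \<open>s\<close>,
  which comes from the value of \<open>phi T (Suc i) ^ s\<close> in \<open>tt\<close>, and the
  denominator \<open>kpv T (Suc i) ^ s\<close> in \<open>cc\<close> accounts for exactly
  this.\<close>

lemma rlink_Suc:
  assumes "level_at T i" "level_at T (Suc i)" "is_type K T (Suc i)" "rlink T i"
    and "vlink T (Suc i)" "vadd T (Suc i)" "0 < i \<Longrightarrow> vadd T i"
  shows "rlink T (Suc i)"
  unfolding rlink_def
proof (intro allI impI)
  fix g :: "'k poly" assume g: "g \<noteq> 0"
  let ?i = "Suc i"
  interpret L: level K "mm T i" "nv T i" "rv T i" "Dv T i" "fst (pev T i)" "pv T i" "FF K T i" "phv T i"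
     "snd (pev T i)" "Vv T i" "kpv T i" "ee T i" "hh T i" "lv T i" "lv' T i" "psi T i" "zz T i" "Bv T i" by (rule assms(1))
  interpret M: level K "mm T ?i" "nv T ?i" "rv T ?i" "Dv T ?i" "fst (pev T ?i)" "pv T ?i" "FF K T ?i" "phv T ?i"
     "snd (pev T ?i)" "Vv T ?i" "kpv T ?i" "ee T ?i" "hh T ?i" "lv T ?i" "lv' T ?i" "psi T ?i" "zz T ?i" "Bv T ?i"
    by (rule assms(2))
  have T: "is_type K T i" "representative K T i (phi T ?i)" "0 < hh T ?i" using assms(3) by (simp_all only: is_type.simps)
  have ph: "phv T ?i = phi T ?i" by (simp add: phv_def)
  note V_e = Vv_Suc[OF assms(1) T(1) assms(4) T(2) assms(5)]
  note side = newton_side[OF assms(2,6) zero_less_Suc T(3) g]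
  define c where "c s = (let a = expansion_coeff (phi T ?i) g s in
      if a \<noteq> 0 \<and> newton_point K T ?i g s \<in> newton_neg K T ?i g
      then zz T i powi tt K T i g s * poly (RR K T i a) (zz T i) else 0)" for s
  define b where "b = Min (M.S g)"
  define d where "d = (Max (M.S g) - b) div ee T ?i"
  have RR: "RR K T ?i g = (\<Sum>j\<le>d. monom (c (b + j * ee T ?i)) j)"
    by (simp only: RR.simps c_def Let_def side b_def d_def)
  have "c s = M.cc g s" if s: "s \<in> M.S g" for s
  proof -
    define a where "a = M.ec g s"
    have a0: "a \<noteq> 0" using M.S_supp[OF s] by (simp add: a_def M.in_supp)
    have "s \<in> exp_supp (phi T ?i) g" using M.S_supp[OF s] by (simp only: ph)
    from side(4)[OF this] s have "newton_point K T ?i g s \<in> newton_neg K T ?i g" by simp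
    then have c: "c s = zz T i powi tt K T i g s * poly (RR K T i a) (zz T i)"
      using a0 by (simp add: c_def a_def ph)
    have RRa: "RR K T i a = L.res (bv T i a) a" using assms(4) a0 by (simp add: rlink_def)
    have cc: "M.cc g s = L.rho' a / kpv T ?i ^ s" unfolding M.cc_def unfolding a_def rv.simps(2) ..
    have u: "vv K T ?i (a * phi T ?i ^ s) = nv T ?i a + int s * Vv T ?i" using assms(6) a0 by (simp add: vadd_def)
    show ?thesis
    proof (cases "i = 0")
      case True
      have "L.rho' a = poly (L.res 0 a) (zz T i)"
        by (rule L.rho'_base_0[OF a0]) (use True ee_0[OF T(1)] in \<open>auto simp: lv_def\<close>)
      moreover have "kpv T ?i = 1" by (simp add: kpv.simps lv_def True)
      moreover have "bv T i a = 0" by (simp add: bv_def True)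
      moreover have "tt K T i g s = 0" by (simp add: tt_def True)
      ultimately show ?thesis unfolding c cc RRa by simp
    next
      case False
      have hi: "0 < hh T i" using False T(1) by (cases i) auto
      have "0 < i" using False by simp
      note side_i = newton_side[OF assms(1) assms(7)[OF \<open>0 < i\<close>] \<open>0 < i\<close> hi a0]
      have z0: "zz T i \<noteq> 0" using L.z_eq_0 hi by auto
      define k where "k = Vv T ?i div int (ee T i)"
      have l: "lv T i = ell T i" using False by (simp add: lv_def)
      have "tt K T i g s = (int (Min (L.S a)) - ell T i * vv K T ?i (a * phi T ?i ^ s)) div int (ee T i)"
        unfolding tt_def a_def ph using False side_i(1)[unfolded a_def ph] by (simp add: Let_def)
      also have "int (Min (L.S a)) - ell T i * vv K T ?i (a * phi T ?i ^ s) =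
          (int (Min (L.S a)) - ell T i * nv T ?i a) + int (ee T i) * (- (ell T i * int s * k))"
        unfolding u V_e[folded k_def] by (simp add: algebra_simps)
      also have "\<dots> div int (ee T i) = (int (Min (L.S a)) - ell T i * nv T ?i a) div int (ee T i) - ell T i * int s * k"
        using L.e_pos by (subst div_mult_self2) auto
      finally have tt: "tt K T i g s = (int (Min (L.S a)) - ell T i * L.nn' a) div int (ee T i) - (ell T i * k) * int s"
        by (simp only: nv.simps(2) mult_ac)
      have kp: "kpv T ?i ^ s = zz T i powi ((ell T i * k) * int s)"
        unfolding kpv.simps power_int_mult power_int_of_nat by (simp add: l k_def power_int_mult)
      have "bv T i a = Min (L.S a)" using False by (simp add: bv_def)
      then show ?thesis unfolding c cc RRa unfolding L.rho'_def unfolding tt kp l using z0 by (simp add: power_int_diff)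
    qed
  qed
  moreover have "c s = 0" if "s \<notin> M.S g" "b \<le> s" "s \<le> Max (M.S g)" for s
  proof (cases "s \<in> exp_supp (phi T ?i) g")
    case True
    then show ?thesis using side(4)[OF True] that by (simp add: c_def Let_def b_def)
  next
    case False
    then show ?thesis by (simp add: c_def exp_supp_def)
  qed
  ultimately have cS: "c s = (if s \<in> M.S g then M.cc g s else 0)" if "b \<le> s" "s \<le> Max (M.S g)" for s
    using that by auto
  have based: "M.based b g" unfolding b_def by (rule M.based_Min[OF g])
  have "RR K T ?i g = M.res b g"
  proof (rule poly_eqI)
    fix j
    have coeff: "coeff (RR K T ?i g) j = (if j \<le> d then c (b + j * ee T ?i) else 0)"
      unfolding RR by (simp add: coeff_sum)
    show "coeff (RR K T ?i g) j = coeff (M.res b g) j"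
    proof (cases "j \<le> d")
      case True
      have "Max (M.S g) \<in> M.S g" using M.S_nonempty[OF g] by simp
      then have b_le: "b \<le> Max (M.S g)" by (simp add: b_def)
      have "j * ee T ?i \<le> d * ee T ?i" using True by simp
      also have "\<dots> \<le> Max (M.S g) - b" unfolding d_def by simp
      finally have "b + j * ee T ?i \<le> Max (M.S g)" using b_le by simp
      then show ?thesis unfolding coeff M.coeff_res[OF based] using True cS[of "b + j * ee T ?i"]
        by (simp add: mult.commute)
    next
      case False
      then have "(Max (M.S g) - b) div ee T ?i < j" by (simp add: d_def)
      then have "Max (M.S g) - b < j * ee T ?i" using M.e_pos by (simp add: div_less_iff_less_mult)
      then have "Max (M.S g) < b + ee T ?i * j" by (simp add: mult.commute)
      then have "b + ee T ?i * j \<notin> M.S g" using Max_ge[OF M.finite_S] by (meson not_le)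
      then show ?thesis unfolding coeff M.coeff_res[OF based] using False by simp
    qed
  qed
  then show "RR K T ?i g = resv T ?i (bv T ?i g) g" by (simp add: bv_def b_def)
qed

text \<open>The claims need each other: the link of the residual polynomials shows that the next
  representative is a key polynomial, and the level built on it provides the next links.\<close>

lemma levels:
  "is_type K T i \<Longrightarrow> level_at T i \<and> rlink T i \<and> vlink T (Suc i) \<and> (0 < i \<longrightarrow> vadd T i)"
proof (induction i)
  case 0
  then show ?case using level_at_0 rlink_0 vlink_1 by simp
next
  case (Suc i)
  have T: "is_type K T i" "representative K T i (phi T (Suc i))" using Suc.prems by (simp_all only: is_type.simps)
  note IH = Suc.IH[OF T(1)]
  have "lead_coeff (phi T (Suc i)) = 1" using T(2) unfolding representative_def by blast
  then have phi0: "phi T (Suc i) \<noteq> 0" by auto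
  have lev: "level_at T (Suc i)" using level_at_Suc Suc.prems IH by blast
  have va: "vadd T (Suc i)" using vadd_Suc[OF _ _ phi0] IH by blast
  have "rlink T (Suc i)" using rlink_Suc[of T i] lev va Suc.prems IH by blast
  moreover have "vlink T (Suc (Suc i))" by (rule vlink_Suc[OF lev va])
  ultimately show ?case using lev va by blast
qed

end

section \<open>Orthogonal bases\<close>

text \<open>A nonzero combination of \<open>q\<close> and \<open>F\<close> of least degree divides
  both. It is a unit because \<open>F\<close> is irreducible and does not divide
  \<open>q\<close>.\<close>

lemma ev_inverse:
  fixes F :: "'k::field poly"
  assumes F: "irreducible F" "ev F \<theta> = 0" and q: "ev q \<theta> \<noteq> 0"
  shows "\<exists>p. ev p \<theta> * ev q \<theta> = 1"
proof -
  define I where "I = {d. d \<noteq> 0 \<and> (\<exists>a b. d = a * q + b * F)}"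
  define d where "d = arg_min degree (\<lambda>d. d \<in> I)"
  have "q \<noteq> 0" using q by auto
  moreover have "q = 1 * q + 0 * F" by simp
  ultimately have "q \<in> I" unfolding I_def by blast
  then have dI: "d \<in> I" unfolding d_def by (rule arg_min_natI)
  have dmin: "degree d \<le> degree g" if "g \<in> I" for g unfolding d_def using that by (rule arg_min_nat_le)
  obtain a b where ab: "d = a * q + b * F" and d0: "d \<noteq> 0" using dI by (auto simp: I_def)
  have dvd: "d dvd g" if "g = a' * q + b' * F" for g a' b'
  proof -
    have "g mod d = (a' - (g div d) * a) * q + (b' - (g div d) * b) * F"
      unfolding minus_div_mult_eq_mod[symmetric] that(1) by (subst (2) ab) (simp add: algebra_simps that(1)[symmetric])
    moreover have "g mod d = 0 \<or> degree (g mod d) < degree d" by (rule degree_mod_less[OF d0])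
    ultimately have "g mod d = 0" using dmin[of "g mod d"] by (force simp: I_def)
    then show ?thesis by auto
  qed
  have "d dvd F" by (rule dvd[of F 0 1]) simp
  then obtain c where c: "F = d * c" by (elim dvdE)
  have "\<not> is_unit c"
  proof
    assume "is_unit c"
    then have "F dvd d" using c by (metis dvd_refl mult_unit_dvd_iff)
    moreover have "d dvd q" by (rule dvd[of q 1 0]) simp
    ultimately obtain u where "q = F * u" by (meson dvdE dvd_trans)
    then show False using q F(2) by (simp add: ev_mult)
  qed
  then have "is_unit d" using Factorial_Ring.irreducibleD[OF F(1) c] by blast
  then obtain k where k: "d = [:k:]" "k \<noteq> 0" using d0 by (auto simp: is_unit_poly_iff)
  have "to_ac k = ev a \<theta> * ev q \<theta>"
  proof -
    have "to_ac k = ev d \<theta>" by (simp add: k)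
    also have "\<dots> = ev a \<theta> * ev q \<theta>" by (subst ab) (simp add: ev_add ev_mult F(2))
    finally show ?thesis .
  qed
  then have "ev (smult (inverse k) a) \<theta> * ev q \<theta> = to_ac (inverse k) * to_ac k"
    by (simp add: ev_smult mult.assoc)
  also have "\<dots> = 1" using k(2) by (metis left_inverse to_ac_1 to_ac_mult)
  finally have "ev (smult (inverse k) a) \<theta> * ev q \<theta> = 1" .
  then show ?thesis by blast
qed

lemma adjoin_eq:
  fixes F :: "'k::field poly"
  assumes F: "irreducible F" "ev F \<theta> = 0"
  shows "adjoin \<theta> = range (\<lambda>g. ev g \<theta>)"
proof
  show "range (\<lambda>g. ev g \<theta>) \<subseteq> adjoin \<theta>"
  proof
    fix x assume "x \<in> range (\<lambda>g. ev g \<theta>)"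
    then obtain g where "x = ev g \<theta>" by blast
    then have "x = ev g \<theta> / ev 1 \<theta> \<and> ev 1 \<theta> \<noteq> 0" by simp
    then show "x \<in> adjoin \<theta>" unfolding adjoin_def ev_def by blast
  qed
  show "adjoin \<theta> \<subseteq> range (\<lambda>g. ev g \<theta>)"
  proof
    fix x assume "x \<in> adjoin \<theta>"
    then obtain p q where pq: "x = ev p \<theta> / ev q \<theta>" "ev q \<theta> \<noteq> 0" by (auto simp: adjoin_def ev_def)
    obtain p' where "ev p' \<theta> * ev q \<theta> = 1" using ev_inverse[OF F pq(2)] by blast
    then have "inverse (ev q \<theta>) = ev p' \<theta>" by (intro inverse_unique) (simp add: mult.commute)
    then have "x = ev (p * p') \<theta>" using pq by (simp add: ev_mult divide_inverse)
    then show "x \<in> range (\<lambda>g. ev g \<theta>)" by blast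
  qed
qed

text \<open>Passes from an injectively indexed family to the set of its members, for which
  \<open>is_basis\<close> asks for extensional coefficient functions.\<close>

lemma is_basis_image:
  fixes Q :: "'i \<Rightarrow> 'a::comm_ring_1"
  assumes J: "finite J" and QM: "\<And>j. j \<in> J \<Longrightarrow> Q j \<in> M" and inj: "inj_on Q J"
    and closed: "\<And>c. (\<And>j. j \<in> J \<Longrightarrow> c j \<in> A) \<Longrightarrow> (\<Sum>j\<in>J. c j * Q j) \<in> M"
    and span: "\<And>m. m \<in> M \<Longrightarrow> \<exists>c. (\<forall>j\<in>J. c j \<in> A) \<and> m = (\<Sum>j\<in>J. c j * Q j)"
    and indep: "\<And>c c' j. (\<And>j. j \<in> J \<Longrightarrow> c j \<in> A \<and> c' j \<in> A) \<Longrightarrow>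
      (\<Sum>j\<in>J. c j * Q j) = (\<Sum>j\<in>J. c' j * Q j) \<Longrightarrow> j \<in> J \<Longrightarrow> c j = c' j"
  shows "is_basis A M (Q ` J)"
proof -
  have re: "(\<Sum>b\<in>Q ` J. c b * b) = (\<Sum>j\<in>J. c (Q j) * Q j)" for c :: "'a \<Rightarrow> 'a"
    by (simp add: sum.reindex[OF inj])
  have "\<exists>!c. c \<in> Q ` J \<rightarrow>\<^sub>E A \<and> m = (\<Sum>b\<in>Q ` J. c b * b)" if m: "m \<in> M" for m
  proof (rule ex_ex1I)
    obtain c where c: "\<forall>j\<in>J. c j \<in> A" "m = (\<Sum>j\<in>J. c j * Q j)" using span[OF m] by blast
    define c' where "c' = restrict (\<lambda>b. c (the_inv_into J Q b)) (Q ` J)"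
    have c'Q: "c' (Q j) = c j" if "j \<in> J" for j using that inj by (simp add: c'_def the_inv_into_f_f)
    have "c' \<in> Q ` J \<rightarrow>\<^sub>E A" using c(1) inj by (auto simp: c'_def the_inv_into_f_f)
    moreover have "m = (\<Sum>b\<in>Q ` J. c' b * b)" unfolding re c(2) by (intro sum.cong) (simp_all add: c'Q)
    ultimately show "\<exists>c. c \<in> Q ` J \<rightarrow>\<^sub>E A \<and> m = (\<Sum>b\<in>Q ` J. c b * b)" by blast
  next
    fix c c' assume c: "c \<in> Q ` J \<rightarrow>\<^sub>E A \<and> m = (\<Sum>b\<in>Q ` J. c b * b)" "c' \<in> Q ` J \<rightarrow>\<^sub>E A \<and> m = (\<Sum>b\<in>Q ` J. c' b * b)"
    have "c (Q j) = c' (Q j)" if "j \<in> J" for j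
      using indep[of "\<lambda>j. c (Q j)" "\<lambda>j. c' (Q j)" j] c that unfolding re by (auto simp: PiE_def Pi_def)
    then show "c = c'" using c by (intro PiE_ext[of _ "Q ` J" "\<lambda>_. A"]) auto
  qed
  moreover have "(\<Sum>b\<in>Q ` J. c b * b) \<in> M" if "c \<in> Q ` J \<rightarrow>\<^sub>E A" for c
    unfolding re using that by (intro closed) auto
  ultimately show ?thesis using J QM by (auto simp: is_basis_def)
qed

lemma subfield_type_algebra: "subfld A \<Longrightarrow> subfield A (ring_of_type_algebra :: 'a::field ring)"
proof -
  assume A: "subfld A"
  interpret R: field "ring_of_type_algebra :: 'a ring" by (rule field_from_type_algebra)
  have inv: "inv\<^bsub>ring_of_type_algebra\<^esub> x = inverse x" if "x \<noteq> 0" for x :: 'a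
    by (rule R.comm_inv_char) (use that in \<open>auto simp: ring_of_type_algebra_def\<close>)
  have neg: "\<ominus>\<^bsub>ring_of_type_algebra\<^esub> x = - x" for x :: 'a
    by (rule R.minus_equality) (auto simp: ring_of_type_algebra_def)
  show ?thesis
  proof (rule R.subfieldI')
    show "subring A ring_of_type_algebra"
    proof (rule R.subringI)
      show "\<And>h. h \<in> A \<Longrightarrow> \<ominus>\<^bsub>ring_of_type_algebra\<^esub> h \<in> A" unfolding neg using subfldD[OF A] by simp
    qed (use subfldD[OF A] in \<open>auto simp: ring_of_type_algebra_def\<close>)
    fix k assume "k \<in> A - {\<zero>\<^bsub>ring_of_type_algebra\<^esub>}"
    then show "inv\<^bsub>ring_of_type_algebra\<^esub> k \<in> A" using A inv[of k] by (auto simp: ring_of_type_algebra_def subfldD)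
  qed
qed

text \<open>The dimension grows by one with each line extension; independence says that the new
  element is not in the span so far.\<close>

lemma dimension_of_independent:
  fixes B :: "'a::field set"
  assumes A: "subfld A" and B: "finite B"
    and indep: "\<And>c. (\<And>b. b \<in> B \<Longrightarrow> c b \<in> A) \<Longrightarrow> (\<Sum>b\<in>B. c b * b) = 0 \<Longrightarrow> \<forall>b\<in>B. c b = 0"
  shows "ring.dimension ring_of_type_algebra (card B) A {\<Sum>b\<in>B. c b * b | c. \<forall>b\<in>B. c b \<in> A}"
  using B indep
proof (induction B rule: finite_induct)
  case empty
  interpret R: field "ring_of_type_algebra :: 'a ring" by (rule field_from_type_algebra)
  show ?case using R.zero_dim[of A] by (simp add: ring_of_type_algebra_def)
next
  case (insert x B)
  interpret R: field "ring_of_type_algebra :: 'a ring" by (rule field_from_type_algebra)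
  let ?E = "{\<Sum>b\<in>B. c b * b | c. \<forall>b\<in>B. c b \<in> A}"
  have "R.dimension (card B) A ?E"
  proof (rule insert.IH)
    fix c assume c: "\<And>b. b \<in> B \<Longrightarrow> c b \<in> A" "(\<Sum>b\<in>B. c b * b) = 0"
    let ?c = "c(x := 0)"
    have "(\<Sum>b\<in>B. ?c b * b) = (\<Sum>b\<in>B. c b * b)" using insert.hyps by (intro sum.cong) auto
    then have "(\<Sum>b\<in>insert x B. ?c b * b) = 0" using insert.hyps c(2) by simp
    then have "\<forall>b\<in>insert x B. ?c b = 0" using c(1) subfldD(1)[OF A] by (intro insert.prems) auto
    then show "\<forall>b\<in>B. c b = 0" using insert.hyps by (metis fun_upd_apply insertCI)
  qed
  moreover have "x \<notin> ?E"
  proof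
    assume "x \<in> ?E"
    then obtain c where c: "x = (\<Sum>b\<in>B. c b * b)" "\<forall>b\<in>B. c b \<in> A" by blast
    let ?c = "c(x := - 1)"
    have "(\<Sum>b\<in>B. ?c b * b) = x" unfolding c(1) using insert.hyps by (intro sum.cong) (auto simp flip: c(1))
    then have "(\<Sum>b\<in>insert x B. ?c b * b) = 0" using insert.hyps by simp
    then have "\<forall>b\<in>insert x B. ?c b = 0" using c(2) subfldD(2,5)[OF A] by (intro insert.prems) auto
    then show False by simp
  qed
  ultimately have "R.dimension (Suc (card B)) A (R.line_extension A x ?E)"
    by (intro R.Suc_dim) (auto simp: ring_of_type_algebra_def)
  moreover have "R.line_extension A x ?E = {\<Sum>b\<in>insert x B. c b * b | c. \<forall>b\<in>insert x B. c b \<in> A}"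
  proof (intro equalityI subsetI)
    fix y assume "y \<in> R.line_extension A x ?E"
    then obtain k c where k: "k \<in> A" "\<forall>b\<in>B. c b \<in> A" "y = k * x + (\<Sum>b\<in>B. c b * b)"
      unfolding R.line_extension_mem_iff by (auto simp: ring_of_type_algebra_def)
    have "(\<Sum>b\<in>B. (c(x := k)) b * b) = (\<Sum>b\<in>B. c b * b)" using insert.hyps by (intro sum.cong) auto
    then have "y = (\<Sum>b\<in>insert x B. (c(x := k)) b * b)" using insert.hyps k(3) by simp
    moreover have "\<forall>b\<in>insert x B. (c(x := k)) b \<in> A" using k by simp
    ultimately show "y \<in> {\<Sum>b\<in>insert x B. c b * b | c. \<forall>b\<in>insert x B. c b \<in> A}" by blast
  next
    fix y assume "y \<in> {\<Sum>b\<in>insert x B. c b * b | c. \<forall>b\<in>insert x B. c b \<in> A}"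
    then obtain c where "y = (\<Sum>b\<in>insert x B. c b * b)" "\<forall>b\<in>insert x B. c b \<in> A" by blast
    then show "y \<in> R.line_extension A x ?E"
      unfolding R.line_extension_mem_iff using insert.hyps by (auto simp: ring_of_type_algebra_def)
  qed
  ultimately show ?case using insert.hyps by simp
qed

lemma dim_of_is_basis:
  assumes A: "subfld A" and B: "is_basis A M B" and M: "0 \<in> M"
  shows "ring.dim ring_of_type_algebra A M = card B"
proof -
  interpret R: field "ring_of_type_algebra :: 'a ring" by (rule field_from_type_algebra)
  note b = B[unfolded is_basis_def]
  have "M = {\<Sum>b\<in>B. c b * b | c. \<forall>b\<in>B. c b \<in> A}"
  proof (intro equalityI subsetI)
    fix m assume "m \<in> M"
    then obtain c where "c \<in> B \<rightarrow>\<^sub>E A" "m = (\<Sum>b\<in>B. c b * b)" using b by blast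
    then show "m \<in> {\<Sum>b\<in>B. c b * b | c. \<forall>b\<in>B. c b \<in> A}" by auto
  next
    fix m assume "m \<in> {\<Sum>b\<in>B. c b * b | c. \<forall>b\<in>B. c b \<in> A}"
    then obtain c where c: "\<forall>b\<in>B. c b \<in> A" "m = (\<Sum>b\<in>B. c b * b)" by blast
    have "restrict c B \<in> B \<rightarrow>\<^sub>E A" using c by auto
    then have "(\<Sum>b\<in>B. restrict c B b * b) \<in> M" using b by blast
    then show "m \<in> M" using c(2) by (simp cong: sum.cong)
  qed
  moreover have "\<forall>b\<in>B. c b = 0" if c: "\<And>b. b \<in> B \<Longrightarrow> c b \<in> A" "(\<Sum>b\<in>B. c b * b) = 0" for c
  proof -
    have "restrict c B \<in> B \<rightarrow>\<^sub>E A \<and> 0 = (\<Sum>b\<in>B. restrict c B b * b)" using c by (auto cong: sum.cong)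
    moreover have "(\<lambda>b\<in>B. 0) \<in> B \<rightarrow>\<^sub>E A \<and> 0 = (\<Sum>b\<in>B. (\<lambda>b\<in>B. 0) b * b)"
      using subfldD(1)[OF A] by (auto intro!: sum.neutral[symmetric])
    ultimately have "restrict c B = (\<lambda>b\<in>B. 0)" using b M by blast
    then show ?thesis by (metis restrict_apply')
  qed
  ultimately have "R.dimension (card B) A M" using dimension_of_independent[OF A, of B] b by auto
  from R.dimI[OF subfield_type_algebra[OF A] this] show ?thesis by (simp add: over_def)
qed

text \<open>The assumption \<open>orth\<close> says that no cancellation occurs in combinations over
  the base field. \<open>Q_gt\<close> and \<open>Q_le\<close> place the values in
  \<open>[0, 1)\<close>, and \<open>aval_values\<close> with \<open>minimal_value\<close> identify
  \<open>E\<close> as the ramification index.\<close>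

locale orthogonal_family = local_field K for K :: "('k::field, 'f::field) valued_field" +
  fixes F :: "'k poly" and \<theta> :: "'k alg_closure" and J :: "'i set" and Q :: "'i \<Rightarrow> 'k alg_closure" and E :: nat
  assumes irr: "irreducible F" and root: "ev F \<theta> = 0" and finJ: "finite J" and cardJ: "card J = degree F"
    and QL: "j \<in> J \<Longrightarrow> Q j \<in> adjoin \<theta>" and Q_gt: "j \<in> J \<Longrightarrow> exp (- 1) < nrm (Q j)" and Q_le: "j \<in> J \<Longrightarrow> nrm (Q j) \<le> 1"
    and orth: "j \<in> J \<Longrightarrow> nrm (to_ac (c j) * Q j) \<le> nrm (\<Sum>i\<in>J. to_ac (c i) * Q i)"
    and E: "0 < E" and aval_values: "\<alpha> \<in> adjoin \<theta> \<Longrightarrow> \<alpha> \<noteq> 0 \<Longrightarrow> \<exists>n. nrm \<alpha> = exp (- (real_of_int n / real E))"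
    and minimal_value: "\<exists>\<alpha>\<in>adjoin \<theta>. nrm \<alpha> = exp (- (1 / real E))"
begin

abbreviation L :: "'k alg_closure set" where "L \<equiv> adjoin \<theta>"

lemmas L_eq = adjoin_eq[OF irr root]

lemma L_add: "x \<in> L \<Longrightarrow> y \<in> L \<Longrightarrow> x + y \<in> L"
  unfolding L_eq by (auto simp flip: ev_add)

lemma L_mult: "x \<in> L \<Longrightarrow> y \<in> L \<Longrightarrow> x * y \<in> L"
  unfolding L_eq by (auto simp flip: ev_mult)

lemma L_to_ac: "to_ac c \<in> L"
  unfolding L_eq using ev_const[of c \<theta>] by (metis rangeI)

lemma L_0: "0 \<in> L" and L_1: "1 \<in> L"
  using L_to_ac[of 0] L_to_ac[of 1] by simp_all

lemma L_inverse: "x \<in> L \<Longrightarrow> inverse x \<in> L"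
proof (cases "x = 0")
  case False
  assume "x \<in> L"
  then obtain q where q: "x = ev q \<theta>" unfolding L_eq by blast
  then obtain p where "ev p \<theta> * x = 1" using ev_inverse[OF irr root, of q] False by auto
  then have "inverse x = ev p \<theta>" by (intro inverse_unique) (simp add: mult.commute)
  then show ?thesis unfolding L_eq by blast
qed simp

lemma L_sum: "(\<And>i. i \<in> I \<Longrightarrow> x i \<in> L) \<Longrightarrow> sum x I \<in> L"
  by (induction I rule: infinite_finite_induct) (auto intro: L_add L_0)

lemma L_power: "x \<in> L \<Longrightarrow> x ^ n \<in> L"
  by (induction n) (auto intro: L_mult L_1)

lemma L_powi: "x \<in> L \<Longrightarrow> x powi n \<in> L"
  by (auto simp: power_int_def intro: L_power L_inverse)

lemma Q_nz: "j \<in> J \<Longrightarrow> Q j \<noteq> 0"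
  using Q_gt[of j] by (metis exp_gt_zero nrm_pos order_less_trans)

lemma orth_0: "(\<Sum>i\<in>J. to_ac (c i) * Q i) = 0 \<Longrightarrow> j \<in> J \<Longrightarrow> c j = 0"
  using orth[of j c] Q_nz[of j] by (auto simp: order_antisym_conv[OF nrm_ge_0])

lemma inj_Q: "inj_on Q J"
proof (rule inj_onI, rule ccontr)
  fix i j assume ij: "i \<in> J" "j \<in> J" "Q i = Q j" "i \<noteq> j"
  define c :: "'i \<Rightarrow> 'k" where "c = (\<lambda>l. if l = i then 1 else if l = j then - 1 else 0)"
  have "(\<Sum>l\<in>J. to_ac (c l) * Q l) = (\<Sum>l\<in>{i, j}. to_ac (c l) * Q l)"
    by (rule sum.mono_neutral_right) (use finJ ij in \<open>auto simp: c_def\<close>)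
  also have "\<dots> = 0" using ij by (simp add: c_def)
  finally have "c i = 0" using orth_0 ij(1) by blast
  then show False by (simp add: c_def)
qed

text \<open>Orthogonality implies independence, and \<open>L\<close> is spanned by
  \<open>degree F\<close> powers of \<open>\<theta>\<close>; the equality of \<open>card J\<close>
  and \<open>degree F\<close> then leaves no room for a further independent element.\<close>

lemma spanning:
  assumes "x \<in> L"
  shows "\<exists>c. x = (\<Sum>j\<in>J. to_ac (c j) * Q j)"
proof -
  interpret V: vector_space "\<lambda>c x. to_ac c * (x :: 'k alg_closure)"
    by unfold_locales (simp_all add: algebra_simps)
  define P where "P = (\<lambda>i. \<theta> ^ i) ` {..<degree F}"
  have P: "finite P" "card P \<le> degree F" using card_image_le[of "{..<degree F}"] by (auto simp: P_def)
  have F0: "F \<noteq> 0" using irr by auto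
  moreover have "\<not> F dvd 1" using irr Factorial_Ring.irreducible_not_unit by blast
  ultimately have dF: "0 < degree F" by (simp add: is_unit_iff_degree)
  have LP: "L \<subseteq> V.span P"
  proof
    fix y assume "y \<in> L"
    then obtain g where g: "y = ev g \<theta>" unfolding L_eq by blast
    have "ev g \<theta> = ev (g div F * F + g mod F) \<theta>" by simp
    also have "\<dots> = ev (g mod F) \<theta>" unfolding ev_add ev_mult root by simp
    also have "\<dots> = (\<Sum>i\<le>degree (g mod F). to_ac (coeff (g mod F) i) * \<theta> ^ i)" by (rule ev_altdef)
    also have "\<dots> \<in> V.span P"
    proof (intro V.span_sum V.span_scale V.span_base)
      fix i assume "i \<in> {..degree (g mod F)}"
      moreover have "degree (g mod F) < degree F" using dF degree_mod_less'[of F g] F0 by (cases "g mod F = 0") auto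
      ultimately show "\<theta> ^ i \<in> P" by (auto simp: P_def)
    qed
    finally show "y \<in> V.span P" using g by simp
  qed
  have ind: "V.independent (Q ` J)"
  proof (rule V.independent_if_scalars_zero)
    fix u y assume "(\<Sum>x\<in>Q ` J. to_ac (u x) * x) = 0" "y \<in> Q ` J"
    then show "u y = 0" using orth_0[of "\<lambda>j. u (Q j)"] by (auto simp: sum.reindex[OF inj_Q])
  qed (use finJ in simp)
  have "x \<in> V.span (Q ` J)"
  proof (rule ccontr)
    assume n: "x \<notin> V.span (Q ` J)"
    then have "V.independent (insert x (Q ` J))" by (rule V.independent_insertI) (rule ind)
    moreover have "insert x (Q ` J) \<subseteq> V.span P" using LP assms QL by auto
    ultimately have "card (insert x (Q ` J)) \<le> card P" by (rule V.independent_span_bound[OF P(1), THEN conjunct2])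
    moreover have "x \<notin> Q ` J" using n V.span_base[of x "Q ` J"] by (rule contrapos_nn)
    ultimately show False using P(2) finJ cardJ card_image[OF inj_Q] by simp
  qed
  then obtain u where "x = (\<Sum>v\<in>Q ` J. to_ac (u v) * v)" using finJ by (auto simp: V.span_finite)
  then show ?thesis by (auto simp: sum.reindex[OF inj_Q])
qed

lemma int_ring_of_iff: "x \<in> int_ring_of K L \<longleftrightarrow> x \<in> L \<and> nrm x \<le> 1"
  by (simp add: int_ring_of_def ac_int_ring_iff)

text \<open>The value of \<open>Q j\<close> is below 1, so integrality of the product gives the
  coefficient a value above -1, and this value is an integer.\<close>

lemma integral_coefficient:
  assumes "nrm (to_ac c * Q j) \<le> 1" "j \<in> J"
  shows "c \<in> int_ring K"
proof (cases "c = 0")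
  case False
  have "nrm (to_ac c) * exp (- 1) < 1"
  proof -
    have "nrm (to_ac c) * exp (- 1) < nrm (to_ac c) * nrm (Q j)" using False Q_gt[OF assms(2)] by simp
    then show ?thesis using assms by (simp add: nrm_mult)
  qed
  then have "exp (- real_of_int (val K c) - 1) < exp 0" using False by (simp add: nrm_to_ac exp_add[symmetric] del: exp_less_one_iff)
  then have "0 \<le> val K c" unfolding exp_less_cancel_iff by linarith
  then show ?thesis by (simp add: int_ring_def val_ge_def)
qed (simp add: int_ring_def val_ge_def)

lemma basis_int: "int_basis K L (Q ` J)"
  unfolding int_basis_def
proof (rule is_basis_image[OF finJ _ inj_Q])
  show "Q j \<in> int_ring_of K L" if "j \<in> J" for j using that QL Q_le by (simp add: int_ring_of_iff)
  fix c assume c: "\<And>j. j \<in> J \<Longrightarrow> c j \<in> to_ac ` int_ring K"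
  show "(\<Sum>j\<in>J. c j * Q j) \<in> int_ring_of K L" unfolding int_ring_of_iff
  proof
    have "c j \<in> L" if "j \<in> J" for j using c[OF that] by (auto simp: L_to_ac)
    then show "(\<Sum>j\<in>J. c j * Q j) \<in> L" using QL by (intro L_sum L_mult)
    show "nrm (\<Sum>j\<in>J. c j * Q j) \<le> 1"
    proof (rule nrm_sum_le)
      fix j assume j: "j \<in> J"
      obtain a where "c j = to_ac a" "a \<in> int_ring K" using c[OF j] by blast
      then have "nrm (c j) \<le> 1" by (simp add: int_ring_iff)
      then show "nrm (c j * Q j) \<le> 1" using Q_le[OF j] by (simp add: nrm_mult mult_le_one)
    qed simp
  qed
next
  fix m assume m: "m \<in> int_ring_of K L"
  then obtain c where c: "m = (\<Sum>j\<in>J. to_ac (c j) * Q j)" using spanning by (auto simp: int_ring_of_iff)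
  have "c j \<in> int_ring K" if "j \<in> J" for j
    using orth[OF that, of c] m that unfolding int_ring_of_iff c[symmetric] by (intro integral_coefficient) auto
  then show "\<exists>c. (\<forall>j\<in>J. c j \<in> to_ac ` int_ring K) \<and> m = (\<Sum>j\<in>J. c j * Q j)"
    using c by (intro exI[of _ "\<lambda>j. to_ac (c j)"]) auto
next
  fix c c' j assume c: "\<And>j. j \<in> J \<Longrightarrow> c j \<in> to_ac ` int_ring K \<and> c' j \<in> to_ac ` int_ring K"
    and eq: "(\<Sum>j\<in>J. c j * Q j) = (\<Sum>j\<in>J. c' j * Q j)" and j: "j \<in> J"
  obtain d d' where d: "\<And>j. j \<in> J \<Longrightarrow> c j = to_ac (d j)" "\<And>j. j \<in> J \<Longrightarrow> c' j = to_ac (d' j)"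
  proof -
    have "\<forall>j\<in>J. \<exists>d. c j = to_ac d" "\<forall>j\<in>J. \<exists>d. c' j = to_ac d" using c by fast+
    then show thesis using that by (auto dest!: bchoice)
  qed
  have "(\<Sum>j\<in>J. to_ac (d j - d' j) * Q j) = (\<Sum>j\<in>J. c j * Q j) - (\<Sum>j\<in>J. c' j * Q j)"
    unfolding sum_subtractf[symmetric] by (intro sum.cong) (simp_all add: d algebra_simps)
  then have "d j - d' j = 0" using orth_0[OF _ j, of "\<lambda>j. d j - d' j"] eq by simp
  then show "c j = c' j" using d j by simp
qed

lemma nrm_exp_aval: "x \<noteq> 0 \<Longrightarrow> nrm x = exp (- aval K x)"
  by (simp add: nrm_def)

lemma uniformizer_power:
  obtains x where "x \<in> L" "x \<noteq> 0" "nrm x = exp (- (real_of_int n / real E))"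
proof -
  obtain y where y: "y \<in> L" "nrm y = exp (- (1 / real E))" using minimal_value by blast
  have "y \<noteq> 0" using y(2) by auto
  then show thesis using y by (intro that[of "y powi n"]) (auto intro: L_powi simp: nrm_powi exp_powi)
qed

lemma ram_index_eq: "ram_index K L = E"
proof -
  define R where "R = {(x :: real, y). x - y \<in> \<int>}"
  have vals: "aval K ` (L - {0}) = range (\<lambda>n. real_of_int n / real E)"
  proof (intro equalityI subsetI)
    fix v assume "v \<in> aval K ` (L - {0})"
    then obtain x where x: "x \<in> L" "x \<noteq> 0" "v = aval K x" by blast
    then show "v \<in> range (\<lambda>n. real_of_int n / real E)" using aval_values[of x] by (auto simp: nrm_exp_aval)
  next
    fix v assume "v \<in> range (\<lambda>n. real_of_int n / real E)"
    then obtain n where n: "v = real_of_int n / real E" by blast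
    obtain x where "x \<in> L" "x \<noteq> 0" "nrm x = exp (- (real_of_int n / real E))" by (rule uniformizer_power)
    then show "v \<in> aval K ` (L - {0})" using n by (auto intro!: image_eqI[of _ _ x] simp: nrm_exp_aval)
  qed
  have eqR: "R `` {x} = R `` {y} \<longleftrightarrow> x - y \<in> \<int>" for x y
  proof
    assume "R `` {x} = R `` {y}"
    moreover have "y \<in> R `` {y}" by (simp add: R_def)
    ultimately have "y \<in> R `` {x}" by simp
    then show "x - y \<in> \<int>" by (simp add: R_def)
  next
    assume xy: "x - y \<in> \<int>"
    have "x - u \<in> \<int> \<longleftrightarrow> y - u \<in> \<int>" for u
      using Ints_diff[OF _ xy, of "x - u"] Ints_add[OF xy, of "y - u"] by auto
    then show "R `` {x} = R `` {y}" by (auto simp: R_def)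
  qed
  have diffZ: "real_of_int a / real E - real_of_int b / real E \<in> \<int> \<longleftrightarrow> int E dvd a - b" for a b
  proof
    assume "real_of_int a / real E - real_of_int b / real E \<in> \<int>"
    then obtain k where "real_of_int a / real E - real_of_int b / real E = real_of_int k" by (auto elim: Ints_cases)
    then have "real_of_int (a - b) = real_of_int (int E * k)" using E by (simp add: field_simps)
    then have "a - b = int E * k" unfolding of_int_eq_iff .
    then show "int E dvd a - b" by simp
  next
    assume "int E dvd a - b"
    then obtain k where k: "a - b = int E * k" by (elim dvdE)
    have "real_of_int a / real E - real_of_int b / real E = real_of_int (a - b) / real E" by (simp add: diff_divide_distrib)
    also have "\<dots> = real_of_int k" unfolding k using E by simp
    finally show "real_of_int a / real E - real_of_int b / real E \<in> \<int>" by simp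
  qed
  have "(aval K ` (L - {0})) // R = (\<lambda>t. R `` {real_of_int (int t) / real E}) ` {..<E}"
  proof (intro equalityI subsetI)
    fix C assume "C \<in> (aval K ` (L - {0})) // R"
    then obtain n where n: "C = R `` {real_of_int n / real E}" unfolding vals by (auto elim: quotientE)
    have "C = R `` {real_of_int (int (nat (n mod int E))) / real E}" unfolding n eqR diffZ
      using E by (simp add: mod_eq_dvd_iff[symmetric])
    moreover have "nat (n mod int E) \<in> {..<E}" using E by (simp add: nat_less_iff)
    ultimately show "C \<in> (\<lambda>t. R `` {real_of_int (int t) / real E}) ` {..<E}" by blast
  next
    fix C assume "C \<in> (\<lambda>t. R `` {real_of_int (int t) / real E}) ` {..<E}"
    then show "C \<in> (aval K ` (L - {0})) // R" unfolding vals by (blast intro: quotientI)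
  qed
  moreover have "inj_on (\<lambda>t. R `` {real_of_int (int t) / real E}) {..<E}"
    by (rule inj_onI) (auto simp: eqR diffZ mod_eq_dvd_iff[symmetric] simp del: of_int_of_nat_eq)
  ultimately have "card ((aval K ` (L - {0})) // R) = E" by (simp add: card_image)
  then show ?thesis by (simp add: ram_index_def R_def)
qed

text \<open>The values of \<open>x\<close> and \<open>Q j\<close> lie in \<open>[0, 1)\<close> and
  differ by the integer \<open>val K c\<close>, which must therefore be 0.\<close>

lemma same_strip:
  assumes j: "j \<in> J" and x: "exp (- 1) < nrm x" "nrm x \<le> 1" and eq: "nrm (to_ac c * Q j) = nrm x"
  shows "nrm (to_ac c) = 1" "nrm (Q j) = nrm x"
proof -
  have x0: "x \<noteq> 0" using x(1) by (metis exp_gt_zero nrm_pos order_less_trans)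
  have c0: "c \<noteq> 0" using eq x0 by auto
  have "exp (- (real_of_int (val K c) + aval K (Q j))) = exp (- aval K x)"
    using eq c0 x0 Q_nz[OF j] by (simp add: nrm_mult nrm_exp_aval aval_to_ac exp_add[symmetric])
  then have "real_of_int (val K c) + aval K (Q j) = aval K x" by simp
  moreover have "0 \<le> aval K x" "aval K x < 1" using x x0 by (simp_all add: nrm_exp_aval)
  moreover have "0 \<le> aval K (Q j)" "aval K (Q j) < 1" using Q_gt[OF j] Q_le[OF j] Q_nz[OF j] by (simp_all add: nrm_exp_aval)
  ultimately have "val K c = 0" by linarith
  then show "nrm (to_ac c) = 1" using c0 by (simp add: nrm_to_ac)
  then show "nrm (Q j) = nrm x" using eq by (simp add: nrm_mult)
qed

text \<open>In an expansion of an element of value at least \<open>t / E\<close>, the terms of value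
  exactly \<open>t / E\<close> come from \<open>Jt\<close>, and all others have larger value. After
  division by a fixed member of \<open>Jt\<close> only the former survive reduction, so the residues
  span; the absence of cancellation makes them independent.\<close>

lemma residue_basis:
  assumes t: "t < E"
  defines "Jt \<equiv> {j \<in> J. aval K (Q j) = real t / real E}"
  obtains i where "i \<in> Jt" "inj_on (\<lambda>j. red K (inverse (Q i) * Q j)) Jt"
    "is_basis (residue_field K) (residue_field_of K L) ((\<lambda>j. red K (inverse (Q i) * Q j)) ` Jt)"
proof -
  let ?q = "exp (- (real t / real E))"
  have q: "exp (- 1) < ?q" "?q \<le> 1" using t by simp_all
  have JtJ: "Jt \<subseteq> J" by (auto simp: Jt_def)
  have Jt: "j \<in> Jt \<longleftrightarrow> j \<in> J \<and> nrm (Q j) = ?q" for j using Q_nz by (auto simp: Jt_def nrm_exp_aval)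
  have fin: "finite Jt" using finJ JtJ finite_subset by blast
  note red = placeD[OF place_red] place_sum[OF place_red]
  \<comment> \<open>The value \<open>t / E\<close> occurs in \<open>L\<close>. Without members of
    \<open>Jt\<close>, an element of this value would be a sum of terms of strictly smaller
    norm.\<close>
  have "Jt \<noteq> {}"
  proof
    assume em: "Jt = {}"
    obtain x where x: "x \<in> L" "x \<noteq> 0" "nrm x = exp (- (real_of_int (int t) / real E))" by (rule uniformizer_power)
    obtain c where c: "x = (\<Sum>j\<in>J. to_ac (c j) * Q j)" using spanning[OF x(1)] by blast
    have "nrm (to_ac (c j) * Q j) < nrm x" if j: "j \<in> J" for j
    proof -
      have "nrm (to_ac (c j) * Q j) \<noteq> nrm x"
        using same_strip(2)[OF j, of x "c j"] x(3) q em j Jt[of j] by auto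
      then show ?thesis using orth[OF j, of c] c by simp
    qed
    then have "nrm (\<Sum>j\<in>J. to_ac (c j) * Q j) < nrm x" using x by (intro nrm_sum_less) auto
    then show False using c by simp
  qed
  then obtain i where i: "i \<in> Jt" by blast
  define \<omega> where "\<omega> = Q i"
  have \<omega>: "\<omega> \<in> L" "\<omega> \<noteq> 0" "nrm \<omega> = ?q" using i Jt QL Q_nz by (auto simp: \<omega>_def)
  have "nrm (inverse \<omega> * x) = nrm x / ?q" for x by (simp add: nrm_mult nrm_inverse \<omega>(3) divide_inverse)
  then have scale: "nrm (inverse \<omega> * x) \<le> 1 \<longleftrightarrow> nrm x \<le> ?q" "nrm (inverse \<omega> * x) < 1 \<longleftrightarrow> nrm x < ?q" for x
    by simp_all
  have unit: "nrm (inverse \<omega> * Q j) = 1" "inverse \<omega> * Q j \<in> L" if "j \<in> Jt" for j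
    using that Jt[of j] \<omega> QL by (auto simp: nrm_mult nrm_inverse intro: L_mult L_inverse)
  have expand: "(\<Sum>j\<in>Jt. red K (to_ac (a j)) * red K (inverse \<omega> * Q j)) = red K (inverse \<omega> * (\<Sum>j\<in>Jt. to_ac (a j) * Q j))"
    if a: "\<And>j. j \<in> Jt \<Longrightarrow> nrm (to_ac (a j)) \<le> 1" for a
  proof -
    have "inverse \<omega> * (\<Sum>j\<in>Jt. to_ac (a j) * Q j) = (\<Sum>j\<in>Jt. to_ac (a j) * (inverse \<omega> * Q j))"
      by (simp add: sum_distrib_left mult_ac)
    moreover have "red K \<dots> = (\<Sum>j\<in>Jt. red K (to_ac (a j) * (inverse \<omega> * Q j)))"
      using a unit(1) by (intro red(5)) (simp add: nrm_mult)
    moreover have "\<dots> = (\<Sum>j\<in>Jt. red K (to_ac (a j)) * red K (inverse \<omega> * Q j))"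
      using a unit(1) by (intro sum.cong red(3)) simp_all
    ultimately show ?thesis by simp
  qed
  have lift: "\<exists>a. \<forall>j\<in>Jt. c j = red K (to_ac (a j)) \<and> nrm (to_ac (a j)) \<le> 1" if c: "\<And>j. j \<in> Jt \<Longrightarrow> c j \<in> residue_field K" for c
  proof -
    have "\<forall>j\<in>Jt. \<exists>a. c j = red K (to_ac a) \<and> nrm (to_ac a) \<le> 1"
      using c by (fastforce simp: residue_field_def int_ring_iff)
    then show ?thesis by (rule bchoice)
  qed
  have indep0: "c j = 0" if c: "\<And>j. j \<in> Jt \<Longrightarrow> c j \<in> residue_field K"
    and s0: "(\<Sum>j\<in>Jt. c j * red K (inverse \<omega> * Q j)) = 0" and j: "j \<in> Jt" for c j
  proof -
    obtain a where a: "\<And>j. j \<in> Jt \<Longrightarrow> c j = red K (to_ac (a j))" "\<And>j. j \<in> Jt \<Longrightarrow> nrm (to_ac (a j)) \<le> 1" using lift[of c] c by blast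
    let ?s = "\<Sum>j\<in>Jt. to_ac (a j) * Q j"
    have "red K (inverse \<omega> * ?s) = 0" using expand[OF a(2)] s0 a(1) by (simp cong: sum.cong)
    moreover have "nrm ?s \<le> ?q" using a(2) Jt by (intro nrm_sum_le) (auto simp: nrm_mult)
    then have "nrm (inverse \<omega> * ?s) \<le> 1" unfolding scale .
    ultimately have "nrm (inverse \<omega> * ?s) < 1" using red(4) by blast
    then have "nrm ?s < ?q" unfolding scale .
    define a' where "a' = (\<lambda>j. if j \<in> Jt then a j else 0)"
    have "?s = (\<Sum>j\<in>J. to_ac (a' j) * Q j)"
      by (rule sum.mono_neutral_cong_left) (use finJ JtJ in \<open>auto simp: a'_def\<close>)
    then have "nrm (to_ac (a' j) * Q j) \<le> nrm ?s" using orth[of j a'] j JtJ by auto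
    then have "nrm (to_ac (a j) * Q j) < ?q" using j \<open>nrm ?s < ?q\<close> by (simp add: a'_def)
    then have "nrm (to_ac (a j)) * ?q < 1 * ?q" using Jt[of j] j by (simp add: nrm_mult)
    then have "nrm (to_ac (a j)) < 1" by (rule mult_right_less_imp_less) simp
    then show ?thesis using a j red(4)[of "to_ac (a j)"] by simp
  qed
  have indep: "c j = c' j" if c: "\<And>j. j \<in> Jt \<Longrightarrow> c j \<in> residue_field K \<and> c' j \<in> residue_field K"
    and eq: "(\<Sum>j\<in>Jt. c j * red K (inverse \<omega> * Q j)) = (\<Sum>j\<in>Jt. c' j * red K (inverse \<omega> * Q j))" and j: "j \<in> Jt" for c c' j
    using indep0[of "\<lambda>j. c j - c' j" j] c eq j subfld_diff[OF subfld_residue_field]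
    by (simp add: left_diff_distrib sum_subtractf)
  have inj: "inj_on (\<lambda>j. red K (inverse \<omega> * Q j)) Jt"
  proof (rule inj_onI, rule ccontr)
    fix j j' assume j: "j \<in> Jt" "j' \<in> Jt" "red K (inverse \<omega> * Q j) = red K (inverse \<omega> * Q j')" "j \<noteq> j'"
    have d: "(\<Sum>l\<in>Jt. (if l = k then 1 else 0) * red K (inverse \<omega> * Q l)) = red K (inverse \<omega> * Q k)" if "k \<in> Jt" for k
      using that fin by (simp add: if_distrib[of "\<lambda>x. x * _"] cong: if_cong)
    have "(if j = j then 1 else 0 :: 'f) = (if j = j' then 1 else 0)"
      by (rule indep[of "\<lambda>l. if l = j then 1 else 0" "\<lambda>l. if l = j' then 1 else 0"])
        (use j d subfldD(1,2)[OF subfld_residue_field] in auto)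
    then show False using j(4) by simp
  qed
  have "is_basis (residue_field K) (residue_field_of K L) ((\<lambda>j. red K (inverse \<omega> * Q j)) ` Jt)"
  proof (rule is_basis_image[OF fin _ inj])
    show "red K (inverse \<omega> * Q j) \<in> residue_field_of K L" if "j \<in> Jt" for j
      using unit[OF that] by (auto simp: residue_field_of_def int_ring_of_iff)
    fix c assume c: "\<And>j. j \<in> Jt \<Longrightarrow> c j \<in> residue_field K"
    obtain a where a: "\<And>j. j \<in> Jt \<Longrightarrow> c j = red K (to_ac (a j))" "\<And>j. j \<in> Jt \<Longrightarrow> nrm (to_ac (a j)) \<le> 1" using lift[of c] c by blast
    let ?s = "\<Sum>j\<in>Jt. to_ac (a j) * Q j"
    have "nrm ?s \<le> ?q" using a(2) Jt by (intro nrm_sum_le) (auto simp: nrm_mult)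
    then have "nrm (inverse \<omega> * ?s) \<le> 1" unfolding scale .
    moreover have "inverse \<omega> * ?s \<in> L" using JtJ QL \<omega>(1) by (auto intro!: L_mult L_sum L_inverse L_to_ac)
    ultimately have "red K (inverse \<omega> * ?s) \<in> residue_field_of K L" by (auto simp: residue_field_of_def int_ring_of_iff)
    moreover have "(\<Sum>j\<in>Jt. c j * red K (inverse \<omega> * Q j)) = red K (inverse \<omega> * ?s)"
      using expand[OF a(2)] a(1) by (simp cong: sum.cong)
    ultimately show "(\<Sum>j\<in>Jt. c j * red K (inverse \<omega> * Q j)) \<in> residue_field_of K L" by simp
  next
    fix m assume "m \<in> residue_field_of K L"
    then obtain y where y: "y \<in> L" "nrm y \<le> 1" "m = red K y" by (auto simp: residue_field_of_def int_ring_of_iff)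
    \<comment> \<open>Multiplication by \<open>\<omega>\<close> moves an integral lift to norm at
      most that of \<open>\<omega>\<close>, where every term off \<open>Jt\<close> is strictly
      smaller and vanishes under reduction.\<close>
    obtain c where c: "y * \<omega> = (\<Sum>j\<in>J. to_ac (c j) * Q j)" using spanning[of "y * \<omega>"] y(1) \<omega>(1) L_mult by blast
    have bound: "nrm (to_ac (c j) * Q j) \<le> ?q" if "j \<in> J" for j
    proof -
      have "nrm (to_ac (c j) * Q j) \<le> nrm (y * \<omega>)" using orth[OF that, of c] c by simp
      also have "\<dots> \<le> ?q" using y(2) \<omega>(3) by (simp add: nrm_mult)
      finally show ?thesis .
    qed
    have bound1: "nrm (inverse \<omega> * (to_ac (c j) * Q j)) \<le> 1" if "j \<in> J" for j
      using bound[OF that] unfolding scale .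
    have c1: "nrm (to_ac (c j)) \<le> 1" if "j \<in> Jt" for j
      using bound[of j] that Jt[of j] by (simp add: nrm_mult)
    have out: "red K (inverse \<omega> * (to_ac (c j) * Q j)) = 0" if j: "j \<in> J" "j \<notin> Jt" for j
    proof -
      have "nrm (to_ac (c j) * Q j) \<noteq> ?q"
        using same_strip(2)[OF j(1), of \<omega> "c j"] \<omega>(3) q j Jt[of j] by auto
      then have "nrm (to_ac (c j) * Q j) < ?q" using bound[OF j(1)] by simp
      then have "nrm (inverse \<omega> * (to_ac (c j) * Q j)) < 1" unfolding scale .
      then show ?thesis by (rule place_small[OF place_red])
    qed
    have "y = inverse \<omega> * (y * \<omega>)" using \<omega>(2) by simp
    then have "m = red K (\<Sum>j\<in>J. inverse \<omega> * (to_ac (c j) * Q j))" unfolding y(3) c sum_distrib_left by simp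
    also have "\<dots> = (\<Sum>j\<in>J. red K (inverse \<omega> * (to_ac (c j) * Q j)))" by (rule red(5)) (rule bound1)
    also have "\<dots> = (\<Sum>j\<in>Jt. red K (inverse \<omega> * (to_ac (c j) * Q j)))"
      by (rule sum.mono_neutral_right) (use finJ JtJ out in auto)
    also have "\<dots> = (\<Sum>j\<in>Jt. red K (to_ac (c j)) * red K (inverse \<omega> * Q j))"
    proof (rule sum.cong)
      fix j assume j: "j \<in> Jt"
      have "inverse \<omega> * (to_ac (c j) * Q j) = to_ac (c j) * (inverse \<omega> * Q j)" by (simp only: mult_ac)
      then show "red K (inverse \<omega> * (to_ac (c j) * Q j)) = red K (to_ac (c j)) * red K (inverse \<omega> * Q j)"
        using red(3)[OF c1[OF j], of "inverse \<omega> * Q j"] unit(1)[OF j] by (simp only: order_refl)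
    qed simp
    finally show "\<exists>c. (\<forall>j\<in>Jt. c j \<in> residue_field K) \<and> m = (\<Sum>j\<in>Jt. c j * red K (inverse \<omega> * Q j))"
      using c1 residue_fieldI by (intro exI[of _ "\<lambda>j. red K (to_ac (c j))"]) auto
  next
    show "c j = c' j" if "\<And>j. j \<in> Jt \<Longrightarrow> c j \<in> residue_field K \<and> c' j \<in> residue_field K"
      "(\<Sum>j\<in>Jt. c j * red K (inverse \<omega> * Q j)) = (\<Sum>j\<in>Jt. c' j * red K (inverse \<omega> * Q j))" "j \<in> Jt" for c c' j
      by (rule indep[OF that])
  qed
  then show thesis using i inj by (intro that[of i]) (simp_all add: \<omega>_def)
qed

lemma basis_standard: "standard_form K L (Q ` J)"
  unfolding standard_form_def Let_def ram_index_eq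
proof (intro conjI allI impI)
  show "Q ` J \<subseteq> unit_strip K L"
    using QL Q_gt Q_le Q_nz by (auto simp: unit_strip_def int_ring_of_iff nrm_exp_aval)
  fix t assume t: "t < E"
  let ?Jt = "{j \<in> J. aval K (Q j) = real t / real E}"
  have Bt: "{\<alpha> \<in> Q ` J. aval K \<alpha> = real t / real E} = Q ` ?Jt" by auto
  obtain i where i: "i \<in> ?Jt" "inj_on (\<lambda>j. red K (inverse (Q i) * Q j)) ?Jt"
    "is_basis (residue_field K) (residue_field_of K L) ((\<lambda>j. red K (inverse (Q i) * Q j)) ` ?Jt)"
    using residue_basis[OF t] .
  have "0 \<in> residue_field_of K L" unfolding residue_field_of_def
    using L_0 place_0[OF place_red] by (auto intro!: image_eqI[of _ _ 0] simp: int_ring_of_iff)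
  then have "res_degree K L = card ?Jt"
    unfolding res_degree_def using dim_of_is_basis[OF subfld_residue_field i(3)] card_image[OF i(2)] by simp
  moreover have "card (Q ` ?Jt) = card ?Jt" by (rule card_image) (rule inj_on_subset[OF inj_Q], auto)
  ultimately show "card {\<alpha> \<in> Q ` J. aval K \<alpha> = real t / real E} = res_degree K L" unfolding Bt by simp
  show "\<exists>\<omega>\<in>{\<alpha> \<in> Q ` J. aval K \<alpha> = real t / real E}. is_basis (residue_field K) (residue_field_of K L)
      ((\<lambda>\<alpha>. red K (inverse \<omega> * \<alpha>)) ` {\<alpha> \<in> Q ` J. aval K \<alpha> = real t / real E})"
    unfolding Bt using i by (intro bexI[of _ "Q i"]) (auto simp: image_image)
qed

end

section \<open>Values of the quotients at a root\<close>

context local_field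
begin

lemma is_type_le: "is_type K T r \<Longrightarrow> i \<le> r \<Longrightarrow> is_type K T i"
  by (induction r) (auto simp: le_Suc_eq)

lemma aval_of_nrm: "nrm x = exp (- a) \<Longrightarrow> aval K x = a"
  by (auto simp: nrm_def split: if_splits)

text \<open>Subtracting an integer commutes with the floor, so the successive divisions by powers of
  the uniformizer telescope.\<close>

lemma foldl_star:
  assumes a: "nrm a = 1" and y: "\<And>i. 1 \<le> i \<Longrightarrow> i \<le> n \<Longrightarrow> nrm (y i) = exp (- H i)"
  shows "foldl (star K) a (map y [1..<Suc n]) = a * (\<Prod>i=1..n. y i) / \<pi> powi \<lfloor>\<Sum>i=1..n. H i\<rfloor>"
  using y
proof (induction n)
  case 0
  then show ?case by simp
next
  case (Suc n)
  define p where "p = (\<Prod>i=1..n. y i)"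
  define s where "s = (\<Sum>i=1..n. H i)"
  have IH: "foldl (star K) a (map y [1..<Suc n]) = a * p / \<pi> powi \<lfloor>s\<rfloor>"
    unfolding p_def s_def using Suc.prems by (intro Suc.IH) auto
  have np: "nrm p = exp (- s)"
  proof -
    have "nrm (prod y I) = exp (- sum H I)" if "finite I" "I \<subseteq> {1..n}" for I
      using that by (induction I rule: finite_induct) (auto simp: nrm_mult Suc.prems exp_add[symmetric])
    then show ?thesis unfolding p_def s_def by simp
  qed
  let ?x = "a * p / \<pi> powi \<lfloor>s\<rfloor> * y (Suc n)"
  have nx: "nrm ?x = exp (- (s + H (Suc n) - real_of_int \<lfloor>s\<rfloor>))"
    using Suc.prems[of "Suc n"] by (simp add: nrm_mult nrm_divide a np nrm_powi nrm_unif exp_powi exp_add[symmetric] exp_diff[symmetric])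
  have "\<lfloor>aval K ?x\<rfloor> = \<lfloor>s + H (Suc n)\<rfloor> - \<lfloor>s\<rfloor>" unfolding aval_of_nrm[OF nx] by (simp add: floor_diff_of_int)
  moreover have "\<pi> powi \<lfloor>s + H (Suc n)\<rfloor> = \<pi> powi \<lfloor>s\<rfloor> * \<pi> powi (\<lfloor>s + H (Suc n)\<rfloor> - \<lfloor>s\<rfloor>)"
    using power_int_add[OF disjI1[OF unif_nz], of "\<lfloor>s\<rfloor>" "\<lfloor>s + H (Suc n)\<rfloor> - \<lfloor>s\<rfloor>"] by simp
  ultimately have "star K (a * p / \<pi> powi \<lfloor>s\<rfloor>) (y (Suc n)) = a * (p * y (Suc n)) / \<pi> powi \<lfloor>s + H (Suc n)\<rfloor>"
    unfolding star_def by simp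
  moreover have "[1..<Suc (Suc n)] = [1..<Suc n] @ [Suc n]" by simp
  ultimately show ?case by (simp add: IH p_def s_def del: upt_Suc One_nat_def)
qed

end

lemma sum_PiE_Suc:
  "(\<Sum>j\<in>PiE {..<Suc n} A. g j) = (\<Sum>k\<in>A n. \<Sum>j\<in>PiE {..<n} A. g (j(n := k)))"
proof -
  have "inj_on (\<lambda>(k, j). j(n := k)) (A n \<times> PiE {..<n} A)"
    using inj_combinator[of n "{..<n}" A] by simp
  moreover have "PiE {..<Suc n} A = (\<lambda>(k, j). j(n := k)) ` (A n \<times> PiE {..<n} A)"
    unfolding lessThan_Suc by (rule PiE_insert_eq)
  ultimately have "(\<Sum>j\<in>PiE {..<Suc n} A. g j) = (\<Sum>(k, j)\<in>A n \<times> PiE {..<n} A. g (j(n := k)))"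
    by (simp add: sum.reindex case_prod_unfold)
  then show ?thesis by (simp add: sum.cartesian_product)
qed

locale point_of_type = local_field K for K :: "('k::field, 'f::field) valued_field" +
  fixes T :: "('k, 'f) type_data" and r :: nat and \<theta> :: "'k alg_closure" and \<rho> :: "'k alg_closure \<Rightarrow> 'f" and f :: "'k poly"
  assumes type: "is_type K T r" and point: "(\<theta>, \<rho>) \<in> Dv T (Suc r)" and f: "f \<noteq> 0" "ev f \<theta> = 0"
begin

lemma level_le: "i \<le> r \<Longrightarrow> level_at T i"
  using levels is_type_le[OF type] by blast

lemma zz_nz: "i \<le> r \<Longrightarrow> 0 < i \<Longrightarrow> 0 < hh T i \<and> zz T i \<noteq> 0"
proof -
  assume i: "i \<le> r" "0 < i"
  have "0 < hh T i" using is_type_le[OF type i(1)] i(2) by (cases i) auto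
  interpret L: level K "mm T i" "nv T i" "rv T i" "Dv T i" "fst (pev T i)" "pv T i" "FF K T i" "phv T i"
     "snd (pev T i)" "Vv T i" "kpv T i" "ee T i" "hh T i" "lv T i" "lv' T i" "psi T i" "zz T i" "Bv T i"
    by (rule level_le[OF i(1)])
  show ?thesis using L.z_eq_0 \<open>0 < hh T i\<close> by auto
qed

lemma point_le: "i \<le> Suc r \<Longrightarrow> (\<theta>, \<rho>) \<in> Dv T i"
proof (induction rule: inc_induct)
  case base
  show ?case by (rule point)
next
  case (step i)
  interpret L: level K "mm T i" "nv T i" "rv T i" "Dv T i" "fst (pev T i)" "pv T i" "FF K T i" "phv T i"
     "snd (pev T i)" "Vv T i" "kpv T i" "ee T i" "hh T i" "lv T i" "lv' T i" "psi T i" "zz T i" "Bv T i"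
    by (rule level_le) (use step in simp)
  show ?case using step.IH unfolding Dv.simps by (rule L.D'_D)
qed

lemma pv_eq: "i \<le> Suc r \<Longrightarrow> pv T i = exp (- (1 / real (\<Prod>n<i. ee T n))) \<and> 0 < (\<Prod>n<i. ee T n)"
proof (induction i)
  case 0
  then show ?case by (simp add: pv.simps)
next
  case (Suc i)
  interpret L: level K "mm T i" "nv T i" "rv T i" "Dv T i" "fst (pev T i)" "pv T i" "FF K T i" "phv T i"
     "snd (pev T i)" "Vv T i" "kpv T i" "ee T i" "hh T i" "lv T i" "lv' T i" "psi T i" "zz T i" "Bv T i"
    by (rule level_le) (use Suc in simp)
  have "pv T (Suc i) = pv T i powr (1 / real (ee T i))" unfolding pv.simps by (rule L.q_def)
  then show ?case using Suc L.e_pos by (simp add: powr_def mult.commute)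
qed

definition gen :: "nat \<Rightarrow> nat \<Rightarrow> 'k alg_closure" where
  "gen i k = (if i = 0 then \<theta> ^ k else quotient_val K T f \<theta> i k)"

lemma side_end_eq: "i \<le> r \<Longrightarrow> 0 < i \<Longrightarrow> side_end K T f i = Max (Sv T i f)"
proof -
  assume i: "i \<le> r" "0 < i"
  have va: "vadd T i" using levels is_type_le[OF type i(1)] i(2) by blast
  note ns = newton_side[OF level_le[OF i(1)] va i(2) _ f(1)]
  show ?thesis using ns(2,3) zz_nz[OF i] unfolding side_end_def by simp
qed

text \<open>One shape for the factors of all levels, including the power of \<open>\<theta>\<close>
  at level 0, as \<open>independent_combination\<close> requires.\<close>

lemma gen_form:
  assumes i: "i \<le> r" and k: "k < ee T i * ff T i"
  shows "\<exists>u t P. gen i k = level.Ph (phv T i) (snd (pev T i)) \<theta> ^ (k mod ee T i) * fst (pev T i) \<theta> powi u * t \<and>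
      nrm t = 1 \<and> \<rho> t = poly P (zz T i) \<and> P \<in> polys_over (FF K T i) \<and> degree P = k div ee T i \<and> P \<noteq> 0"
    and "i = 0 \<Longrightarrow> nrm (gen i k) = 1"
    and "0 < i \<Longrightarrow> nrm (gen i k) = exp (- HH K T f i k)"
proof -
  interpret L: level K "mm T i" "nv T i" "rv T i" "Dv T i" "fst (pev T i)" "pv T i" "FF K T i" "phv T i"
     "snd (pev T i)" "Vv T i" "kpv T i" "ee T i" "hh T i" "lv T i" "lv' T i" "psi T i" "zz T i" "Bv T i"
    by (rule level_le[OF i])
  have kf: "k < ee T i * L.f" using k by (simp add: L.f_def ff_def)
  have D': "(\<theta>, \<rho>) \<in> L.D'" using point_le[of "Suc i"] i unfolding Dv.simps by simp
  note place = L.D_place[OF L.D'_D[OF D']]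
  have zero: "nrm (\<theta> ^ k) = 1 \<and> \<rho> (\<theta> ^ k) = poly (monom 1 k) (zz T i) \<and> ee T i = 1" if i0: "i = 0"
  proof -
    have e1: "ee T i = 1" and h0: "hh T i = 0" using is_type_le[OF type, of 0] i0 by auto
    have ph: "phv T i = [:0, 1:]" "snd (pev T i) \<theta> = 1" using i0 by (simp_all add: phv_def pev.simps)
    have "L.Ph \<theta> = \<theta>" unfolding L.Ph_def unfolding ph by simp
    then have "L.gam \<theta> = \<theta>" unfolding L.gam_def unfolding e1 h0 by simp
    then have th: "nrm \<theta> \<le> 1" "\<rho> \<theta> = zz T i" using L.D'_gam_le[OF D'] L.D'_gam[OF D'] by simp_all
    \<comment> \<open>If the residue of \<open>\<theta>\<close> is 0, then \<open>\<psi>\<close> is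
      \<open>y\<close>, of degree 1, and the exponent \<open>k\<close> can only be 0.\<close>
    have "k = 0 \<or> nrm \<theta> = 1"
    proof (cases "zz T i = 0")
      case True
      then have "psi T i = [:0, 1:]" using irreducible_over_root_0[OF L.A(1) L.psi(1,2)] L.psi(3) by simp
      then show ?thesis using k e1 by (simp add: ff_def)
    next
      case False
      then show ?thesis using placeD(4)[OF place th(1)] th by auto
    qed
    moreover have "\<rho> (\<theta> ^ k) = zz T i ^ k" using place_power[OF place th(1)] th(2) by simp
    ultimately show ?thesis using e1 by (auto simp: nrm_power poly_monom)
  qed
  then show "i = 0 \<Longrightarrow> nrm (gen i k) = 1" by (simp add: gen_def)
  let ?M = "Max (L.S f)"
  have pos: "k \<le> ?M" "gen i k = ev (f div phv T i ^ (?M - k)) \<theta>" "Min (L.S f) \<le> ?M - k" "zz T i \<noteq> 0" if i0: "0 < i"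
  proof -
    show z: "zz T i \<noteq> 0" using zz_nz[OF i i0] by simp
    have "Min (L.S f) + ee T i * L.f \<le> ?M" by (rule L.res_vanishes[OF D' z f])
    then show "k \<le> ?M" "Min (L.S f) \<le> ?M - k" using kf by linarith+
    show "gen i k = ev (f div phv T i ^ (?M - k)) \<theta>"
      using side_end_eq[OF i i0] i0 by (simp add: gen_def quotient_val_def quotient_poly_def ev_def phv_def)
  qed
  show "0 < i \<Longrightarrow> nrm (gen i k) = exp (- HH K T f i k)"
  proof -
    assume i0: "0 < i"
    have va: "vadd T i" using levels is_type_le[OF type i] i0 by blast
    let ?l = "?M - k"
    have "real (Min (L.S f)) \<le> real ?l" "real ?l \<le> real ?M" using pos(3)[OF i0] by simp_all
    then have "side_ordinate K T f i k = real_of_int (nv T (Suc i) f) / real (ee T i) - real (hh T i) / real (ee T i) * real ?l"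
      using newton_side(5)[OF level_le[OF i] va i0 _ f(1)] zz_nz[OF i i0]
      unfolding side_ordinate_def side_end_eq[OF i i0] by blast
    then have HH: "HH K T f i k = (real_of_int (nv T (Suc i) f) / real (ee T i) - real (hh T i) / real (ee T i) * real ?l
        - real ?l * real_of_int (Vv T i)) / real (\<Prod>n<i. ee T n)"
      using i0 unfolding HH_def side_end_eq[OF i i0] Vv_def by simp
    have "nrm (gen i k) = L.q powi (L.nn' f - int ?l * (int (ee T i) * Vv T i + int (hh T i)))"
      unfolding pos(2)[OF i0] by (rule L.quotient_lead(1)[OF D' pos(4)[OF i0] f(1) kf pos(1)[OF i0]])
    also have "L.q = exp (- (1 / real (\<Prod>n<Suc i. ee T n)))" using pv_eq[of "Suc i"] i unfolding pv.simps by simp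
    also have "L.nn' f = nv T (Suc i) f" by (simp add: nv.simps)
    also have "exp (- (1 / real (\<Prod>n<Suc i. ee T n))) powi (nv T (Suc i) f - int ?l * (int (ee T i) * Vv T i + int (hh T i)))
        = exp (- HH K T f i k)"
      unfolding exp_powi HH using L.e_pos pv_eq[of i] i by (simp add: field_simps)
    finally show ?thesis .
  qed
  show "\<exists>u t P. gen i k = L.Ph \<theta> ^ (k mod ee T i) * fst (pev T i) \<theta> powi u * t \<and>
      nrm t = 1 \<and> \<rho> t = poly P (zz T i) \<and> P \<in> polys_over (FF K T i) \<and> degree P = k div ee T i \<and> P \<noteq> 0"
  proof (cases "i = 0")
    case True
    have "gen i k = L.Ph \<theta> ^ (k mod ee T i) * fst (pev T i) \<theta> powi 0 * \<theta> ^ k"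
      using zero[OF True] True by (simp add: gen_def)
    moreover have "monom 1 k \<in> polys_over (FF K T i)" "degree (monom 1 k :: 'f poly) = k div ee T i" "monom 1 k \<noteq> (0 :: 'f poly)"
      using polys_over_monom[OF L.A(1) subfldD(2)[OF L.A(1)]] zero[OF True] by (simp_all add: degree_monom_eq)
    ultimately show ?thesis using zero[OF True] by blast
  next
    case False
    then have i0: "0 < i" by simp
    show ?thesis unfolding pos(2)[OF i0]
      by (rule L.quotient_lead(2)[OF D' pos(4)[OF i0] f(1) kf pos(1)[OF i0]])
  qed
qed

abbreviation multi :: "nat \<Rightarrow> (nat \<Rightarrow> nat) set" where
  "multi n \<equiv> PiE {..<n} (\<lambda>i. {..<ee T i * ff T i})"

text \<open>A partial sum over the lower levels is zero or has a leading term with residue in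
  \<open>FF K T n\<close>, so it can serve as coefficient of a factor from level \<open>n\<close>.
  The first claim is the input of the induction step, the second its aim.\<close>

lemma combination:
  assumes "n \<le> Suc r"
  defines "s \<equiv> \<lambda>c. \<Sum>j\<in>multi n. to_ac (c j) * (\<Prod>i<n. gen i (j i))"
  shows "s c = 0 \<or> inG \<rho> (fst (pev T n) \<theta>) (FF K T n) (s c)"
    and "j \<in> multi n \<Longrightarrow> nrm (to_ac (c j) * (\<Prod>i<n. gen i (j i))) \<le> nrm (s c)"
  using assms(1) unfolding s_def
proof (induction n arbitrary: c j)
  case 0
  interpret L: stage K 1 nn0 rho0 D0 "\<lambda>_. \<pi>" "exp (-1)" "residue_field K" by (rule stage_0)
  have D: "(\<theta>, \<rho>) \<in> D0" using point_le[of 0] by (simp add: Dv.simps)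
  {
    case 1
    show ?case
    proof (cases "c (\<lambda>_. undefined) = 0")
      case False
      then have "lead \<rho> \<pi> (to_ac (c (\<lambda>_. undefined))) (nn0 [:c (\<lambda>_. undefined):]) (rho0 [:c (\<lambda>_. undefined):])"
        using L.D_lead[OF D, of "[:c (\<lambda>_. undefined):]"] by simp
      moreover have "rho0 [:c (\<lambda>_. undefined):] \<in> residue_field K" using L.rho_A[of "[:c (\<lambda>_. undefined):]"] False by simp
      ultimately show ?thesis by (auto simp: inG_def pev.simps)
    qed simp
  next
    case 2
    then show ?case by simp
  }
next
  case (Suc n)
  {
    fix c :: "(nat \<Rightarrow> nat) \<Rightarrow> 'k" assume "Suc n \<le> Suc r"
    then have n: "n \<le> r" "n \<le> Suc r" by simp_all
    interpret L: level K "mm T n" "nv T n" "rv T n" "Dv T n" "fst (pev T n)" "pv T n" "FF K T n" "phv T n"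
       "snd (pev T n)" "Vv T n" "kpv T n" "ee T n" "hh T n" "lv T n" "lv' T n" "psi T n" "zz T n" "Bv T n"
      by (rule level_le[OF n(1)])
    have D': "(\<theta>, \<rho>) \<in> L.D'" using point_le[of "Suc n"] n unfolding Dv.simps by simp
    define x where "x k = (\<Sum>j\<in>multi n. to_ac (c (j(n := k))) * (\<Prod>i<n. gen i (j i)))" for k
    have split: "to_ac (c (j(n := k))) * (\<Prod>i<Suc n. gen i ((j(n := k)) i)) =
        to_ac (c (j(n := k))) * (\<Prod>i<n. gen i (j i)) * gen n k" for j k
      by (simp add: mult.assoc)
    have sum_eq: "(\<Sum>j\<in>multi (Suc n). to_ac (c j) * (\<Prod>i<Suc n. gen i (j i))) = (\<Sum>k<ee T n * ff T n. x k * gen n k)"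
      unfolding sum_PiE_Suc split by (simp add: x_def sum_distrib_right)
    have ff: "ff T n = L.f" unfolding ff_def by (rule L.f_def[symmetric])
    have "\<forall>k<ee T n * ff T n. \<exists>u t P. gen n k = L.Ph \<theta> ^ (k mod ee T n) * fst (pev T n) \<theta> powi u * t \<and>
      nrm t = 1 \<and> \<rho> t = poly P (zz T n) \<and> P \<in> polys_over (FF K T n) \<and> degree P = k div ee T n \<and> P \<noteq> 0"
      using gen_form(1)[OF n(1)] by blast
    then obtain u t P where utP: "\<And>k. k < ee T n * ff T n \<Longrightarrow> gen n k = L.Ph \<theta> ^ (k mod ee T n) * fst (pev T n) \<theta> powi u k * t k \<and>
      nrm (t k) = 1 \<and> \<rho> (t k) = poly (P k) (zz T n) \<and> P k \<in> polys_over (FF K T n) \<and> degree (P k) = k div ee T n \<and> P k \<noteq> 0"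
      by metis
    note ic = L.independent_combination[OF D', of "gen n" u t P x]
    have 1: "(\<Sum>k<ee T n * ff T n. x k * gen n k) = 0 \<or>
        inG \<rho> (fst (pev T (Suc n)) \<theta>) (FF K T (Suc n)) (\<Sum>k<ee T n * ff T n. x k * gen n k)"
      unfolding FF_Suc pev.simps fst_conv ff
      by (rule ic(1)) (use utP Suc.IH(1)[OF n(2)] in \<open>auto simp: ff x_def\<close>)
    have 2: "nrm (x k * gen n k) \<le> nrm (\<Sum>k<ee T n * ff T n. x k * gen n k)" if "k < ee T n * ff T n" for k
      unfolding ff
      by (rule ic(2)) (use utP Suc.IH(1)[OF n(2)] that in \<open>auto simp: ff x_def\<close>)
    have "nrm (to_ac (c j) * (\<Prod>i<Suc n. gen i (j i))) \<le> nrm (\<Sum>k<ee T n * ff T n. x k * gen n k)"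
      if "j \<in> multi (Suc n)" for j
    proof -
      have "j \<in> (\<lambda>(k, j). j(n := k)) ` ({..<ee T n * ff T n} \<times> multi n)"
        using that unfolding lessThan_Suc PiE_insert_eq .
      then obtain k j' where k: "j = j'(n := k)" "k < ee T n * ff T n" "j' \<in> multi n" by auto
      have "nrm (to_ac (c (j'(n := k))) * (\<Prod>i<n. gen i (j' i))) \<le> nrm (x k)"
        unfolding x_def using Suc.IH(2)[OF k(3) n(2), of "\<lambda>j. c (j(n := k))"] by simp
      then have "nrm (to_ac (c j) * (\<Prod>i<Suc n. gen i (j i))) \<le> nrm (x k * gen n k)"
        unfolding k(1) split by (simp add: nrm_mult mult_right_mono)
      also have "\<dots> \<le> nrm (\<Sum>k<ee T n * ff T n. x k * gen n k)" by (rule 2[OF k(2)])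
      finally show ?thesis .
    qed
    note this 1
    then have "((\<Sum>j\<in>multi (Suc n). to_ac (c j) * (\<Prod>i<Suc n. gen i (j i))) = 0 \<or>
        inG \<rho> (fst (pev T (Suc n)) \<theta>) (FF K T (Suc n)) (\<Sum>j\<in>multi (Suc n). to_ac (c j) * (\<Prod>i<Suc n. gen i (j i)))) \<and>
      (\<forall>j\<in>multi (Suc n). nrm (to_ac (c j) * (\<Prod>i<Suc n. gen i (j i))) \<le>
        nrm (\<Sum>j\<in>multi (Suc n). to_ac (c j) * (\<Prod>i<Suc n. gen i (j i))))"
      unfolding sum_eq by blast
  }
  note main = this
  {
    case 1
    then show ?case using main by blast
  next
    case 2
    then show ?case using main by blast
  }
qed

lemma multiindices_eq: "multiindices T r = multi (Suc r)"
  by (simp add: multiindices_def lessThan_Suc_atMost)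

lemma card_multiindices: "card (multiindices T r) = mm T (Suc r)"
proof -
  have "(\<Prod>i<n. ee T i * ff T i) = mm T n" for n by (induction n) auto
  then show ?thesis unfolding multiindices_eq by (simp only: card_PiE finite_lessThan card_lessThan)
qed

lemma QQ_eq:
  assumes j: "j \<in> multiindices T r"
  shows "QQ K T r f \<theta> j = \<theta> ^ j 0 * (\<Prod>i=1..r. quotient_val K T f \<theta> i (j i)) / \<pi> powi \<lfloor>\<Sum>i=1..r. HH K T f i (j i)\<rfloor>"
    and "QQ K T r f \<theta> j = (\<Prod>i<Suc r. gen i (j i)) / \<pi> powi \<lfloor>\<Sum>i=1..r. HH K T f i (j i)\<rfloor>"
    and "exp (- 1) < nrm (QQ K T r f \<theta> j)" "nrm (QQ K T r f \<theta> j) \<le> 1"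
proof -
  have jk: "j i < ee T i * ff T i" if "i \<le> r" for i
    using that PiE_mem[OF j[unfolded multiindices_def], of i] by simp
  let ?s = "\<Sum>i=1..r. HH K T f i (j i)"
  have 0: "nrm (\<theta> ^ j 0) = 1" using gen_form(2)[of 0, OF _ jk] by (simp add: gen_def)
  have pos: "nrm (quotient_val K T f \<theta> i (j i)) = exp (- HH K T f i (j i))" if "1 \<le> i" "i \<le> r" for i
    using gen_form(3)[OF that(2) jk[OF that(2)]] that by (simp add: gen_def)
  show 1: "QQ K T r f \<theta> j = \<theta> ^ j 0 * (\<Prod>i=1..r. quotient_val K T f \<theta> i (j i)) / \<pi> powi \<lfloor>?s\<rfloor>"
    unfolding QQ_def using 0 pos by (rule foldl_star)
  have "(\<Prod>i<Suc r. gen i (j i)) = gen 0 (j 0) * (\<Prod>i\<in>{1..r}. gen i (j i))"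
  proof -
    have "{..<Suc r} = insert 0 {1..r}" by auto
    then show ?thesis by simp
  qed
  also have "\<dots> = \<theta> ^ j 0 * (\<Prod>i=1..r. quotient_val K T f \<theta> i (j i))"
    by (simp add: gen_def)
  finally show 2: "QQ K T r f \<theta> j = (\<Prod>i<Suc r. gen i (j i)) / \<pi> powi \<lfloor>?s\<rfloor>" using 1 by simp
  have "nrm (prod (\<lambda>i. quotient_val K T f \<theta> i (j i)) I) = exp (- (\<Sum>i\<in>I. HH K T f i (j i)))" if "finite I" "I \<subseteq> {1..r}" for I
    using that by (induction I rule: finite_induct) (auto simp: nrm_mult pos exp_add[symmetric])
  then have "nrm (\<Prod>i=1..r. quotient_val K T f \<theta> i (j i)) = exp (- ?s)" by simp
  then have nQ: "nrm (QQ K T r f \<theta> j) = exp (real_of_int \<lfloor>?s\<rfloor> - ?s)"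
    unfolding 1 by (simp add: nrm_mult nrm_divide 0 nrm_powi nrm_unif exp_powi exp_diff[symmetric] exp_add[symmetric])
  have "- 1 < real_of_int \<lfloor>?s\<rfloor> - ?s" "real_of_int \<lfloor>?s\<rfloor> - ?s \<le> 0" by linarith+
  then show "exp (- 1) < nrm (QQ K T r f \<theta> j)" "nrm (QQ K T r f \<theta> j) \<le> 1" unfolding nQ by simp_all
qed

lemma QQ_adjoin:
  assumes "irreducible F" "ev F \<theta> = 0" "j \<in> multiindices T r"
  shows "QQ K T r f \<theta> j \<in> adjoin \<theta>"
proof -
  have mult: "x \<in> adjoin \<theta> \<Longrightarrow> y \<in> adjoin \<theta> \<Longrightarrow> x * y \<in> adjoin \<theta>" for x y
    unfolding adjoin_eq[OF assms(1,2)] by (auto simp flip: ev_mult)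
  have 1: "to_ac c \<in> adjoin \<theta>" for c
    unfolding adjoin_eq[OF assms(1,2)] by (metis ev_const rangeI)
  have gen: "gen i k \<in> adjoin \<theta>" for i k
  proof -
    have "gen i k = ev (if i = 0 then [:0, 1:] ^ k else quotient_poly K T f i k) \<theta>"
      by (simp add: gen_def quotient_val_def ev_power flip: ev_def)
    then show ?thesis unfolding adjoin_eq[OF assms(1,2)] by blast
  qed
  have "prod (\<lambda>i. gen i (j i)) I \<in> adjoin \<theta>" for I
    by (induction I rule: infinite_finite_induct) (use 1[of 1] in \<open>auto intro: mult gen\<close>)
  then have "to_ac (unif K powi (- \<lfloor>\<Sum>i=1..r. HH K T f i (j i)\<rfloor>)) * (\<Prod>i<Suc r. gen i (j i)) \<in> adjoin \<theta>"
    using 1 mult by blast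
  then show ?thesis unfolding QQ_eq(2)[OF assms(3)] to_ac_powi by (simp add: power_int_minus divide_inverse mult.commute del: prod.lessThan_Suc)
qed

text \<open>Elements of \<open>L\<close> are values of polynomials of degree below
  \<open>mm T (Suc r)\<close>, whose leading terms the last stage knows; \<open>lift\<close>
  supplies one of value 1 in its units, which is the minimal positive value.\<close>

lemma orthogonal:
  assumes F: "irreducible F" "lead_coeff F = 1" "degree F = mm T (Suc r)" "ev F \<theta> = 0"
  shows "orthogonal_family K F \<theta> (multiindices T r) (QQ K T r f \<theta>) (\<Prod>n<Suc r. ee T n)"
proof (unfold_locales)
  let ?J = "multiindices T r"
  let ?E = "\<Prod>n<Suc r. ee T n"
  show "finite ?J" unfolding multiindices_def by (intro finite_PiE) auto
  show "card ?J = degree F" using card_multiindices F(3) by simp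
  show "QQ K T r f \<theta> j \<in> adjoin \<theta>" "exp (- 1) < nrm (QQ K T r f \<theta> j)" "nrm (QQ K T r f \<theta> j) \<le> 1" if "j \<in> ?J" for j
    by (rule QQ_adjoin[OF F(1,4) that] QQ_eq(3,4)[OF that])+
  show "nrm (to_ac (c j) * QQ K T r f \<theta> j) \<le> nrm (\<Sum>i\<in>?J. to_ac (c i) * QQ K T r f \<theta> i)" if j: "j \<in> ?J" for c j
  proof -
    define c' where "c' j = c j * unif K powi (- \<lfloor>\<Sum>i=1..r. HH K T f i (j i)\<rfloor>)" for j
    have eq: "to_ac (c j) * QQ K T r f \<theta> j = to_ac (c' j) * (\<Prod>i<Suc r. gen i (j i))" if "j \<in> ?J" for j
      unfolding QQ_eq(2)[OF that] c'_def to_ac_mult to_ac_powi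
      by (simp add: power_int_minus divide_inverse mult_ac del: prod.lessThan_Suc)
    have "(\<Sum>i\<in>?J. to_ac (c i) * QQ K T r f \<theta> i) = (\<Sum>j\<in>?J. to_ac (c' j) * (\<Prod>i<Suc r. gen i (j i)))"
      using eq by (rule sum.cong[OF refl])
    then show ?thesis using combination(2)[of "Suc r" j c'] j unfolding multiindices_eq eq[OF j] by simp
  qed
  interpret S: stage K "mm T (Suc r)" "nv T (Suc r)" "rv T (Suc r)" "Dv T (Suc r)" "fst (pev T (Suc r))" "pv T (Suc r)" "FF K T (Suc r)"
    by (rule stage_at_Suc[OF level_le[OF order_refl]])
  have lead: "nrm (ev g \<theta>) = exp (- (real_of_int (nv T (Suc r) g) / real ?E))" if "g \<noteq> 0" "degree g < mm T (Suc r)" for g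
  proof -
    have "nrm (ev g \<theta>) = pv T (Suc r) powi nv T (Suc r) g"
      using S.D_lead[OF point that] S.D_w[OF point] by (simp add: lead_def)
    also have "\<dots> = exp (- (real_of_int (nv T (Suc r) g) / real ?E))"
      using pv_eq[of "Suc r"] by (simp add: exp_powi del: prod.lessThan_Suc)
    finally show ?thesis .
  qed
  show "0 < ?E" using pv_eq[of "Suc r"] by blast
  show "\<exists>n. nrm \<alpha> = exp (- (real_of_int n / real ?E))" if \<alpha>: "\<alpha> \<in> adjoin \<theta>" "\<alpha> \<noteq> 0" for \<alpha>
  proof -
    obtain g where g: "\<alpha> = ev g \<theta>" using \<alpha>(1) unfolding adjoin_eq[OF F(1,4)] by blast
    have F0: "F \<noteq> 0" using F(1) by auto
    have "ev g \<theta> = ev (g div F * F + g mod F) \<theta>" by simp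
    also have "\<dots> = ev (g mod F) \<theta>" unfolding ev_add ev_mult F(4) by simp
    finally have g': "\<alpha> = ev (g mod F) \<theta>" using g by simp
    then have "g mod F \<noteq> 0" using \<alpha>(2) by auto
    then show ?thesis using lead[of "g mod F"] degree_mod_less'[of F g] F0 F(3) g' by auto
  qed
  obtain a where a: "a \<noteq> 0" "degree a < mm T (Suc r)" "nv T (Suc r) a = 1"
    using S.lift[OF subfldD(2)[OF S.A(1)] one_neq_zero, of 1] by blast
  show "\<exists>\<alpha>\<in>adjoin \<theta>. nrm \<alpha> = exp (- (1 / real ?E))"
    using lead[OF a(1,2)] a(3) unfolding adjoin_eq[OF F(1,4)] by auto
qed (use F in auto)

end

context local_field
begin

text \<open>Order 1 means divisibility by \<open>psi T r\<close> but not by its square, which is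
  what \<open>irreducible_of_type\<close> asks for at the last level.\<close>

lemma complete_type_root:
  assumes type: "complete_type K T r F" and F: "irreducible F" "lead_coeff F = 1" "ev F \<theta> = 0"
  shows "degree F = mm T (Suc r) \<and> (\<exists>\<rho>. (\<theta>, \<rho>) \<in> Dv T (Suc r))"
proof -
  have T: "is_type K T r" and o: "ord_type K T r F = 1" using type by (auto simp: complete_type_def)
  have lev: "level_at T r" and rl: "rlink T r" using levels[OF T] by auto
  interpret L: level K "mm T r" "nv T r" "rv T r" "Dv T r" "fst (pev T r)" "pv T r" "FF K T r" "phv T r"
     "snd (pev T r)" "Vv T r" "kpv T r" "ee T r" "hh T r" "lv T r" "lv' T r" "psi T r" "zz T r" "Bv T r" by (rule lev)
  have F0: "F \<noteq> 0" using F(1) by auto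
  note b = based_bv[OF lev T F0]
  have RR: "RR K T r F = L.res (bv T r F) F" using rl F0 by (simp add: rlink_def)
  have R0: "L.res (bv T r F) F \<noteq> 0" by (rule L.res_nz[OF F0 b])
  let ?S = "{n. psi T r ^ n dvd L.res (bv T r F) F}"
  \<comment> \<open>Finiteness is needed to draw conclusions from the \<open>Max\<close> in
    \<open>ord_type\<close>.\<close>
  have "?S \<subseteq> {..degree (L.res (bv T r F) F)}"
  proof
    fix n assume "n \<in> ?S"
    then have "degree (psi T r ^ n) \<le> degree (L.res (bv T r F) F)" using R0 by (intro dvd_imp_degree_le) auto
    moreover have "degree (psi T r ^ n) = n * L.f"
      using L.psi(2) by (subst degree_power_eq) (auto simp: L.f_def)
    moreover have "n \<le> n * L.f" using L.f_pos by simp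
    ultimately show "n \<in> {..degree (L.res (bv T r F) F)}" unfolding atMost_iff by linarith
  qed
  then have fin: "finite ?S" by (rule finite_subset) simp
  have max: "Max ?S = 1" using o by (simp add: ord_type_def RR)
  have "0 \<in> ?S" by simp
  then have "Max ?S \<in> ?S" using Max_in[OF fin] by blast
  then have 1: "psi T r dvd L.res (bv T r F) F" unfolding max by simp
  have 2: "\<not> psi T r ^ 2 dvd L.res (bv T r F) F" using Max_ge[OF fin, of 2] unfolding max by auto
  have z: "bv T r F = 0 \<or> zz T r \<noteq> 0"
  proof (cases r)
    case (Suc i)
    then have "0 < hh T r" using T by simp
    then show ?thesis using L.z_eq_0 by auto
  qed (simp add: bv_def)
  note ir = L.irreducible_of_type[OF F(1,2) b z 1 2]
  have "L.m' = mm T (Suc r)" by (simp add: L.m'_def L.f_def ff_def)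
  moreover have "\<theta> \<in> fst ` Dv T (Suc r)" using ir(2)[OF F(3)] unfolding Dv.simps .
  ultimately show ?thesis using ir(1) by auto
qed

end

theorem theorem4p7:
  fixes K :: "('k::field, 'f::field) valued_field"
    and T :: "('k, 'f) type_data"
    and F f :: "'k poly"
    and \<theta> :: "'k alg_closure"
    and r :: nat
  assumes "local_field K"
    and "F \<in> polys_over (int_ring K)" and "lead_coeff F = 1"
    and "irreducible F" and "separable_poly F"
    and "poly (map_poly to_ac F) \<theta> = 0"
    and "complete_type K T r F"
    and "f \<in> polys_over (int_ring K)" and "lead_coeff f = 1" and "separable_poly f"
    and "\<exists>g \<in> polys_over (int_ring K). f = F * g"
  shows "(\<forall>j \<in> multiindices T r.
            QQ K T r f \<theta> j =
              \<theta> ^ j 0 * (\<Prod>i=1..r. quotient_val K T f \<theta> i (j i))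
                / to_ac (unif K) powi \<lfloor>\<Sum>i=1..r. HH K T f i (j i)\<rfloor>
            \<and> QQ K T r f \<theta> j \<in> unit_strip K (adjoin \<theta>)) \<and>
         inj_on (QQ K T r f \<theta>) (multiindices T r) \<and>
         int_basis K (adjoin \<theta>) (QQ K T r f \<theta> ` multiindices T r) \<and>
         standard_form K (adjoin \<theta>) (QQ K T r f \<theta> ` multiindices T r)"
proof -
  interpret local_field K by (rule assms)
  have root: "ev F \<theta> = 0" using assms(6) by (simp add: ev_def)
  obtain \<rho> where \<rho>: "degree F = mm T (Suc r)" "(\<theta>, \<rho>) \<in> Dv T (Suc r)"
    using complete_type_root[OF assms(7,4,3) root] by blast
  obtain g where "f = F * g" using assms(11) by blast
  then have f: "ev f \<theta> = 0" "f \<noteq> 0" using root assms(9) by (auto simp: ev_mult)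
  interpret point_of_type K T r \<theta> \<rho> f
    by unfold_locales (use \<rho> f assms(7) in \<open>auto simp: complete_type_def\<close>)
  interpret orthogonal_family K F \<theta> "multiindices T r" "QQ K T r f \<theta>" "\<Prod>n<Suc r. ee T n"
    by (rule orthogonal[OF assms(4,3) \<rho>(1) root])
  show ?thesis using QQ_eq(1) inj_Q basis_int basis_standard by (auto simp: standard_form_def)
qed

end
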